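(* Let $\mathcal{H}_1,\mathcal{H}_2$ be Hilbert spaces and let $T=\begin{bmatrix}A&D_{A^*}LD_B\\0&B\end{bmatrix}:\mathcal{H}_1\oplus\mathcal{H}_2\to\mathcal{H}_1\oplus\mathcal{H}_2$ be a contraction, where $A\in B(\mathcal{H}_1)$, $B\in B(\mathcal{H}_2)$ and $L\in B(\mathcal{D}_B,\mathcal{D}_{A^*})$ are contractions. Let $\tau\in B(\mathcal{D}_T,\mathcal{D}_A\oplus\mathcal{D}_L)$ and $\tau_*\in B(\mathcal{D}_{T^*},\mathcal{D}_{B^*}\oplus\mathcal{D}_{L^*})$ be unitary operators such that $\Theta_T(z)=\Theta_3'(z)\Theta_2'(z)\Theta_1'(z)$ for all $z\in\mathbb{D}$, where $$\Theta_3'(z)=\tau_*^{-1}\begin{bmatrix}\Theta_B(z)&0\\0&I_{\mathcal{D}_{L^*}}\end{bmatrix},\quad \Theta_2'(z)=\begin{bmatrix}L^*&D_L\\ D_{L^*}&-L\end{bmatrix},\quad \Theta_1'(z)=\begin{bmatrix}\Theta_A(z)&0\\0&I_{\mathcal{D}_L}\end{bmatrix}\tau .$$ Then the factorization $\Theta_T(z)=\Theta_3'(z)\Theta_2'(z)\Theta_1'(z)$ is $3$-regular if and only if $$\Delta_B(t)\mathcal{D}_B\cap L^*\left[\Delta_{*A}(t)\mathcal{D}_{A^*}\cap\ker(D_{L^*})\right]=\{0\}\quad\text{for a.e. }t\in[0,2\pi],$$ where $\Delta_B(t)=\left(I_{\mathcal{D}_B}-\Theta_B(e^{it})^*\Theta_B(e^{it})\right)^{1/2}$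 and $\Delta_{*A}(t)=\left(I_{\mathcal{D}_{A^*}}-\Theta_A(e^{it})\Theta_A(e^{it})^*\right)^{1/2}$.
   Context: All Hilbert spaces are complex and separable; $\mathbb{D}$ is the open unit disc. For a contraction $T$ between Hilbert spaces, $D_T=(I-T^*T)^{1/2}$, $D_{T^*}=(I-TT^* )^{1/2}$, $\mathcal{D}_T=\overline{\mathrm{range}(D_T)}$, $\mathcal{D}_{T^*}=\overline{\mathrm{range}(D_{T^*})}$. The characteristic function of a contraction $T$ on $\mathcal{H}$ is $\Theta_T:\mathbb{D}\to B(\mathcal{D}_T,\mathcal{D}_{T^*})$, $\Theta_T(z)=(-T+zD_{T^*}(I-zT^* )^{-1}D_T)|_{\mathcal{D}_T}$. The operator $D_{L^*}=(I-LL^* )^{1/2}$ acts on $\mathcal{D}_{A^*}$, and $\ker(D_{L^*})\subseteq\mathcal{D}_{A^*}$. By a theorem of Sz.-Nagy and Foiaş, every contraction $\begin{bmatrix}A&X\\0&B\end{bmatrix}$ on $\mathcal{H}_1\oplus\mathcal{H}_2$ has $X=D_{A^*}LD_B$ for some contraction $L\in B(\mathcal{D}_B,\mathcal{D}_{A^*})$ (the coupling operator), and unitaries $\tau,\tau_*$ giving the stated factorization exist. Here $\Theta_1'(z):\mathcal{D}_T\to\mathcal{D}_{A^*}\oplus\mathcal{D}_L$, $\Theta_2'(z):\mathcal{D}_{A^*}\oplus\mathcal{D}_L\to\mathcal{D}_B\oplus\mathcal{D}_{L^*}$ (a constant unitary), and $\Theta_3'(z):\mathcal{D}_B\oplus\mathcal{D}_{L^*}\to\mathcal{D}_{T^*}$.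 A contractive analytic function $\{\mathcal{E},\mathcal{E}_*,\Theta(z)\}$ consists of Hilbert spaces $\mathcal{E},\mathcal{E}_*$ and an analytic function $\Theta:\mathbb{D}\to B(\mathcal{E},\mathcal{E}_* )$ with $\|\Theta(z)\|\le1$ for all $z\in\mathbb{D}$. The boundary values $\Theta(e^{it})=\lim_{r\to1^-}\Theta(re^{it})$ exist a.e. in the strong operator topology, and $\Theta$ also denotes the multiplication operator $L^2(\mathcal{E})\to L^2(\mathcal{E}_* )$, $(\Theta v)(t)=\Theta(e^{it})v(t)$, where $L^2(\mathcal{E})$ is the space of square-integrable $\mathcal{E}$-valued functions on $[0,2\pi]$. Let $\{\mathcal{E},\mathcal{E}_*,\Theta(z)\}$ and $\{\mathcal{E}_i,\mathcal{E}_{i+1},\Theta_i(z)\}$, $i=1,2,3$, be contractive analytic functions with $\mathcal{E}_1=\mathcal{E}$, $\mathcal{E}_4=\mathcal{E}_*$ and $\Theta(z)=\Theta_3(z)\Theta_2(z)\Theta_1(z)$ for all $z\in\mathbb{D}$. Put $\Delta_\Theta=(I-\Theta^*\Theta)^{1/2}$ and $\Delta_i=(I-\Theta_i^*\Theta_i)^{1/2}$ (operators on $L^2(\mathcal{E})$ and $L^2(\mathcal{E}_i)$). The factorization is $3$-regular if the isometry $Z_3:\overline{\Delta_\Theta L^2(\mathcal{E}_1)}\to\overline{\Delta_3L^2(\mathcal{E}_3)}\oplus\overline{\Delta_2L^2(\mathcal{E}_2)}\oplus\overline{\Delta_1L^2(\mathcal{E}_1)}$ obtained by continuous extension of $Z_3(\Delta_\Theta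 f)=\Delta_3\Theta_2\Theta_1f\oplus\Delta_2\Theta_1f\oplus\Delta_1f$, $f\in L^2(\mathcal{E}_1)$, is unitary. *)

theory Defs
  imports "HOL-Analysis.Analysis"
begin

section \<open>Complex Hilbert spaces\<close>

text \<open>The complex inner product is linear in its first argument. The real inner product, the norm
  and the topology are the ones of the underlying real inner product space.\<close>

class complex_inner = real_inner +
  fixes scaleC :: "complex \<Rightarrow> 'a \<Rightarrow> 'a"  (infixr \<open>*\<^sub>C\<close> 75)
    and cinner :: "'a \<Rightarrow> 'a \<Rightarrow> complex"
  assumes scaleC_add_right: "a *\<^sub>C (x + y) = a *\<^sub>C x + a *\<^sub>C y"
    and scaleC_add_left: "(a + b) *\<^sub>C x = a *\<^sub>C x + b *\<^sub>C x"
    and scaleC_scaleC: "a *\<^sub>C (b *\<^sub>C x) = (a * b) *\<^sub>C x"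
    and scaleR_scaleC: "r *\<^sub>R x = complex_of_real r *\<^sub>C x"
    and cinner_commute: "cinner x y = cnj (cinner y x)"
    and cinner_add_left: "cinner (x + y) z = cinner x z + cinner y z"
    and cinner_scaleC_left: "cinner (a *\<^sub>C x) y = a * cinner x y"
    and inner_eq_Re_cinner: "inner x y = Re (cinner x y)"

text \<open>For metric spaces second countability is separability.\<close>

class chilbert = complex_inner + complete_space + second_countable_topology

instantiation prod :: (complex_inner, complex_inner) complex_inner
begin

definition scaleC_prod_def: "c *\<^sub>C p = (c *\<^sub>C fst p, c *\<^sub>C snd p)"
definition cinner_prod_def: "cinner p q = cinner (fst p) (fst q) + cinner (snd p) (snd q)"

instance
proof
  fix a b :: complex and r :: real and x y z :: "'a \<times> 'b"
  show "a *\<^sub>C (x + y) = a *\<^sub>C x + a *\<^sub>C y"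
    by (simp add: scaleC_prod_def scaleC_add_right)
  show "(a + b) *\<^sub>C x = a *\<^sub>C x + b *\<^sub>C x"
    by (simp add: scaleC_prod_def scaleC_add_left)
  show "a *\<^sub>C (b *\<^sub>C x) = (a * b) *\<^sub>C x"
    by (simp add: scaleC_prod_def scaleC_scaleC)
  show "r *\<^sub>R x = complex_of_real r *\<^sub>C x"
    by (simp add: scaleC_prod_def scaleR_scaleC prod_eq_iff)
  show "cinner x y = cnj (cinner y x)"
    unfolding cinner_prod_def complex_cnj_add by (metis cinner_commute)
  show "cinner (x + y) z = cinner x z + cinner y z"
    by (simp add: cinner_prod_def cinner_add_left)
  show "cinner (a *\<^sub>C x) y = a * cinner x y"
    by (simp add: cinner_prod_def scaleC_prod_def cinner_scaleC_left algebra_simps)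
  show "inner x y = Re (cinner x y)"
    by (simp add: cinner_prod_def inner_prod_def inner_eq_Re_cinner)
qed

end

instance prod :: (chilbert, chilbert) chilbert ..


section \<open>Operators between closed subspaces\<close>

text \<open>A Hilbert space that occurs as a subspace (a defect space, say) is a closed complex subspace
  \<open>E\<close> of a type. An operator in \<open>B(E,F)\<close> is a function on the whole type of which only the
  restriction to \<open>E\<close> is used: no notion below depends on its values outside \<open>E\<close>.\<close>

definition closed_csubspace :: "'a::complex_inner set \<Rightarrow> bool" where
  "closed_csubspace E \<longleftrightarrow> closed E \<and> 0 \<in> E \<and> (\<forall>x\<in>E. \<forall>y\<in>E. x + y \<in> E) \<and> (\<forall>c. \<forall>x\<in>E. c *\<^sub>C x \<in> E)"

definition bounded_op :: "'a::complex_inner set \<Rightarrow> 'b::complex_inner set \<Rightarrow> ('a \<Rightarrow> 'b) \<Rightarrow> bool" where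
  "bounded_op E F S \<longleftrightarrow>
     (\<forall>x\<in>E. S x \<in> F) \<and>
     (\<forall>x\<in>E. \<forall>y\<in>E. S (x + y) = S x + S y) \<and>
     (\<forall>c. \<forall>x\<in>E. S (c *\<^sub>C x) = c *\<^sub>C S x) \<and>
     (\<exists>K. \<forall>x\<in>E. norm (S x) \<le> K * norm x)"

definition contraction :: "'a::complex_inner set \<Rightarrow> 'b::complex_inner set \<Rightarrow> ('a \<Rightarrow> 'b) \<Rightarrow> bool" where
  "contraction E F S \<longleftrightarrow> bounded_op E F S \<and> (\<forall>x\<in>E. norm (S x) \<le> norm x)"

definition unitary_op :: "'a::complex_inner set \<Rightarrow> 'b::complex_inner set \<Rightarrow> ('a \<Rightarrow> 'b) \<Rightarrow> bool" where
  "unitary_op E F U \<longleftrightarrow>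
     bounded_op E F U \<and> U ` E = F \<and> (\<forall>x\<in>E. \<forall>y\<in>E. cinner (U x) (U y) = cinner x y)"

text \<open>The adjoint of an operator with domain \<open>E\<close>. For \<open>S \<in> B(E,F)\<close> its restriction to \<open>F\<close>
  is the adjoint in \<open>B(F,E)\<close>, so that \<open>F\<close> is not needed as a parameter.\<close>

definition adjoint_op :: "'a::complex_inner set \<Rightarrow> ('a \<Rightarrow> 'b::complex_inner) \<Rightarrow> 'b \<Rightarrow> 'a" where
  "adjoint_op E S y = (THE x. x \<in> E \<and> (\<forall>u\<in>E. cinner (S u) y = cinner u x))"

definition positive_op :: "'a::complex_inner set \<Rightarrow> ('a \<Rightarrow> 'a) \<Rightarrow> bool" where
  "positive_op E S \<longleftrightarrow> bounded_op E E S \<and> (\<forall>x\<in>E. cinner (S x) x \<in> \<real> \<and> 0 \<le> Re (cinner (S x) x))"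

text \<open>The positive square root of an operator on \<open>E\<close>; the last conjunct only fixes the
  irrelevant values outside \<open>E\<close>, which makes the function unique.\<close>

definition sqrt_op :: "'a::complex_inner set \<Rightarrow> ('a \<Rightarrow> 'a) \<Rightarrow> 'a \<Rightarrow> 'a" where
  "sqrt_op E P =
     (THE S. positive_op E S \<and> (\<forall>x\<in>E. S (S x) = P x) \<and> (\<forall>x. x \<notin> E \<longrightarrow> S x = 0))"

text \<open>For \<open>S \<in> B(E,F)\<close>: the defect operators \<open>(I - S\<^sup>*S)\<^bsup>1/2\<^esup>\<close> on \<open>E\<close> and
  \<open>(I - SS\<^sup>*)\<^bsup>1/2\<^esup>\<close> on \<open>F\<close>, and the closures of their ranges.\<close>

definition defect :: "'a::complex_inner set \<Rightarrow> ('a \<Rightarrow> 'b::complex_inner) \<Rightarrow> 'a \<Rightarrow> 'a" where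
  "defect E S = sqrt_op E (\<lambda>x. x - adjoint_op E S (S x))"

definition defect_adj ::
  "'a::complex_inner set \<Rightarrow> 'b::complex_inner set \<Rightarrow> ('a \<Rightarrow> 'b) \<Rightarrow> 'b \<Rightarrow> 'b" where
  "defect_adj E F S = sqrt_op F (\<lambda>y. y - S (adjoint_op E S y))"

definition defect_space :: "'a::complex_inner set \<Rightarrow> ('a \<Rightarrow> 'b::complex_inner) \<Rightarrow> 'a set" where
  "defect_space E S = closure (defect E S ` E)"

definition defect_space_adj ::
  "'a::complex_inner set \<Rightarrow> 'b::complex_inner set \<Rightarrow> ('a \<Rightarrow> 'b) \<Rightarrow> 'b set" where
  "defect_space_adj E F S = closure (defect_adj E F S ` F)"

definition block_op ::
  "('a \<Rightarrow> 'c::complex_inner) \<Rightarrow> ('b \<Rightarrow> 'c) \<Rightarrow> ('a \<Rightarrow> 'd::complex_inner) \<Rightarrow> ('b \<Rightarrow> 'd) \<Rightarrow> 'a \<times> 'b \<Rightarrow> 'c \<times> 'd"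
  where "block_op S11 S12 S21 S22 = (\<lambda>(x, y). (S11 x + S12 y, S21 x + S22 y))"

text \<open>The characteristic function of a contraction on a whole Hilbert space; it is to be regarded
  as an operator from \<open>defect_space UNIV S\<close> to \<open>defect_space_adj UNIV UNIV S\<close>.\<close>

definition char_fun :: "('a::complex_inner \<Rightarrow> 'a) \<Rightarrow> complex \<Rightarrow> 'a \<Rightarrow> 'a" where
  "char_fun S z x =
     - S x + z *\<^sub>C defect_adj UNIV UNIV S (inv (\<lambda>y. y - z *\<^sub>C adjoint_op UNIV S y) (defect UNIV S x))"


section \<open>The space of square-integrable vector-valued functions\<close>

abbreviation circle_measure :: "real measure" where
  "circle_measure \<equiv> lebesgue_on {0..2 * pi}"

definition square_integrable :: "(real \<Rightarrow> 'a::chilbert) \<Rightarrow> bool" where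
  "square_integrable f \<longleftrightarrow>
     f \<in> borel_measurable circle_measure \<and> integrable circle_measure (\<lambda>t. (norm (f t))\<^sup>2)"

definition L2_rel :: "(real \<Rightarrow> 'a::chilbert) \<Rightarrow> (real \<Rightarrow> 'a) \<Rightarrow> bool" where
  "L2_rel f g \<longleftrightarrow>
     square_integrable f \<and> square_integrable g \<and> (AE t in circle_measure. f t = g t)"

lemma scaleC_one [simp]: "1 *\<^sub>C (x::'a::complex_inner) = x"
  using scaleR_scaleC[of 1 x] by simp

lemma cinner_scaleC_right: "cinner x (a *\<^sub>C y) = cnj a * cinner (x::'a::complex_inner) y"
  by (metis cinner_commute cinner_scaleC_left complex_cnj_mult)

lemma cinner_self: "cinner x x = complex_of_real ((norm (x::'a::complex_inner))\<^sup>2)"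
proof (rule complex_eqI)
  show "Re (cinner x x) = Re (complex_of_real ((norm x)\<^sup>2))"
    by (simp add: inner_eq_Re_cinner[symmetric] dot_square_norm)
  show "Im (cinner x x) = Im (complex_of_real ((norm x)\<^sup>2))"
    using arg_cong[OF cinner_commute[of x x], of Im] by simp
qed

lemma norm_scaleC: "norm (a *\<^sub>C x) = cmod a * norm (x::'a::complex_inner)"
proof -
  have "complex_of_real ((norm (a *\<^sub>C x))\<^sup>2) = complex_of_real ((cmod a * norm x)\<^sup>2)"
    by (simp only: cinner_self[symmetric] cinner_scaleC_left cinner_scaleC_right)
       (simp add: cinner_self power_mult_distrib complex_norm_square del: of_real_power)
  then have "(norm (a *\<^sub>C x))\<^sup>2 = (cmod a * norm x)\<^sup>2"
    using of_real_eq_iff by blast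
  then show ?thesis
    by (simp add: power2_eq_iff_nonneg)
qed

lemma cinner_eq_Complex: "cinner x y = Complex (inner x y) (inner x (\<i> *\<^sub>C (y::'a::complex_inner)))"
  by (rule complex_eqI) (simp_all add: inner_eq_Re_cinner cinner_scaleC_right)

lemma bounded_linear_scaleC: "bounded_linear (\<lambda>x::'a::complex_inner. a *\<^sub>C x)"
  by (rule bounded_linear_intro[where K = "cmod a"])
     (simp_all add: scaleC_add_right norm_scaleC scaleR_scaleC scaleC_scaleC mult.commute)

lemma cmod_cinner_le: "cmod (cinner x y) \<le> 2 * (norm x * norm (y::'a::complex_inner))"
proof -
  have "cmod (cinner x y) \<le> \<bar>inner x y\<bar> + \<bar>inner x (\<i> *\<^sub>C y)\<bar>"
    unfolding cinner_eq_Complex using cmod_le by (metis complex.sel)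
  also have "\<dots> \<le> norm x * norm y + norm x * norm (\<i> *\<^sub>C y)"
    by (intro add_mono Cauchy_Schwarz_ineq2)
  finally show ?thesis
    by (simp add: norm_scaleC)
qed

lemma borel_measurable_scaleC:
  fixes f :: "'m \<Rightarrow> 'a::chilbert"
  assumes "f \<in> borel_measurable M"
  shows "(\<lambda>t. a *\<^sub>C f t) \<in> borel_measurable M"
  using bounded_linear.continuous_on[OF bounded_linear_scaleC continuous_on_id]
  by (intro borel_measurable_continuous_on[OF _ assms])

lemma borel_measurable_cinner:
  fixes f g :: "'m \<Rightarrow> 'a::chilbert"
  assumes "f \<in> borel_measurable M" "g \<in> borel_measurable M"
  shows "(\<lambda>t. cinner (f t) (g t)) \<in> borel_measurable M"
proof -
  have "(\<lambda>t. inner (f t) (\<i> *\<^sub>C g t)) \<in> borel_measurable M"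
    by (intro borel_measurable_inner borel_measurable_scaleC assms)
  moreover have "(\<lambda>t. inner (f t) (g t)) \<in> borel_measurable M"
    by (intro borel_measurable_inner assms)
  ultimately show ?thesis
    by (simp add: cinner_eq_Complex Complex_eq)
qed

lemma two_mult_le_squares: "2 * (a * b) \<le> a\<^sup>2 + (b::real)\<^sup>2"
  using sum_squares_bound[of a b] by (simp add: mult.assoc)

lemma integrable_cinner:
  assumes "square_integrable f" "square_integrable g"
  shows "integrable circle_measure (\<lambda>t. cinner (f t) (g t))"
proof (rule Bochner_Integration.integrable_bound)
  show "integrable circle_measure (\<lambda>t. (norm (f t))\<^sup>2 + (norm (g t))\<^sup>2)"
    using assms by (simp add: square_integrable_def)
  show "(\<lambda>t. cinner (f t) (g t)) \<in> borel_measurable circle_measure"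
    using assms by (simp add: square_integrable_def borel_measurable_cinner)
  show "AE t in circle_measure.
      norm (cinner (f t) (g t)) \<le> norm ((norm (f t))\<^sup>2 + (norm (g t))\<^sup>2)"
    using order_trans[OF cmod_cinner_le two_mult_le_squares] by (intro AE_I2) (simp add: abs_of_nonneg)
qed

lemma square_integrable_add:
  assumes "square_integrable f" "square_integrable g"
  shows "square_integrable (\<lambda>t. f t + g t)"
  unfolding square_integrable_def
proof
  show *: "(\<lambda>t. f t + g t) \<in> borel_measurable circle_measure"
    using assms by (auto simp: square_integrable_def intro: borel_measurable_add)
  show "integrable circle_measure (\<lambda>t. (norm (f t + g t))\<^sup>2)"
  proof (rule Bochner_Integration.integrable_bound)
    show "integrable circle_measure (\<lambda>t. 2 * (norm (f t))\<^sup>2 + 2 * (norm (g t))\<^sup>2)"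
      using assms by (simp add: square_integrable_def)
    show "(\<lambda>t. (norm (f t + g t))\<^sup>2) \<in> borel_measurable circle_measure"
      using * by simp
    have "(norm (f t + g t))\<^sup>2 \<le> 2 * (norm (f t))\<^sup>2 + 2 * (norm (g t))\<^sup>2" for t
    proof -
      have "(norm (f t + g t))\<^sup>2 \<le> (norm (f t) + norm (g t))\<^sup>2"
        by (intro power_mono norm_triangle_ineq) simp
      also have "\<dots> \<le> 2 * (norm (f t))\<^sup>2 + 2 * (norm (g t))\<^sup>2"
        using two_mult_le_squares[of "norm (f t)" "norm (g t)"] by (simp add: power2_sum)
      finally show ?thesis .
    qed
    then show "AE t in circle_measure.
        norm ((norm (f t + g t))\<^sup>2) \<le> norm (2 * (norm (f t))\<^sup>2 + 2 * (norm (g t))\<^sup>2)"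
      by simp
  qed
qed

lemma square_integrable_scaleC:
  "square_integrable f \<Longrightarrow> square_integrable (\<lambda>t. a *\<^sub>C f t)"
  by (simp add: square_integrable_def norm_scaleC power_mult_distrib borel_measurable_scaleC)

lemma square_integrable_zero: "square_integrable (\<lambda>_. 0)"
  by (simp add: square_integrable_def)

lemma square_integrable_uminus: "square_integrable f \<Longrightarrow> square_integrable (\<lambda>t. - f t)"
  by (simp add: square_integrable_def)

lemma square_integrable_diff:
  assumes "square_integrable f" "square_integrable g"
  shows "square_integrable (\<lambda>t. f t - g t)"
  using square_integrable_add[OF assms(1) square_integrable_uminus[OF assms(2)]] by simp

quotient_type (overloaded) 'a L2 = "real \<Rightarrow> 'a::chilbert" / partial: L2_rel
proof (rule part_equivpI)
  show "\<exists>f::real \<Rightarrow> 'a. L2_rel f f"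
    using square_integrable_zero by (auto simp: L2_rel_def)
  show "symp (L2_rel :: (real \<Rightarrow> 'a) \<Rightarrow> _)"
    by (auto simp: symp_def L2_rel_def)
  show "transp (L2_rel :: (real \<Rightarrow> 'a) \<Rightarrow> _)"
    unfolding transp_def L2_rel_def by (auto intro: AE_mp)
qed

instantiation L2 :: (chilbert) complex_inner
begin

lift_definition zero_L2 :: "'a L2" is "\<lambda>_. 0"
  by (simp add: L2_rel_def square_integrable_zero)

lift_definition plus_L2 :: "'a L2 \<Rightarrow> 'a L2 \<Rightarrow> 'a L2" is "\<lambda>f g t. f t + g t"
  by (auto simp: L2_rel_def square_integrable_add)

lift_definition minus_L2 :: "'a L2 \<Rightarrow> 'a L2 \<Rightarrow> 'a L2" is "\<lambda>f g t. f t - g t"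
  by (auto simp: L2_rel_def square_integrable_diff)

lift_definition uminus_L2 :: "'a L2 \<Rightarrow> 'a L2" is "\<lambda>f t. - f t"
  by (auto simp: L2_rel_def square_integrable_uminus)

lift_definition scaleC_L2 :: "complex \<Rightarrow> 'a L2 \<Rightarrow> 'a L2" is "\<lambda>c f t. c *\<^sub>C f t"
  by (auto simp: L2_rel_def square_integrable_scaleC)

definition scaleR_L2 :: "real \<Rightarrow> 'a L2 \<Rightarrow> 'a L2" where
  "scaleR_L2 r f = complex_of_real r *\<^sub>C f"

lift_definition cinner_L2 :: "'a L2 \<Rightarrow> 'a L2 \<Rightarrow> complex"
  is "\<lambda>f g. integral\<^sup>L circle_measure (\<lambda>t. cinner (f t) (g t))"
  unfolding L2_rel_def
  by (intro integral_cong_AE) (auto simp: square_integrable_def intro!: borel_measurable_cinner)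

definition inner_L2 :: "'a L2 \<Rightarrow> 'a L2 \<Rightarrow> real" where
  "inner_L2 f g = Re (cinner f g)"

definition norm_L2 :: "'a L2 \<Rightarrow> real" where
  "norm_L2 f = sqrt (inner f f)"

definition dist_L2 :: "'a L2 \<Rightarrow> 'a L2 \<Rightarrow> real" where
  "dist_L2 f g = norm (f - g)"

definition sgn_L2 :: "'a L2 \<Rightarrow> 'a L2" where
  "sgn_L2 f = inverse (norm f) *\<^sub>R f"

definition uniformity_L2 :: "('a L2 \<times> 'a L2) filter" where
  "uniformity_L2 = (INF e\<in>{0<..}. principal {(f, g). dist f g < e})"

definition open_L2 :: "'a L2 set \<Rightarrow> bool" where
  "open_L2 U \<longleftrightarrow> (\<forall>f\<in>U. eventually (\<lambda>(f', g). f' = f \<longrightarrow> g \<in> U) uniformity)"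

instance
proof
  fix f g h :: "'a L2" and a b :: complex and r s :: real and U :: "'a L2 set"
  show "f + g + h = f + (g + h)"
    by transfer (auto simp: L2_rel_def square_integrable_add add.assoc)
  show "f + g = g + f"
    by transfer (auto simp: L2_rel_def square_integrable_add add.commute)
  show "0 + f = f"
    by transfer (auto simp: L2_rel_def)
  show "- f + f = 0"
    by transfer (auto simp: L2_rel_def square_integrable_zero)
  show "f - g = f + - g"
    by transfer (auto simp: L2_rel_def square_integrable_diff)
  show C1: "a *\<^sub>C (f + g) = a *\<^sub>C f + a *\<^sub>C g" for a and f g :: "'a L2"
    by transfer (auto simp: L2_rel_def square_integrable_add square_integrable_scaleC scaleC_add_right)
  show C2: "(a + b) *\<^sub>C f = a *\<^sub>C f + b *\<^sub>C f" for a b and f :: "'a L2"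
    by transfer (auto simp: L2_rel_def square_integrable_add square_integrable_scaleC scaleC_add_left)
  show C3: "a *\<^sub>C b *\<^sub>C f = (a * b) *\<^sub>C f" for a b and f :: "'a L2"
    by transfer (auto simp: L2_rel_def square_integrable_scaleC scaleC_scaleC)
  have C4: "1 *\<^sub>C f = f"
    by transfer (auto simp: L2_rel_def)
  show "r *\<^sub>R f = complex_of_real r *\<^sub>C f"
    by (simp add: scaleR_L2_def)
  show "r *\<^sub>R (f + g) = r *\<^sub>R f + r *\<^sub>R g"
    by (simp add: scaleR_L2_def C1)
  show "(r + s) *\<^sub>R f = r *\<^sub>R f + s *\<^sub>R f"
    by (simp add: scaleR_L2_def C2)
  show "r *\<^sub>R s *\<^sub>R f = (r * s) *\<^sub>R f"
    by (simp add: scaleR_L2_def C3)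
  show "1 *\<^sub>R f = f"
    by (simp add: scaleR_L2_def C4)
  show D1: "cinner f g = cnj (cinner g f)" for f g :: "'a L2"
    by transfer (subst cinner_commute, simp)
  show D2: "cinner (f + g) h = cinner f h + cinner g h" for f g h :: "'a L2"
    by transfer (simp add: L2_rel_def cinner_add_left integrable_cinner)
  show D3: "cinner (a *\<^sub>C f) g = a * cinner f g" for a and f g :: "'a L2"
    by transfer (simp add: cinner_scaleC_left)
  show "inner f g = Re (cinner f g)"
    by (rule inner_L2_def)
  show "inner f g = inner g f"
    unfolding inner_L2_def by (subst D1) simp
  show "inner (f + g) h = inner f h + inner g h"
    by (simp add: inner_L2_def D2)
  show "inner (r *\<^sub>R f) g = r * inner f g"
    by (simp add: inner_L2_def scaleR_L2_def D3)
  show "0 \<le> inner f f"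
    unfolding inner_L2_def
    by transfer (simp add: cinner_self del: of_real_power)
  show "inner f f = 0 \<longleftrightarrow> f = 0"
    unfolding inner_L2_def
  proof transfer
    fix f :: "real \<Rightarrow> 'a"
    assume "L2_rel f f"
    then have f: "square_integrable f"
      by (simp add: L2_rel_def)
    have "Re (integral\<^sup>L circle_measure (\<lambda>t. cinner (f t) (f t))) =
        integral\<^sup>L circle_measure (\<lambda>t. (norm (f t))\<^sup>2)"
      by (simp add: cinner_self del: of_real_power)
    also have "\<dots> = 0 \<longleftrightarrow> (AE t in circle_measure. (norm (f t))\<^sup>2 = 0)"
      using f by (intro integral_nonneg_eq_0_iff_AE) (auto simp: square_integrable_def)
    finally show "Re (integral\<^sup>L circle_measure (\<lambda>t. cinner (f t) (f t))) = 0 \<longleftrightarrow> L2_rel f (\<lambda>_. 0)"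
      using f by (simp add: L2_rel_def square_integrable_zero)
  qed
  show "norm f = sqrt (inner f f)"
    by (rule norm_L2_def)
  show "dist f g = norm (f - g)"
    by (rule dist_L2_def)
  show "sgn f = inverse (norm f) *\<^sub>R f"
    by (rule sgn_L2_def)
  show "uniformity = (INF e\<in>{0<..}. principal {(x::'a L2, y). dist x y < e})"
    by (rule uniformity_L2_def)
  show "open U \<longleftrightarrow> (\<forall>x\<in>U. \<forall>\<^sub>F (x', y) in uniformity. x' = x \<longrightarrow> y \<in> U)"
    by (rule open_L2_def)
qed

end

text \<open>The space \<open>L\<^sup>2(E)\<close> for a closed subspace \<open>E\<close>, as a closed subspace of the space of
  square-integrable functions into the whole type.\<close>

definition L2_space :: "'a::chilbert set \<Rightarrow> 'a L2 set" where
  "L2_space E = {f. AE t in circle_measure. rep_L2 f t \<in> E}"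


section \<open>Contractive analytic functions and regular factorizations\<close>

text \<open>Analyticity is complex differentiability at every point of the disc with respect to the
  operator norm of \<open>B(E,F)\<close>.\<close>

definition analytic_op_fun ::
  "'a::complex_inner set \<Rightarrow> 'b::complex_inner set \<Rightarrow> (complex \<Rightarrow> 'a \<Rightarrow> 'b) \<Rightarrow> bool" where
  "analytic_op_fun E F \<Theta> \<longleftrightarrow>
     (\<forall>z. cmod z < 1 \<longrightarrow>
        bounded_op E F (\<Theta> z) \<and>
        (\<exists>D. bounded_op E F D \<and>
           (\<forall>e>0. \<exists>d>0. \<forall>w. cmod w < 1 \<and> cmod (w - z) < d \<longrightarrow>
              (\<forall>x\<in>E. norm (\<Theta> w x - \<Theta> z x - (w - z) *\<^sub>C D x) \<le> e * cmod (w - z) * norm x))))"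

definition contractive_analytic ::
  "'a::chilbert set \<Rightarrow> 'b::chilbert set \<Rightarrow> (complex \<Rightarrow> 'a \<Rightarrow> 'b) \<Rightarrow> bool" where
  "contractive_analytic E F \<Theta> \<longleftrightarrow>
     closed_csubspace E \<and> closed_csubspace F \<and> analytic_op_fun E F \<Theta> \<and>
     (\<forall>z. cmod z < 1 \<longrightarrow> contraction E F (\<Theta> z))"

text \<open>The strong radial limit at \<open>e\<^bsup>it\<^esup>\<close>, as an operator; it is meaningful for those \<open>t\<close>
  (almost all) for which the limit exists for every vector of the domain of \<open>\<Theta>\<close>.\<close>

definition boundary_value :: "(complex \<Rightarrow> 'a \<Rightarrow> 'b::t2_space) \<Rightarrow> real \<Rightarrow> 'a \<Rightarrow> 'b" where
  "boundary_value \<Theta> t x = Lim (at_left 1) (\<lambda>r. \<Theta> (complex_of_real r * cis t) x)"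

definition mult_op :: "(complex \<Rightarrow> 'a::chilbert \<Rightarrow> 'b::chilbert) \<Rightarrow> 'a L2 \<Rightarrow> 'b L2" where
  "mult_op \<Theta> v = abs_L2 (\<lambda>t. boundary_value \<Theta> t (rep_L2 v t))"

abbreviation Delta :: "'a::chilbert set \<Rightarrow> (complex \<Rightarrow> 'a \<Rightarrow> 'b::chilbert) \<Rightarrow> 'a L2 \<Rightarrow> 'a L2" where
  "Delta E \<Theta> \<equiv> defect (L2_space E) (mult_op \<Theta>)"

abbreviation Delta_space :: "'a::chilbert set \<Rightarrow> (complex \<Rightarrow> 'a \<Rightarrow> 'b::chilbert) \<Rightarrow> 'a L2 set" where
  "Delta_space E \<Theta> \<equiv> defect_space (L2_space E) (mult_op \<Theta>)"

definition factorization3 ::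
  "'a::chilbert set \<Rightarrow> 'b::chilbert set \<Rightarrow> 'c::chilbert set \<Rightarrow> 'd::chilbert set \<Rightarrow>
   (complex \<Rightarrow> 'a \<Rightarrow> 'd) \<Rightarrow> (complex \<Rightarrow> 'a \<Rightarrow> 'b) \<Rightarrow> (complex \<Rightarrow> 'b \<Rightarrow> 'c) \<Rightarrow> (complex \<Rightarrow> 'c \<Rightarrow> 'd) \<Rightarrow> bool"
  where
  "factorization3 E1 E2 E3 E4 \<Theta> \<Theta>1 \<Theta>2 \<Theta>3 \<longleftrightarrow>
     contractive_analytic E1 E4 \<Theta> \<and> contractive_analytic E1 E2 \<Theta>1 \<and>
     contractive_analytic E2 E3 \<Theta>2 \<and> contractive_analytic E3 E4 \<Theta>3 \<and>
     (\<forall>z. cmod z < 1 \<longrightarrow> (\<forall>x\<in>E1. \<Theta> z x = \<Theta>3 z (\<Theta>2 z (\<Theta>1 z x))))"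

text \<open>\<open>Z\<^sub>3\<close> is the continuous extension to \<open>Delta_space E1 \<Theta>\<close> of a map given on the
  dense subspace \<open>Delta E1 \<Theta> ` L2_space E1\<close>. These conditions determine it uniquely there.\<close>

definition is_Z3 ::
  "'a::chilbert set \<Rightarrow> 'b::chilbert set \<Rightarrow> 'c::chilbert set \<Rightarrow>
   (complex \<Rightarrow> 'a \<Rightarrow> 'd::chilbert) \<Rightarrow> (complex \<Rightarrow> 'a \<Rightarrow> 'b) \<Rightarrow> (complex \<Rightarrow> 'b \<Rightarrow> 'c) \<Rightarrow> (complex \<Rightarrow> 'c \<Rightarrow> 'd) \<Rightarrow>
   ('a L2 \<Rightarrow> 'c L2 \<times> 'b L2 \<times> 'a L2) \<Rightarrow> bool"
  where
  "is_Z3 E1 E2 E3 \<Theta> \<Theta>1 \<Theta>2 \<Theta>3 Z \<longleftrightarrow>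
     continuous_on (Delta_space E1 \<Theta>) Z \<and>
     (\<forall>f\<in>L2_space E1. Z (Delta E1 \<Theta> f) =
        (Delta E3 \<Theta>3 (mult_op \<Theta>2 (mult_op \<Theta>1 f)), Delta E2 \<Theta>2 (mult_op \<Theta>1 f), Delta E1 \<Theta>1 f))"

definition regular3 ::
  "'a::chilbert set \<Rightarrow> 'b::chilbert set \<Rightarrow> 'c::chilbert set \<Rightarrow> 'd::chilbert set \<Rightarrow>
   (complex \<Rightarrow> 'a \<Rightarrow> 'd) \<Rightarrow> (complex \<Rightarrow> 'a \<Rightarrow> 'b) \<Rightarrow> (complex \<Rightarrow> 'b \<Rightarrow> 'c) \<Rightarrow> (complex \<Rightarrow> 'c \<Rightarrow> 'd) \<Rightarrow> bool"
  where
  "regular3 E1 E2 E3 E4 \<Theta> \<Theta>1 \<Theta>2 \<Theta>3 \<longleftrightarrow>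
     factorization3 E1 E2 E3 E4 \<Theta> \<Theta>1 \<Theta>2 \<Theta>3 \<and>
     (\<exists>Z. is_Z3 E1 E2 E3 \<Theta> \<Theta>1 \<Theta>2 \<Theta>3 Z \<and>
        unitary_op (Delta_space E1 \<Theta>) (Delta_space E3 \<Theta>3 \<times> Delta_space E2 \<Theta>2 \<times> Delta_space E1 \<Theta>1) Z)"

end

theory Submission
  imports Defs
begin

text \<open>Let \<open>V\<^sub>1, V\<^sub>2, V\<^sub>3\<close> be the operators of multiplication by the boundary values of the three factors,
  with defect operators \<open>D\<^sub>i\<close>. Since \<open>V\<^sub>2\<close> is unitary, \<open>D\<^sub>2 = 0\<close>, and \<open>Z\<^sub>3\<close> is unitary exactly if the
  vectors \<open>(D\<^sub>3 V\<^sub>2 V\<^sub>1 f, D\<^sub>1 f)\<close> are dense in the product of the closures of the ranges of \<open>D\<^sub>3\<close> and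
  \<open>D\<^sub>1\<close>. Taking orthogonal complements, this says that \<open>V\<^sub>1\<^sup>* V\<^sub>2\<^sup>* D\<^sub>3 a + D\<^sub>1 b = 0\<close> forces \<open>D\<^sub>3 a = 0\<close>
  (\<open>isometric_extension_unitary_iff\<close>).

  All operators in that condition act fibrewise, through measurable fields of contractions. The
  condition holds for square-integrable functions if and only if it holds in almost every fibre
  (\<open>trivial_complement_pointwise\<close>): constant vectors, projected in each fibre onto the space of
  solutions, are square-integrable solutions, and those of a countable dense set span the solutions
  in almost every fibre. In a single fibre the relation \<open>S D\<^sub>S = D\<^sub>S\<^sub>* S\<close> turns the condition into
  \<open>ran D\<^sub>3 \<inter> V\<^sub>2 (ran D\<^sub>1\<^sub>*) = {0}\<close> (\<open>trivial_complement_iff_ranges\<close>). Together this is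
  \<open>regular3_iff_boundary_ranges\<close>. For the factorization of an upper triangular contraction the identity
  summands and the unitary operators \<open>\<tau>\<close> and \<open>\<tau>\<^sub>*\<close> only add zero summands to the defect operators
  (\<open>defect_unitary_diag_id\<close>, \<open>defect_adj_diag_id_unitary\<close>). So the two ranges in a fibre are
  \<open>\<Delta>\<^sub>B(t) \<D>\<^sub>B \<oplus> 0\<close> and the image of \<open>\<Delta>\<^sub>*\<^sub>A(t) \<D>\<^sub>A\<^sub>* \<oplus> 0\<close> under the Julia operator, which maps \<open>y \<oplus> 0\<close> to
  \<open>L\<^sup>* y \<oplus> D\<^sub>L\<^sub>* y\<close>; the second component vanishes exactly on the kernel of \<open>D\<^sub>L\<^sub>*\<close>.

  Boundary values have to exist for this to make sense. The function \<open>z \<mapsto> \<Theta>\<^sub>T(z) x\<close> is a power series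
  whose coefficients, apart from the first, are \<open>D\<^sub>T\<^sub>* T\<^sup>*\<^sup>n D\<^sub>T x\<close>; their squared norms telescope to a sum of
  at most \<open>(norm (D\<^sub>T x))\<^sup>2\<close> (\<open>char_coeff_summable\<close>). A power series with square-summable vector coefficients has radial limits almost
  everywhere (\<open>AE_radial_limit\<close>): it is the Poisson integral of a square-integrable function, and
  Poisson integrals converge at Lebesgue points, which are almost all points by Vitali's covering
  theorem. Uniform contractivity and separability give the limit for all \<open>x\<close> at once.

  Square roots are obtained throughout as limits of the polynomials \<open>sqrt_iter\<close>. This one construction
  gives their uniqueness, the relation \<open>S D\<^sub>S = D\<^sub>S\<^sub>* S\<close>, and the measurability of \<open>t \<mapsto> D\<^sub>S\<^sub>(\<^sub>t\<^sub>)\<close>.\<close>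

section \<open>Elementary Hilbert space theory\<close>

instance chilbert \<subseteq> banach ..

lemma cinner_add_right: "cinner x (y + z) = cinner x y + cinner (x::'a::complex_inner) z"
  by (metis cinner_add_left cinner_commute complex_cnj_add)

lemma scaleC_zero_left [simp]: "0 *\<^sub>C (x::'a::complex_inner) = 0"
  using scaleR_scaleC[of 0 x] by simp

lemma scaleC_minus1: "(-1) *\<^sub>C (x::'a::complex_inner) = - x"
  using scaleR_scaleC[of "-1" x] by simp

lemma bounded_bilinear_scaleC: "bounded_bilinear (\<lambda>a (x::'a::complex_inner). a *\<^sub>C x)"
proof
  fix a b :: complex and x y :: 'a and r :: real
  show "(a + b) *\<^sub>C x = a *\<^sub>C x + b *\<^sub>C x" by (rule scaleC_add_left)
  show "a *\<^sub>C (x + y) = a *\<^sub>C x + a *\<^sub>C y" by (rule scaleC_add_right)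
  show "(r *\<^sub>R a) *\<^sub>C x = r *\<^sub>R (a *\<^sub>C x)"
    by (simp add: scaleR_scaleC scaleC_scaleC scaleR_conv_of_real)
  show "a *\<^sub>C (r *\<^sub>R x) = r *\<^sub>R (a *\<^sub>C x)"
    by (simp add: scaleR_scaleC scaleC_scaleC mult.commute)
  show "\<exists>K. \<forall>(a::complex) x::'a. norm (a *\<^sub>C x) \<le> norm a * norm x * K"
    by (rule exI[of _ 1]) (simp add: norm_scaleC)
qed

lemma bounded_bilinear_cinner: "bounded_bilinear (cinner :: 'a::complex_inner \<Rightarrow> 'a \<Rightarrow> complex)"
proof
  fix x y z :: 'a and r :: real
  show "cinner (x + y) z = cinner x z + cinner y z" by (rule cinner_add_left)
  show "cinner x (y + z) = cinner x y + cinner x z" by (rule cinner_add_right)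
  show "cinner (r *\<^sub>R x) y = r *\<^sub>R cinner x y"
    by (simp add: scaleR_scaleC cinner_scaleC_left scaleR_conv_of_real)
  show "cinner x (r *\<^sub>R y) = r *\<^sub>R cinner x y"
    by (simp add: scaleR_scaleC cinner_scaleC_right scaleR_conv_of_real)
  show "\<exists>K. \<forall>x y::'a. norm (cinner x y) \<le> norm x * norm y * K"
    by (rule exI[of _ 2], intro allI) (use cmod_cinner_le in \<open>simp add: mult.commute mult.left_commute\<close>)
qed

interpretation scaleC: bounded_bilinear "\<lambda>a (x::'a::complex_inner). a *\<^sub>C x"
  by (rule bounded_bilinear_scaleC)

interpretation cinner: bounded_bilinear "cinner :: 'a::complex_inner \<Rightarrow> 'a \<Rightarrow> complex"
  by (rule bounded_bilinear_cinner)

lemmas cinner_simps = cinner.add_left cinner.add_right cinner.diff_left cinner.diff_right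
  cinner.minus_left cinner.minus_right cinner.zero_left cinner.zero_right
  cinner_scaleC_left cinner_scaleC_right

lemma cinner_eq_zero_iff [simp]: "cinner x x = 0 \<longleftrightarrow> (x::'a::complex_inner) = 0"
  by (simp add: cinner_self)

lemma norm_sq_cinner: "(norm (x::'a::complex_inner))\<^sup>2 = Re (cinner x x)"
  by (simp add: cinner_self del: of_real_power)

lemma cinner_Im_self [simp]: "Im (cinner x (x::'a::complex_inner)) = 0"
  by (simp add: cinner_self del: of_real_power)

lemma Re_cinner_le: "Re (cinner x y) \<le> norm x * norm (y::'a::complex_inner)"
  by (metis inner_eq_Re_cinner norm_cauchy_schwarz)

lemma csubspace_closed: "closed_csubspace E \<Longrightarrow> closed E"
  and csubspace_0: "closed_csubspace E \<Longrightarrow> 0 \<in> E"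
  and csubspace_add: "closed_csubspace E \<Longrightarrow> x \<in> E \<Longrightarrow> y \<in> E \<Longrightarrow> x + y \<in> E"
  and csubspace_scaleC: "closed_csubspace E \<Longrightarrow> x \<in> E \<Longrightarrow> c *\<^sub>C x \<in> E"
  by (auto simp: closed_csubspace_def)

lemma csubspace_scaleR: "closed_csubspace E \<Longrightarrow> x \<in> E \<Longrightarrow> c *\<^sub>R x \<in> E"
  by (simp add: scaleR_scaleC csubspace_scaleC)

lemma csubspace_minus: "closed_csubspace E \<Longrightarrow> x \<in> E \<Longrightarrow> - x \<in> E"
  by (metis csubspace_scaleC scaleC_minus1)

lemma csubspace_diff: "closed_csubspace E \<Longrightarrow> x \<in> E \<Longrightarrow> y \<in> E \<Longrightarrow> x - y \<in> E"
  by (metis csubspace_add csubspace_minus diff_conv_add_uminus)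

lemmas csubspace_rules = csubspace_0 csubspace_add csubspace_scaleC csubspace_scaleR
  csubspace_minus csubspace_diff

lemma csubspace_UNIV: "closed_csubspace UNIV"
  by (simp add: closed_csubspace_def)

lemma csubspace_Times: "closed_csubspace E \<Longrightarrow> closed_csubspace F \<Longrightarrow> closed_csubspace (E \<times> F)"
  by (auto simp: closed_csubspace_def closed_Times scaleC_prod_def zero_prod_def)

lemma csubspace_closure:
  assumes "0 \<in> R" "\<And>x y. x \<in> R \<Longrightarrow> y \<in> R \<Longrightarrow> x + y \<in> R" "\<And>c x. x \<in> R \<Longrightarrow> c *\<^sub>C x \<in> R"
  shows "closed_csubspace (closure (R::'a::complex_inner set))"
  unfolding closed_csubspace_def
proof (intro conjI ballI allI)
  show "0 \<in> closure R" using assms(1) closure_subset by blast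
  show "x + y \<in> closure R" if xy: "x \<in> closure R" "y \<in> closure R" for x y
  proof -
    obtain f g where f: "\<And>n. f n \<in> R" "f \<longlonglongrightarrow> x" and g: "\<And>n. g n \<in> R" "g \<longlonglongrightarrow> y"
      using xy unfolding closure_sequential by blast
    have "\<forall>n. f n + g n \<in> R" by (simp add: assms(2) f g)
    then show ?thesis unfolding closure_sequential using tendsto_add[OF f(2) g(2)] by (intro exI conjI)
  qed
  show "c *\<^sub>C x \<in> closure R" if x: "x \<in> closure R" for c x
  proof -
    obtain f where f: "\<And>n. f n \<in> R" "f \<longlonglongrightarrow> x"
      using x unfolding closure_sequential by blast
    have "\<forall>n. c *\<^sub>C f n \<in> R" by (simp add: assms(3) f)
    then show ?thesis unfolding closure_sequential
      using scaleC.tendsto[OF tendsto_const f(2)] by (intro exI conjI)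
  qed
qed simp

lemma bounded_op_in: "bounded_op E F S \<Longrightarrow> x \<in> E \<Longrightarrow> S x \<in> F"
  and bounded_op_add: "bounded_op E F S \<Longrightarrow> x \<in> E \<Longrightarrow> y \<in> E \<Longrightarrow> S (x + y) = S x + S y"
  and bounded_op_scaleC: "bounded_op E F S \<Longrightarrow> x \<in> E \<Longrightarrow> S (c *\<^sub>C x) = c *\<^sub>C S x"
  by (auto simp: bounded_op_def)

lemma bounded_op_zero: "bounded_op E F S \<Longrightarrow> 0 \<in> E \<Longrightarrow> S 0 = 0"
  using bounded_op_scaleC[of E F S 0 0] by simp

lemma bounded_op_minus: "bounded_op E F S \<Longrightarrow> x \<in> E \<Longrightarrow> S (- x) = - S x"
  by (metis bounded_op_scaleC scaleC_minus1)

lemma bounded_op_diff: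
  assumes "closed_csubspace E" "bounded_op E F S" "x \<in> E" "y \<in> E"
  shows "S (x - y) = S x - S y"
  using bounded_op_add[OF assms(2,3) csubspace_minus[OF assms(1,4)]] bounded_op_minus[OF assms(2,4)]
  by simp

lemma bounded_op_scaleR: "bounded_op E F S \<Longrightarrow> x \<in> E \<Longrightarrow> S (c *\<^sub>R x) = c *\<^sub>R S x"
  by (simp add: scaleR_scaleC bounded_op_scaleC)

lemma bounded_op_bound:
  assumes "bounded_op E F S"
  obtains K where "K > 0" "\<And>x. x \<in> E \<Longrightarrow> norm (S x) \<le> K * norm x"
proof -
  obtain K where K: "\<forall>x\<in>E. norm (S x) \<le> K * norm x"
    using assms by (auto simp: bounded_op_def)
  have "norm (S x) \<le> max K 1 * norm x" if "x \<in> E" for x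
    using K that by (meson max.cobounded1 mult_right_mono norm_ge_zero order_trans)
  then show thesis using that[of "max K 1"] by auto
qed

lemma bounded_op_tendsto:
  assumes E: "closed_csubspace E" and S: "bounded_op E F S"
    and f: "(f \<longlongrightarrow> x) G" "\<forall>\<^sub>F n in G. f n \<in> E" and x: "x \<in> E"
  shows "((\<lambda>n. S (f n)) \<longlongrightarrow> S x) G"
proof -
  obtain K where K: "K > 0" "\<And>x. x \<in> E \<Longrightarrow> norm (S x) \<le> K * norm x"
    using bounded_op_bound[OF S] by blast
  have "((\<lambda>n. K * norm (f n - x)) \<longlongrightarrow> 0) G"
    using tendsto_norm[OF LIM_zero[OF f(1)]] by (auto intro: tendsto_mult_right_zero)
  moreover have "\<forall>\<^sub>F n in G. norm (S (f n) - S x) \<le> K * norm (f n - x)"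
    using f(2) by eventually_elim (metis E K(2) S bounded_op_diff csubspace_diff x)
  ultimately have "((\<lambda>n. S (f n) - S x) \<longlongrightarrow> 0) G"
    by (rule Lim_null_comparison[rotated])
  then show ?thesis by (rule LIM_zero_cancel)
qed

lemma bounded_op_continuous_on:
  assumes "closed_csubspace E" "bounded_op E F S"
  shows "continuous_on E S"
  unfolding continuous_on_def
  by (auto intro!: bounded_op_tendsto[OF assms] simp: eventually_at_filter)

lemma bounded_op_subset: "bounded_op E F S \<Longrightarrow> E' \<subseteq> E \<Longrightarrow> F \<subseteq> F' \<Longrightarrow> bounded_op E' F' S"
  unfolding bounded_op_def by blast

lemma contraction_subset: "contraction E F S \<Longrightarrow> E' \<subseteq> E \<Longrightarrow> F \<subseteq> F' \<Longrightarrow> contraction E' F' S"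
  using bounded_op_subset unfolding contraction_def by blast

lemma contraction_bounded_op: "contraction E F S \<Longrightarrow> bounded_op E F S"
  and contraction_norm: "contraction E F S \<Longrightarrow> x \<in> E \<Longrightarrow> norm (S x) \<le> norm x"
  and contraction_in: "contraction E F S \<Longrightarrow> x \<in> E \<Longrightarrow> S x \<in> F"
  by (auto simp: contraction_def bounded_op_def)

lemma contractionI:
  assumes "\<And>x. x \<in> E \<Longrightarrow> S x \<in> F" "\<And>x y. x \<in> E \<Longrightarrow> y \<in> E \<Longrightarrow> S (x + y) = S x + S y"
    "\<And>c x. x \<in> E \<Longrightarrow> S (c *\<^sub>C x) = c *\<^sub>C S x" "\<And>x. x \<in> E \<Longrightarrow> norm (S x) \<le> norm x"
  shows "contraction E F S"
  unfolding contraction_def bounded_op_def using assms by (auto intro!: exI[of _ 1])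

lemma contraction_comp:
  assumes S: "contraction E F S" and R: "contraction F G R"
  shows "contraction E G (\<lambda>x. R (S x))"
proof -
  note b = contraction_bounded_op[OF S] contraction_bounded_op[OF R]
  have "norm (R (S x)) \<le> norm x" if "x \<in> E" for x
    using contraction_norm[OF S that] contraction_norm[OF R contraction_in[OF S that]] by simp
  then show ?thesis
    by (intro contractionI)
      (use b in \<open>auto simp: bounded_op_in bounded_op_add bounded_op_scaleC\<close>)
qed

lemma bounded_op_image_closure_csubspace:
  assumes E: "closed_csubspace E" and S: "bounded_op E F S"
  shows "closed_csubspace (closure (S ` E))"
proof (rule csubspace_closure)
  show "0 \<in> S ` E" using bounded_op_zero[OF S csubspace_0[OF E]] csubspace_0[OF E] by (metis imageI)
  show "x + y \<in> S ` E" if "x \<in> S ` E" "y \<in> S ` E" for x y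
    using that csubspace_add[OF E] bounded_op_add[OF S] by (smt (verit) imageE imageI)
  show "c *\<^sub>C x \<in> S ` E" if "x \<in> S ` E" for c x
    using that csubspace_scaleC[OF E] bounded_op_scaleC[OF S] by (smt (verit) imageE imageI)
qed

lemma closure_image_subset:
  assumes "bounded_op E F S" "closed F" shows "closure (S ` E) \<subseteq> F"
  by (intro closure_minimal assms) (use assms bounded_op_in in blast)

lemma bounded_op_closure_image:
  assumes E: "closed_csubspace E" and S: "bounded_op E F S" and R: "R \<subseteq> E"
    and x: "x \<in> closure R" and im: "\<And>x. x \<in> R \<Longrightarrow> S x \<in> G"
  shows "S x \<in> closure G"
proof -
  obtain f where f: "\<And>n. f n \<in> R" "f \<longlonglongrightarrow> x"
    using x unfolding closure_sequential by blast
  have "x \<in> E" using x R E by (metis closure_minimal csubspace_closed subsetD)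
  have "(\<lambda>n. S (f n)) \<longlonglongrightarrow> S x"
    by (rule bounded_op_tendsto[OF E S f(2) always_eventually \<open>x \<in> E\<close>]) (use f(1) R in blast)
  moreover have "\<forall>n. S (f n) \<in> G" using f(1) im by blast
  ultimately show ?thesis unfolding closure_sequential by (intro exI conjI)
qed

subsection \<open>Projections and adjoints\<close>

text \<open>The parallelogram law makes every minimizing sequence for the distance to \<open>E\<close> a Cauchy sequence.\<close>

lemma projection_exists:
  fixes x :: "'a::{complex_inner,complete_space}"
  assumes E: "closed_csubspace E"
  obtains p where "p \<in> E" "\<And>u. u \<in> E \<Longrightarrow> cinner (x - p) u = 0"
proof -
  define A where "A = (\<lambda>u. norm (x - u)) ` E"
  have A: "A \<noteq> {}" "bdd_below A" using csubspace_0[OF E] by (auto simp: A_def intro!: bdd_belowI[of _ 0])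
  define d where "d = Inf A"
  have d0: "0 \<le> d" unfolding d_def using A by (intro cInf_greatest) (auto simp: A_def)
  have dle: "d \<le> norm (x - u)" if "u \<in> E" for u
    unfolding d_def using A that by (intro cInf_lower) (auto simp: A_def)
  have "\<exists>u\<in>E. (norm (x - u))\<^sup>2 < d\<^sup>2 + inverse (real (Suc n))" for n
  proof (rule ccontr)
    assume "\<not> ?thesis"
    then have *: "sqrt (d\<^sup>2 + inverse (real (Suc n))) \<le> norm (x - u)" if "u \<in> E" for u
      using that by (auto simp: not_less intro!: real_le_lsqrt)
    have "sqrt (d\<^sup>2 + inverse (real (Suc n))) \<le> d"
      unfolding d_def using A * by (intro cInf_greatest) (auto simp: A_def d_def)
    then have "d\<^sup>2 + inverse (real (Suc n)) \<le> d\<^sup>2" using d0 by (metis sqrt_le_D)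
    then show False by simp
  qed
  then obtain u where u: "\<And>n. u n \<in> E" "\<And>n. (norm (x - u n))\<^sup>2 < d\<^sup>2 + inverse (real (Suc n))"
    by metis
  have par: "(norm (u n - u m))\<^sup>2 \<le> 2 * inverse (real (Suc n)) + 2 * inverse (real (Suc m))" for n m
  proof -
    have "(1/2) *\<^sub>R (u n + u m) \<in> E" using u E by (intro csubspace_rules)
    then have "d\<^sup>2 \<le> (norm (x - (1/2) *\<^sub>R (u n + u m)))\<^sup>2" using dle d0 by (intro power_mono)
    moreover have "(norm (u n - u m))\<^sup>2 + 4 * (norm (x - (1/2) *\<^sub>R (u n + u m)))\<^sup>2
        = 2 * (norm (x - u n))\<^sup>2 + 2 * (norm (x - u m))\<^sup>2"
      by (simp add: power2_norm_eq_inner inner_simps algebra_simps inner_commute)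
    ultimately show ?thesis using u(2)[of n] u(2)[of m] by argo
  qed
  have "Cauchy u"
  proof (rule metric_CauchyI)
    fix e :: real assume e: "e > 0"
    obtain N where N: "inverse (real (Suc N)) < e\<^sup>2 / 4"
      using reals_Archimedean[of "e\<^sup>2/4"] e by auto
    have "dist (u m) (u n) < e" if "m \<ge> N" "n \<ge> N" for m n
    proof -
      have "inverse (real (Suc m)) \<le> inverse (real (Suc N))" "inverse (real (Suc n)) \<le> inverse (real (Suc N))"
        using that by (auto intro!: le_imp_inverse_le)
      then have "(norm (u m - u n))\<^sup>2 < e\<^sup>2" using par[of m n] N by argo
      then show ?thesis using e by (simp add: dist_norm power2_less_imp_less)
    qed
    then show "\<exists>M. \<forall>m\<ge>M. \<forall>n\<ge>M. dist (u m) (u n) < e" by blast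
  qed
  then obtain p where p: "u \<longlonglongrightarrow> p" using Cauchy_convergent convergent_def by blast
  have pE: "p \<in> E" using p u csubspace_closed[OF E] closed_sequentially by blast
  have pd: "(norm (x - p))\<^sup>2 \<le> d\<^sup>2"
  proof (rule LIMSEQ_le)
    show "(\<lambda>n. (norm (x - u n))\<^sup>2) \<longlonglongrightarrow> (norm (x - p))\<^sup>2" by (intro tendsto_intros p)
    show "(\<lambda>n. d\<^sup>2 + inverse (real (Suc n))) \<longlonglongrightarrow> d\<^sup>2"
      using tendsto_add[OF tendsto_const LIMSEQ_inverse_real_of_nat, of "d\<^sup>2"] by simp
    show "\<exists>N. \<forall>n\<ge>N. (norm (x - u n))\<^sup>2 \<le> d\<^sup>2 + inverse (real (Suc n))"
      using u(2) less_imp_le by blast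
  qed
  have re: "inner (x - p) w = 0" if w: "w \<in> E" for w
  proof (cases "w = 0")
    case False
    define c where "c = inner (x - p) w / (norm w)\<^sup>2"
    have "p + c *\<^sub>R w \<in> E" using pE w E by (intro csubspace_rules)
    then have "d\<^sup>2 \<le> (norm (x - (p + c *\<^sub>R w)))\<^sup>2" using dle d0 by (intro power_mono)
    then have "(norm (x - p))\<^sup>2 \<le> (norm ((x - p) - c *\<^sub>R w))\<^sup>2" using pd by (simp only: diff_diff_eq)
    also have "\<dots> = (norm (x - p))\<^sup>2 - 2 * c * inner (x - p) w + c\<^sup>2 * (norm w)\<^sup>2"
      unfolding power2_norm_eq_inner by (simp add: inner_simps inner_commute power2_eq_square algebra_simps)
    finally have "2 * c * inner (x - p) w \<le> c\<^sup>2 * (norm w)\<^sup>2" by simp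
    moreover have "c * (norm w)\<^sup>2 = inner (x - p) w" using False by (simp add: c_def)
    ultimately have "2 * c * (c * (norm w)\<^sup>2) \<le> c * (c * (norm w)\<^sup>2)" by (simp add: power2_eq_square mult.assoc)
    then have "c * c * (norm w)\<^sup>2 \<le> 0" by simp
    then have "c = 0" using False by (smt (verit, best) mult_pos_pos not_real_square_gt_zero zero_less_norm_iff zero_less_power)
    then show ?thesis using False by (simp add: c_def)
  qed simp
  have "cinner (x - p) w = 0" if "w \<in> E" for w
    using re[OF that] re[OF csubspace_scaleC[OF E that, of \<i>]] by (simp add: cinner_eq_Complex Complex_eq)
  then show thesis using that pE by blast
qed

text \<open>The representing vector is a multiple of the component of \<open>u\<^sub>0\<close> orthogonal to the kernel of the
  functional \<open>u \<mapsto> cinner (S u) y\<close>, where \<open>u\<^sub>0\<close> is any vector outside that kernel.\<close>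

lemma riesz_representation:
  fixes S :: "'a::{complex_inner,complete_space} \<Rightarrow> 'b::complex_inner"
  assumes E: "closed_csubspace E" and S: "bounded_op E F S"
  shows "\<exists>x\<in>E. \<forall>u\<in>E. cinner (S u) y = cinner u x"
proof (cases "\<forall>u\<in>E. cinner (S u) y = 0")
  case True
  then show ?thesis using csubspace_0[OF E] by (intro bexI[of _ 0]) (simp_all add: cinner.zero_right)
next
  case False
  then obtain u0 where u0: "u0 \<in> E" "cinner (S u0) y \<noteq> 0" by blast
  define N where "N = {u \<in> E. cinner (S u) y = 0}"
  have N: "closed_csubspace N"
    unfolding closed_csubspace_def
  proof (intro conjI)
    have "continuous_on E (\<lambda>u. cinner (S u) y)"
      by (rule cinner.continuous_on[OF bounded_op_continuous_on[OF E S] continuous_on_const])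
    then have "closed (E \<inter> (\<lambda>u. cinner (S u) y) -` {0})"
      using csubspace_closed[OF E] by (intro continuous_closed_preimage) auto
    moreover have "E \<inter> (\<lambda>u. cinner (S u) y) -` {0} = N" by (auto simp: N_def)
    ultimately show "closed N" by simp
  qed (use E S in \<open>auto simp: N_def csubspace_rules bounded_op_zero bounded_op_add bounded_op_scaleC cinner_simps\<close>)
  obtain p where p: "p \<in> N" "\<And>u. u \<in> N \<Longrightarrow> cinner (u0 - p) u = 0"
    using projection_exists[OF N] by blast
  define w where "w = u0 - p"
  have pE: "p \<in> E" "cinner (S p) y = 0" using p by (auto simp: N_def)
  have wE: "w \<in> E" using pE u0 E by (auto simp: w_def csubspace_rules)
  define c where "c = cinner (S w) y"
  have c: "c \<noteq> 0" using u0 pE by (simp add: c_def w_def bounded_op_diff[OF E S] cinner_simps)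
  then have w0: "w \<noteq> 0" using bounded_op_zero[OF S csubspace_0[OF E]] by (auto simp: c_def cinner_simps)
  \<comment> \<open>The combination of \<open>u\<close> and \<open>w\<close> on which the functional vanishes is orthogonal to \<open>w\<close>.\<close>
  have "cinner (S u) y = cinner u ((cnj c / (norm w)\<^sup>2) *\<^sub>C w)" if u: "u \<in> E" for u
  proof -
    have "c *\<^sub>C u - cinner (S u) y *\<^sub>C w \<in> N"
      using u wE E S by (simp add: N_def csubspace_rules bounded_op_diff bounded_op_scaleC cinner_simps c_def)
    then have "cinner w (c *\<^sub>C u - cinner (S u) y *\<^sub>C w) = 0" using p by (simp add: w_def)
    then have "cinner (c *\<^sub>C u - cinner (S u) y *\<^sub>C w) w = 0" by (metis cinner_commute complex_cnj_zero)
    then have "c * cinner u w = cinner (S u) y * (norm w)\<^sup>2" by (simp add: cinner_simps cinner_self)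
    then show ?thesis using w0 by (simp add: cinner_simps field_simps)
  qed
  then show ?thesis using csubspace_scaleC[OF E wE] by blast
qed

lemma adjoint_op_eqI:
  assumes E: "closed_csubspace E" and x: "x \<in> E" "\<And>u. u \<in> E \<Longrightarrow> cinner (S u) y = cinner u x"
  shows "adjoint_op E S y = x"
  unfolding adjoint_op_def
proof (rule the_equality)
  fix x' assume x': "x' \<in> E \<and> (\<forall>u\<in>E. cinner (S u) y = cinner u x')"
  then have "cinner u (x' - x) = 0" if "u \<in> E" for u using x that by (auto simp: cinner_simps)
  then have "cinner (x' - x) (x' - x) = 0" using csubspace_diff[OF E] x x' by blast
  then show "x' = x" by simp
qed (use x in blast)

context
  fixes E :: "'a::{complex_inner,complete_space} set" and F :: "'b::complex_inner set" and S
  assumes E: "closed_csubspace E" and S: "bounded_op E F S"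
begin

lemma adjoint_op_char:
  "adjoint_op E S y \<in> E \<and> (\<forall>u\<in>E. cinner (S u) y = cinner u (adjoint_op E S y))"
  using riesz_representation[OF E S, of y] adjoint_op_eqI[OF E] by metis

lemma adjoint_op_in: "adjoint_op E S y \<in> E"
  and adjoint_op_cinner: "u \<in> E \<Longrightarrow> cinner (S u) y = cinner u (adjoint_op E S y)"
  using adjoint_op_char by auto

lemma adjoint_op_cinner': "u \<in> E \<Longrightarrow> cinner y (S u) = cinner (adjoint_op E S y) u"
  by (metis adjoint_op_cinner cinner_commute)

lemma adjoint_op_add: "adjoint_op E S (x + y) = adjoint_op E S x + adjoint_op E S y"
  by (intro adjoint_op_eqI[OF E]) (simp_all add: adjoint_op_in adjoint_op_cinner cinner_simps csubspace_rules[OF E])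

lemma adjoint_op_scaleC: "adjoint_op E S (c *\<^sub>C x) = c *\<^sub>C adjoint_op E S x"
  by (intro adjoint_op_eqI[OF E]) (simp_all add: adjoint_op_in adjoint_op_cinner cinner_simps csubspace_rules[OF E])

lemma adjoint_op_norm_le:
  assumes K: "K \<ge> 0" "\<And>x. x \<in> E \<Longrightarrow> norm (S x) \<le> K * norm x"
  shows "norm (adjoint_op E S y) \<le> K * norm y"
proof -
  let ?x = "adjoint_op E S y"
  have "(norm ?x)\<^sup>2 = Re (cinner (S ?x) y)"
    using adjoint_op_cinner[OF adjoint_op_in] by (simp add: norm_sq_cinner)
  also have "\<dots> \<le> (K * norm ?x) * norm y"
    using Re_cinner_le[of "S ?x" y] K(2)[OF adjoint_op_in, of y]
    by (meson mult_right_mono norm_ge_zero order_trans)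
  finally have *: "norm ?x * norm ?x \<le> (K * norm y) * norm ?x" by (simp add: power2_eq_square mult_ac)
  show ?thesis
  proof (cases "?x = 0")
    case True
    then show ?thesis using K(1) by simp
  next
    case False
    then show ?thesis using * by (intro mult_right_le_imp_le[OF *]) simp
  qed
qed

end

lemma adjoint_op_contraction:
  fixes S :: "'a::{complex_inner,complete_space} \<Rightarrow> 'b::complex_inner"
  assumes "closed_csubspace E" "contraction E F S"
  shows "contraction F' E (adjoint_op E S)"
proof -
  note b = contraction_bounded_op[OF assms(2)]
  show ?thesis
    using contraction_norm[OF assms(2)] adjoint_op_norm_le[OF assms(1) b, of 1]
    by (intro contractionI)
      (simp_all add: adjoint_op_in[OF assms(1) b] adjoint_op_add[OF assms(1) b] adjoint_op_scaleC[OF assms(1) b])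
qed

lemma adjoint_op_adjoint_op:
  fixes S :: "'a::{complex_inner,complete_space} \<Rightarrow> 'b::{complex_inner,complete_space}"
  assumes "closed_csubspace E" "closed_csubspace F" "bounded_op E F S" "x \<in> E"
  shows "adjoint_op F (adjoint_op E S) x = S x"
  using assms by (intro adjoint_op_eqI) (simp_all add: bounded_op_in adjoint_op_cinner'[OF assms(1,3)])

lemma adjoint_op_cong: "(\<And>x. x \<in> E \<Longrightarrow> S x = S' x) \<Longrightarrow> adjoint_op E S = adjoint_op E S'"
  unfolding adjoint_op_def by (intro ext arg_cong[where f = The]) auto

lemma sqrt_op_cong: "(\<And>x. x \<in> E \<Longrightarrow> P x = P' x) \<Longrightarrow> sqrt_op E P = sqrt_op E P'"
  unfolding sqrt_op_def by (intro arg_cong[where f = The]) auto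

lemma defect_cong: "(\<And>x. x \<in> E \<Longrightarrow> S x = S' x) \<Longrightarrow> defect E S = defect E S'"
  unfolding defect_def using adjoint_op_cong[of E S S'] by (intro sqrt_op_cong) auto

text \<open>Every fact about defect operators thereby has a counterpart for adjoint defect operators.\<close>

lemma defect_adj_eq_defect:
  fixes S :: "'a::{complex_inner,complete_space} \<Rightarrow> 'b::{complex_inner,complete_space}"
  assumes "closed_csubspace E" "closed_csubspace F" "contraction E F S"
  shows "defect_adj E F S = defect F (adjoint_op E S)"
  unfolding defect_adj_def defect_def
  using adjoint_op_adjoint_op[OF assms(1,2) contraction_bounded_op[OF assms(3)]]
    contraction_in[OF adjoint_op_contraction[OF assms(1,3)]] by (intro sqrt_op_cong) (metis UNIV_I)

subsection \<open>Positive square roots\<close>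

text \<open>Realness of the form at \<open>x + y\<close> and at \<open>x + \<i> y\<close> yields the imaginary and the real part of the claim.\<close>

lemma complex_polarize:
  assumes "bounded_op E E S" "closed_csubspace E"
    and r: "\<And>x. x \<in> E \<Longrightarrow> cinner (S x) x \<in> \<real>" and x: "x \<in> E" and y: "y \<in> E"
  shows "cinner (S x) y = cinner x (S y)"
proof -
  have im: "Im (cinner (S x) x) = 0" if "x \<in> E" for x using r[OF that] by (simp add: complex_is_Real_iff)
  have 1: "Im (cinner (S x) y) + Im (cinner (S y) x) = 0" if "x \<in> E" "y \<in> E" for x y
    using im[OF csubspace_add[OF assms(2) that]] im[OF that(1)] im[OF that(2)]
    by (simp add: bounded_op_add[OF assms(1) that] cinner_simps)
  have iy: "\<i> *\<^sub>C y \<in> E" by (simp add: assms(2) csubspace_scaleC y)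
  have "Im (cinner (S x) y) = - Im (cinner (S y) x)" using 1[OF x y] by simp
  moreover have "Re (cinner (S x) y) = Re (cinner (S y) x)"
    using 1[OF x iy] by (simp add: bounded_op_scaleC[OF assms(1) y] cinner_simps)
  ultimately have "cinner (S x) y = cnj (cinner (S y) x)" by (simp add: complex_eq_iff)
  then show ?thesis by (metis cinner_commute)
qed

lemma positive_op_selfadjoint:
  "positive_op E S \<Longrightarrow> closed_csubspace E \<Longrightarrow> x \<in> E \<Longrightarrow> y \<in> E \<Longrightarrow> cinner (S x) y = cinner x (S y)"
  by (rule complex_polarize) (auto simp: positive_op_def)

text \<open>The quadratic polynomial \<open>\<langle>S (y - c S y), y - c S y\<rangle>\<close> in the real variable \<open>c\<close> is nonnegative, has no
  constant term, and has linear coefficient \<open>-2 (norm (S y))\<^sup>2\<close>.\<close>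

lemma positive_op_kernel:
  assumes S: "positive_op E S" and E: "closed_csubspace E" and y: "y \<in> E" and 0: "Re (cinner (S y) y) = 0"
  shows "S y = 0"
proof -
  have b: "bounded_op E E S" using S by (simp add: positive_op_def)
  define q where "q = Re (cinner (S (S y)) (S y))"
  have Sy: "S y \<in> E" "S (S y) \<in> E" using b y by (auto simp: bounded_op_in)
  have *: "2 * c * (norm (S y))\<^sup>2 \<le> c\<^sup>2 * q" for c :: real
  proof -
    let ?z = "y - c *\<^sub>R S y"
    have z: "?z \<in> E" using E y Sy by (simp add: csubspace_rules)
    have eq: "cinner (S (S y)) y = cinner (S y) (S y)" by (rule positive_op_selfadjoint[OF S E Sy(1) y])
    have Sz: "S ?z = S y - c *\<^sub>R S (S y)"
      using E y Sy by (simp add: bounded_op_diff[OF E b] bounded_op_scaleR[OF b] csubspace_scaleR)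
    have "Re (cinner (S ?z) ?z) = - 2 * c * (norm (S y))\<^sup>2 + c\<^sup>2 * q"
      unfolding Sz using 0 eq by (simp add: cinner_simps q_def norm_sq_cinner[unfolded power2_eq_square] scaleR_scaleC power2_eq_square algebra_simps)
    moreover have "0 \<le> Re (cinner (S ?z) ?z)" using S z by (simp add: positive_op_def)
    ultimately show ?thesis by simp
  qed
  have "norm (S y) = 0"
  proof (rule ccontr)
    assume n: "norm (S y) \<noteq> 0"
    define c where "c = (norm (S y))\<^sup>2 / (\<bar>q\<bar> + 1)"
    have c: "c > 0" using n by (simp add: c_def)
    have "2 * (norm (S y))\<^sup>2 \<le> c * q" using *[of c] c by (simp add: power2_eq_square)
    also have "\<dots> \<le> c * (\<bar>q\<bar> + 1)" using c by (intro mult_left_mono) auto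
    also have "\<dots> = (norm (S y))\<^sup>2" by (simp add: c_def)
    finally show False using n by simp
  qed
  then show ?thesis by simp
qed

text \<open>The iterates \<open>Y\<^sub>n\<close> with \<open>Y\<^sub>n\<^sub>+\<^sub>1 = (X + Y\<^sub>n\<^sup>2) / 2\<close> are polynomials in \<open>X\<close> and converge to
  \<open>I - (I - X)\<^bsup>1/2\<^esup>\<close>. All that is used of the square root comes from them: it is positive,
  commutes with what commutes with \<open>X\<close>, and depends measurably on a measurable \<open>X\<close>.\<close>

primrec sqrt_iter :: "('a::complex_inner \<Rightarrow> 'a) \<Rightarrow> nat \<Rightarrow> 'a \<Rightarrow> 'a" where
  "sqrt_iter X 0 = (\<lambda>x. 0)"
| "sqrt_iter X (Suc n) = (\<lambda>x. (1/2) *\<^sub>R (X x + sqrt_iter X n (sqrt_iter X n x)))"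

lemma sqrt_iter_contraction:
  assumes E: "closed_csubspace E" and X: "contraction E E X"
  shows "contraction E E (sqrt_iter X n)"
proof (induction n)
  case 0
  show ?case by (intro contractionI) (use csubspace_0[OF E] in \<open>auto simp: scaleC.zero_right\<close>)
next
  case (Suc n)
  let ?Y = "sqrt_iter X n"
  note Y = contraction_comp[OF Suc Suc]
  note b = contraction_bounded_op[OF X] contraction_bounded_op[OF Y]
  have "norm ((1/2) *\<^sub>R (X x + ?Y (?Y x))) \<le> norm x" if "x \<in> E" for x
    using contraction_norm[OF X that] contraction_norm[OF Y that] norm_triangle_ineq[of "X x" "?Y (?Y x)"]
    by simp
  moreover have "c *\<^sub>C ((1/2) *\<^sub>R x) = (1/2) *\<^sub>R (c *\<^sub>C x)" for c and x :: 'a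
    by (simp add: scaleC.scaleR_right)
  ultimately show ?case
    by (intro contractionI)
      (simp_all add: bounded_op_add[OF b(1)] bounded_op_add[OF b(2)] bounded_op_scaleC[OF b(1)]
        bounded_op_scaleC[OF b(2)] bounded_op_in[OF b(1)] bounded_op_in[OF b(2)] csubspace_add[OF E]
        csubspace_scaleR[OF E] scaleC_add_right algebra_simps)
qed

lemma sqrt_iter_intertwine:
  assumes E: "closed_csubspace E" and X: "contraction E E X"
    and R: "bounded_op E F R"
    and XR: "\<And>x. x \<in> E \<Longrightarrow> R (X x) = X' (R x)" and x: "x \<in> E"
  shows "R (sqrt_iter X n x) = sqrt_iter X' n (R x)"
  using x
proof (induction n arbitrary: x)
  case 0
  then show ?case using bounded_op_zero[OF R csubspace_0[OF E]] by simp
next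
  case (Suc n)
  have i: "X x \<in> E" "sqrt_iter X n x \<in> E" "sqrt_iter X n (sqrt_iter X n x) \<in> E"
    using Suc.prems X sqrt_iter_contraction[OF E X] by (meson contraction_in)+
  then show ?case
    by (simp add: bounded_op_scaleR[OF R] bounded_op_add[OF R] csubspace_rules[OF E] Suc XR)
qed

lemma sqrt_iter_selfadjoint:
  assumes E: "closed_csubspace E" and X: "contraction E E X"
    and sa: "\<And>x y. x \<in> E \<Longrightarrow> y \<in> E \<Longrightarrow> cinner (X x) y = cinner x (X y)"
    and "x \<in> E" "y \<in> E"
  shows "cinner (sqrt_iter X n x) y = cinner x (sqrt_iter X n y)"
  using assms(4,5)
proof (induction n arbitrary: x y)
  case (Suc n)
  have "sqrt_iter X n x \<in> E" "sqrt_iter X n y \<in> E"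
    using Suc.prems sqrt_iter_contraction[OF E X] by (meson contraction_in)+
  then show ?case using Suc sa
    by (simp add: cinner_simps scaleR_scaleC)
qed (simp add: cinner_simps)

text \<open>The same recursion with \<open>X\<close> replaced by the number \<open>1\<close>; it dominates the operator iterates and
  increases to \<open>1\<close>.\<close>

primrec sqrt_iter_bound :: "nat \<Rightarrow> real" where
  "sqrt_iter_bound 0 = 0"
| "sqrt_iter_bound (Suc n) = (1 + (sqrt_iter_bound n)\<^sup>2) / 2"

lemma sqrt_iter_bound_range: "0 \<le> sqrt_iter_bound n \<and> sqrt_iter_bound n \<le> 1"
  by (induction n) (auto simp: power_le_one)

lemma sqrt_iter_bound_mono: "sqrt_iter_bound n \<le> sqrt_iter_bound (Suc n)"
proof -
  have "0 \<le> (1 - sqrt_iter_bound n)\<^sup>2" by simp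
  then show ?thesis by (simp add: power2_eq_square algebra_simps)
qed

lemma sqrt_iter_bound_convergent: "convergent sqrt_iter_bound"
  using sqrt_iter_bound_range sqrt_iter_bound_mono
  by (intro Bseq_monoseq_convergent BseqI'[of _ 1]) (auto simp: monoseq_Suc)

text \<open>As the iterates commute, \<open>Y\<^sub>n\<^sub>+\<^sub>2 - Y\<^sub>n\<^sub>+\<^sub>1 = (Y\<^sub>n\<^sub>+\<^sub>1 + Y\<^sub>n) (Y\<^sub>n\<^sub>+\<^sub>1 - Y\<^sub>n) / 2\<close>, and the scalar iterates satisfy the
  same identity.\<close>

lemma sqrt_iter_estimates:
  assumes E: "closed_csubspace E" and X: "contraction E E X" and "x \<in> E"
  shows "norm (sqrt_iter X n x) \<le> sqrt_iter_bound n * norm x"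
    and "norm (sqrt_iter X (Suc n) x - sqrt_iter X n x)
      \<le> (sqrt_iter_bound (Suc n) - sqrt_iter_bound n) * norm x"
proof -
  note Yc = sqrt_iter_contraction[OF E X]
  note Yb = contraction_bounded_op[OF Yc]
  have Yin: "sqrt_iter X n x \<in> E" if "x \<in> E" for n x using contraction_in[OF Yc that] .
  have XY: "X (sqrt_iter X n x) = sqrt_iter X n (X x)" if "x \<in> E" for n x
    by (rule sqrt_iter_intertwine[OF E X contraction_bounded_op[OF X] _ that]) simp
  have YY: "sqrt_iter X n (sqrt_iter X m x) = sqrt_iter X m (sqrt_iter X n x)" if "x \<in> E" for n m x
    by (rule sqrt_iter_intertwine[OF E X Yb _ that]) (simp add: XY)
  have A: "norm (sqrt_iter X n x) \<le> sqrt_iter_bound n * norm x" if "x \<in> E" for n x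
    using that
  proof (induction n arbitrary: x)
    case (Suc n)
    have "norm (X x) \<le> norm x" using contraction_norm[OF X] Suc.prems by blast
    moreover have "norm (sqrt_iter X n (sqrt_iter X n x)) \<le> sqrt_iter_bound n * (sqrt_iter_bound n * norm x)"
      using Suc.IH[OF Yin[OF Suc.prems]] Suc.IH[OF Suc.prems] sqrt_iter_bound_range
      by (meson mult_left_mono order_trans)
    ultimately show ?case
      using norm_triangle_ineq[of "X x" "sqrt_iter X n (sqrt_iter X n x)"]
      unfolding sqrt_iter.simps norm_scaleR by (simp add: power2_eq_square algebra_simps)
  qed simp
  then show "norm (sqrt_iter X n x) \<le> sqrt_iter_bound n * norm x" using \<open>x \<in> E\<close> .
  show "norm (sqrt_iter X (Suc n) x - sqrt_iter X n x)
      \<le> (sqrt_iter_bound (Suc n) - sqrt_iter_bound n) * norm x"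
    using \<open>x \<in> E\<close>
  proof (induction n arbitrary: x)
    case 0
    then show ?case using contraction_norm[OF X] by simp
  next
    case (Suc n)
    let ?a = "sqrt_iter X (Suc n)" and ?b = "sqrt_iter X n" and ?p = "sqrt_iter_bound (Suc n)" and ?q = "sqrt_iter_bound n"
    define w where "w = ?a x - ?b x"
    have w: "w \<in> E" using Yin Suc.prems E by (simp add: w_def csubspace_rules del: sqrt_iter.simps)
    have ab: "?a (?b x) = ?b (?a x)" by (rule YY[OF Suc.prems])
    have "sqrt_iter X (Suc (Suc n)) x - ?a x = (1/2) *\<^sub>R (?a (?a x) - ?b (?b x))"
      by (subst (1 2) sqrt_iter.simps(2)) (simp add: algebra_simps)
    also have "?a (?a x) - ?b (?b x) = ?a w + ?b w"
      unfolding w_def using Yin Suc.prems ab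
      by (simp add: bounded_op_diff[OF E Yb] del: sqrt_iter.simps)
    finally have "norm (sqrt_iter X (Suc (Suc n)) x - ?a x) \<le> (1/2) * (norm (?a w) + norm (?b w))"
      using norm_triangle_ineq[of "?a w" "?b w"] by (simp del: sqrt_iter.simps)
    also have "\<dots> \<le> (1/2) * (?p * norm w + ?q * norm w)"
      using A[OF w, of n] A[OF w, of "Suc n"] by (simp del: sqrt_iter.simps)
    also have "\<dots> = (1/2) * (?p + ?q) * norm w" by (simp add: algebra_simps)
    also have "\<dots> \<le> (1/2) * (?p + ?q) * ((?p - ?q) * norm x)"
      using Suc.IH[OF Suc.prems] sqrt_iter_bound_range[of n] sqrt_iter_bound_range[of "Suc n"]
      by (intro mult_left_mono) (auto simp: w_def simp del: sqrt_iter.simps sqrt_iter_bound.simps)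
    also have "\<dots> = (sqrt_iter_bound (Suc (Suc n)) - ?p) * norm x"
      by (subst sqrt_iter_bound.simps(2)[of "Suc n"], subst (3) sqrt_iter_bound.simps(2)[of "n"])
        (simp add: power2_eq_square field_simps)
    finally show ?case .
  qed
qed

lemma sqrt_iter_converges:
  fixes E :: "'a::{complex_inner,complete_space} set"
  assumes E: "closed_csubspace E" and X: "contraction E E X" and x: "x \<in> E"
  shows "convergent (\<lambda>n. sqrt_iter X n x)"
proof -
  have *: "norm (sqrt_iter X (n + k) x - sqrt_iter X n x) \<le> (sqrt_iter_bound (n + k) - sqrt_iter_bound n) * norm x" for n k
  proof (induction k)
    case (Suc k)
    have "norm (sqrt_iter X (n + Suc k) x - sqrt_iter X n x)
      \<le> norm (sqrt_iter X (Suc (n + k)) x - sqrt_iter X (n + k) x) + norm (sqrt_iter X (n + k) x - sqrt_iter X n x)"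
      using norm_triangle_ineq[of "sqrt_iter X (Suc (n + k)) x - sqrt_iter X (n + k) x"
          "sqrt_iter X (n + k) x - sqrt_iter X n x"] by (simp del: sqrt_iter.simps)
    also have "\<dots> \<le> (sqrt_iter_bound (n + Suc k) - sqrt_iter_bound n) * norm x"
      using sqrt_iter_estimates(2)[OF E X x, of "n + k"] Suc
      by (simp add: algebra_simps del: sqrt_iter.simps sqrt_iter_bound.simps)
    finally show ?case .
  qed simp
  have C: "Cauchy sqrt_iter_bound" using sqrt_iter_bound_convergent convergent_Cauchy by blast
  have "Cauchy (\<lambda>n. sqrt_iter X n x)"
  proof (rule CauchyI')
    fix e :: real assume e: "e > 0"
    obtain M where M: "\<And>m n. m \<ge> M \<Longrightarrow> n > m \<Longrightarrow> norm (sqrt_iter_bound m - sqrt_iter_bound n) < e / (norm x + 1)"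
      using CauchyD[OF C, of "e / (norm x + 1)"] e
      by (metis divide_pos_pos add_nonneg_pos norm_ge_zero zero_less_one less_imp_le_nat order_trans)
    show "\<exists>M. \<forall>m\<ge>M. \<forall>n>m. dist (sqrt_iter X m x) (sqrt_iter X n x) < e"
      unfolding dist_norm
    proof (intro exI allI impI)
      fix m n assume mn: "m \<ge> M" "m < n"
      have "norm (sqrt_iter X m x - sqrt_iter X n x) \<le> (sqrt_iter_bound n - sqrt_iter_bound m) * norm x"
        using *[of m "n - m"] mn by (simp add: norm_minus_commute)
      also have "\<dots> \<le> e / (norm x + 1) * norm x"
        using M[OF mn] by (intro mult_right_mono) auto
      also have "\<dots> < e" using e by (simp add: pos_divide_less_eq add_nonneg_pos)
      finally show "norm (sqrt_iter X m x - sqrt_iter X n x) < e" .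
    qed
  qed
  then show ?thesis by (rule Cauchy_convergent)
qed

definition sqrt_limit :: "('a::complex_inner \<Rightarrow> 'a) \<Rightarrow> 'a \<Rightarrow> 'a" where
  "sqrt_limit X x = x - lim (\<lambda>n. sqrt_iter X n x)"

context
  fixes E :: "'a::{complex_inner,complete_space} set" and X
  assumes E: "closed_csubspace E" and X: "contraction E E X"
    and sa: "\<And>x y. x \<in> E \<Longrightarrow> y \<in> E \<Longrightarrow> cinner (X x) y = cinner x (X y)"
begin

lemma sqrt_limit_tendsto: "x \<in> E \<Longrightarrow> (\<lambda>n. x - sqrt_iter X n x) \<longlonglongrightarrow> sqrt_limit X x"
  unfolding sqrt_limit_def
  using sqrt_iter_converges[OF E X] by (intro tendsto_intros) (simp add: convergent_LIMSEQ_iff)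

lemma sqrt_limit_in: "x \<in> E \<Longrightarrow> sqrt_limit X x \<in> E"
  using csubspace_closed[OF E] sqrt_limit_tendsto closed_sequentially
    csubspace_diff[OF E] contraction_in[OF sqrt_iter_contraction[OF E X]]
  by (metis (no_types, lifting))

lemma sqrt_limit_norm: assumes "x \<in> E" shows "norm (x - sqrt_limit X x) \<le> norm x"
proof -
  have "(\<lambda>n. norm (x - (x - sqrt_iter X n x))) \<longlonglongrightarrow> norm (x - sqrt_limit X x)"
    by (intro tendsto_intros sqrt_limit_tendsto assms)
  then show ?thesis
    using contraction_norm[OF sqrt_iter_contraction[OF E X] assms]
    by (intro LIMSEQ_le_const2[where X = "\<lambda>n. norm (x - (x - sqrt_iter X n x))"]) auto
qed

lemma sqrt_limit_positive: "positive_op E (sqrt_limit X)"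
proof -
  note Yb = contraction_bounded_op[OF sqrt_iter_contraction[OF E X]]
  have add: "sqrt_limit X (x + y) = sqrt_limit X x + sqrt_limit X y" if "x \<in> E" "y \<in> E" for x y
  proof (rule LIMSEQ_unique)
    show "(\<lambda>n. (x + y) - sqrt_iter X n (x + y)) \<longlonglongrightarrow> sqrt_limit X (x + y)"
      using that E by (intro sqrt_limit_tendsto csubspace_rules)
    show "(\<lambda>n. (x + y) - sqrt_iter X n (x + y)) \<longlonglongrightarrow> sqrt_limit X x + sqrt_limit X y"
      using tendsto_add[OF sqrt_limit_tendsto[OF that(1)] sqrt_limit_tendsto[OF that(2)]]
      by (simp add: bounded_op_add[OF Yb that] algebra_simps)
  qed
  have sc: "sqrt_limit X (c *\<^sub>C x) = c *\<^sub>C sqrt_limit X x" if "x \<in> E" for c x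
  proof (rule LIMSEQ_unique)
    show "(\<lambda>n. c *\<^sub>C x - sqrt_iter X n (c *\<^sub>C x)) \<longlonglongrightarrow> sqrt_limit X (c *\<^sub>C x)"
      using that E by (intro sqrt_limit_tendsto csubspace_rules)
    show "(\<lambda>n. c *\<^sub>C x - sqrt_iter X n (c *\<^sub>C x)) \<longlonglongrightarrow> c *\<^sub>C sqrt_limit X x"
      using scaleC.tendsto[OF tendsto_const sqrt_limit_tendsto[OF that], of c]
      by (simp add: bounded_op_scaleC[OF Yb that] scaleC.diff_right)
  qed
  have bd: "norm (sqrt_limit X x) \<le> 2 * norm x" if "x \<in> E" for x
    using sqrt_limit_norm[OF that] norm_triangle_ineq4[of x "x - sqrt_limit X x"] by simp
  have b: "bounded_op E E (sqrt_limit X)"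
    unfolding bounded_op_def using sqrt_limit_in add sc bd by blast
  have "cinner (sqrt_limit X x) x \<in> \<real> \<and> 0 \<le> Re (cinner (sqrt_limit X x) x)" if x: "x \<in> E" for x
  proof
    have "Im (cinner (x - sqrt_iter X n x) x) = 0" for n
    proof -
      have "cinner (sqrt_iter X n x) x = cnj (cinner (sqrt_iter X n x) x)"
        by (metis cinner_commute sqrt_iter_selfadjoint[OF E X sa x x])
      then have "Im (cinner (sqrt_iter X n x) x) = 0"
        by (metis cnj.simps(2) equal_neg_zero)
      then show ?thesis by (simp add: cinner_simps)
    qed
    moreover have "(\<lambda>n. Im (cinner (x - sqrt_iter X n x) x)) \<longlonglongrightarrow> Im (cinner (sqrt_limit X x) x)"
      by (intro tendsto_Im cinner.tendsto sqrt_limit_tendsto x tendsto_const)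
    ultimately have "Im (cinner (sqrt_limit X x) x) = 0"
      by (simp add: LIMSEQ_const_iff)
    then show "cinner (sqrt_limit X x) x \<in> \<real>" by (simp add: complex_is_Real_iff)
    have "Re (cinner (x - sqrt_limit X x) x) \<le> norm x * norm x"
      using Re_cinner_le[of "x - sqrt_limit X x" x] sqrt_limit_norm[OF x]
      by (meson mult_right_mono norm_ge_zero order_trans)
    then show "0 \<le> Re (cinner (sqrt_limit X x) x)"
      using norm_sq_cinner[of x] by (simp add: cinner_simps power2_eq_square)
  qed
  then show ?thesis using b by (simp add: positive_op_def)
qed

text \<open>The limit \<open>Y\<close> of the iterates is a fixed point: \<open>2 Y = X + Y\<^sup>2\<close>, that is, \<open>(I - Y)\<^sup>2 = I - X\<close>.\<close>

lemma sqrt_limit_square: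
  assumes x: "x \<in> E" shows "sqrt_limit X (sqrt_limit X x) = x - X x"
proof -
  define Y where "Y = (\<lambda>x. x - sqrt_limit X x)"
  note Yc = sqrt_iter_contraction[OF E X]
  have Yt: "(\<lambda>n. sqrt_iter X n x) \<longlonglongrightarrow> Y x" if "x \<in> E" for x
    using tendsto_diff[OF tendsto_const[of x] sqrt_limit_tendsto[OF that]] by (simp add: Y_def)
  have Yin: "Y x \<in> E" if "x \<in> E" for x using that E by (simp add: Y_def csubspace_rules sqrt_limit_in)
  have "(\<lambda>n. sqrt_iter X n (sqrt_iter X n x)) \<longlonglongrightarrow> Y (Y x)"
  proof (rule LIM_zero_cancel, rule Lim_null_comparison)
    show "(\<lambda>n. norm (sqrt_iter X n x - Y x) + norm (sqrt_iter X n (Y x) - Y (Y x))) \<longlonglongrightarrow> 0"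
      using tendsto_add[OF tendsto_norm_zero[OF LIM_zero[OF Yt[OF x]]] tendsto_norm_zero[OF LIM_zero[OF Yt[OF Yin[OF x]]]]]
      by simp
    have "norm (sqrt_iter X n (sqrt_iter X n x) - Y (Y x))
        \<le> norm (sqrt_iter X n x - Y x) + norm (sqrt_iter X n (Y x) - Y (Y x))" for n
    proof -
      have i: "sqrt_iter X n x \<in> E" by (rule contraction_in[OF Yc x])
      have "norm (sqrt_iter X n (sqrt_iter X n x - Y x)) \<le> norm (sqrt_iter X n x - Y x)"
        using contraction_norm[OF Yc] csubspace_diff[OF E i Yin[OF x]] by blast
      then show ?thesis
        using norm_triangle_ineq[of "sqrt_iter X n (sqrt_iter X n x - Y x)" "sqrt_iter X n (Y x) - Y (Y x)"]
        by (simp add: bounded_op_diff[OF E contraction_bounded_op[OF Yc] i Yin[OF x]])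
    qed
    then show "\<forall>\<^sub>F n in sequentially. norm (sqrt_iter X n (sqrt_iter X n x) - Y (Y x))
        \<le> norm (sqrt_iter X n x - Y x) + norm (sqrt_iter X n (Y x) - Y (Y x))" by simp
  qed
  then have "(\<lambda>n. sqrt_iter X (Suc n) x) \<longlonglongrightarrow> (1/2) *\<^sub>R (X x + Y (Y x))"
    by (simp only: sqrt_iter.simps) (intro tendsto_intros)
  then have "(1/2) *\<^sub>R (X x + Y (Y x)) = Y x"
    using LIMSEQ_unique LIMSEQ_Suc[OF Yt[OF x]] by blast
  then have eq: "X x + Y (Y x) = Y x + Y x"
    by (metis scaleR_half_double scaleR_add_right)
  have "Y (Y x) = Y x - (sqrt_limit X x - sqrt_limit X (sqrt_limit X x))"
    using bounded_op_diff[OF E _ x sqrt_limit_in[OF x], of E "sqrt_limit X"] sqrt_limit_positive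
    by (simp add: Y_def positive_op_def)
  then have 1: "sqrt_limit X (sqrt_limit X x) = Y (Y x) - Y x + (x - Y x)" by (simp add: Y_def)
  have "Y (Y x) = Y x + Y x - X x" using eq by (simp add: algebra_simps)
  then show ?thesis unfolding 1 by simp
qed

lemma sqrt_limit_intertwine:
  assumes R: "bounded_op E F R" and E': "closed_csubspace E'" and X': "contraction E' E' X'"
    and F: "F \<subseteq> E'"
    and XR: "\<And>x. x \<in> E \<Longrightarrow> R (X x) = X' (R x)" and x: "x \<in> E"
  shows "R (sqrt_limit X x) = sqrt_limit (X'::'b::{complex_inner,complete_space} \<Rightarrow> 'b) (R x)"
proof (rule LIMSEQ_unique)
  note Yc = sqrt_iter_contraction[OF E X]
  show "(\<lambda>n. R (x - sqrt_iter X n x)) \<longlonglongrightarrow> R (sqrt_limit X x)"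
    by (rule bounded_op_tendsto[OF E R sqrt_limit_tendsto[OF x] always_eventually sqrt_limit_in[OF x]])
      (use contraction_in[OF Yc x] x in \<open>auto intro: csubspace_diff[OF E]\<close>)
  have "(\<lambda>n. R x - sqrt_iter X' n (R x)) \<longlonglongrightarrow> sqrt_limit X' (R x)"
    unfolding sqrt_limit_def using sqrt_iter_converges[OF E' X'] bounded_op_in[OF R x] F
    by (intro tendsto_intros) (auto simp: convergent_LIMSEQ_iff)
  then show "(\<lambda>n. R (x - sqrt_iter X n x)) \<longlonglongrightarrow> sqrt_limit X' (R x)"
    using sqrt_iter_intertwine[OF E X R XR x]
    by (simp add: bounded_op_diff[OF E R x contraction_in[OF Yc x]])
qed

text \<open>A positive square root \<open>R\<close> of \<open>I - X\<close> commutes with \<open>X = I - R\<^sup>2\<close>, hence with the limit \<open>S\<close>. For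
  \<open>y = (S - R) x\<close> this gives \<open>(S + R) y = 0\<close>, so positivity forces \<open>S y = 0\<close> and \<open>R y = 0\<close>, and then
  \<open>\<langle>y, y\<rangle> = \<langle>x, (S - R) y\<rangle> = 0\<close>.\<close>

lemma sqrt_limit_unique:
  assumes R: "positive_op E R" and sq: "\<And>x. x \<in> E \<Longrightarrow> R (R x) = x - X x" and x: "x \<in> E"
  shows "R x = sqrt_limit X x"
proof -
  let ?S = "sqrt_limit X"
  have b: "bounded_op E E R" "bounded_op E E ?S"
    using R sqrt_limit_positive by (auto simp: positive_op_def)
  have XR: "R (X x) = X (R x)" if "x \<in> E" for x
  proof -
    have "R (R (R x)) = R (x - X x)" using sq that by simp
    also have "\<dots> = R x - R (X x)" using that X by (intro bounded_op_diff[OF E b(1)] contraction_in[OF X])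
    finally show ?thesis using sq[of "R x"] bounded_op_in[OF b(1) that] by simp
  qed
  have com: "R (?S x) = ?S (R x)" if "x \<in> E" for x
    by (rule sqrt_limit_intertwine[OF b(1) E X order_refl XR that])
  define y where "y = ?S x - R x"
  have i: "?S x \<in> E" "R x \<in> E" using b x by (auto simp: bounded_op_in)
  have y: "y \<in> E" by (simp add: y_def csubspace_diff[OF E] i)
  have "?S y + R y = 0"
    using i x sq sqrt_limit_square com by (simp add: y_def bounded_op_diff[OF E b(1)] bounded_op_diff[OF E b(2)])
  then have "Re (cinner (?S y) y) + Re (cinner (R y) y) = 0"
    by (simp flip: plus_complex.sel cinner.add_left add: cinner.zero_left)
  moreover have "0 \<le> Re (cinner (?S y) y)" "0 \<le> Re (cinner (R y) y)"
    using R sqrt_limit_positive y by (auto simp: positive_op_def)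
  ultimately have "?S y = 0" "R y = 0"
    using positive_op_kernel[OF R E y] positive_op_kernel[OF sqrt_limit_positive E y] by linarith+
  then have "cinner y y = 0"
    using positive_op_selfadjoint[OF R E x y] positive_op_selfadjoint[OF sqrt_limit_positive E x y]
    by (simp add: y_def cinner_simps)
  then show ?thesis by (simp add: y_def)
qed

lemma sqrt_op_eq_sqrt_limit:
  assumes P: "\<And>x. x \<in> E \<Longrightarrow> P x = x - X x" and x: "x \<in> E"
  shows "sqrt_op E P x = sqrt_limit X x"
proof -
  define S where "S = (\<lambda>x. if x \<in> E then sqrt_limit X x else 0)"
  have Sp: "positive_op E S"
    using sqrt_limit_positive E unfolding positive_op_def bounded_op_def
    by (simp add: S_def csubspace_rules)
  have "sqrt_op E P = S"
    unfolding sqrt_op_def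
  proof (rule the_equality)
    show "positive_op E S \<and> (\<forall>x\<in>E. S (S x) = P x) \<and> (\<forall>x. x \<notin> E \<longrightarrow> S x = 0)"
      using Sp sqrt_limit_square sqrt_limit_in P by (simp add: S_def)
    fix R assume R: "positive_op E R \<and> (\<forall>x\<in>E. R (R x) = P x) \<and> (\<forall>x. x \<notin> E \<longrightarrow> R x = 0)"
    then show "R = S" using sqrt_limit_unique[of R] P by (auto simp: S_def fun_eq_iff)
  qed
  then show ?thesis using x by (simp add: S_def)
qed

end

subsection \<open>Defect operators\<close>

context
  fixes E :: "'a::{complex_inner,complete_space} set" and F :: "'b::complex_inner set" and S
  assumes E: "closed_csubspace E" and S: "contraction E F S"
begin

lemma adj_op_self_contraction: "contraction E E (\<lambda>x. adjoint_op E S (S x))"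
  by (rule contraction_comp[OF S adjoint_op_contraction[OF E S]])

lemma adj_op_self_selfadjoint: "x \<in> E \<Longrightarrow> y \<in> E \<Longrightarrow>
    cinner (adjoint_op E S (S x)) y = cinner x (adjoint_op E S (S y))"
  by (simp flip: adjoint_op_cinner[OF E contraction_bounded_op[OF S]] adjoint_op_cinner'[OF E contraction_bounded_op[OF S]])

lemma defect_eq_sqrt_limit: "x \<in> E \<Longrightarrow> defect E S x = sqrt_limit (\<lambda>x. adjoint_op E S (S x)) x"
  unfolding defect_def
  by (rule sqrt_op_eq_sqrt_limit[OF E adj_op_self_contraction adj_op_self_selfadjoint]) auto

lemma defect_tendsto: "x \<in> E \<Longrightarrow>
    (\<lambda>n. x - sqrt_iter (\<lambda>x. adjoint_op E S (S x)) n x) \<longlonglongrightarrow> defect E S x"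
  by (simp add: defect_eq_sqrt_limit)
    (rule sqrt_limit_tendsto[OF E adj_op_self_contraction adj_op_self_selfadjoint])

lemma defect_positive: "positive_op E (defect E S)"
  using sqrt_limit_positive[OF E adj_op_self_contraction adj_op_self_selfadjoint] E
  unfolding positive_op_def bounded_op_def
  by (simp add: defect_eq_sqrt_limit csubspace_rules)

lemma defect_bounded: "bounded_op E E (defect E S)"
  using defect_positive by (simp add: positive_op_def)

lemma defect_square: "x \<in> E \<Longrightarrow> defect E S (defect E S x) = x - adjoint_op E S (S x)"
  using bounded_op_in[OF defect_bounded, of x]
    sqrt_limit_square[OF E adj_op_self_contraction adj_op_self_selfadjoint]
  by (simp add: defect_eq_sqrt_limit)

lemma defect_selfadjoint: "x \<in> E \<Longrightarrow> y \<in> E \<Longrightarrow> cinner (defect E S x) y = cinner x (defect E S y)"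
  using positive_op_selfadjoint[OF defect_positive E] .

lemma defect_unique:
  assumes "positive_op E R" "\<And>x. x \<in> E \<Longrightarrow> R (R x) = x - adjoint_op E S (S x)" "x \<in> E"
  shows "defect E S x = R x"
  using sqrt_limit_unique[OF E adj_op_self_contraction adj_op_self_selfadjoint assms] assms(3)
  by (simp add: defect_eq_sqrt_limit)

lemma cinner_defect: "x \<in> E \<Longrightarrow> y \<in> E \<Longrightarrow>
    cinner (defect E S x) (defect E S y) = cinner x y - cinner (S x) (S y)"
  using defect_selfadjoint[of x "defect E S y"] defect_square[of y] bounded_op_in[OF defect_bounded]
    adjoint_op_cinner[OF E contraction_bounded_op[OF S]]
  by (simp add: cinner_simps)

lemma norm_defect: "x \<in> E \<Longrightarrow> (norm (defect E S x))\<^sup>2 = (norm x)\<^sup>2 - (norm (S x))\<^sup>2"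
  using cinner_defect[of x x] by (simp add: norm_sq_cinner)

lemma defect_contraction: "contraction E E (defect E S)"
proof (rule contractionI)
  show "norm (defect E S x) \<le> norm x" if "x \<in> E" for x
    by (rule power2_le_imp_le) (simp_all add: norm_defect[OF that])
qed (use defect_bounded in \<open>auto simp: bounded_op_def\<close>)

lemma defect_space_csubspace: "closed_csubspace (defect_space E S)"
  unfolding defect_space_def by (rule bounded_op_image_closure_csubspace[OF E defect_bounded])

lemma defect_space_subset: "defect_space E S \<subseteq> E"
  unfolding defect_space_def by (rule closure_image_subset[OF defect_bounded csubspace_closed[OF E]])

lemma defect_in_space: "x \<in> E \<Longrightarrow> defect E S x \<in> defect_space E S"
  unfolding defect_space_def by (rule subsetD[OF closure_subset imageI])

end

context
  fixes E :: "'a::{complex_inner,complete_space} set" and F :: "'b::{complex_inner,complete_space} set" and S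
  assumes E: "closed_csubspace E" and F: "closed_csubspace F" and S: "contraction E F S"
begin

lemma defect_adj_space_eq: "defect_space_adj E F S = defect_space F (adjoint_op E S)"
  unfolding defect_space_adj_def defect_space_def by (simp add: defect_adj_eq_defect[OF E F S])

lemma defect_adj_square: "x \<in> F \<Longrightarrow> defect_adj E F S (defect_adj E F S x) = x - S (adjoint_op E S x)"
  using defect_square[OF F adjoint_op_contraction[OF E S]]
    adjoint_op_adjoint_op[OF E F contraction_bounded_op[OF S]]
    contraction_in[OF adjoint_op_contraction[OF E S]]
  by (simp add: defect_adj_eq_defect[OF E F S])

text \<open>\<open>S (S\<^sup>*S) = (SS\<^sup>*) S\<close> passes to the square roots.\<close>

lemma defect_intertwine: "x \<in> E \<Longrightarrow> S (defect E S x) = defect_adj E F S (S x)"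
proof -
  let ?A = "adjoint_op E S"
  assume x: "x \<in> E"
  have A: "contraction F E ?A" by (rule adjoint_op_contraction[OF E S])
  have AA: "adjoint_op F ?A x = S x" if "x \<in> E" for x
    using adjoint_op_adjoint_op[OF E F contraction_bounded_op[OF S] that] .
  have "S (sqrt_limit (\<lambda>x. ?A (S x)) x) = sqrt_limit (\<lambda>y. adjoint_op F ?A (?A y)) (S x)"
    using AA contraction_in[OF S] contraction_in[OF A]
    by (intro sqrt_limit_intertwine[OF E adj_op_self_contraction[OF E S] adj_op_self_selfadjoint[OF E S]
          contraction_bounded_op[OF S] F adj_op_self_contraction[OF F A] order_refl _ x]) auto
  then show ?thesis
    using x by (simp add: defect_adj_eq_defect[OF E F S] defect_eq_sqrt_limit[OF E S]
        defect_eq_sqrt_limit[OF F A] contraction_in[OF S])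
qed

lemma defect_adj_in: "y \<in> F \<Longrightarrow> defect_adj E F S y \<in> F"
  using bounded_op_in[OF defect_bounded[OF F adjoint_op_contraction[OF E S]]]
  by (simp add: defect_adj_eq_defect[OF E F S])

end

lemma defect_intertwine_adj:
  fixes E :: "'a::{complex_inner,complete_space} set" and F :: "'b::{complex_inner,complete_space} set"
  assumes E: "closed_csubspace E" and F: "closed_csubspace F" and S: "contraction E F S" and y: "y \<in> F"
  shows "adjoint_op E S (defect_adj E F S y) = defect E S (adjoint_op E S y)"
proof -
  let ?A = "adjoint_op E S"
  have A: "contraction F E ?A" by (rule adjoint_op_contraction[OF E S])
  have "defect_adj F E ?A = defect E (adjoint_op F ?A)" by (rule defect_adj_eq_defect[OF F E A])
  also have "\<dots> = defect E S"
    by (rule defect_cong) (rule adjoint_op_adjoint_op[OF E F contraction_bounded_op[OF S]])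
  finally show ?thesis using defect_intertwine[OF F E A y] by (simp add: defect_adj_eq_defect[OF E F S])
qed

section \<open>Regularity of a product of three contractions\<close>

lemma closure_seqI: "(\<And>n. u n \<in> S) \<Longrightarrow> u \<longlonglongrightarrow> x \<Longrightarrow> (x::'a::metric_space) \<in> closure S"
  unfolding closure_sequential by (intro exI[of _ u] conjI) auto

lemma unitary_op_contraction:
  assumes "unitary_op E F U" shows "contraction E F U"
proof -
  have "norm (U x) = norm x" if "x \<in> E" for x
    using assms that unfolding unitary_op_def by (metis norm_ge_zero norm_sq_cinner power2_eq_imp_eq)
  then show ?thesis using assms by (simp add: contraction_def unitary_op_def)
qed

lemma unitary_op_norm: "unitary_op E F U \<Longrightarrow> x \<in> E \<Longrightarrow> norm (U x) = norm x"
  unfolding unitary_op_def by (metis norm_ge_zero norm_sq_cinner power2_eq_imp_eq)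

lemma unitary_op_adjoint:
  assumes E: "closed_csubspace E" and U: "unitary_op E F U"
  shows "x \<in> E \<Longrightarrow> adjoint_op E U (U x) = x" and "y \<in> F \<Longrightarrow> U (adjoint_op E U y) = y"
proof -
  show *: "adjoint_op E U (U x) = x" if "x \<in> E" for x
    using that U by (intro adjoint_op_eqI[OF E]) (auto simp: unitary_op_def)
  show "U (adjoint_op E U y) = y" if "y \<in> F"
    using that U * by (auto simp: unitary_op_def)
qed

lemma unitary_op_defect_zero:
  fixes U :: "'a::{complex_inner,complete_space} \<Rightarrow> 'b::complex_inner"
  assumes E: "closed_csubspace E" and U: "unitary_op E F U" and x: "x \<in> E"
  shows "defect E U x = 0"
  using norm_defect[OF E unitary_op_contraction[OF U] x] unitary_op_norm[OF U x] by simp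

lemma defect_space_kernel:
  fixes S :: "'a::{complex_inner,complete_space} \<Rightarrow> 'b::complex_inner"
  assumes E: "closed_csubspace E" and S: "contraction E F S"
    and a: "a \<in> defect_space E S" and 0: "defect E S a = 0"
  shows "a = 0"
proof -
  have aE: "a \<in> E" using a defect_space_subset[OF E S] by blast
  have 1: "cinner a y = 0" if "y \<in> defect E S ` E" for y
    using that defect_selfadjoint[OF E S aE] 0 by (auto simp: cinner.zero_left)
  have "continuous_on (closure (defect E S ` E)) (\<lambda>y. cinner a y)"
    by (rule cinner.continuous_on[OF continuous_on_const continuous_on_id])
  from continuous_constant_on_closure[OF this 1] have "cinner a a = 0"
    using a unfolding defect_space_def by blast
  then show ?thesis by simp
qed

text \<open>The range of \<open>f \<mapsto> (D\<^sub>3 V\<^sub>2 V\<^sub>1 f, D\<^sub>1 f)\<close> is orthogonal to \<open>(a, b)\<close> exactly if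
  \<open>V\<^sub>1\<^sup>* V\<^sub>2\<^sup>* D\<^sub>3 a + D\<^sub>1 b = 0\<close>. The product is regular if the only such pairs are the trivial
  ones, in which \<open>a\<close> and \<open>b\<close> are orthogonal to the ranges of \<open>D\<^sub>3\<close> and \<open>D\<^sub>1\<close>; since
  \<open>D\<^sub>3 a = 0\<close> forces \<open>D\<^sub>1 b = 0\<close>, it suffices to record the former.\<close>

definition trivial_complement where
  "trivial_complement E1 E2 E3 V1 V2 V3 \<longleftrightarrow>
     (\<forall>a\<in>E3. \<forall>b\<in>E1. adjoint_op E1 V1 (adjoint_op E2 V2 (defect E3 V3 a)) + defect E1 V1 b = 0
        \<longrightarrow> defect E3 V3 a = 0)"

context
  fixes E1 :: "'a::{complex_inner,complete_space} set" and E2 :: "'b::{complex_inner,complete_space} set"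
    and E3 :: "'c::{complex_inner,complete_space} set" and E4 :: "'d::{complex_inner,complete_space} set"
    and V1 V2 V3
  assumes E: "closed_csubspace E1" "closed_csubspace E2" "closed_csubspace E3"
    and V1: "contraction E1 E2 V1" and V2: "unitary_op E2 E3 V2" and V3: "contraction E3 E4 V3"
begin

text \<open>A common vector \<open>D\<^sub>3 a = V\<^sub>2 D\<^sub>1\<^sub>* c\<close> of the two ranges gives the solution \<open>b = - V\<^sub>1\<^sup>* c\<close>, because
  \<open>V\<^sub>1\<^sup>* D\<^sub>1\<^sub>* = D\<^sub>1 V\<^sub>1\<^sup>*\<close>. Conversely, if \<open>(a, b)\<close> is a solution and \<open>y = V\<^sub>2\<^sup>* D\<^sub>3 a\<close>, then
  \<open>y = D\<^sub>1\<^sub>*\<^sup>2 y + V\<^sub>1 V\<^sub>1\<^sup>* y = D\<^sub>1\<^sub>*\<^sup>2 y - V\<^sub>1 D\<^sub>1 b = D\<^sub>1\<^sub>* (D\<^sub>1\<^sub>* y - V\<^sub>1 b)\<close>, so \<open>D\<^sub>3 a = V\<^sub>2 y\<close> lies in both ranges.\<close>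

lemma trivial_complement_iff_ranges:
  "trivial_complement E1 E2 E3 V1 V2 V3 \<longleftrightarrow>
     defect E3 V3 ` E3 \<inter> V2 ` defect_adj E1 E2 V1 ` E2 = {0}"
proof
  note V2c = unitary_op_contraction[OF V2]
  have V1a: "contraction E2 E1 (adjoint_op E1 V1)" by (rule adjoint_op_contraction[OF E(1) V1])
  have V2a: "contraction E3 E2 (adjoint_op E2 V2)" by (rule adjoint_op_contraction[OF E(2) V2c])
  note b = contraction_bounded_op[OF V1] contraction_bounded_op[OF V2c] contraction_bounded_op[OF V1a]
    contraction_bounded_op[OF V2a] defect_bounded[OF E(3) V3] defect_bounded[OF E(1) V1]
  have Ds: "bounded_op E2 E2 (defect_adj E1 E2 V1)"
    using defect_bounded[OF E(2) V1a] by (simp add: defect_adj_eq_defect[OF E(1,2) V1])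
  {
    assume K: "trivial_complement E1 E2 E3 V1 V2 V3"
    have "y = 0" if y: "y \<in> defect E3 V3 ` E3 \<inter> V2 ` defect_adj E1 E2 V1 ` E2" for y
    proof -
      obtain a c where a: "a \<in> E3" "y = defect E3 V3 a" and c: "c \<in> E2" "y = V2 (defect_adj E1 E2 V1 c)"
        using y by blast
      have V1c: "adjoint_op E1 V1 c \<in> E1" by (rule contraction_in[OF V1a c(1)])
      have "adjoint_op E1 V1 (adjoint_op E2 V2 y) = defect E1 V1 (adjoint_op E1 V1 c)"
        unfolding c(2) using unitary_op_adjoint(1)[OF E(2) V2 bounded_op_in[OF Ds c(1)]]
          defect_intertwine_adj[OF E(1,2) V1 c(1)] by simp
      then have "adjoint_op E1 V1 (adjoint_op E2 V2 (defect E3 V3 a)) + defect E1 V1 (- adjoint_op E1 V1 c) = 0"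
        using a by (simp add: bounded_op_minus[OF b(6) V1c])
      then show "y = 0" using K a V1c csubspace_minus[OF E(1) V1c] unfolding trivial_complement_def by blast
    qed
    moreover have "0 \<in> defect E3 V3 ` E3 \<inter> V2 ` defect_adj E1 E2 V1 ` E2"
      using bounded_op_zero[OF b(5)] bounded_op_zero[OF b(2)] bounded_op_zero[OF Ds] E csubspace_0
      by (metis IntI imageI)
    ultimately show "defect E3 V3 ` E3 \<inter> V2 ` defect_adj E1 E2 V1 ` E2 = {0}" by blast
  }
  assume R: "defect E3 V3 ` E3 \<inter> V2 ` defect_adj E1 E2 V1 ` E2 = {0}"
  show "trivial_complement E1 E2 E3 V1 V2 V3"
    unfolding trivial_complement_def
  proof (intro ballI impI)
    fix a b assume a: "a \<in> E3" and bE: "b \<in> E1"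
      and 0: "adjoint_op E1 V1 (adjoint_op E2 V2 (defect E3 V3 a)) + defect E1 V1 b = 0"
    let ?D = "defect_adj E1 E2 V1"
    define y where "y = adjoint_op E2 V2 (defect E3 V3 a)"
    have D3: "defect E3 V3 a \<in> E3" by (rule bounded_op_in[OF b(5) a])
    have y: "y \<in> E2" unfolding y_def by (rule contraction_in[OF V2a D3])
    have V1b: "V1 b \<in> E2" "?D y \<in> E2" using bounded_op_in[OF b(1) bE] bounded_op_in[OF Ds y] by auto
    have "?D (?D y - V1 b) = y - V1 (adjoint_op E1 V1 y) - V1 (defect E1 V1 b)"
      using V1b by (simp add: bounded_op_diff[OF E(2) Ds] defect_adj_square[OF E(1,2) V1 y]
          defect_intertwine[OF E(1,2) V1 bE])
    also have "V1 (adjoint_op E1 V1 y) + V1 (defect E1 V1 b) = V1 0"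
      using 0 bounded_op_add[OF b(1) contraction_in[OF V1a y] bounded_op_in[OF b(6) bE]]
      by (simp add: y_def)
    then have "y - V1 (adjoint_op E1 V1 y) - V1 (defect E1 V1 b) = y"
      using bounded_op_zero[OF b(1) csubspace_0[OF E(1)]] by (simp add: algebra_simps)
    finally have "V2 (?D (?D y - V1 b)) = defect E3 V3 a"
      unfolding y_def using unitary_op_adjoint(2)[OF E(2) V2 D3] by simp
    moreover have "?D y - V1 b \<in> E2" by (rule csubspace_diff[OF E(2) V1b(2,1)])
    ultimately have "defect E3 V3 a \<in> defect E3 V3 ` E3 \<inter> V2 ` defect_adj E1 E2 V1 ` E2"
      using a by (metis IntI imageI)
    then show "defect E3 V3 a = 0" using R by blast
  qed
qed

text \<open>\<open>D\<^sub>V f \<mapsto> W f = (D\<^sub>3 V\<^sub>2 V\<^sub>1 f, D\<^sub>2 V\<^sub>1 f, D\<^sub>1 f)\<close> preserves inner products, since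
  \<open>I - V\<^sup>*V\<close> telescopes along the three factors. So it extends to an isometry of the closure, and this is
  onto exactly if nothing in the target is orthogonal to all \<open>W f\<close>.\<close>

lemma isometric_extension_unitary_iff:
  assumes V: "contraction E1 E4 V" and V_eq: "\<And>x. x \<in> E1 \<Longrightarrow> V x = V3 (V2 (V1 x))"
  shows "(\<exists>Z. continuous_on (defect_space E1 V) Z \<and>
      (\<forall>f\<in>E1. Z (defect E1 V f) = (defect E3 V3 (V2 (V1 f)), defect E2 V2 (V1 f), defect E1 V1 f)) \<and>
      unitary_op (defect_space E1 V) (defect_space E3 V3 \<times> defect_space E2 V2 \<times> defect_space E1 V1) Z)
    \<longleftrightarrow> trivial_complement E1 E2 E3 V1 V2 V3" (is "(\<exists>Z. ?Z Z) \<longleftrightarrow> _")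
proof -
  note V2c = unitary_op_contraction[OF V2]
  have V1a: "contraction E2 E1 (adjoint_op E1 V1)" by (rule adjoint_op_contraction[OF E(1) V1])
  have V2a: "contraction E3 E2 (adjoint_op E2 V2)" by (rule adjoint_op_contraction[OF E(2) V2c])
  note b = contraction_bounded_op[OF V1] contraction_bounded_op[OF V2c] contraction_bounded_op[OF V1a]
    contraction_bounded_op[OF V2a] defect_bounded[OF E(3) V3] defect_bounded[OF E(1) V1]
    defect_bounded[OF E(2) V2c] defect_bounded[OF E(1) V]
  define W where "W = (\<lambda>f. (defect E3 V3 (V2 (V1 f)), defect E2 V2 (V1 f), defect E1 V1 f))"
  define D where "D = defect E1 V"
  define G where "G = defect_space E3 V3 \<times> defect_space E2 V2 \<times> defect_space E1 V1"
  have G: "closed_csubspace G"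
    unfolding G_def using defect_space_csubspace[OF E(3) V3] defect_space_csubspace[OF E(2) V2c]
      defect_space_csubspace[OF E(1) V1] by (intro csubspace_Times)
  have mem: "V1 f \<in> E2" "V2 (V1 f) \<in> E3" if "f \<in> E1" for f
    using that contraction_in[OF V1] contraction_in[OF V2c] by blast+
  have DE: "D f \<in> E1" if "f \<in> E1" for f unfolding D_def using bounded_op_in[OF b(8) that] .
  have isom: "cinner (W f) (W g) = cinner (D f) (D g)" if "f \<in> E1" "g \<in> E1" for f g
    using that mem by (simp add: W_def D_def cinner_prod_def cinner_defect[OF E(1) V] cinner_defect[OF E(1) V1]
        cinner_defect[OF E(2) V2c] cinner_defect[OF E(3) V3] V_eq)
  have Wb: "bounded_op E1 G W"
  proof -
    have n: "norm (W f) \<le> 1 * norm f" if "f \<in> E1" for f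
    proof -
      have "norm (W f) = norm (D f)"
        using isom[OF that that] by (metis norm_ge_zero norm_sq_cinner power2_eq_imp_eq)
      then show ?thesis unfolding D_def using contraction_norm[OF defect_contraction[OF E(1) V] that] by simp
    qed
    have "W f \<in> G" if "f \<in> E1" for f
      using mem[OF that] that unfolding W_def G_def
      by (simp add: defect_in_space[OF E(3) V3] defect_in_space[OF E(2) V2c] defect_in_space[OF E(1) V1])
    moreover have "W (f + g) = W f + W g" if "f \<in> E1" "g \<in> E1" for f g
      using mem[OF that(1)] mem[OF that(2)] that unfolding W_def
      by (simp add: bounded_op_add[OF b(1)] bounded_op_add[OF b(2)] bounded_op_add[OF b(5)]
          bounded_op_add[OF b(6)] bounded_op_add[OF b(7)])
    moreover have "W (c *\<^sub>C f) = c *\<^sub>C W f" if "f \<in> E1" for c f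
      using mem[OF that] that unfolding W_def
      by (simp add: bounded_op_scaleC[OF b(1)] bounded_op_scaleC[OF b(2)] bounded_op_scaleC[OF b(5)]
          bounded_op_scaleC[OF b(6)] bounded_op_scaleC[OF b(7)] scaleC_prod_def)
    ultimately show ?thesis unfolding bounded_op_def using n by blast
  qed
  have nWD: "norm (W f - W g) = norm (D f - D g)" if "f \<in> E1" "g \<in> E1" for f g
  proof -
    have fg: "f - g \<in> E1" using that E(1) by (simp add: csubspace_diff)
    have "norm (W (f - g)) = norm (D (f - g))"
      using isom[OF fg fg] by (metis norm_ge_zero norm_sq_cinner power2_eq_imp_eq)
    then show ?thesis using bounded_op_diff[OF E(1) Wb that] bounded_op_diff[OF E(1) b(8) that] by (simp add: D_def)
  qed
  have orth: "cinner (W f) (a, 0, c) =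
      cinner f (adjoint_op E1 V1 (adjoint_op E2 V2 (defect E3 V3 a)) + defect E1 V1 c)"
    if "f \<in> E1" "a \<in> E3" "c \<in> E1" for f a c
    using that mem by (simp add: W_def cinner_prod_def cinner_simps defect_selfadjoint[OF E(3) V3]
        defect_selfadjoint[OF E(1) V1] adjoint_op_cinner[OF E(1) b(1)] adjoint_op_cinner[OF E(2) b(2)])
  have cl: "defect_space E1 V = closure (D ` E1)" by (simp add: defect_space_def D_def)
  show ?thesis
  proof
    assume "\<exists>Z. ?Z Z"
    then obtain Z where Z: "?Z Z" by blast
    have Zc: "continuous_on (closure (D ` E1)) Z" and ZD: "\<And>f. f \<in> E1 \<Longrightarrow> Z (D f) = W f"
      and Zu: "unitary_op (closure (D ` E1)) G Z"
      using Z unfolding cl[symmetric] by (simp_all add: D_def W_def G_def)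
    show "trivial_complement E1 E2 E3 V1 V2 V3"
      unfolding trivial_complement_def
    proof (intro ballI impI)
      fix a c assume a: "a \<in> E3" and c: "c \<in> E1"
        and 0: "adjoint_op E1 V1 (adjoint_op E2 V2 (defect E3 V3 a)) + defect E1 V1 c = 0"
      obtain p where p: "p \<in> defect_space E3 V3" "\<And>u. u \<in> defect_space E3 V3 \<Longrightarrow> cinner (a - p) u = 0"
        using projection_exists[OF defect_space_csubspace[OF E(3) V3]] by blast
      obtain q where q: "q \<in> defect_space E1 V1" "\<And>u. u \<in> defect_space E1 V1 \<Longrightarrow> cinner (c - q) u = 0"
        using projection_exists[OF defect_space_csubspace[OF E(1) V1]] by blast
      have pE: "p \<in> E3" and qE: "q \<in> E1"
        using p(1) q(1) defect_space_subset[OF E(3) V3] defect_space_subset[OF E(1) V1] by auto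
      have Dp: "defect E3 V3 (a - p) = 0"
      proof -
        have i: "a - p \<in> E3" using a pE E(3) by (simp add: csubspace_diff)
        let ?d = "defect E3 V3 (a - p)"
        have d: "?d \<in> E3" by (rule bounded_op_in[OF b(5) i])
        have "cinner ?d ?d = cinner (a - p) (defect E3 V3 ?d)" by (rule defect_selfadjoint[OF E(3) V3 i d])
        also have "\<dots> = 0" by (intro p(2) defect_in_space[OF E(3) V3] d)
        finally show ?thesis by simp
      qed
      have Dq: "defect E1 V1 (c - q) = 0"
      proof -
        have i: "c - q \<in> E1" using c qE E(1) by (simp add: csubspace_diff)
        let ?d = "defect E1 V1 (c - q)"
        have d: "?d \<in> E1" by (rule bounded_op_in[OF b(6) i])
        have "cinner ?d ?d = cinner (c - q) (defect E1 V1 ?d)" by (rule defect_selfadjoint[OF E(1) V1 i d])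
        also have "\<dots> = 0" by (intro q(2) defect_in_space[OF E(1) V1] d)
        finally show ?thesis by simp
      qed
      \<comment> \<open>Projecting to the defect spaces yields a vector of the target with the same defects.\<close>
      have eqs: "defect E3 V3 a = defect E3 V3 p" "defect E1 V1 c = defect E1 V1 q"
        using Dp Dq by (simp_all add: bounded_op_diff[OF E(3) b(5) a pE] bounded_op_diff[OF E(1) b(6) c qE])
      have "(p, 0, q) \<in> G"
        using p q csubspace_0[OF defect_space_csubspace[OF E(2) V2c]] by (simp add: G_def)
      then obtain x where x: "x \<in> closure (D ` E1)" "Z x = (p, 0, q)"
        using Zu unfolding unitary_op_def by (metis imageE)
      have W0: "cinner (Z y) (p, 0, q) = 0" if y: "y \<in> D ` E1" for y
      proof -
        obtain f where f: "f \<in> E1" "y = D f" using y by blast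
        show ?thesis unfolding f(2) ZD[OF f(1)] orth[OF f(1) pE qE] using 0 eqs by (simp add: cinner.zero_right)
      qed
      have "cinner (Z x) (p, 0, q) = 0"
        by (rule continuous_constant_on_closure[OF cinner.continuous_on[OF Zc continuous_on_const] W0 x(1)])
      then have "p = 0" using x(2) by (simp add: prod_eq_iff)
      then show "defect E3 V3 a = 0" using eqs bounded_op_zero[OF b(5) csubspace_0[OF E(3)]] by simp
    qed
  next
    assume K: "trivial_complement E1 E2 E3 V1 V2 V3"
    define z where "z = (\<lambda>p. W (SOME f. f \<in> E1 \<and> D f = p))"
    have zD: "z (D f) = W f" if f: "f \<in> E1" for f
    proof -
      define g where "g = (SOME g. g \<in> E1 \<and> D g = D f)"
      have "g \<in> E1 \<and> D g = D f" unfolding g_def by (rule someI[of _ f]) (use f in simp)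
      then have "norm (W g - W f) = 0" using nWD[of g f] f by simp
      then show ?thesis by (simp add: z_def g_def)
    qed
    have "uniformly_continuous_on (D ` E1) z"
      unfolding uniformly_continuous_on_def by (force simp: zD dist_norm nWD)
    then obtain Z where Zuc: "uniformly_continuous_on (closure (D ` E1)) Z"
      and "\<And>x. x \<in> D ` E1 \<Longrightarrow> z x = Z x"
      by (rule uniformly_continuous_on_extension_on_closure) blast
    then have ZD: "Z (D f) = W f" if "f \<in> E1" for f using zD that by (metis imageI)
    have Zc: "continuous_on (closure (D ` E1)) Z" using Zuc by (rule uniformly_continuous_imp_continuous)
    have seq: "\<exists>f. (\<forall>n. f n \<in> E1) \<and> (\<lambda>n. D (f n)) \<longlonglongrightarrow> x" if xcl: "x \<in> closure (D ` E1)" for x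
    proof -
      obtain u where u: "\<And>n. u n \<in> D ` E1" "u \<longlonglongrightarrow> x" using xcl unfolding closure_sequential by blast
      from u(1) have "\<forall>n. \<exists>g. g \<in> E1 \<and> u n = D g" by blast
      then obtain f where f: "\<forall>n. f n \<in> E1 \<and> u n = D (f n)" by (rule choice[THEN exE])
      then have "u = (\<lambda>n. D (f n))" by auto
      then show ?thesis using u(2) f by (intro exI[of _ f]) simp
    qed
    have ZW: "(\<lambda>n. W (f n)) \<longlonglongrightarrow> Z x" if "\<And>n. f n \<in> E1" "(\<lambda>n. D (f n)) \<longlonglongrightarrow> x" for f x
    proof -
      have "D (f n) \<in> closure (D ` E1)" for n using that(1) closure_subset by (metis imageI subsetD)
      moreover have "x \<in> closure (D ` E1)" using that by (intro closure_seqI[of "\<lambda>n. D (f n)"]) auto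
      ultimately have "(\<lambda>n. Z (D (f n))) \<longlonglongrightarrow> Z x"
        using continuous_on_tendsto_compose[OF Zc that(2)] by simp
      then show ?thesis using ZD that(1) by simp
    qed
    have ci: "cinner (Z x) (Z y) = cinner x y" if x: "x \<in> closure (D ` E1)" and y: "y \<in> closure (D ` E1)" for x y
    proof -
      obtain f g where f: "\<And>n. f n \<in> E1" "(\<lambda>n. D (f n)) \<longlonglongrightarrow> x" and g: "\<And>n. g n \<in> E1" "(\<lambda>n. D (g n)) \<longlonglongrightarrow> y"
        using seq[OF x] seq[OF y] by blast
      have "(\<lambda>n. cinner (W (f n)) (W (g n))) \<longlonglongrightarrow> cinner (Z x) (Z y)"
        by (rule cinner.tendsto[OF ZW[OF f] ZW[OF g]])
      moreover have "(\<lambda>n. cinner (W (f n)) (W (g n))) \<longlonglongrightarrow> cinner x y"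
        using cinner.tendsto[OF f(2) g(2)] by (simp add: isom[OF f(1) g(1)])
      ultimately show ?thesis using LIMSEQ_unique by blast
    qed
    have add: "Z (x + y) = Z x + Z y" if x: "x \<in> closure (D ` E1)" and y: "y \<in> closure (D ` E1)" for x y
    proof -
      obtain f g where f: "\<And>n. f n \<in> E1" "(\<lambda>n. D (f n)) \<longlonglongrightarrow> x" and g: "\<And>n. g n \<in> E1" "(\<lambda>n. D (g n)) \<longlonglongrightarrow> y"
        using seq[OF x] seq[OF y] by blast
      have 1: "W (f n + g n) = W (f n) + W (g n)" "D (f n + g n) = D (f n) + D (g n)" for n
        using bounded_op_add[OF Wb f(1) g(1)] bounded_op_add[OF b(8) f(1) g(1)] by (auto simp: D_def)
      have "(\<lambda>n. D (f n + g n)) \<longlonglongrightarrow> x + y" unfolding 1 by (intro tendsto_add f g)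
      then have "(\<lambda>n. W (f n + g n)) \<longlonglongrightarrow> Z (x + y)"
        using csubspace_add[OF E(1) f(1) g(1)] by (intro ZW) auto
      moreover have "(\<lambda>n. W (f n + g n)) \<longlonglongrightarrow> Z x + Z y"
        unfolding 1 by (rule tendsto_add[OF ZW[OF f] ZW[OF g]])
      ultimately show ?thesis using LIMSEQ_unique by blast
    qed
    have sc: "Z (k *\<^sub>C x) = k *\<^sub>C Z x" if x: "x \<in> closure (D ` E1)" for k x
    proof -
      obtain f where f: "\<And>n. f n \<in> E1" "(\<lambda>n. D (f n)) \<longlonglongrightarrow> x" using seq[OF x] by blast
      have 1: "W (k *\<^sub>C f n) = k *\<^sub>C W (f n)" "D (k *\<^sub>C f n) = k *\<^sub>C D (f n)" for n
        using bounded_op_scaleC[OF Wb f(1)] bounded_op_scaleC[OF b(8) f(1)] by (auto simp: D_def)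
      have "(\<lambda>n. D (k *\<^sub>C f n)) \<longlonglongrightarrow> k *\<^sub>C x" unfolding 1 by (intro scaleC.tendsto tendsto_const f)
      then have "(\<lambda>n. W (k *\<^sub>C f n)) \<longlonglongrightarrow> Z (k *\<^sub>C x)"
        using csubspace_scaleC[OF E(1) f(1)] by (intro ZW) auto
      moreover have "(\<lambda>n. W (k *\<^sub>C f n)) \<longlonglongrightarrow> k *\<^sub>C Z x"
        unfolding 1 by (rule scaleC.tendsto[OF tendsto_const ZW[OF f]])
      ultimately show ?thesis using LIMSEQ_unique by blast
    qed
    have ZG: "Z ` closure (D ` E1) \<subseteq> G"
      by (rule image_closure_subset[OF Zc csubspace_closed[OF G]])
        (use ZD bounded_op_in[OF Wb] in auto)
    have "G \<subseteq> Z ` closure (D ` E1)"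
    proof
      fix q assume q: "q \<in> G"
      have N: "closed_csubspace (closure (W ` E1))" by (rule bounded_op_image_closure_csubspace[OF E(1) Wb])
      obtain p where p: "p \<in> closure (W ` E1)" "\<And>u. u \<in> closure (W ` E1) \<Longrightarrow> cinner (q - p) u = 0"
        using projection_exists[OF N] by blast
      have "closure (W ` E1) \<subseteq> G" by (rule closure_image_subset[OF Wb csubspace_closed[OF G]])
      then have "q - p \<in> G" using p q csubspace_diff[OF G] by blast
      then obtain a d c where r: "q - p = (a, d, c)" "a \<in> defect_space E3 V3" "d \<in> defect_space E2 V2" "c \<in> defect_space E1 V1"
        by (auto simp: G_def)
      have d: "d = 0"
        using r(3) unitary_op_defect_zero[OF E(2) V2] defect_space_kernel[OF E(2) V2c r(3)]
          defect_space_subset[OF E(2) V2c] by blast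
      have aE: "a \<in> E3" and cE: "c \<in> E1"
        using r defect_space_subset[OF E(3) V3] defect_space_subset[OF E(1) V1] by auto
      let ?m = "adjoint_op E1 V1 (adjoint_op E2 V2 (defect E3 V3 a)) + defect E1 V1 c"
      have m: "?m \<in> E1"
        using aE cE by (intro csubspace_add[OF E(1)] contraction_in[OF V1a] contraction_in[OF V2a]
            bounded_op_in[OF b(5)] bounded_op_in[OF b(6)])
      have "cinner (q - p) (W ?m) = 0" using p(2) m closure_subset by (metis imageI subsetD)
      then have "cinner (W ?m) (q - p) = 0" by (metis cinner_commute complex_cnj_zero)
      then have m0: "?m = 0" using orth[OF m aE cE] r d by simp
      then have D3: "defect E3 V3 a = 0" using K aE cE unfolding trivial_complement_def by blast
      then have "defect E1 V1 c = 0"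
        using m0 bounded_op_zero[OF b(4) csubspace_0[OF E(3)]] bounded_op_zero[OF b(3) csubspace_0[OF E(2)]] by simp
      then have "q = p"
        using r d defect_space_kernel[OF E(3) V3 r(2) D3] defect_space_kernel[OF E(1) V1 r(4)]
        by (simp add: zero_prod_def[symmetric])
      then obtain u where u: "\<And>n. u n \<in> W ` E1" "u \<longlonglongrightarrow> q"
        using p(1) unfolding closure_sequential by blast
      from u(1) have "\<forall>n. \<exists>g. g \<in> E1 \<and> u n = W g" by blast
      then obtain f where f: "\<forall>n. f n \<in> E1 \<and> u n = W (f n)" by (rule choice[THEN exE])
      have "Cauchy (\<lambda>n. D (f n))"
      proof (rule metric_CauchyI)
        fix e :: real assume "e > 0"
        then obtain M where "\<forall>m\<ge>M. \<forall>n\<ge>M. dist (u m) (u n) < e"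
          using LIMSEQ_imp_Cauchy[OF u(2)] metric_CauchyD by blast
        then show "\<exists>M. \<forall>m\<ge>M. \<forall>n\<ge>M. dist (D (f m)) (D (f n)) < e"
          using f nWD by (metis dist_norm)
      qed
      then obtain x where x: "(\<lambda>n. D (f n)) \<longlonglongrightarrow> x" using Cauchy_convergent convergent_def by blast
      have "(\<lambda>n. W (f n)) \<longlonglongrightarrow> Z x" using ZW[OF _ x] f by blast
      moreover have "u = (\<lambda>n. W (f n))" using f by auto
      then have "(\<lambda>n. W (f n)) \<longlonglongrightarrow> q" using u(2) by simp
      ultimately have "Z x = q" using LIMSEQ_unique by blast
      moreover have "x \<in> closure (D ` E1)" using x f by (intro closure_seqI[of "\<lambda>n. D (f n)"]) auto
      ultimately show "q \<in> Z ` closure (D ` E1)" by blast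
    qed
    then have im: "Z ` closure (D ` E1) = G" using ZG by blast
    have nZ: "norm (Z x) \<le> 1 * norm x" if "x \<in> closure (D ` E1)" for x
      using ci[OF that that] by (metis mult_1 norm_ge_zero norm_sq_cinner order_refl power2_eq_imp_eq)
    have "bounded_op (closure (D ` E1)) G Z"
      unfolding bounded_op_def using add sc im nZ by blast
    then have "unitary_op (closure (D ` E1)) G Z" using im ci by (simp add: unitary_op_def)
    then have "?Z Z" using Zc ZD unfolding cl by (simp add: D_def W_def G_def)
    then show "\<exists>Z. ?Z Z" by blast
  qed
qed

end

section \<open>Completeness of the space of square-integrable functions\<close>

lemma complete_measure_circle: "complete_measure circle_measure"
proof
  fix A B :: "real set" assume "B \<subseteq> A" "A \<in> null_sets circle_measure"
  then have "A \<subseteq> {0..2 * pi}" "A \<in> null_sets lebesgue" by (auto simp: null_sets_restrict_space)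
  then have "B \<in> sets lebesgue" "B \<subseteq> {0..2 * pi}"
    using \<open>B \<subseteq> A\<close> completion.complete[of B A] by auto
  then show "B \<in> sets circle_measure" by (simp add: sets_restrict_space_iff)
qed

text \<open>Boundary values are only determined almost everywhere, so completeness of the measure is what makes
  them measurable.\<close>

lemma borel_measurable_AE_eq:
  fixes f g :: "real \<Rightarrow> 'a::topological_space"
  assumes f: "f \<in> borel_measurable circle_measure" and eq: "AE t in circle_measure. f t = g t"
  shows "g \<in> borel_measurable circle_measure"
proof (rule measurableI)
  fix A :: "'a set" assume "A \<in> sets borel"
  then have A: "f -` A \<inter> space circle_measure \<in> sets circle_measure" using f by (rule measurable_sets[rotated])
  show "g -` A \<inter> space circle_measure \<in> sets circle_measure"
    by (rule complete_measure.in_sets_AE[OF complete_measure_circle _ A]) (use eq in \<open>auto elim: eventually_mono\<close>)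
qed simp

lemma borel_measurable_AE_limit:
  fixes f :: "nat \<Rightarrow> real \<Rightarrow> 'a::chilbert"
  assumes f: "\<And>n. f n \<in> borel_measurable circle_measure"
    and lim: "AE t in circle_measure. (\<lambda>n. f n t) \<longlonglongrightarrow> g t"
  shows "g \<in> borel_measurable circle_measure"
proof (rule borel_measurable_AE_eq)
  show "(\<lambda>t. lim (\<lambda>n. f n t)) \<in> borel_measurable circle_measure" using f by (rule borel_measurable_lim_metric)
  show "AE t in circle_measure. lim (\<lambda>n. f n t) = g t" using lim by eventually_elim (rule limI)
qed

lemma finite_circle_measure: "finite_measure circle_measure"
  by (rule finite_measure_lebesgue_on) simp

lemma integral_circle_const: "integral\<^sup>L circle_measure (\<lambda>t. c::real) = 2 * pi * c"
  by (simp add: measure_restrict_space)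

lemma square_integrable_measurable: "square_integrable f \<Longrightarrow> f \<in> borel_measurable circle_measure"
  and square_integrable_integrable: "square_integrable f \<Longrightarrow> integrable circle_measure (\<lambda>t. (norm (f t))\<^sup>2)"
  by (auto simp: square_integrable_def)

lemma square_integrable_bound:
  assumes g: "square_integrable g" and f: "f \<in> borel_measurable circle_measure"
    and le: "AE t in circle_measure. norm (f t) \<le> norm (g t)"
  shows "square_integrable f"
  unfolding square_integrable_def
proof
  show "integrable circle_measure (\<lambda>t. (norm (f t))\<^sup>2)"
    by (rule Bochner_Integration.integrable_bound[OF square_integrable_integrable[OF g]])
      (use f le in \<open>auto elim!: eventually_mono intro: power_mono\<close>)
qed (rule f)

lemma square_integrable_const_bound:
  assumes f: "f \<in> borel_measurable circle_measure" and le: "AE t in circle_measure. norm (f t) \<le> K"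
  shows "square_integrable f"
  unfolding square_integrable_def
proof
  interpret finite_measure circle_measure by (rule finite_circle_measure)
  show "integrable circle_measure (\<lambda>t. (norm (f t))\<^sup>2)"
    by (rule Bochner_Integration.integrable_bound[of _ "\<lambda>_. K\<^sup>2"])
      (use f le in \<open>auto elim!: eventually_mono intro: power_mono\<close>)
qed (rule f)

lemma square_integrable_imp_integrable_norm:
  assumes "square_integrable f" shows "integrable circle_measure (\<lambda>t. norm (f t))"
proof (rule Bochner_Integration.integrable_bound)
  interpret finite_measure circle_measure by (rule finite_circle_measure)
  show "integrable circle_measure (\<lambda>t. 1 + (norm (f t))\<^sup>2)"
    using square_integrable_integrable[OF assms] by simp
  have "norm (f t) \<le> 1 + (norm (f t))\<^sup>2" for t
  proof -
    have "2 * norm (f t) \<le> 1 + (norm (f t))\<^sup>2" using two_mult_le_squares[of 1 "norm (f t)"] by simp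
    then show ?thesis using norm_ge_zero[of "f t"] by linarith
  qed
  then show "AE t in circle_measure. norm (norm (f t)) \<le> norm (1 + (norm (f t))\<^sup>2)"
    by (intro AE_I2) simp
qed (use square_integrable_measurable[OF assms] in simp)

text \<open>The Riesz-Fischer theorem. A subsequence with mean square increments below \<open>4\<^sup>-\<^sup>k\<close> converges almost
  everywhere, and Fatou's lemma identifies its limit as the limit in mean square.\<close>

lemma square_integrable_complete:
  fixes f :: "nat \<Rightarrow> real \<Rightarrow> 'a::chilbert"
  assumes sq: "\<And>n. square_integrable (f n)"
    and C: "\<And>e. e > 0 \<Longrightarrow> \<exists>N. \<forall>m\<ge>N. \<forall>n\<ge>N. integral\<^sup>L circle_measure (\<lambda>t. (norm (f m t - f n t))\<^sup>2) < e"
  obtains g where "square_integrable g"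
    "(\<lambda>n. integral\<^sup>L circle_measure (\<lambda>t. (norm (f n t - g t))\<^sup>2)) \<longlonglongrightarrow> 0"
proof -
  let ?M = circle_measure
  interpret finite_measure ?M by (rule finite_circle_measure)
  have meas: "f n \<in> borel_measurable ?M" for n using sq square_integrable_measurable by blast
  have int: "integrable ?M (\<lambda>t. (norm (f m t - f n t))\<^sup>2)" for m n
    using square_integrable_integrable[OF square_integrable_diff[OF sq sq]] .
  have "\<forall>k. \<exists>N. \<forall>m\<ge>N. \<forall>n\<ge>N. integral\<^sup>L ?M (\<lambda>t. (norm (f m t - f n t))\<^sup>2) < (1/4)^k"
    using C by simp
  then obtain N where N: "\<And>k m n. m \<ge> N k \<Longrightarrow> n \<ge> N k \<Longrightarrow> integral\<^sup>L ?M (\<lambda>t. (norm (f m t - f n t))\<^sup>2) < (1/4)^k"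
    by metis
  define r where "r = (\<lambda>k::nat. k + (\<Sum>i\<le>k. N i))"
  have rN: "N k \<le> r k" "N k \<le> r (Suc k)" "k \<le> r k" for k
    using member_le_sum[of k "{..k}" N] by (auto simp: r_def)
  define d where "d = (\<lambda>k t. norm (f (r (Suc k)) t - f (r k) t))"
  have dm: "d k \<in> borel_measurable ?M" for k unfolding d_def using meas by measurable
  define c where "c = pi + 1/2"
  have dint: "(\<integral>\<^sup>+t. ennreal (d k t) \<partial>?M) \<le> ennreal (c * (1/2)^k)" for k
  proof -
    \<comment> \<open>In place of the Cauchy-Schwarz inequality: the measure is finite, so this makes the integrals of \<open>d k\<close> summable.\<close>
    have b: "d k t \<le> (1/2)^k / 2 + 2^k / 2 * (d k t)\<^sup>2" for t
    proof -
      have "0 \<le> (2^k * d k t - 1)\<^sup>2" by simp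
      also have "\<dots> = 2^k * (2^k * (d k t)\<^sup>2 + (1/2)^k - 2 * d k t)"
        by (simp add: power2_eq_square algebra_simps power_one_over)
      finally have "0 \<le> 2^k * (d k t)\<^sup>2 + (1/2)^k - 2 * d k t"
        by (metis linorder_not_le mult_pos_neg zero_less_power zero_less_numeral)
      then show ?thesis by simp
    qed
    have i: "integrable ?M (\<lambda>t. (1/2)^k / 2 + 2^k / 2 * (d k t)\<^sup>2)"
      unfolding d_def using int by simp
    have "(\<integral>\<^sup>+t. ennreal (d k t) \<partial>?M) \<le> (\<integral>\<^sup>+t. ennreal ((1/2)^k / 2 + 2^k / 2 * (d k t)\<^sup>2) \<partial>?M)"
      using b by (intro nn_integral_mono ennreal_leI)
    also have "\<dots> = ennreal (integral\<^sup>L ?M (\<lambda>t. (1/2)^k / 2 + 2^k / 2 * (d k t)\<^sup>2))"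
      by (intro nn_integral_eq_integral i) simp
    also have "integral\<^sup>L ?M (\<lambda>t. (1/2)^k / 2 + 2^k / 2 * (d k t)\<^sup>2)
        = pi * (1/2)^k + 2^k / 2 * integral\<^sup>L ?M (\<lambda>t. (d k t)\<^sup>2)"
      using int by (subst Bochner_Integration.integral_add) (auto simp: d_def measure_restrict_space)
    also have "\<dots> \<le> pi * (1/2)^k + 2^k / 2 * (1/4)^k"
      unfolding d_def using N[OF rN(2) rN(1), of k] by (intro add_left_mono mult_left_mono) auto
    also have "\<dots> = c * (1/2)^k"
    proof -
      have "2^k * (1/4)^k = ((1/2)::real)^k" by (simp flip: power_mult_distrib)
      then show ?thesis by (simp add: c_def algebra_simps)
    qed
    finally show ?thesis by (simp add: ennreal_leI)
  qed
  have "(\<integral>\<^sup>+t. (\<Sum>k. ennreal (d k t)) \<partial>?M) = (\<Sum>k. \<integral>\<^sup>+t. ennreal (d k t) \<partial>?M)"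
    using dm by (intro nn_integral_suminf) simp
  also have "\<dots> \<le> (\<Sum>k. ennreal (c * (1/2)^k))"
    by (intro suminf_le dint) auto
  also have "\<dots> = ennreal (\<Sum>k. c * (1/2)^k)"
    by (intro suminf_ennreal2) (auto simp: c_def intro!: add_nonneg_nonneg summable_mult summable_geometric)
  finally have "(\<integral>\<^sup>+t. (\<Sum>k. ennreal (d k t)) \<partial>?M) < \<infinity>"
    by (metis ennreal_less_top infinity_ennreal_def le_less_trans)
  then have fin: "AE t in ?M. (\<Sum>k. ennreal (d k t)) \<noteq> \<infinity>"
    using dm by (intro nn_integral_PInf_AE) auto
  define g where "g = (\<lambda>t. lim (\<lambda>k. f (r k) t))"
  have gm: "g \<in> borel_measurable ?M" unfolding g_def using meas by (intro borel_measurable_lim_metric)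
  have lim: "AE t in ?M. (\<lambda>k. f (r k) t) \<longlonglongrightarrow> g t"
    using fin
  proof eventually_elim
    case (elim t)
    then have "summable (\<lambda>k. d k t)" by (intro summable_suminf_not_top) (auto simp: d_def)
    then have "summable (\<lambda>k. f (r (Suc k)) t - f (r k) t)" unfolding d_def by (rule summable_norm_cancel)
    then have "convergent (\<lambda>n. \<Sum>k<n. f (r (Suc k)) t - f (r k) t)" by (simp add: summable_iff_convergent)
    then have "convergent (\<lambda>n. f (r n) t - f (r 0) t)" by (simp add: sum_lessThan_telescope[of "\<lambda>k. f (r k) t"])
    then have "convergent (\<lambda>n. f (r n) t)" by (simp add: convergent_diff_const_right_iff)
    then show ?case by (simp add: g_def convergent_LIMSEQ_iff)
  qed
  have est: "(\<integral>\<^sup>+t. ennreal ((norm (f n t - g t))\<^sup>2) \<partial>?M) \<le> ennreal e"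
    if n: "n \<ge> N0" and N0: "\<And>m n. m \<ge> N0 \<Longrightarrow> n \<ge> N0 \<Longrightarrow> integral\<^sup>L ?M (\<lambda>t. (norm (f m t - f n t))\<^sup>2) < e" for n N0 e
  proof -
    have "(\<integral>\<^sup>+t. ennreal ((norm (f n t - g t))\<^sup>2) \<partial>?M)
        = (\<integral>\<^sup>+t. liminf (\<lambda>k. ennreal ((norm (f n t - f (r (k + N0)) t))\<^sup>2)) \<partial>?M)"
    proof (rule nn_integral_cong_AE)
      show "AE t in ?M. ennreal ((norm (f n t - g t))\<^sup>2) = liminf (\<lambda>k. ennreal ((norm (f n t - f (r (k + N0)) t))\<^sup>2))"
        using lim
      proof eventually_elim
        case (elim t)
        have "(\<lambda>k. ennreal ((norm (f n t - f (r (k + N0)) t))\<^sup>2)) \<longlonglongrightarrow> ennreal ((norm (f n t - g t))\<^sup>2)"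
          by (intro tendsto_intros LIMSEQ_ignore_initial_segment[OF elim])
        then show ?case by (intro lim_imp_Liminf[symmetric]) auto
      qed
    qed
    also have "\<dots> \<le> liminf (\<lambda>k. \<integral>\<^sup>+t. ennreal ((norm (f n t - f (r (k + N0)) t))\<^sup>2) \<partial>?M)"
      using meas by (intro nn_integral_liminf) measurable
    also have "\<dots> \<le> limsup (\<lambda>k. \<integral>\<^sup>+t. ennreal ((norm (f n t - f (r (k + N0)) t))\<^sup>2) \<partial>?M)"
      by (intro Liminf_le_Limsup) simp
    also have "\<dots> \<le> ennreal e"
    proof (intro Limsup_bounded always_eventually allI)
      fix k
      have "N0 \<le> r (k + N0)" using rN(3)[of "k + N0"] by simp
      then have "integral\<^sup>L ?M (\<lambda>t. (norm (f n t - f (r (k + N0)) t))\<^sup>2) \<le> e" using N0[OF n] by (simp add: less_imp_le)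
      then show "(\<integral>\<^sup>+t. ennreal ((norm (f n t - f (r (k + N0)) t))\<^sup>2) \<partial>?M) \<le> ennreal e"
        by (subst nn_integral_eq_integral[OF int]) (auto intro: ennreal_leI)
    qed
    finally show ?thesis .
  qed
  have sqd: "square_integrable (\<lambda>t. f n t - g t) \<and> integral\<^sup>L ?M (\<lambda>t. (norm (f n t - g t))\<^sup>2) \<le> e"
    if n: "n \<ge> N0" and e: "e > 0" and N0: "\<And>m n. m \<ge> N0 \<Longrightarrow> n \<ge> N0 \<Longrightarrow> integral\<^sup>L ?M (\<lambda>t. (norm (f m t - f n t))\<^sup>2) < e" for n N0 e
  proof
    have m: "(\<lambda>t. f n t - g t) \<in> borel_measurable ?M" using meas gm by measurable
    have le: "(\<integral>\<^sup>+t. ennreal ((norm (f n t - g t))\<^sup>2) \<partial>?M) \<le> ennreal e" by (rule est[OF n N0])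
    have i: "integrable ?M (\<lambda>t. (norm (f n t - g t))\<^sup>2)"
      using m le by (intro integrableI_bounded) (auto simp: le_less_trans)
    then show "square_integrable (\<lambda>t. f n t - g t)" using m by (simp add: square_integrable_def)
    show "integral\<^sup>L ?M (\<lambda>t. (norm (f n t - g t))\<^sup>2) \<le> e"
      using le e by (simp add: nn_integral_eq_integral[OF i])
  qed
  have sqg: "square_integrable g"
  proof -
    obtain N0 where N0: "\<And>m n. m \<ge> N0 \<Longrightarrow> n \<ge> N0 \<Longrightarrow> integral\<^sup>L ?M (\<lambda>t. (norm (f m t - f n t))\<^sup>2) < 1"
      using C[of 1] by auto
    have "square_integrable (\<lambda>t. f N0 t - g t)"
      by (rule sqd[THEN conjunct1, OF order_refl zero_less_one N0])
    then have "square_integrable (\<lambda>t. f N0 t - (f N0 t - g t))"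
      by (rule square_integrable_diff[OF sq])
    then show ?thesis by simp
  qed
  have "(\<lambda>n. integral\<^sup>L ?M (\<lambda>t. (norm (f n t - g t))\<^sup>2)) \<longlonglongrightarrow> 0"
  proof (rule LIMSEQ_I)
    fix e :: real assume e: "e > 0"
    obtain N0 where N0: "\<And>m n. m \<ge> N0 \<Longrightarrow> n \<ge> N0 \<Longrightarrow> integral\<^sup>L ?M (\<lambda>t. (norm (f m t - f n t))\<^sup>2) < e/2"
      using C[of "e/2"] e by auto
    have "norm (integral\<^sup>L ?M (\<lambda>t. (norm (f n t - g t))\<^sup>2) - 0) < e" if "n \<ge> N0" for n
      using sqd[OF that _ N0] e by (simp add: abs_of_nonneg)
    then show "\<exists>N0. \<forall>n\<ge>N0. norm (integral\<^sup>L ?M (\<lambda>t. (norm (f n t - g t))\<^sup>2) - 0) < e" by blast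
  qed
  then show thesis using that sqg by blast
qed

subsection \<open>Representatives\<close>

lemma rep_L2_square_integrable: "square_integrable (rep_L2 x)"
  using Quotient_rep_reflp[OF Quotient_L2, of x] by (simp add: L2_rel_def)

lemma rep_L2_measurable [measurable]: "rep_L2 x \<in> borel_measurable circle_measure"
  by (rule square_integrable_measurable[OF rep_L2_square_integrable])

lemma abs_L2_rep_L2: "abs_L2 (rep_L2 x) = x"
  using Quotient_abs_rep[OF Quotient_L2] .

lemma rep_L2_abs_L2: "square_integrable f \<Longrightarrow> AE t in circle_measure. rep_L2 (abs_L2 f) t = f t"
  using Quotient_rep_abs[OF Quotient_L2, of f] by (simp add: L2_rel_def)

lemma abs_L2_eqI:
  "square_integrable f \<Longrightarrow> square_integrable g \<Longrightarrow> AE t in circle_measure. f t = g t \<Longrightarrow> abs_L2 f = abs_L2 g"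
  by (rule Quotient_rel_abs[OF Quotient_L2]) (simp add: L2_rel_def)

lemma L2_eqI: "AE t in circle_measure. rep_L2 x t = rep_L2 y t \<Longrightarrow> x = y"
  using abs_L2_eqI[OF rep_L2_square_integrable rep_L2_square_integrable] abs_L2_rep_L2 by metis

lemma abs_L2_cong_AE:
  assumes f: "square_integrable f" and eq: "AE t in circle_measure. f t = g t"
  shows "abs_L2 g = abs_L2 f"
proof (rule abs_L2_eqI[OF _ f])
  have "g \<in> borel_measurable circle_measure"
    by (rule borel_measurable_AE_eq[OF square_integrable_measurable[OF f] eq])
  then show "square_integrable g"
    by (rule square_integrable_bound[OF f]) (use eq in \<open>auto elim: eventually_mono\<close>)
  show "AE t in circle_measure. g t = f t" using eq by (auto elim: eventually_mono)
qed

lemma rep_L2_plus: "AE t in circle_measure. rep_L2 (x + y) t = rep_L2 x t + rep_L2 y t"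
  and rep_L2_minus: "AE t in circle_measure. rep_L2 (x - y) t = rep_L2 x t - rep_L2 y t"
  and rep_L2_scaleC: "AE t in circle_measure. rep_L2 (c *\<^sub>C x) t = c *\<^sub>C rep_L2 x t"
  and rep_L2_zero: "AE t in circle_measure. rep_L2 (0::'a L2) t = 0"
  for x y :: "'a::chilbert L2"
proof -
  note sq = rep_L2_square_integrable
  show "AE t in circle_measure. rep_L2 (x + y) t = rep_L2 x t + rep_L2 y t"
    using rep_L2_abs_L2[OF square_integrable_add[OF sq[of x] sq[of y]]]
    by (simp add: plus_L2.abs_eq[symmetric] L2_rel_def sq abs_L2_rep_L2)
  show "AE t in circle_measure. rep_L2 (x - y) t = rep_L2 x t - rep_L2 y t"
    using rep_L2_abs_L2[OF square_integrable_diff[OF sq[of x] sq[of y]]]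
    by (simp add: minus_L2.abs_eq[symmetric] L2_rel_def sq abs_L2_rep_L2)
  show "AE t in circle_measure. rep_L2 (c *\<^sub>C x) t = c *\<^sub>C rep_L2 x t"
    using rep_L2_abs_L2[OF square_integrable_scaleC[OF sq[of x]]]
    by (simp add: scaleC_L2.abs_eq[symmetric] L2_rel_def sq abs_L2_rep_L2)
  show "AE t in circle_measure. rep_L2 (0::'a L2) t = 0"
    using rep_L2_abs_L2[OF square_integrable_zero] by (simp add: zero_L2_def)
qed

lemma cinner_L2_rep: "cinner x y = integral\<^sup>L circle_measure (\<lambda>t. cinner (rep_L2 x t) (rep_L2 y t))"
  by (simp add: cinner_L2_def)

lemma norm_L2_rep: "(norm x)\<^sup>2 = integral\<^sup>L circle_measure (\<lambda>t. (norm (rep_L2 x t))\<^sup>2)"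
  unfolding norm_sq_cinner[of x] cinner_L2_rep
  by (simp add: cinner_self del: of_real_power)

lemma norm_L2_diff_rep:
  "(norm (x - y))\<^sup>2 = integral\<^sup>L circle_measure (\<lambda>t. (norm (rep_L2 x t - rep_L2 y t))\<^sup>2)"
  unfolding norm_L2_rep
proof (rule integral_cong_AE)
  show "AE t in circle_measure. (norm (rep_L2 (x - y) t))\<^sup>2 = (norm (rep_L2 x t - rep_L2 y t))\<^sup>2"
    using rep_L2_minus[of x y] by eventually_elim simp
qed measurable

instance L2 :: (chilbert) complete_space
proof
  fix X :: "nat \<Rightarrow> 'a L2" assume X: "Cauchy X"
  have C: "\<exists>N. \<forall>m\<ge>N. \<forall>n\<ge>N. integral\<^sup>L circle_measure (\<lambda>t. (norm (rep_L2 (X m) t - rep_L2 (X n) t))\<^sup>2) < e"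
    if e: "e > 0" for e
  proof -
    obtain N where N: "\<forall>m\<ge>N. \<forall>n\<ge>N. norm (X m - X n) < sqrt e" using CauchyD[OF X, of "sqrt e"] e by auto
    have "(norm (X m - X n))\<^sup>2 < e" if "m \<ge> N" "n \<ge> N" for m n
      using N that e by (metis norm_ge_zero power_strict_mono real_sqrt_pow2 less_imp_le zero_less_numeral)
    then show ?thesis unfolding norm_L2_diff_rep by blast
  qed
  obtain g where g: "square_integrable g"
    "(\<lambda>n. integral\<^sup>L circle_measure (\<lambda>t. (norm (rep_L2 (X n) t - g t))\<^sup>2)) \<longlonglongrightarrow> 0"
    using square_integrable_complete[OF rep_L2_square_integrable C] by blast
  have "(norm (X n - abs_L2 g))\<^sup>2 = integral\<^sup>L circle_measure (\<lambda>t. (norm (rep_L2 (X n) t - g t))\<^sup>2)" for n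
    unfolding norm_L2_diff_rep
  proof (rule integral_cong_AE)
    have [measurable]: "g \<in> borel_measurable circle_measure" by (rule square_integrable_measurable[OF g(1)])
    show "(\<lambda>t. (norm (rep_L2 (X n) t - g t))\<^sup>2) \<in> borel_measurable circle_measure" by measurable
    show "AE t in circle_measure. (norm (rep_L2 (X n) t - rep_L2 (abs_L2 g) t))\<^sup>2 = (norm (rep_L2 (X n) t - g t))\<^sup>2"
      using rep_L2_abs_L2[OF g(1)] by eventually_elim simp
  qed measurable
  then have "(\<lambda>n. (norm (X n - abs_L2 g))\<^sup>2) \<longlonglongrightarrow> 0" using g(2) by simp
  then have "(\<lambda>n. sqrt ((norm (X n - abs_L2 g))\<^sup>2)) \<longlonglongrightarrow> sqrt 0" by (rule tendsto_real_sqrt)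
  then have "(\<lambda>n. norm (X n - abs_L2 g)) \<longlonglongrightarrow> 0" by simp
  then have "X \<longlonglongrightarrow> abs_L2 g" by (simp add: tendsto_norm_zero_iff LIM_zero_iff)
  then show "convergent X" by (rule convergentI)
qed

lemma L2_space_iff: "x \<in> L2_space E \<longleftrightarrow> (AE t in circle_measure. rep_L2 x t \<in> E)"
  by (simp add: L2_space_def)

lemma abs_L2_in_L2_space: "square_integrable f \<Longrightarrow> AE t in circle_measure. f t \<in> E \<Longrightarrow> abs_L2 f \<in> L2_space E"
  unfolding L2_space_iff using rep_L2_abs_L2[of f] by (auto elim: eventually_elim2)

lemma L2_space_csubspace:
  assumes E: "closed_csubspace E" shows "closed_csubspace (L2_space E)"
  unfolding closed_csubspace_def
proof (intro conjI ballI allI)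
  show "0 \<in> L2_space E" unfolding L2_space_iff
    using rep_L2_zero[where 'a = 'a] by eventually_elim (simp add: csubspace_0[OF E])
  show "x + y \<in> L2_space E" if "x \<in> L2_space E" "y \<in> L2_space E" for x y
    using that rep_L2_plus[of x y] unfolding L2_space_iff by eventually_elim (simp add: csubspace_add[OF E])
  show "c *\<^sub>C x \<in> L2_space E" if "x \<in> L2_space E" for c x
    using that rep_L2_scaleC[of c x] unfolding L2_space_iff by eventually_elim (simp add: csubspace_scaleC[OF E])
  show "closed (L2_space E)"
    unfolding closed_sequential_limits
  proof (intro allI impI)
    fix X x assume X: "(\<forall>n. X n \<in> L2_space E) \<and> X \<longlonglongrightarrow> x"
    have "(\<lambda>n. (norm (X n - x))\<^sup>2) \<longlonglongrightarrow> 0\<^sup>2"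
      using X by (intro tendsto_power tendsto_norm_zero LIM_zero) simp
    then have "(\<lambda>n. integral\<^sup>L circle_measure (\<lambda>t. norm ((norm (rep_L2 (X n) t - rep_L2 x t))\<^sup>2))) \<longlonglongrightarrow> 0"
      by (simp add: norm_L2_diff_rep)
    then obtain r where "AE t in circle_measure. (\<lambda>n. (norm (rep_L2 (X (r n)) t - rep_L2 x t))\<^sup>2) \<longlonglongrightarrow> 0"
      using tendsto_L1_AE_subseq[of circle_measure "\<lambda>n t. (norm (rep_L2 (X n) t - rep_L2 x t))\<^sup>2"]
        square_integrable_integrable[OF square_integrable_diff[OF rep_L2_square_integrable rep_L2_square_integrable]]
      by blast
    moreover have "AE t in circle_measure. \<forall>n. rep_L2 (X n) t \<in> E"
      using X unfolding AE_all_countable L2_space_iff by blast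
    ultimately show "x \<in> L2_space E"
      unfolding L2_space_iff
    proof eventually_elim
      case (elim t)
      have "(\<lambda>n. sqrt ((norm (rep_L2 (X (r n)) t - rep_L2 x t))\<^sup>2)) \<longlonglongrightarrow> sqrt 0"
        by (rule tendsto_real_sqrt[OF elim(1)])
      then have "(\<lambda>n. rep_L2 (X (r n)) t) \<longlonglongrightarrow> rep_L2 x t"
        by (simp add: tendsto_norm_zero_iff LIM_zero_iff)
      then show ?case by (rule closed_sequentially[OF csubspace_closed[OF E], rotated]) (use elim(2) in simp)
    qed
  qed
qed

section \<open>Measurable fields of contractions\<close>

definition proj :: "'a::{complex_inner,complete_space} set \<Rightarrow> 'a \<Rightarrow> 'a" where
  "proj E = adjoint_op E (\<lambda>x. x)"

lemma inclusion_contraction: "contraction E UNIV (\<lambda>x. x)"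
  by (rule contractionI) auto

lemma proj_contraction: "closed_csubspace E \<Longrightarrow> contraction UNIV E (proj E)"
  unfolding proj_def by (rule adjoint_op_contraction[OF _ inclusion_contraction])

lemma proj_id: "closed_csubspace E \<Longrightarrow> x \<in> E \<Longrightarrow> proj E x = x"
  unfolding proj_def by (rule adjoint_op_eqI) auto

lemma cinner_proj: "closed_csubspace E \<Longrightarrow> y \<in> E \<Longrightarrow> cinner x y = cinner (proj E x) y"
  unfolding proj_def by (rule adjoint_op_cinner'[OF _ contraction_bounded_op[OF inclusion_contraction]])

text \<open>A countable set \<open>D\<close> suffices to test the norm, so balls have measurable preimages under weakly
  measurable functions.\<close>

lemma norm_le_weak:
  fixes y :: "'a::complex_inner"
  assumes D: "\<And>X. open X \<Longrightarrow> X \<noteq> {} \<Longrightarrow> \<exists>d\<in>D. d \<in> X" and r: "0 \<le> r"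
  shows "norm y \<le> r \<longleftrightarrow> (\<forall>x\<in>D. Re (cinner x y) \<le> norm x * r)"
proof
  assume "norm y \<le> r"
  then show "\<forall>x\<in>D. Re (cinner x y) \<le> norm x * r"
    using Re_cinner_le by (metis mult_left_mono norm_ge_zero order_trans)
next
  assume *: "\<forall>x\<in>D. Re (cinner x y) \<le> norm x * r"
  have o: "open {x. norm x * r < Re (cinner x y)}"
    unfolding inner_eq_Re_cinner[symmetric] by (intro open_Collect_less continuous_intros)
  have "Re (cinner y y) \<le> norm y * r"
  proof (rule ccontr)
    assume "\<not> ?thesis"
    then have "y \<in> {x. norm x * r < Re (cinner x y)}" by simp
    then obtain d where "d \<in> D" "d \<in> {x. norm x * r < Re (cinner x y)}" using D[OF o] by blast
    then show False using * by force
  qed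
  then have "norm y * norm y \<le> norm y * r" by (simp add: norm_sq_cinner[symmetric] power2_eq_square)
  then show "norm y \<le> r" using r by (cases "y = 0") auto
qed

text \<open>Pettis' theorem for separable spaces. It makes the adjoints of a measurable field measurable.\<close>

lemma borel_measurable_weak:
  fixes g :: "'m \<Rightarrow> 'a::chilbert"
  assumes w: "\<And>x. (\<lambda>t. cinner x (g t)) \<in> borel_measurable M"
  shows "g \<in> borel_measurable M"
proof (rule borel_measurableI)
  fix U :: "'a set" assume U: "open U"
  obtain D :: "'a set" where D: "countable D" "\<And>X. open X \<Longrightarrow> X \<noteq> {} \<Longrightarrow> \<exists>d\<in>D. d \<in> X"
    using countable_dense_exists by blast
  define I where "I = {(a, r). a \<in> D \<and> r \<in> \<rat> \<and> 0 \<le> r \<and> cball a r \<subseteq> U}"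
  have "I \<subseteq> D \<times> \<rat>" by (auto simp: I_def)
  then have I: "countable I" using D(1) countable_rat by (meson countable_SIGMA countable_subset)
  have UI: "U = (\<Union>(a, r)\<in>I. cball a r)"
  proof
    show "U \<subseteq> (\<Union>(a, r)\<in>I. cball a r)"
    proof
      fix x assume "x \<in> U"
      then obtain e where e: "e > 0" "ball x e \<subseteq> U" using U openE by blast
      \<comment> \<open>Any \<open>r\<close> with \<open>e/3 < r\<close> and \<open>r + e/3 < e\<close> would do.\<close>
      obtain r where r: "r \<in> \<rat>" "e/3 < r" "r < e/2" using Rats_dense_in_real[of "e/3" "e/2"] e by auto
      obtain a where a: "a \<in> D" "a \<in> ball x (e/3)" using D(2)[of "ball x (e/3)"] e by auto
      have "cball a r \<subseteq> ball x e"
      proof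
        fix z assume "z \<in> cball a r"
        then show "z \<in> ball x e" using dist_triangle[of x z a] a r e by simp
      qed
      then have "(a, r) \<in> I" using a r e by (auto simp: I_def)
      moreover have "x \<in> cball a r" using a r by (simp add: dist_commute)
      ultimately show "x \<in> (\<Union>(a, r)\<in>I. cball a r)" by blast
    qed
  qed (auto simp: I_def)
  have S: "g -` cball a r \<inter> space M \<in> sets M" if "0 \<le> r" for a r
  proof -
    have "g -` cball a r \<inter> space M = {t \<in> space M. norm (g t - a) \<le> r}"
      by (auto simp: dist_norm norm_minus_commute)
    also have "\<dots> = {t \<in> space M. \<forall>x\<in>D. Re (cinner x (g t - a)) \<le> norm x * r}"
      using norm_le_weak[OF D(2) that] by simp
    also have "\<dots> \<in> sets M"
    proof (rule sets.sets_Collect_countable_All'[OF _ D(1)])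
      fix x
      have "(\<lambda>t. Re (cinner x (g t - a))) \<in> borel_measurable M"
        using w[of x] by (simp add: cinner.diff_right)
      then show "{t \<in> space M. Re (cinner x (g t - a)) \<le> norm x * r} \<in> sets M" by measurable
    qed
    finally show ?thesis .
  qed
  have "g -` U \<inter> space M = (\<Union>(a, r)\<in>I. g -` cball a r \<inter> space M)" unfolding UI by auto
  also have "\<dots> \<in> sets M" using S by (intro sets.countable_UN''[OF I]) (auto simp: I_def)
  finally show "g -` U \<inter> space M \<in> sets M" .
qed

definition op_field ::
  "'a::complex_inner set \<Rightarrow> 'b::complex_inner set \<Rightarrow> (real \<Rightarrow> 'a \<Rightarrow> 'b) \<Rightarrow> bool" where
  "op_field E F S \<longleftrightarrow>
     (\<forall>t. contraction E F (S t)) \<and> (\<forall>x\<in>E. (\<lambda>t. S t x) \<in> borel_measurable circle_measure)"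

lemma op_field_contraction: "op_field E F S \<Longrightarrow> contraction E F (S t)"
  and op_field_const: "op_field E F S \<Longrightarrow> x \<in> E \<Longrightarrow> (\<lambda>t. S t x) \<in> borel_measurable circle_measure"
  by (auto simp: op_field_def)

text \<open>Approximate \<open>v\<close> by simple functions. Their values may lie outside \<open>E\<close>, whence the projection to \<open>E\<close>.\<close>

lemma op_field_measurable:
  fixes S :: "real \<Rightarrow> 'a::chilbert \<Rightarrow> 'b::chilbert"
  assumes E: "closed_csubspace E" and S: "op_field E F S"
    and v: "v \<in> borel_measurable circle_measure" "AE t in circle_measure. v t \<in> E"
  shows "(\<lambda>t. S t (v t)) \<in> borel_measurable circle_measure"
proof -
  let ?M = circle_measure
  note P = proj_contraction[OF E]
  obtain s where s: "\<And>i. simple_function ?M (s i)" "\<And>t. t \<in> space ?M \<Longrightarrow> (\<lambda>i. s i t) \<longlonglongrightarrow> v t"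
    using borel_measurable_implies_sequence_metric[OF v(1)] by blast
  show ?thesis
  proof (rule borel_measurable_AE_limit)
    show "(\<lambda>t. S t (proj E (s i t))) \<in> borel_measurable ?M" for i
    proof (rule measurable_compose_countable'[where f = "\<lambda>y t. S t (proj E y)"])
      have fin: "finite (s i ` space ?M)" using s(1) by (simp add: simple_function_def)
      then show "countable (s i ` space ?M)" by (rule countable_finite)
      show "s i \<in> measurable ?M (count_space (s i ` space ?M))"
        unfolding measurable_count_space_eq2[OF fin] using s(1)[of i] by (auto simp: simple_function_def)
      show "(\<lambda>t. S t (proj E y)) \<in> borel_measurable ?M" for y
        by (rule op_field_const[OF S contraction_in[OF P]]) simp
    qed
    show "AE t in ?M. (\<lambda>i. S t (proj E (s i t))) \<longlonglongrightarrow> S t (v t)"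
      using v(2) AE_space
    proof eventually_elim
      case (elim t)
      have "(\<lambda>i. proj E (s i t)) \<longlonglongrightarrow> proj E (v t)"
        by (rule bounded_op_tendsto[OF csubspace_UNIV contraction_bounded_op[OF P] s(2)[OF elim(2)]]) auto
      then have "(\<lambda>i. S t (proj E (s i t))) \<longlonglongrightarrow> S t (proj E (v t))"
        by (rule bounded_op_tendsto[OF E contraction_bounded_op[OF op_field_contraction[OF S]]])
          (use contraction_in[OF P] in auto)
      then show ?case using proj_id[OF E elim(1)] by simp
    qed
  qed
qed

lemma op_field_comp:
  fixes S :: "real \<Rightarrow> 'a::chilbert \<Rightarrow> 'b::chilbert" and R :: "real \<Rightarrow> 'b \<Rightarrow> 'c::chilbert"
  assumes "closed_csubspace F" and S: "op_field E F S" and R: "op_field F G R"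
  shows "op_field E G (\<lambda>t x. R t (S t x))"
  unfolding op_field_def
proof (intro conjI allI ballI)
  show "contraction E G (\<lambda>x. R t (S t x))" for t
    by (rule contraction_comp[OF op_field_contraction[OF S] op_field_contraction[OF R]])
  show "(\<lambda>t. R t (S t x)) \<in> borel_measurable circle_measure" if "x \<in> E" for x
    using contraction_in[OF op_field_contraction[OF S] that]
    by (intro op_field_measurable[OF assms(1) R op_field_const[OF S that]]) auto
qed

text \<open>Weak measurability is inherited from \<open>S\<close>, because \<open>\<langle>x, S\<^sup>* y\<rangle> = \<langle>S P x, y\<rangle>\<close> with the projection \<open>P\<close> to \<open>E\<close>.\<close>

lemma op_field_adjoint:
  fixes S :: "real \<Rightarrow> 'a::chilbert \<Rightarrow> 'b::chilbert"
  assumes E: "closed_csubspace E" and S: "op_field E F S"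
  shows "op_field F' E (\<lambda>t. adjoint_op E (S t))"
  unfolding op_field_def
proof (intro conjI allI ballI)
  show "contraction F' E (adjoint_op E (S t))" for t
    by (rule adjoint_op_contraction[OF E op_field_contraction[OF S]])
  show "(\<lambda>t. adjoint_op E (S t) y) \<in> borel_measurable circle_measure" for y
  proof (rule borel_measurable_weak)
    fix x
    have px: "proj E x \<in> E" using contraction_in[OF proj_contraction[OF E]] by blast
    have b: "bounded_op E F (S t)" for t by (rule contraction_bounded_op[OF op_field_contraction[OF S]])
    have "cinner x (adjoint_op E (S t) y) = cinner (S t (proj E x)) y" for t
      using cinner_proj[OF E adjoint_op_in[OF E b]] adjoint_op_cinner[OF E b px] by simp
    then show "(\<lambda>t. cinner x (adjoint_op E (S t) y)) \<in> borel_measurable circle_measure"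
      using op_field_const[OF S px] by (auto intro!: borel_measurable_cinner)
  qed
qed

lemma op_field_sqrt_iter:
  fixes X :: "real \<Rightarrow> 'a::chilbert \<Rightarrow> 'a"
  assumes E: "closed_csubspace E" and X: "op_field E E X"
  shows "op_field E E (\<lambda>t. sqrt_iter (X t) n)"
proof (induction n)
  case 0
  show ?case unfolding op_field_def using sqrt_iter_contraction[OF E op_field_contraction[OF X], of _ 0] by simp
next
  case (Suc n)
  show ?case unfolding op_field_def
  proof (intro conjI allI ballI)
    show "contraction E E (sqrt_iter (X t) (Suc n))" for t
      by (rule sqrt_iter_contraction[OF E op_field_contraction[OF X]])
    show "(\<lambda>t. sqrt_iter (X t) (Suc n) x) \<in> borel_measurable circle_measure" if "x \<in> E" for x
      using op_field_const[OF X that] op_field_const[OF op_field_comp[OF E Suc Suc] that]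
      by (simp del: scaleR_right_distrib)
  qed
qed

lemma op_field_defect:
  fixes S :: "real \<Rightarrow> 'a::chilbert \<Rightarrow> 'b::chilbert"
  assumes E: "closed_csubspace E" and S: "op_field E F S" and F: "closed_csubspace F"
  shows "op_field E E (\<lambda>t. defect E (S t))"
  unfolding op_field_def
proof (intro conjI allI ballI)
  show "contraction E E (defect E (S t))" for t
    by (rule defect_contraction[OF E op_field_contraction[OF S]])
  show "(\<lambda>t. defect E (S t) x) \<in> borel_measurable circle_measure" if x: "x \<in> E" for x
  proof (rule borel_measurable_AE_limit)
    have "op_field E E (\<lambda>t x. adjoint_op E (S t) (S t x))"
      by (rule op_field_comp[OF F S op_field_adjoint[OF E S]])
    from op_field_const[OF op_field_sqrt_iter[OF E this] x]
    show "(\<lambda>t. x - sqrt_iter (\<lambda>x. adjoint_op E (S t) (S t x)) n x) \<in> borel_measurable circle_measure" for n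
      by simp
    show "AE t in circle_measure. (\<lambda>n. x - sqrt_iter (\<lambda>x. adjoint_op E (S t) (S t x)) n x) \<longlonglongrightarrow> defect E (S t) x"
      using defect_tendsto[OF E op_field_contraction[OF S] x] by simp
  qed
qed

subsection \<open>Multiplication operators\<close>

definition pointwise_op :: "(real \<Rightarrow> 'a::chilbert \<Rightarrow> 'b::chilbert) \<Rightarrow> 'a L2 \<Rightarrow> 'b L2" where
  "pointwise_op S v = abs_L2 (\<lambda>t. S t (rep_L2 v t))"

context
  fixes E :: "'a::chilbert set" and F :: "'b::chilbert set" and S
  assumes E: "closed_csubspace E" and S: "op_field E F S"
begin

lemma pointwise_square_integrable:
  assumes "v \<in> L2_space E" shows "square_integrable (\<lambda>t. S t (rep_L2 v t))"
proof (rule square_integrable_bound[OF rep_L2_square_integrable[of v]])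
  have v: "AE t in circle_measure. rep_L2 v t \<in> E" using assms by (simp add: L2_space_iff)
  show "(\<lambda>t. S t (rep_L2 v t)) \<in> borel_measurable circle_measure"
    by (rule op_field_measurable[OF E S _ v]) simp
  show "AE t in circle_measure. norm (S t (rep_L2 v t)) \<le> norm (rep_L2 v t)"
    using v by eventually_elim (rule contraction_norm[OF op_field_contraction[OF S]])
qed

lemma rep_pointwise_op:
  "v \<in> L2_space E \<Longrightarrow> AE t in circle_measure. rep_L2 (pointwise_op S v) t = S t (rep_L2 v t)"
  unfolding pointwise_op_def by (rule rep_L2_abs_L2[OF pointwise_square_integrable])

lemma pointwise_op_contraction: "contraction (L2_space E) (L2_space F) (pointwise_op S)"
proof (rule contractionI)
  fix x assume x: "x \<in> L2_space E"
  then have xE: "AE t in circle_measure. rep_L2 x t \<in> E" by (simp add: L2_space_iff)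
  note c = op_field_contraction[OF S]
  show "pointwise_op S x \<in> L2_space F"
    unfolding L2_space_iff using rep_pointwise_op[OF x] xE
    by eventually_elim (simp add: contraction_in[OF c])
  show "pointwise_op S (x + y) = pointwise_op S x + pointwise_op S y" if y: "y \<in> L2_space E" for y
  proof (rule L2_eqI)
    have yE: "AE t in circle_measure. rep_L2 y t \<in> E" using y by (simp add: L2_space_iff)
    have xy: "x + y \<in> L2_space E" using x y csubspace_add[OF L2_space_csubspace[OF E]] by blast
    show "AE t in circle_measure. rep_L2 (pointwise_op S (x + y)) t = rep_L2 (pointwise_op S x + pointwise_op S y) t"
      using rep_pointwise_op[OF xy] rep_pointwise_op[OF x] rep_pointwise_op[OF y] xE yE rep_L2_plus[of x y]
        rep_L2_plus[of "pointwise_op S x" "pointwise_op S y"]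
      by eventually_elim (simp add: bounded_op_add[OF contraction_bounded_op[OF c]])
  qed
  show "pointwise_op S (k *\<^sub>C x) = k *\<^sub>C pointwise_op S x" for k
  proof (rule L2_eqI)
    have kx: "k *\<^sub>C x \<in> L2_space E" using x csubspace_scaleC[OF L2_space_csubspace[OF E]] by blast
    show "AE t in circle_measure. rep_L2 (pointwise_op S (k *\<^sub>C x)) t = rep_L2 (k *\<^sub>C pointwise_op S x) t"
      using rep_pointwise_op[OF kx] rep_pointwise_op[OF x] xE rep_L2_scaleC[of k x]
        rep_L2_scaleC[of k "pointwise_op S x"]
      by eventually_elim (simp add: bounded_op_scaleC[OF contraction_bounded_op[OF c]])
  qed
  have "(norm (pointwise_op S x))\<^sup>2 \<le> (norm x)\<^sup>2"
    unfolding norm_L2_rep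
  proof (rule integral_mono_AE)
    show "AE t in circle_measure. (norm (rep_L2 (pointwise_op S x) t))\<^sup>2 \<le> (norm (rep_L2 x t))\<^sup>2"
      using rep_pointwise_op[OF x] xE
      by eventually_elim (simp add: contraction_norm[OF c] power_mono)
  qed (intro square_integrable_integrable rep_L2_square_integrable)+
  then show "norm (pointwise_op S x) \<le> norm x" by (rule power2_le_imp_le) simp
qed

lemma pointwise_op_adjoint:
  assumes w: "w \<in> L2_space F'" and F': "closed_csubspace F'"
  shows "adjoint_op (L2_space E) (pointwise_op S) w = pointwise_op (\<lambda>t. adjoint_op E (S t)) w"
proof (rule adjoint_op_eqI[OF L2_space_csubspace[OF E]])
  have A: "op_field F' E (\<lambda>t. adjoint_op E (S t))" by (rule op_field_adjoint[OF E S])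
  have wF: "AE t in circle_measure. rep_L2 w t \<in> F'" using w by (simp add: L2_space_iff)
  have rA: "AE t in circle_measure. rep_L2 (pointwise_op (\<lambda>t. adjoint_op E (S t)) w) t = adjoint_op E (S t) (rep_L2 w t)"
    unfolding pointwise_op_def
  proof (rule rep_L2_abs_L2, rule square_integrable_bound[OF rep_L2_square_integrable[of w]])
    show "(\<lambda>t. adjoint_op E (S t) (rep_L2 w t)) \<in> borel_measurable circle_measure"
      by (rule op_field_measurable[OF F' A _ wF]) simp
    show "AE t in circle_measure. norm (adjoint_op E (S t) (rep_L2 w t)) \<le> norm (rep_L2 w t)"
      using wF by eventually_elim (rule contraction_norm[OF op_field_contraction[OF A]])
  qed
  show "pointwise_op (\<lambda>t. adjoint_op E (S t)) w \<in> L2_space E"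
    unfolding L2_space_iff using rA wF
    by eventually_elim (simp add: contraction_in[OF op_field_contraction[OF A]])
  fix u assume u: "u \<in> L2_space E"
  then have uE: "AE t in circle_measure. rep_L2 u t \<in> E" by (simp add: L2_space_iff)
  show "cinner (pointwise_op S u) w = cinner u (pointwise_op (\<lambda>t. adjoint_op E (S t)) w)"
    unfolding cinner_L2_rep
  proof (rule integral_cong_AE)
    show "AE t in circle_measure. cinner (rep_L2 (pointwise_op S u) t) (rep_L2 w t)
        = cinner (rep_L2 u t) (rep_L2 (pointwise_op (\<lambda>t. adjoint_op E (S t)) w) t)"
      using rep_pointwise_op[OF u] rA uE
      by eventually_elim (simp add: adjoint_op_cinner[OF E contraction_bounded_op[OF op_field_contraction[OF S]]])
  qed (auto intro!: borel_measurable_cinner)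
qed

end

lemma pointwise_op_cong:
  assumes E: "closed_csubspace E" and S: "op_field E F S" and v: "v \<in> L2_space E"
    and eq: "AE t in circle_measure. \<forall>x\<in>E. S t x = S' t x"
  shows "pointwise_op S' v = pointwise_op S v"
  unfolding pointwise_op_def
proof (rule abs_L2_cong_AE[OF pointwise_square_integrable[OF E S v]])
  show "AE t in circle_measure. S t (rep_L2 v t) = S' t (rep_L2 v t)"
    using eq v unfolding L2_space_iff by eventually_elim simp
qed

lemma pointwise_op_comp:
  assumes E: "closed_csubspace E" and F: "closed_csubspace F" and S: "op_field E F S" and R: "op_field F G R"
    and v: "v \<in> L2_space E"
  shows "pointwise_op R (pointwise_op S v) = pointwise_op (\<lambda>t x. R t (S t x)) v"
proof (rule L2_eqI)
  show "AE t in circle_measure. rep_L2 (pointwise_op R (pointwise_op S v)) t = rep_L2 (pointwise_op (\<lambda>t x. R t (S t x)) v) t"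
    using rep_pointwise_op[OF F R contraction_in[OF pointwise_op_contraction[OF E S] v]]
      rep_pointwise_op[OF E S v] rep_pointwise_op[OF E op_field_comp[OF F S R] v]
    by eventually_elim simp
qed

text \<open>The fibrewise square roots form a positive operator with the right square, and square roots are unique.\<close>

lemma pointwise_op_defect:
  assumes E: "closed_csubspace E" and F: "closed_csubspace F" and S: "op_field E F S" and v: "v \<in> L2_space E"
  shows "defect (L2_space E) (pointwise_op S) v = pointwise_op (\<lambda>t. defect E (S t)) v"
proof (rule defect_unique[OF L2_space_csubspace[OF E] pointwise_op_contraction[OF E S] _ _ v])
  have D: "op_field E E (\<lambda>t. defect E (S t))" by (rule op_field_defect[OF E S F])
  note Dc = pointwise_op_contraction[OF E D]
  show "positive_op (L2_space E) (pointwise_op (\<lambda>t. defect E (S t)))"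
    unfolding positive_op_def
  proof (intro conjI ballI)
    show "bounded_op (L2_space E) (L2_space E) (pointwise_op (\<lambda>t. defect E (S t)))"
      by (rule contraction_bounded_op[OF Dc])
    fix x assume x: "x \<in> L2_space E"
    let ?h = "\<lambda>t. Re (cinner (rep_L2 (pointwise_op (\<lambda>t. defect E (S t)) x) t) (rep_L2 x t))"
    have p: "AE t in circle_measure. cinner (rep_L2 (pointwise_op (\<lambda>t. defect E (S t)) x) t) (rep_L2 x t) = of_real (?h t) \<and> 0 \<le> ?h t"
      using rep_pointwise_op[OF E D x] x unfolding L2_space_iff
    proof eventually_elim
      case (elim t)
      then show ?case using defect_positive[OF E op_field_contraction[OF S]]
        by (auto simp: positive_op_def)
    qed
    have "cinner (pointwise_op (\<lambda>t. defect E (S t)) x) x = integral\<^sup>L circle_measure (\<lambda>t. complex_of_real (?h t))"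
      unfolding cinner_L2_rep
      by (rule integral_cong_AE) (use p in \<open>auto intro!: borel_measurable_cinner measurable_compose[OF borel_measurable_cinner] elim: eventually_mono\<close>)
    also have "\<dots> = of_real (integral\<^sup>L circle_measure ?h)" by (rule integral_complex_of_real)
    finally have e: "cinner (pointwise_op (\<lambda>t. defect E (S t)) x) x = of_real (integral\<^sup>L circle_measure ?h)" .
    show "cinner (pointwise_op (\<lambda>t. defect E (S t)) x) x \<in> \<real>" unfolding e by simp
    show "0 \<le> Re (cinner (pointwise_op (\<lambda>t. defect E (S t)) x) x)"
      unfolding e using p by (auto intro!: integral_nonneg_AE elim: eventually_mono)
  qed
  fix x assume x: "x \<in> L2_space E"
  have A: "op_field F E (\<lambda>t. adjoint_op E (S t))" by (rule op_field_adjoint[OF E S])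
  have Sx: "pointwise_op S x \<in> L2_space F" by (rule contraction_in[OF pointwise_op_contraction[OF E S] x])
  have "pointwise_op (\<lambda>t. defect E (S t)) (pointwise_op (\<lambda>t. defect E (S t)) x)
      = x - pointwise_op (\<lambda>t. adjoint_op E (S t)) (pointwise_op S x)"
    unfolding pointwise_op_comp[OF E E D D x] pointwise_op_comp[OF E F S A x]
  proof (rule L2_eqI)
    show "AE t in circle_measure. rep_L2 (pointwise_op (\<lambda>t x. defect E (S t) (defect E (S t) x)) x) t
        = rep_L2 (x - pointwise_op (\<lambda>t x. adjoint_op E (S t) (S t x)) x) t"
      using rep_pointwise_op[OF E op_field_comp[OF E D D] x] rep_pointwise_op[OF E op_field_comp[OF F S A] x]
        rep_L2_minus[of x "pointwise_op (\<lambda>t x. adjoint_op E (S t) (S t x)) x"] x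
      unfolding L2_space_iff
      by eventually_elim (simp add: defect_square[OF E op_field_contraction[OF S]])
  qed
  then show "pointwise_op (\<lambda>t. defect E (S t)) (pointwise_op (\<lambda>t. defect E (S t)) x)
      = x - adjoint_op (L2_space E) (pointwise_op S) (pointwise_op S x)"
    by (simp add: pointwise_op_adjoint[OF E S Sx F])
qed

section \<open>Kernels of measurable fields\<close>

lemma countable_dense_subset:
  fixes S :: "'a::{metric_space,second_countable_topology} set"
  obtains C where "countable C" "C \<subseteq> S" "S \<subseteq> closure C"
proof -
  obtain B :: "'a set set" where B: "countable B" "topological_basis B" using ex_countable_basis by blast
  define c where "c = (\<lambda>b. SOME x. x \<in> b \<inter> S)"
  have c: "c b \<in> b \<inter> S" if "b \<inter> S \<noteq> {}" for b
    unfolding c_def by (rule someI_ex) (use that in blast)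
  define C where "C = c ` {b \<in> B. b \<inter> S \<noteq> {}}"
  have "x \<in> closure C" if x: "x \<in> S" for x
    unfolding closure_approachable
  proof (intro allI impI)
    fix e :: real assume "e > 0"
    then obtain b where b: "b \<in> B" "x \<in> b" "b \<subseteq> ball x e"
      using topological_basisE[OF B(2) open_ball, of x x e] by (metis centre_in_ball)
    then have "b \<inter> S \<noteq> {}" using x by blast
    from c[OF this] have "c b \<in> ball x e" "c b \<in> C" using b \<open>b \<inter> S \<noteq> {}\<close> by (auto simp: C_def)
    then show "\<exists>y\<in>C. dist y x < e" by (auto simp: dist_commute)
  qed
  moreover have "countable C" unfolding C_def using B(1) by (intro countable_image) auto
  moreover have "C \<subseteq> S" unfolding C_def using c by auto
  ultimately show thesis using that by blast
qed

lemma norm_diff_sq: "(norm (x - y))\<^sup>2 = (norm x)\<^sup>2 + (norm y)\<^sup>2 - 2 * Re (cinner x (y::'a::complex_inner))"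
  unfolding norm_sq_cinner using arg_cong[OF cinner_commute[of y x], of Re] by (simp add: cinner_simps)

lemma kernel_csubspace:
  assumes E: "closed_csubspace E" and S: "bounded_op E F S"
  shows "closed_csubspace {x \<in> E. S x = 0}"
  unfolding closed_csubspace_def
proof (intro conjI)
  have "closed (E \<inter> S -` {0})"
    using bounded_op_continuous_on[OF E S] csubspace_closed[OF E] by (intro continuous_closed_preimage) auto
  moreover have "E \<inter> S -` {0} = {x \<in> E. S x = 0}" by auto
  ultimately show "closed {x \<in> E. S x = 0}" by simp
qed (use E S in \<open>auto simp: csubspace_rules bounded_op_zero bounded_op_add bounded_op_scaleC scaleC.zero_right\<close>)

text \<open>For a contraction \<open>N\<close>, the powers of the positive contraction \<open>I - N\<^sup>*N\<close> decrease to the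
  projection onto the kernel of \<open>N\<close>. Hence the projections onto the kernels of a measurable field
  are again a measurable field, and no measurable selection theorem is needed.\<close>

lemma defect_powers_tendsto_kernel_proj:
  fixes E :: "'a::{complex_inner,complete_space} set" and N :: "'a \<Rightarrow> 'b::complex_inner"
  assumes E: "closed_csubspace E" and N: "contraction E F N" and x: "x \<in> E"
  shows "(\<lambda>n. (defect E N ^^ (2 * n)) x) \<longlonglongrightarrow> proj {x \<in> E. N x = 0} x"
proof -
  define D where "D = defect E N"
  have Dc: "contraction E E D" unfolding D_def by (rule defect_contraction[OF E N])
  have Dn: "contraction E E (D ^^ n)" for n
  proof (induction n)
    case 0 show ?case by (rule contractionI) auto
  next
    case (Suc n) then show ?case using contraction_comp[OF Suc Dc] by (simp add: comp_def)
  qed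
  have Din: "(D ^^ n) y \<in> E" if "y \<in> E" for n y using contraction_in[OF Dn that] .
  have sa: "cinner ((D ^^ n) u) v = cinner u ((D ^^ n) v)" if "u \<in> E" "v \<in> E" for n u v
    using that
  proof (induction n arbitrary: v)
    case (Suc n)
    have "cinner ((D ^^ Suc n) u) v = cinner ((D ^^ n) u) (D v)"
      using defect_selfadjoint[OF E N Din[OF Suc.prems(1)] Suc.prems(2)] by (simp add: D_def)
    also have "\<dots> = cinner u ((D ^^ n) (D v))" using Suc.IH[OF Suc.prems(1)] contraction_in[OF Dc Suc.prems(2)] by blast
    finally show ?case by (simp add: funpow_swap1)
  qed simp
  define a where "a = (\<lambda>k. (norm ((D ^^ k) x))\<^sup>2)"
  have "a (Suc k) \<le> a k" for k
    unfolding a_def using contraction_norm[OF Dc Din[OF x]] by (simp add: power_mono)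
  then have "convergent a"
    by (intro Bseq_monoseq_convergent decseq_bounded[of _ 0]) (auto simp: monoseq_Suc decseq_Suc_iff a_def)
  then obtain l where l: "a \<longlonglongrightarrow> l" by (auto simp: convergent_def)
  have ip: "Re (cinner ((D ^^ (2*m)) x) ((D ^^ (2*n)) x)) = a (m + n)" for m n
  proof -
    have "cinner ((D ^^ (2*m)) x) ((D ^^ (2*n)) x) = cinner x ((D ^^ (2*m)) ((D ^^ (2*n)) x))"
      by (rule sa[OF x Din[OF x]])
    also have "(D ^^ (2*m)) ((D ^^ (2*n)) x) = (D ^^ (m+n)) ((D ^^ (m+n)) x)"
      by (simp flip: funpow_add[THEN fun_cong, unfolded comp_def] add: mult_2 add_ac)
    also have "cinner x \<dots> = cinner ((D ^^ (m+n)) x) ((D ^^ (m+n)) x)"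
      by (rule sa[OF x Din[OF x], symmetric])
    finally show ?thesis by (simp add: a_def norm_sq_cinner)
  qed
  \<comment> \<open>The right-hand side tends to zero because the decreasing sequence \<open>a\<close> converges.\<close>
  have diff: "(norm ((D ^^ (2*m)) x - (D ^^ (2*n)) x))\<^sup>2 = a (2*m) + a (2*n) - 2 * a (m + n)" for m n
    unfolding norm_diff_sq ip by (simp add: a_def)
  have "Cauchy (\<lambda>n. (D ^^ (2*n)) x)"
  proof (rule metric_CauchyI)
    fix e :: real assume e: "e > 0"
    then obtain M where M: "\<And>k. k \<ge> M \<Longrightarrow> \<bar>a k - l\<bar> < e\<^sup>2 / 4"
      using LIMSEQ_D[OF l, of "e\<^sup>2/4"] by (auto simp: real_norm_def)
    have "dist ((D ^^ (2*m)) x) ((D ^^ (2*n)) x) < e" if "m \<ge> M" "n \<ge> M" for m n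
    proof -
      have "(norm ((D ^^ (2*m)) x - (D ^^ (2*n)) x))\<^sup>2 < e\<^sup>2"
      proof -
        have "\<bar>a (2*m) - l\<bar> < e\<^sup>2/4" "\<bar>a (2*n) - l\<bar> < e\<^sup>2/4" "\<bar>a (m+n) - l\<bar> < e\<^sup>2/4"
          using that M[of "2*m"] M[of "2*n"] M[of "m+n"] by simp_all
        then show ?thesis unfolding diff by linarith
      qed
      then show ?thesis using e by (simp add: dist_norm power2_less_imp_less)
    qed
    then show "\<exists>M. \<forall>m\<ge>M. \<forall>n\<ge>M. dist ((D ^^ (2*m)) x) ((D ^^ (2*n)) x) < e" by blast
  qed
  then obtain p where p: "(\<lambda>n. (D ^^ (2*n)) x) \<longlonglongrightarrow> p" using Cauchy_convergent convergent_def by blast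
  have pE: "p \<in> E" by (rule closed_sequentially[OF csubspace_closed[OF E] Din[OF x] p])
  have D2: "contraction E E (\<lambda>x. D (D x))" by (rule contraction_comp[OF Dc Dc])
  have "(\<lambda>n. D (D ((D ^^ (2*n)) x))) \<longlonglongrightarrow> D (D p)"
    by (rule bounded_op_tendsto[OF E contraction_bounded_op[OF D2] p _ pE]) (simp add: Din x)
  moreover have "(\<lambda>n. D (D ((D ^^ (2*n)) x))) \<longlonglongrightarrow> p"
    using LIMSEQ_Suc[OF p] by simp
  ultimately have Dp: "D (D p) = p" using LIMSEQ_unique by blast
  have "norm p \<le> norm (D p)" using contraction_norm[OF Dc contraction_in[OF Dc pE]] Dp by simp
  then have "(norm p)\<^sup>2 \<le> (norm (D p))\<^sup>2" by (simp add: power_mono)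
  then have Np: "N p = 0" using norm_defect[OF E N pE] by (simp add: D_def)
  have "proj {x \<in> E. N x = 0} x = p"
    unfolding proj_def
  proof (rule adjoint_op_eqI[OF kernel_csubspace[OF E contraction_bounded_op[OF N]]])
    show "p \<in> {x \<in> E. N x = 0}" using pE Np by simp
    fix u assume u: "u \<in> {x \<in> E. N x = 0}"
    have "D (D u) = u"
      using u defect_square[OF E N, of u]
        bounded_op_zero[OF contraction_bounded_op[OF adjoint_op_contraction[OF E N, of UNIV]]]
      by (simp add: D_def)
    then have Du: "(D ^^ (2*n)) u = u" for n by (induction n) auto
    have "(\<lambda>n. cinner ((D ^^ (2*n)) u) x) \<longlonglongrightarrow> cinner u p"
      using cinner.tendsto[OF tendsto_const p, of u] u x by (simp add: sa)
    then show "cinner u x = cinner u p" by (simp add: Du LIMSEQ_const_iff)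
  qed
  then show ?thesis using p by (simp add: D_def)
qed

lemma op_field_kernel_proj:
  fixes N :: "real \<Rightarrow> 'a::chilbert \<Rightarrow> 'b::chilbert"
  assumes E: "closed_csubspace E" and N: "op_field E F N" and F: "closed_csubspace F"
  shows "op_field E E (\<lambda>t. proj {x \<in> E. N t x = 0})"
  unfolding op_field_def
proof (intro conjI allI ballI)
  note Nc = op_field_contraction[OF N]
  have D: "op_field E E (\<lambda>t. defect E (N t))" by (rule op_field_defect[OF E N F])
  have Dn: "op_field E E (\<lambda>t. defect E (N t) ^^ n)" for n
  proof (induction n)
    case 0
    show ?case by (auto simp: op_field_def intro: contractionI)
  next
    case (Suc n)
    then show ?case using op_field_comp[OF E Suc D] by (simp add: comp_def)
  qed
  show "contraction E E (proj {x \<in> E. N t x = 0})" for t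
    by (rule contraction_subset[OF proj_contraction[OF kernel_csubspace[OF E contraction_bounded_op[OF Nc]]]]) auto
  show "(\<lambda>t. proj {x \<in> E. N t x = 0} x) \<in> borel_measurable circle_measure" if x: "x \<in> E" for x
  proof (rule borel_measurable_AE_limit)
    show "(\<lambda>t. (defect E (N t) ^^ (2 * n)) x) \<in> borel_measurable circle_measure" for n
      by (rule op_field_const[OF Dn x])
    show "AE t in circle_measure. (\<lambda>n. (defect E (N t) ^^ (2 * n)) x) \<longlonglongrightarrow> proj {x \<in> E. N t x = 0} x"
      using defect_powers_tendsto_kernel_proj[OF E Nc x] by simp
  qed
qed

lemma AE_rep_L2_eq_0: "x = 0 \<longleftrightarrow> (AE t in circle_measure. rep_L2 (x::'a::chilbert L2) t = 0)"
proof
  assume "AE t in circle_measure. rep_L2 x t = 0"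
  with rep_L2_zero[where 'a = 'a] have "AE t in circle_measure. rep_L2 x t = rep_L2 0 t"
    by eventually_elim simp
  then show "x = 0" by (rule L2_eqI)
qed (use rep_L2_zero in simp)

text \<open>For the nontrivial direction, let \<open>Q t\<close> be the projection onto the solutions \<open>(a, b)\<close> in the fibre at
  \<open>t\<close>. Applied to a constant vector it gives a bounded measurable function, to which the condition on
  square-integrable functions applies. So for almost every \<open>t\<close> the operator \<open>D\<^sub>3\<close> annihilates the first
  components of \<open>Q t c\<close> for all \<open>c\<close> in a countable dense set, hence for all \<open>c\<close>.\<close>

lemma trivial_complement_pointwise:
  fixes E1 :: "'a::chilbert set" and E2 :: "'b::chilbert set" and E3 :: "'c::chilbert set" and E4 :: "'d::chilbert set"
  assumes E: "closed_csubspace E1" "closed_csubspace E2" "closed_csubspace E3" "closed_csubspace E4"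
    and S1: "op_field E1 E2 S1" and S2: "op_field E2 E3 S2" and S3: "op_field E3 E4 S3"
  shows "trivial_complement (L2_space E1) (L2_space E2) (L2_space E3) (pointwise_op S1) (pointwise_op S2) (pointwise_op S3)
    \<longleftrightarrow> (AE t in circle_measure. trivial_complement E1 E2 E3 (S1 t) (S2 t) (S3 t))"
proof -
  define A1 where "A1 = (\<lambda>t. adjoint_op E1 (S1 t))"
  define A2 where "A2 = (\<lambda>t. adjoint_op E2 (S2 t))"
  define D3 where "D3 = (\<lambda>t. defect E3 (S3 t))"
  define D1 where "D1 = (\<lambda>t. defect E1 (S1 t))"
  have A1: "op_field E2 E1 A1" unfolding A1_def by (rule op_field_adjoint[OF E(1) S1])
  have A2: "op_field E3 E2 A2" unfolding A2_def by (rule op_field_adjoint[OF E(2) S2])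
  have D3: "op_field E3 E3 D3" unfolding D3_def by (rule op_field_defect[OF E(3) S3 E(4)])
  have D1: "op_field E1 E1 D1" unfolding D1_def by (rule op_field_defect[OF E(1) S1 E(2)])
  define e where "e = (\<lambda>t a b. A1 t (A2 t (D3 t a)) + D1 t b)"
  have tc: "trivial_complement E1 E2 E3 (S1 t) (S2 t) (S3 t) \<longleftrightarrow> (\<forall>a\<in>E3. \<forall>b\<in>E1. e t a b = 0 \<longrightarrow> D3 t a = 0)" for t
    by (simp add: trivial_complement_def e_def A1_def A2_def D3_def D1_def)
  have L: "defect (L2_space E3) (pointwise_op S3) a = 0 \<longleftrightarrow> (AE t in circle_measure. D3 t (rep_L2 a t) = 0)"
    "adjoint_op (L2_space E1) (pointwise_op S1) (adjoint_op (L2_space E2) (pointwise_op S2)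
        (defect (L2_space E3) (pointwise_op S3) a)) + defect (L2_space E1) (pointwise_op S1) b = 0
      \<longleftrightarrow> (AE t in circle_measure. e t (rep_L2 a t) (rep_L2 b t) = 0)"
    if a: "a \<in> L2_space E3" and b: "b \<in> L2_space E1" for a b
  proof -
    have d3: "defect (L2_space E3) (pointwise_op S3) a = pointwise_op D3 a"
      unfolding D3_def by (rule pointwise_op_defect[OF E(3,4) S3 a])
    have d1: "defect (L2_space E1) (pointwise_op S1) b = pointwise_op D1 b"
      unfolding D1_def by (rule pointwise_op_defect[OF E(1,2) S1 b])
    have i3: "pointwise_op D3 a \<in> L2_space E3" by (rule contraction_in[OF pointwise_op_contraction[OF E(3) D3] a])
    have a2: "adjoint_op (L2_space E2) (pointwise_op S2) (pointwise_op D3 a) = pointwise_op A2 (pointwise_op D3 a)"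
      unfolding A2_def by (rule pointwise_op_adjoint[OF E(2) S2 i3 E(3)])
    have i2: "pointwise_op A2 (pointwise_op D3 a) \<in> L2_space E2"
      by (rule contraction_in[OF pointwise_op_contraction[OF E(3) A2] i3])
    have a1: "adjoint_op (L2_space E1) (pointwise_op S1) (pointwise_op A2 (pointwise_op D3 a))
        = pointwise_op A1 (pointwise_op A2 (pointwise_op D3 a))"
      unfolding A1_def by (rule pointwise_op_adjoint[OF E(1) S1 i2 E(2)])
    note r = rep_pointwise_op[OF E(3) D3 a] rep_pointwise_op[OF E(3) A2 i3] rep_pointwise_op[OF E(2) A1 i2]
      rep_pointwise_op[OF E(1) D1 b]
    show "defect (L2_space E3) (pointwise_op S3) a = 0 \<longleftrightarrow> (AE t in circle_measure. D3 t (rep_L2 a t) = 0)"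
      unfolding d3 AE_rep_L2_eq_0 by (rule eventually_subst) (use r(1) in \<open>auto elim: eventually_mono\<close>)
    have "AE t in circle_measure. rep_L2 (pointwise_op A1 (pointwise_op A2 (pointwise_op D3 a)) + pointwise_op D1 b) t
        = e t (rep_L2 a t) (rep_L2 b t)"
      using r rep_L2_plus[of "pointwise_op A1 (pointwise_op A2 (pointwise_op D3 a))" "pointwise_op D1 b"]
      by eventually_elim (simp add: e_def)
    then show "adjoint_op (L2_space E1) (pointwise_op S1) (adjoint_op (L2_space E2) (pointwise_op S2)
        (defect (L2_space E3) (pointwise_op S3) a)) + defect (L2_space E1) (pointwise_op S1) b = 0
      \<longleftrightarrow> (AE t in circle_measure. e t (rep_L2 a t) (rep_L2 b t) = 0)"
      unfolding d3 d1 a2 a1 AE_rep_L2_eq_0 by (intro eventually_subst) (auto elim: eventually_mono)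
  qed
  show ?thesis
  proof
    assume pw: "AE t in circle_measure. trivial_complement E1 E2 E3 (S1 t) (S2 t) (S3 t)"
    show "trivial_complement (L2_space E1) (L2_space E2) (L2_space E3) (pointwise_op S1) (pointwise_op S2) (pointwise_op S3)"
      unfolding trivial_complement_def
    proof (intro ballI impI)
      fix a b assume a: "a \<in> L2_space E3" and b: "b \<in> L2_space E1"
        and 0: "adjoint_op (L2_space E1) (pointwise_op S1) (adjoint_op (L2_space E2) (pointwise_op S2)
          (defect (L2_space E3) (pointwise_op S3) a)) + defect (L2_space E1) (pointwise_op S1) b = 0"
      have "AE t in circle_measure. D3 t (rep_L2 a t) = 0"
        using 0[unfolded L(2)[OF a b]] pw a b unfolding L2_space_iff
      proof eventually_elim
        case (elim t)
        then show ?case unfolding tc by blast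
      qed
      then show "defect (L2_space E3) (pointwise_op S3) a = 0" using L(1)[OF a b] by simp
    qed
  next
    assume K: "trivial_complement (L2_space E1) (L2_space E2) (L2_space E3) (pointwise_op S1) (pointwise_op S2) (pointwise_op S3)"
    \<comment> \<open>The factor makes \<open>N t\<close> a contraction: both summands of \<open>e\<close> are at most \<open>norm p\<close>.\<close>
    define N where "N = (\<lambda>t p. (1/2) *\<^sub>R e t (fst p) (snd p))"
    have E31: "closed_csubspace (E3 \<times> E1)" by (rule csubspace_Times[OF E(3,1)])
    have eA: "op_field E3 E1 (\<lambda>t a. A1 t (A2 t (D3 t a)))"
      by (rule op_field_comp[OF E(2) op_field_comp[OF E(3) D3 A2] A1])
    note ec = op_field_contraction[OF eA] and dc = op_field_contraction[OF D1]
    have N: "op_field (E3 \<times> E1) E1 N"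
      unfolding op_field_def
    proof (intro conjI allI ballI)
      fix t
      show "contraction (E3 \<times> E1) E1 (N t)"
      proof (rule contractionI)
        fix p assume p: "p \<in> E3 \<times> E1"
        then have p': "fst p \<in> E3" "snd p \<in> E1" by auto
        show "N t p \<in> E1" unfolding N_def e_def
          by (intro csubspace_scaleR[OF E(1)] csubspace_add[OF E(1)] contraction_in[OF ec] contraction_in[OF dc] p')
        show "N t (p + q) = N t p + N t q" if "q \<in> E3 \<times> E1" for q
          using p' that unfolding N_def e_def
          by (auto simp: bounded_op_add[OF contraction_bounded_op[OF ec]] bounded_op_add[OF contraction_bounded_op[OF dc]] algebra_simps)
        show "N t (c *\<^sub>C p) = c *\<^sub>C N t p" for c
          using p' unfolding N_def e_def
          by (simp add: scaleC_prod_def bounded_op_scaleC[OF contraction_bounded_op[OF ec]]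
              bounded_op_scaleC[OF contraction_bounded_op[OF dc]] scaleC.scaleR_right scaleC_add_right)
        have "norm (e t (fst p) (snd p)) \<le> norm (fst p) + norm (snd p)"
          unfolding e_def using contraction_norm[OF ec p'(1)] contraction_norm[OF dc p'(2)]
          by (meson add_mono norm_triangle_ineq order_trans)
        also have "\<dots> \<le> norm p + norm p" by (metis add_mono norm_fst_le norm_snd_le prod.collapse)
        finally show "norm (N t p) \<le> norm p" unfolding N_def by simp
      qed
    next
      fix p assume "p \<in> E3 \<times> E1"
      then show "(\<lambda>t. N t p) \<in> borel_measurable circle_measure"
        unfolding N_def e_def using op_field_const[OF eA, of "fst p"] op_field_const[OF D1, of "snd p"]
        by (auto intro!: borel_measurable_scaleR borel_measurable_add)
    qed
    define Q where "Q = (\<lambda>t. proj {p \<in> E3 \<times> E1. N t p = 0})"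
    have Q: "op_field (E3 \<times> E1) (E3 \<times> E1) Q" unfolding Q_def by (rule op_field_kernel_proj[OF E31 N E(1)])
    have ker: "closed_csubspace {p \<in> E3 \<times> E1. N t p = 0}" for t
      by (rule kernel_csubspace[OF E31 contraction_bounded_op[OF op_field_contraction[OF N]]])
    have QN: "N t (Q t p) = 0" for t p
      using contraction_in[OF proj_contraction[OF ker[of t]], of p] by (simp add: Q_def)
    have Q0: "AE t in circle_measure. D3 t (fst (Q t c)) = 0" if c: "c \<in> E3 \<times> E1" for c
    proof -
      have Qi: "Q t c \<in> E3 \<times> E1" for t by (rule contraction_in[OF op_field_contraction[OF Q] c])
      have Qm: "(\<lambda>t. Q t c) \<in> borel_measurable circle_measure" by (rule op_field_const[OF Q c])
      have f: "square_integrable (\<lambda>t. fst (Q t c))"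
      proof (rule square_integrable_const_bound)
        show "(\<lambda>t. fst (Q t c)) \<in> borel_measurable circle_measure"
          by (rule borel_measurable_continuous_on[OF continuous_on_fst[OF continuous_on_id] Qm])
        show "AE t in circle_measure. norm (fst (Q t c)) \<le> norm c"
        proof (rule AE_I2)
          fix t
          have "norm (fst (Q t c)) \<le> norm (Q t c)" by (metis norm_fst_le prod.collapse)
          then show "norm (fst (Q t c)) \<le> norm c"
            using contraction_norm[OF op_field_contraction[OF Q] c] order_trans by blast
        qed
      qed
      have s: "square_integrable (\<lambda>t. snd (Q t c))"
      proof (rule square_integrable_const_bound)
        show "(\<lambda>t. snd (Q t c)) \<in> borel_measurable circle_measure"
          by (rule borel_measurable_continuous_on[OF continuous_on_snd[OF continuous_on_id] Qm])
        show "AE t in circle_measure. norm (snd (Q t c)) \<le> norm c"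
        proof (rule AE_I2)
          fix t
          have "norm (snd (Q t c)) \<le> norm (Q t c)" by (metis norm_snd_le prod.collapse)
          then show "norm (snd (Q t c)) \<le> norm c"
            using contraction_norm[OF op_field_contraction[OF Q] c] order_trans by blast
        qed
      qed
      define a where "a = abs_L2 (\<lambda>t. fst (Q t c))"
      define b where "b = abs_L2 (\<lambda>t. snd (Q t c))"
      have ab: "a \<in> L2_space E3" "b \<in> L2_space E1"
        unfolding a_def b_def using Qi by (auto intro!: abs_L2_in_L2_space f s simp: mem_Times_iff)
      have ra: "AE t in circle_measure. rep_L2 a t = fst (Q t c)" and rb: "AE t in circle_measure. rep_L2 b t = snd (Q t c)"
        unfolding a_def b_def using rep_L2_abs_L2[OF f] rep_L2_abs_L2[OF s] by auto
      have "AE t in circle_measure. e t (rep_L2 a t) (rep_L2 b t) = 0"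
        using ra rb
      proof eventually_elim
        case (elim t)
        then show ?case using QN[of t c] by (simp add: N_def)
      qed
      then have "AE t in circle_measure. D3 t (rep_L2 a t) = 0"
        using K ab L[OF ab] unfolding trivial_complement_def by blast
      then show ?thesis using ra by eventually_elim simp
    qed
    obtain C where C: "countable C" "C \<subseteq> E3 \<times> E1" "E3 \<times> E1 \<subseteq> closure C"
      using countable_dense_subset by blast
    have "AE t in circle_measure. \<forall>c\<in>C. D3 t (fst (Q t c)) = 0"
      unfolding AE_ball_countable[OF C(1)] using Q0 C(2) by blast
    then show "AE t in circle_measure. trivial_complement E1 E2 E3 (S1 t) (S2 t) (S3 t)"
    proof eventually_elim
      case (elim t)
      show ?case unfolding tc
      proof (intro ballI impI)
        fix a b assume ab: "a \<in> E3" "b \<in> E1" and 0: "e t a b = 0"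
        have "(a, b) \<in> closure C" using C(3) ab by blast
        then obtain c where c: "\<forall>n. c n \<in> C" "c \<longlonglongrightarrow> (a, b)"
          unfolding closure_sequential by blast
        have cE: "c n \<in> E3 \<times> E1" for n using c C by blast
        have Qc: "contraction (E3 \<times> E1) (E3 \<times> E1) (Q t)" by (rule op_field_contraction[OF Q])
        have "Q t (a, b) = (a, b)" unfolding Q_def using ab 0 by (intro proj_id[OF ker]) (simp add: N_def)
        moreover have "(\<lambda>n. Q t (c n)) \<longlonglongrightarrow> Q t (a, b)"
          by (rule bounded_op_tendsto[OF E31 contraction_bounded_op[OF Qc] c(2)]) (use cE ab in auto)
        ultimately have "(\<lambda>n. fst (Q t (c n))) \<longlonglongrightarrow> a" using tendsto_fst by fastforce
        then have "(\<lambda>n. D3 t (fst (Q t (c n)))) \<longlonglongrightarrow> D3 t a"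
          by (rule bounded_op_tendsto[OF E(3) contraction_bounded_op[OF op_field_contraction[OF D3]]])
            (use contraction_in[OF Qc cE] ab in \<open>auto simp: mem_Times_iff\<close>)
        then show "D3 t a = 0" using elim c(1) by (simp add: LIMSEQ_const_iff)
      qed
    qed
  qed
qed

section \<open>Lebesgue points\<close>

text \<open>The measure \<open>h(x) dx\<close> gives mass zero to the zero set of \<open>h\<close>, hence arbitrarily small mass to
  some open neighbourhood \<open>U\<close> of it. Zeros at which the means of \<open>h\<close> do not tend to zero have,
  by Vitali's theorem, an almost covering by disjoint balls in \<open>U\<close> on which the mean of \<open>h\<close> is at
  least \<open>e\<close>; so their measure is at most the mass of \<open>U\<close> divided by \<open>e\<close>.\<close>

lemma borel_mean_at_zeros:
  fixes h :: "real \<Rightarrow> real"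
  assumes h [measurable]: "h \<in> borel_measurable borel" and h0: "\<And>x. 0 \<le> h x"
    and fin: "(\<integral>\<^sup>+x. h x \<partial>lborel) < \<infinity>"
  shows "AE t in lebesgue. h t = 0 \<longrightarrow> (\<forall>e>0. \<exists>\<eta>>0. \<forall>d. 0 < d \<and> d < \<eta> \<longrightarrow>
    (\<integral>\<^sup>+s. ennreal (h s) * indicator (ball t d) s \<partial>lborel) \<le> ennreal (e * d))"
proof -
  define \<nu> where "\<nu> = density lborel (\<lambda>x. ennreal (h x))"
  have \<nu>: "emeasure \<nu> A = (\<integral>\<^sup>+s. ennreal (h s) * indicator A s \<partial>lborel)" if "A \<in> sets borel" for A
    unfolding \<nu>_def using that by (subst emeasure_density) auto
  have s\<nu>: "sets \<nu> = sets borel" by (simp add: \<nu>_def)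
  have fin\<nu>: "emeasure \<nu> (space \<nu>) \<noteq> \<infinity>" using \<nu>[of UNIV] fin by (simp add: \<nu>_def)
  define Z where "Z = {t. h t = 0}"
  have Z: "Z \<in> sets borel" unfolding Z_def by measurable
  have \<nu>Z: "emeasure \<nu> Z = 0"
    unfolding \<nu>[OF Z] by (subst nn_integral_0_iff_AE) (auto simp: Z_def indicator_def)
  define S where "S = (\<lambda>e. {t \<in> Z. \<forall>\<eta>>0. \<exists>d. 0 < d \<and> d < \<eta> \<and> emeasure \<nu> (ball t d) > ennreal (e * d)})"
  have neg: "negligible (S e)" if e: "e > 0" for e
    unfolding negligible_outer_le
  proof (intro allI impI)
    fix \<delta> :: real assume \<delta>: "\<delta> > 0"
    have "(INF U\<in>{U. Z \<subseteq> U \<and> open U}. emeasure \<nu> U) = 0"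
      using outer_regular[OF s\<nu> fin\<nu> Z] \<nu>Z by simp
    \<comment> \<open>A ball of radius \<open>d\<close> has length \<open>2 d\<close> and \<open>\<nu>\<close>-measure above \<open>e d\<close>, whence the factor \<open>e / 2\<close>.\<close>
    then have "(INF U\<in>{U. Z \<subseteq> U \<and> open U}. emeasure \<nu> U) < ennreal (e * \<delta> / 2)"
      using e \<delta> by simp
    then have "\<exists>U\<in>{U. Z \<subseteq> U \<and> open U}. emeasure \<nu> U < ennreal (e * \<delta> / 2)" by (simp only: INF_less_iff)
    then obtain U where U: "Z \<subseteq> U" "open U" "emeasure \<nu> U < ennreal (e * \<delta> / 2)" by blast
    define K where "K = {(t, d). t \<in> S e \<and> 0 < d \<and> ennreal (e * d) < emeasure \<nu> (ball t d) \<and> ball t d \<subseteq> U}"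
    have cov: "\<exists>i. i \<in> K \<and> t \<in> ball (fst i) (snd i) \<and> snd i < d" if t: "t \<in> S e" and d: "0 < d" for t d
    proof -
      have "t \<in> U" using t U(1) by (auto simp: S_def)
      then obtain k where k: "k > 0" "ball t k \<subseteq> U" by (rule openE[OF U(2)])
      have "\<forall>\<eta>>0. \<exists>d. 0 < d \<and> d < \<eta> \<and> emeasure \<nu> (ball t d) > ennreal (e * d)"
        using t by (simp add: S_def)
      moreover have "min d k > 0" using k d by simp
      ultimately obtain d' where d': "0 < d'" "d' < min d k" "emeasure \<nu> (ball t d') > ennreal (e * d')"
        by blast
      then have "(t, d') \<in> K" using t k by (auto simp: K_def)
      then show ?thesis using d' by (intro exI[of _ "(t, d')"]) simp
    qed
    obtain C where C: "countable C" "C \<subseteq> K"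
      "pairwise (\<lambda>i j. disjnt (ball (fst i) (snd i)) (ball (fst j) (snd j))) C"
      "negligible (S e - (\<Union>i\<in>C. ball (fst i) (snd i)))"
      by (rule Vitali_covering_theorem_balls[of "S e" K fst snd, OF cov])
    define V where "V = (\<Union>i\<in>C. ball (fst i) (snd i))"
    have CK: "0 < snd i \<and> ennreal (e * snd i) < emeasure \<nu> (ball (fst i) (snd i)) \<and> ball (fst i) (snd i) \<subseteq> U"
      if "i \<in> C" for i
      using subsetD[OF C(2) that] by (cases i) (simp add: K_def)
    then have VU: "V \<subseteq> U" unfolding V_def by blast
    have oV: "open V" unfolding V_def by auto
    have disj: "disjoint_family_on (\<lambda>i. ball (fst i) (snd i)) C"
      using C(3) by (auto simp: disjoint_family_on_def pairwise_def disjnt_def)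
    have "ennreal (e / 2) * emeasure lborel V = ennreal (e / 2) * (\<integral>\<^sup>+i. emeasure lborel (ball (fst i) (snd i)) \<partial>count_space C)"
    proof -
      have "emeasure lborel V = (\<integral>\<^sup>+i. emeasure lborel (ball (fst i) (snd i)) \<partial>count_space C)"
        unfolding V_def by (rule emeasure_UN_countable[OF _ C(1) disj]) simp
      then show ?thesis by simp
    qed
    also have "\<dots> = (\<integral>\<^sup>+i. ennreal (e / 2) * emeasure lborel (ball (fst i) (snd i)) \<partial>count_space C)"
      by (rule nn_integral_cmult[symmetric]) simp
    also have "\<dots> \<le> (\<integral>\<^sup>+i. emeasure \<nu> (ball (fst i) (snd i)) \<partial>count_space C)"
    proof (rule nn_integral_mono)
      fix i assume "i \<in> space (count_space C)"
      then have i: "0 < snd i" "ennreal (e * snd i) < emeasure \<nu> (ball (fst i) (snd i))"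
        using CK[of i] by auto
      have "emeasure lborel (ball (fst i) (snd i)) = ennreal (2 * snd i)"
        using i(1) by (simp add: ball_eq_greaterThanLessThan)
      then show "ennreal (e / 2) * emeasure lborel (ball (fst i) (snd i)) \<le> emeasure \<nu> (ball (fst i) (snd i))"
        using i e by (simp flip: ennreal_mult)
    qed
    also have "\<dots> = emeasure \<nu> V"
      unfolding V_def by (rule emeasure_UN_countable[OF _ C(1) disj, symmetric]) (simp add: s\<nu>)
    also have "\<dots> \<le> emeasure \<nu> U" using VU U(2) by (intro emeasure_mono) (auto simp: s\<nu>)
    also have "\<dots> < ennreal (e * \<delta> / 2)" by (rule U(3))
    also have "\<dots> = ennreal (e / 2) * ennreal \<delta>"
      by (subst ennreal_mult[symmetric]) (use e \<delta> in auto)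
    finally have le: "ennreal (e / 2) * emeasure lborel V < ennreal (e / 2) * ennreal \<delta>" .
    have V\<delta>: "emeasure lborel V \<le> ennreal \<delta>"
    proof (rule ccontr)
      assume "\<not> ?thesis"
      then have "ennreal (e / 2) * ennreal \<delta> \<le> ennreal (e / 2) * emeasure lborel V"
        by (intro mult_left_mono) auto
      then show False using le by (simp add: not_le)
    qed
    have Vf: "V \<in> lmeasurable"
      using V\<delta> oV by (intro fmeasurableI) (auto simp: le_less_trans[OF _ ennreal_less_top])
    let ?T = "V \<union> (S e - V)"
    have T: "?T \<in> lmeasurable" "measure lebesgue ?T = measure lebesgue V"
    proof -
      have n: "S e - V \<in> null_sets lebesgue" using C(4) by (simp add: V_def negligible_iff_null_sets)
      show "?T \<in> lmeasurable"
        by (rule fmeasurable.Un[OF Vf negligible_imp_measurable]) (use n in \<open>simp add: negligible_iff_null_sets\<close>)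
      show "measure lebesgue ?T = measure lebesgue V"
        by (rule measure_Un_null_set[OF _ n]) (use Vf in \<open>simp add: fmeasurableD\<close>)
    qed
    have "measure lebesgue V \<le> \<delta>"
      using V\<delta> oV \<delta> by (simp add: measure_def enn2real_leI)
    then show "\<exists>T. S e \<subseteq> T \<and> T \<in> lmeasurable \<and> measure lebesgue T \<le> \<delta>"
      using T by (intro exI[of _ ?T]) auto
  qed
  have "AE t in lebesgue. \<forall>n. t \<notin> S (inverse (real (Suc n)))"
    unfolding AE_all_countable using neg by (auto intro!: AE_not_in simp flip: negligible_iff_null_sets)
  then show ?thesis
  proof eventually_elim
    case (elim t)
    show ?case
    proof (intro impI allI)
      fix e :: real assume t: "h t = 0" and e: "e > 0"
      obtain n where n: "inverse (real (Suc n)) < e" using reals_Archimedean[OF e] by blast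
      have "t \<notin> S (inverse (real (Suc n)))" using elim by blast
      then have "\<not> (\<forall>\<eta>>0. \<exists>d. 0 < d \<and> d < \<eta> \<and> emeasure \<nu> (ball t d) > ennreal (inverse (real (Suc n)) * d))"
        using t by (simp add: S_def Z_def)
      then obtain \<eta> where \<eta>: "\<eta> > 0" "\<not> (\<exists>d. 0 < d \<and> d < \<eta> \<and> emeasure \<nu> (ball t d) > ennreal (inverse (real (Suc n)) * d))"
        unfolding not_all not_imp by (elim exE conjE)
      show "\<exists>\<eta>>0. \<forall>d. 0 < d \<and> d < \<eta> \<longrightarrow> (\<integral>\<^sup>+s. ennreal (h s) * indicator (ball t d) s \<partial>lborel) \<le> ennreal (e * d)"
      proof (intro exI[of _ \<eta>] conjI allI impI)
        fix d assume d: "0 < d \<and> d < \<eta>"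
        have "emeasure \<nu> (ball t d) \<le> ennreal (inverse (real (Suc n)) * d)" 
          using \<eta>(2) d by (intro leI notI) (elim notE, intro exI conjI, auto)
        also have "\<dots> \<le> ennreal (e * d)" using n d by (intro ennreal_leI mult_right_mono) auto
        finally show "(\<integral>\<^sup>+s. ennreal (h s) * indicator (ball t d) s \<partial>lborel) \<le> ennreal (e * d)" by (simp add: \<nu>)
      qed (rule \<eta>(1))
    qed
  qed
qed

lemma mean_at_zeros:
  fixes h :: "real \<Rightarrow> real"
  assumes h: "h \<in> borel_measurable circle_measure" and h0: "\<And>x. 0 \<le> h x" and int: "integrable circle_measure h"
  shows "AE t in circle_measure. h t = 0 \<longrightarrow> (\<forall>e>0. \<exists>\<eta>>0. \<forall>d. 0 < d \<and> d < \<eta> \<longrightarrow>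
    (\<integral>\<^sup>+s. ennreal (h s) * indicator (ball t d) s \<partial>circle_measure) \<le> ennreal (e * d))"
proof -
  define H where "H = (\<lambda>s. indicator {0..2*pi} s * h s)"
  have HL: "H \<in> borel_measurable lebesgue"
    unfolding H_def using h by (simp add: borel_measurable_restrict_space_iff)
  obtain H' where H': "H' \<in> borel_measurable lborel" "AE x in lborel. H x = H' x"
    using completion_ex_borel_measurable_real[OF HL] by blast
  define H2 where "H2 = (\<lambda>s. max 0 (H' s))"
  have [measurable]: "H' \<in> borel_measurable borel" using H'(1) by (simp only: measurable_lborel2)
  have H2: "H2 \<in> borel_measurable borel" unfolding H2_def by measurable
  have eq: "AE s in lebesgue. H s = H2 s"
    using H'(2) unfolding AE_completion_iff
  proof eventually_elim
    case (elim s)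
    moreover have "0 \<le> H s" using h0 by (simp add: H_def)
    ultimately show ?case by (simp add: H2_def)
  qed
  have H20: "0 \<le> H2 x" for x by (simp add: H2_def)
  have tr: "(\<integral>\<^sup>+s. ennreal (h s) * indicator A s \<partial>circle_measure) = (\<integral>\<^sup>+s. ennreal (H2 s) * indicator A s \<partial>lborel)" for A
  proof -
    have "(\<integral>\<^sup>+s. ennreal (h s) * indicator A s \<partial>circle_measure) = (\<integral>\<^sup>+s. ennreal (h s) * indicator A s * indicator {0..2*pi} s \<partial>lebesgue)"
      by (rule nn_integral_restrict_space) simp
    also have "\<dots> = (\<integral>\<^sup>+s. ennreal (H2 s) * indicator A s \<partial>lebesgue)"
    proof (rule nn_integral_cong_AE)
      show "AE s in lebesgue. ennreal (h s) * indicator A s * indicator {0..2*pi} s = ennreal (H2 s) * indicator A s"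
        using eq by eventually_elim (auto simp: H_def indicator_def split: if_splits)
    qed
    finally show ?thesis by (simp add: nn_integral_completion)
  qed
  have "(\<integral>\<^sup>+s. ennreal (H2 s) \<partial>lborel) = (\<integral>\<^sup>+s. ennreal (h s) \<partial>circle_measure)"
    using tr[of UNIV] by simp
  also have "\<dots> < \<infinity>" using int h0 by (simp add: integrable_iff_bounded)
  finally have fin: "(\<integral>\<^sup>+s. ennreal (H2 s) \<partial>lborel) < \<infinity>" .
  have "AE t in lebesgue. t \<in> {0..2*pi} \<longrightarrow> h t = 0 \<longrightarrow> (\<forall>e>0. \<exists>\<eta>>0. \<forall>d. 0 < d \<and> d < \<eta> \<longrightarrow>
    (\<integral>\<^sup>+s. ennreal (h s) * indicator (ball t d) s \<partial>circle_measure) \<le> ennreal (e * d))"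
    using borel_mean_at_zeros[OF H2 H20 fin] eq unfolding tr
  proof eventually_elim
    case (elim t)
    show ?case
    proof (intro impI)
      assume "t \<in> {0..2*pi}" "h t = 0"
      then have "H2 t = 0" using elim(2) by (simp add: H_def)
      then show "\<forall>e>0. \<exists>\<eta>>0. \<forall>d. 0 < d \<and> d < \<eta> \<longrightarrow>
          (\<integral>\<^sup>+s. ennreal (H2 s) * indicator (ball t d) s \<partial>lborel) \<le> ennreal (e * d)"
        using elim(1) by blast
    qed
  qed
  then show ?thesis by (subst AE_restrict_space_iff) auto
qed

text \<open>Lebesgue points of a vector-valued function: apply the preceding lemma to the functions
  \<open>s \<mapsto> norm (g s - q)\<close>, cut off below \<open>1 / (n + 1)\<close>, for \<open>q\<close> in a countable dense set.\<close>

lemma AE_Lebesgue_point: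
  fixes g :: "real \<Rightarrow> 'a::chilbert"
  assumes g: "square_integrable g"
  shows "AE t in circle_measure. \<forall>e>0. \<exists>\<eta>>0. \<forall>d. 0 < d \<and> d < \<eta> \<longrightarrow>
    (\<integral>\<^sup>+s. ennreal (norm (g s - g t)) * indicator (ball t d) s \<partial>circle_measure) \<le> ennreal (e * d)"
proof -
  interpret finite_measure circle_measure by (rule finite_circle_measure)
  have gm [measurable]: "g \<in> borel_measurable circle_measure" by (rule square_integrable_measurable[OF g])
  obtain D :: "'a set" where D: "countable D" "\<And>X. open X \<Longrightarrow> X \<noteq> {} \<Longrightarrow> \<exists>d\<in>D. d \<in> X"
    using countable_dense_exists by blast
  define h where "h = (\<lambda>q n s. if norm (g s - q) < inverse (real (Suc n)) then 0 else norm (g s - q))"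
  have hm: "h q n \<in> borel_measurable circle_measure" for q n unfolding h_def by measurable
  have h0: "0 \<le> h q n s" for q n s by (simp add: h_def)
  have hi: "integrable circle_measure (h q n)" for q n
  proof (rule Bochner_Integration.integrable_bound)
    show "integrable circle_measure (\<lambda>s. norm (g s) + norm q)"
      using square_integrable_imp_integrable_norm[OF g] by simp
    show "AE s in circle_measure. norm (h q n s) \<le> norm (norm (g s) + norm q)"
      by (intro AE_I2) (simp add: h_def norm_triangle_ineq4 add_nonneg_nonneg)
  qed (rule hm)
  have "AE t in circle_measure. \<forall>q\<in>D. \<forall>n. h q n t = 0 \<longrightarrow> (\<forall>e>0. \<exists>\<eta>>0. \<forall>d. 0 < d \<and> d < \<eta> \<longrightarrow>
    (\<integral>\<^sup>+s. ennreal (h q n s) * indicator (ball t d) s \<partial>circle_measure) \<le> ennreal (e * d))"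
    unfolding AE_ball_countable[OF D(1)] AE_all_countable using mean_at_zeros[OF hm h0 hi] by blast
  then show ?thesis
  proof eventually_elim
    case (elim t)
    show ?case
    proof (intro allI impI)
      fix e :: real assume e: "e > 0"
      then obtain n where n: "inverse (real (Suc n)) < e / 8" using reals_Archimedean[of "e/8"] by auto
      \<comment> \<open>Then the cut-off function \<open>h q n\<close> vanishes at \<open>t\<close>, and replacing \<open>g t\<close> by \<open>q\<close> costs at most \<open>e / 4\<close>.\<close>
      obtain q where q: "q \<in> D" "q \<in> ball (g t) (inverse (real (Suc n)))"
        using D(2)[of "ball (g t) (inverse (real (Suc n)))"] by auto
      have qt: "norm (g t - q) < inverse (real (Suc n))" using q(2) by (simp add: dist_norm)
      then have "h q n t = 0" by (simp add: h_def)
      then obtain \<eta> where \<eta>: "\<eta> > 0" "\<And>d. 0 < d \<Longrightarrow> d < \<eta> \<Longrightarrow>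
          (\<integral>\<^sup>+s. ennreal (h q n s) * indicator (ball t d) s \<partial>circle_measure) \<le> ennreal (e / 2 * d)"
        using elim q(1) e by (metis half_gt_zero)
      have le: "norm (g s - g t) \<le> h q n s + e / 4" for s
      proof -
        have "norm (g s - g t) \<le> norm (g s - q) + norm (g t - q)"
          using norm_triangle_ineq4[of "g s - q" "g t - q"] by simp
        moreover have "norm (g s - q) \<le> h q n s + inverse (real (Suc n))" by (auto simp: h_def)
        ultimately show ?thesis using n qt by linarith
      qed
      show "\<exists>\<eta>>0. \<forall>d. 0 < d \<and> d < \<eta> \<longrightarrow>
          (\<integral>\<^sup>+s. ennreal (norm (g s - g t)) * indicator (ball t d) s \<partial>circle_measure) \<le> ennreal (e * d)"
      proof (intro exI[of _ \<eta>] conjI allI impI)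
        fix d assume d: "0 < d \<and> d < \<eta>"
        have b: "ball t d \<in> sets lebesgue" by simp
        have bm [measurable]: "(\<lambda>s. indicator (ball t d) s :: ennreal) \<in> borel_measurable circle_measure"
          by (intro measurable_restrict_space1 borel_measurable_indicator b)
        have "(\<integral>\<^sup>+s. ennreal (norm (g s - g t)) * indicator (ball t d) s \<partial>circle_measure)
            \<le> (\<integral>\<^sup>+s. ennreal (h q n s) * indicator (ball t d) s + ennreal (e / 4) * indicator (ball t d) s \<partial>circle_measure)"
          using le h0 e by (intro nn_integral_mono)
            (auto simp: distrib_right[symmetric] ennreal_plus[symmetric] simp del: ennreal_plus intro!: mult_right_mono ennreal_leI)
        also have "\<dots> = (\<integral>\<^sup>+s. ennreal (h q n s) * indicator (ball t d) s \<partial>circle_measure)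
            + (\<integral>\<^sup>+s. ennreal (e / 4) * indicator (ball t d) s \<partial>circle_measure)"
          by (rule nn_integral_add)
            (auto intro!: borel_measurable_times_ennreal bm measurable_compose[OF hm measurable_ennreal])
        also have "(\<integral>\<^sup>+s. ennreal (e / 4) * indicator (ball t d) s \<partial>circle_measure) \<le> ennreal (e / 2 * d)"
        proof -
          have "(\<integral>\<^sup>+s. ennreal (e / 4) * indicator (ball t d) s \<partial>circle_measure)
              = (\<integral>\<^sup>+s. ennreal (e / 4) * indicator (ball t d) s * indicator {0..2*pi} s \<partial>lebesgue)"
            by (rule nn_integral_restrict_space) simp
          also have "\<dots> \<le> (\<integral>\<^sup>+s. ennreal (e / 4) * indicator (ball t d) s \<partial>lebesgue)"
            by (intro nn_integral_mono) (simp add: indicator_def)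
          also have "\<dots> = ennreal (e / 4) * emeasure lborel (ball t d)"
            using b by (simp add: nn_integral_cmult_indicator)
          also have "\<dots> = ennreal (e / 2 * d)"
            using d e by (simp add: ball_eq_greaterThanLessThan flip: ennreal_mult)
          finally show ?thesis .
        qed
        also have "(\<integral>\<^sup>+s. ennreal (h q n s) * indicator (ball t d) s \<partial>circle_measure) + ennreal (e / 2 * d)
            \<le> ennreal (e / 2 * d) + ennreal (e / 2 * d)"
          using \<eta>(2) d by (intro add_right_mono) auto
        also have "\<dots> = ennreal (e * d)" using d e by (simp flip: ennreal_plus)
        finally show "(\<integral>\<^sup>+s. ennreal (norm (g s - g t)) * indicator (ball t d) s \<partial>circle_measure) \<le> ennreal (e * d)"
          by (simp add: add_left_mono)
      qed (rule \<eta>(1))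
    qed
  qed
qed

section \<open>The Poisson kernel\<close>

definition poisson :: "real \<Rightarrow> real \<Rightarrow> real" where
  "poisson r u = (1 - r\<^sup>2) / (1 - 2 * r * cos u + r\<^sup>2)"

lemma poisson_denominator: "1 - 2 * r * cos (u::real) + r\<^sup>2 = (1 - r)\<^sup>2 + 4 * r * (sin (u / 2))\<^sup>2"
proof -
  have c: "cos u = 1 - 2 * (sin (u / 2))\<^sup>2" using cos_double_sin[of "u / 2"] by simp
  show ?thesis unfolding c by (simp add: power2_eq_square algebra_simps)
qed

lemma poisson_denominator_pos:
  assumes "0 \<le> r" "r < 1" shows "0 < 1 - 2 * r * cos (u::real) + r\<^sup>2"
  unfolding poisson_denominator using assms by (intro add_pos_nonneg) auto

lemma poisson_nonneg: "0 \<le> r \<Longrightarrow> r < 1 \<Longrightarrow> 0 \<le> poisson r u"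
  unfolding poisson_def using poisson_denominator_pos[of r u]
  by (intro divide_nonneg_pos) (simp_all add: power_le_one)

text \<open>The numerator \<open>1 - r\<^sup>2\<close> is at most \<open>2 (1 - r)\<close>.\<close>

lemma poisson_le:
  assumes r: "0 \<le> r" "r < 1" and c: "0 < c" "c \<le> (1 - r)\<^sup>2 + 4 * r * (sin (u / 2))\<^sup>2"
  shows "poisson r u \<le> 2 * (1 - r) / c"
proof -
  have "1 - r\<^sup>2 = (1 - r) * (1 + r)" by (simp add: power2_eq_square algebra_simps)
  also have "\<dots> \<le> (1 - r) * 2" using r by (intro mult_left_mono) auto
  finally have "1 - r\<^sup>2 \<le> 2 * (1 - r)" by simp
  then show ?thesis unfolding poisson_def poisson_denominator using r c by (intro frac_le) auto
qed

lemma poisson_bounded: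
  assumes "0 \<le> r" "r < 1" shows "poisson r u \<le> 2 / (1 - r)"
proof -
  have "poisson r u \<le> 2 * (1 - r) / (1 - r)\<^sup>2" using assms by (intro poisson_le) auto
  also have "\<dots> = 2 / (1 - r)" using assms by (simp add: power2_eq_square divide_simps)
  finally show ?thesis .
qed

lemma continuous_poisson: "0 \<le> r \<Longrightarrow> r < 1 \<Longrightarrow> continuous_on S (\<lambda>s. poisson r (t - s))"
  unfolding poisson_def using poisson_denominator_pos[of r]
  by (intro continuous_intros) (auto simp: less_imp_neq[THEN not_sym])

lemma sin_ge_half:
  fixes x :: real
  assumes "0 \<le> x" "x \<le> 1" shows "x / 2 \<le> sin x"
proof (cases "x = 0")
  case False
  then have x: "0 < x" using assms by simp
  obtain z where z: "0 < z" "z < x" "sin x - sin 0 = (x - 0) * cos z"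
    using MVT2[OF x, of sin cos] by (auto intro: DERIV_sin)
  \<comment> \<open>\<open>z < 1 < \<pi> / 3\<close>\<close>
  have "cos (pi / 3) \<le> cos z" using z assms pi_gt3 by (intro cos_monotone_0_pi_le) auto
  then have "x * (1/2) \<le> x * cos z" using x by (intro mult_left_mono) (auto simp: cos_60)
  then show ?thesis using z by simp
qed simp

lemma poisson_near:
  assumes r: "1/2 \<le> r" "r < 1" and u: "u \<noteq> 0" "\<bar>u\<bar> \<le> 1"
  shows "poisson r u \<le> 16 * (1 - r) / u\<^sup>2"
proof -
  have "\<bar>u\<bar> / 4 \<le> sin (\<bar>u\<bar> / 2)" using sin_ge_half[of "\<bar>u\<bar> / 2"] u by simp
  then have "(\<bar>u\<bar> / 4)\<^sup>2 \<le> (sin (\<bar>u\<bar> / 2))\<^sup>2" by (intro power_mono) auto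
  also have "(sin (\<bar>u\<bar> / 2))\<^sup>2 = (sin (u / 2))\<^sup>2" by (auto simp: abs_if)
  finally have "u\<^sup>2 / 16 \<le> (sin (u / 2))\<^sup>2" by (simp add: power_divide)
  then have "2 * (u\<^sup>2 / 16) \<le> 4 * r * (sin (u / 2))\<^sup>2" using r by (intro mult_mono) auto
  then have "u\<^sup>2 / 8 \<le> (1 - r)\<^sup>2 + 4 * r * (sin (u / 2))\<^sup>2" by (simp add: add_increasing)
  then show ?thesis using poisson_le[of r "u\<^sup>2 / 8" u] r u by simp
qed

lemma ennreal_le_suminf: "f k \<le> (\<Sum>k. f k)" for f :: "nat \<Rightarrow> ennreal"
  using sum_le_suminf[OF summableI, of "{k}" f] by simp

text \<open>Near its peak the kernel is dominated by a sum of multiples of indicator functions of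
  intervals, whose lengths double while their heights go down by the factor four.\<close>

lemma poisson_dyadic:
  assumes r: "1/2 \<le> r" "r < 1" and u: "\<bar>u\<bar> \<le> 1"
  shows "ennreal (poisson r u) \<le> (\<Sum>k. ennreal (64 * (1/4)^k / (1 - r)) * indicator {-(2^k * (1 - r))<..<2^k * (1 - r)} u)"
proof -
  let ?f = "\<lambda>k. ennreal (64 * (1/4)^k / (1 - r)) * indicator {-(2^k * (1 - r))<..<2^k * (1 - r)} u"
  define \<delta> where "\<delta> = 1 - r"
  have \<delta>: "\<delta> > 0" using r by (simp add: \<delta>_def)
  have "\<exists>k. \<bar>u\<bar> < 2^k * \<delta> \<and> poisson r u \<le> 64 * (1/4)^k / \<delta>"
  proof (cases "\<bar>u\<bar> < \<delta>")
    case True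
    have "poisson r u \<le> 2 / \<delta>" using poisson_bounded r by (simp add: \<delta>_def)
    also have "\<dots> \<le> 64 / \<delta>" using \<delta> by (simp add: divide_right_mono)
    finally show ?thesis using True by (intro exI[of _ 0]) simp
  next
    case False
    \<comment> \<open>For the least \<open>k\<close> with \<open>\<bar>u\<bar> < 2\<^sup>k \<delta>\<close> also \<open>2\<^sup>k\<^sup>-\<^sup>1 \<delta> \<le> \<bar>u\<bar>\<close>, so that \<open>16 \<delta> / u\<^sup>2 \<le> 64 / (4\<^sup>k \<delta>)\<close>.\<close>
    obtain m where m: "\<bar>u\<bar> / \<delta> < 2 ^ m" using real_arch_pow[of 2 "\<bar>u\<bar> / \<delta>"] by auto
    define k where "k = (LEAST k. \<bar>u\<bar> < 2^k * \<delta>)"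
    have k: "\<bar>u\<bar> < 2^k * \<delta>" unfolding k_def
      by (rule LeastI[of _ m]) (use m \<delta> in \<open>simp add: pos_divide_less_eq\<close>)
    have "k \<noteq> 0" using k False by (cases "k = 0") auto
    then obtain j where j: "k = Suc j" by (cases k) auto
    have "\<not> \<bar>u\<bar> < 2^j * \<delta>" using not_less_Least[of j "\<lambda>k. \<bar>u\<bar> < 2^k * \<delta>"] j by (simp add: k_def)
    then have "(2^j * \<delta>)\<^sup>2 \<le> \<bar>u\<bar>\<^sup>2" using \<delta> by (intro power_mono) auto
    moreover have "(2^j)\<^sup>2 = (4::real)^j" by (simp add: power2_eq_square flip: power_mult_distrib)
    ultimately have ju: "4^j * \<delta>\<^sup>2 \<le> u\<^sup>2" by (simp only: power_mult_distrib power2_abs)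
    have u0: "u \<noteq> 0" using False \<delta> by auto
    have "poisson r u \<le> 16 * \<delta> / u\<^sup>2" unfolding \<delta>_def by (rule poisson_near[OF r u0 u])
    also have "\<dots> \<le> 16 * \<delta> / (4^j * \<delta>\<^sup>2)" using \<delta> ju u0 by (intro divide_left_mono) auto
    also have "\<dots> = 64 * (1/4)^k / \<delta>" using \<delta> by (simp add: j power2_eq_square power_one_over field_simps)
    finally show ?thesis using k by blast
  qed
  then obtain k where k: "\<bar>u\<bar> < 2^k * \<delta>" "poisson r u \<le> 64 * (1/4)^k / \<delta>" by blast
  have "ennreal (poisson r u) \<le> ?f k"
    using k by (auto simp: \<delta>_def abs_less_iff intro!: ennreal_leI)
  also have "\<dots> \<le> (\<Sum>k. ?f k)" by (rule ennreal_le_suminf)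
  finally show ?thesis .
qed

lemma integral_cis:
  "integral\<^sup>L circle_measure (\<lambda>s. cis (of_int m * s)) = (if m = 0 then 2 * pi else 0)"
proof (cases "m = 0")
  case True
  then show ?thesis by (simp add: measure_restrict_space scaleR_conv_of_real)
next
  case False
  define c where "c = \<i> * of_int m"
  have c: "c \<noteq> 0" using False by (simp add: c_def)
  have e: "cis (of_int m * s) = exp (c * of_real s)" for s
    by (simp add: cis_conv_exp c_def algebra_simps)
  have "((\<lambda>s. exp (c * of_real s)) has_integral (exp (c * of_real (2*pi)) / c - exp (c * of_real 0) / c)) {0..2*pi}"
  proof (rule fundamental_theorem_of_calculus)
    fix s :: real
    show "((\<lambda>s. exp (c * of_real s) / c) has_vector_derivative exp (c * of_real s)) (at s within {0..2*pi})"
      by (rule has_vector_derivative_real_field) (use c in \<open>auto intro!: derivative_eq_intros\<close>)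
  qed simp
  moreover have "cis (of_int m * (2*pi)) = 1" by (subst mult.commute) (rule cis_multiple_2pi, simp)
  then have "exp (c * of_real (2*pi)) = 1" unfolding e .
  ultimately have "integral {0..2*pi} (\<lambda>s. exp (c * of_real s)) = 0" by (simp add: integral_unique)
  moreover have "integrable circle_measure (\<lambda>s. exp (c * of_real s))"
    by (intro continuous_imp_integrable_real continuous_intros)
  ultimately have "integral\<^sup>L circle_measure (\<lambda>s. exp (c * of_real s)) = 0"
    by (subst lebesgue_integral_eq_integral) auto
  then show ?thesis using False by (simp add: e)
qed

lemma poisson_sums:
  assumes r: "0 \<le> r" "r < 1"
  shows "(\<lambda>k. of_real (r^k) * cis (real k * u) + of_real (r^Suc k) * cis (- real (Suc k) * u)) sums of_real (poisson r u)"
proof -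
  define z where "z = of_real r * cis u"
  define w where "w = of_real r * cis (- u)"
  have n: "norm z < 1" "norm w < 1" using r by (auto simp: z_def w_def norm_mult)
  then have 1: "1 - z \<noteq> 0" "1 - w \<noteq> 0" by auto
  have "(\<lambda>k. z^k + w * w^k) sums (1 / (1 - z) + w * (1 / (1 - w)))"
    by (intro sums_add sums_mult geometric_sums n)
  moreover have "z^k = of_real (r^k) * cis (real k * u)" for k
    by (simp only: z_def power_mult_distrib Complex.DeMoivre of_real_power)
  moreover have "w * w^k = of_real (r^Suc k) * cis (- real (Suc k) * u)" for k
  proof -
    have "w * w^k = w^Suc k" by simp
    also have "\<dots> = of_real (r^Suc k) * cis (real (Suc k) * (- u))"
      by (simp only: w_def power_mult_distrib Complex.DeMoivre of_real_power)
    finally show ?thesis by (simp only: mult_minus_left mult_minus_right)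
  qed
  moreover have "1 / (1 - z) + w * (1 / (1 - w)) = of_real (poisson r u)"
  proof -
    have zw: "z * w = of_real (r\<^sup>2)" by (simp add: z_def w_def power2_eq_square cis_mult)
    have "(1 - z) * (1 - w) = 1 - (z + w) + z * w" by (simp add: algebra_simps)
    also have "z + w = of_real (2 * r * cos u)" by (simp add: z_def w_def complex_eq_iff)
    finally have d: "(1 - z) * (1 - w) = of_real (1 - 2 * r * cos u + r\<^sup>2)" using zw by simp
    have "1 / (1 - z) + w * (1 / (1 - w)) = (1 - z * w) / ((1 - z) * (1 - w))"
      using 1 by (simp add: field_simps)
    then show ?thesis unfolding d zw poisson_def by simp
  qed
  ultimately show ?thesis by simp
qed

text \<open>Integrate the expansion of the kernel term by term; only the \<open>n\<close>-th term survives.\<close>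

lemma poisson_fourier:
  assumes r: "0 \<le> r" "r < 1"
  shows "integral\<^sup>L circle_measure (\<lambda>s. of_real (poisson r (t - s)) * cis (real n * s)) = 2 * pi * (of_real (r^n) * cis (real n * t))"
proof -
  define a where "a = (\<lambda>k s. (of_real (r^k) * cis (real k * (t - s)) + of_real (r^Suc k) * cis (- real (Suc k) * (t - s))) * cis (real n * s))"
  have a_eq: "a k s = of_real (r^k) * cis (real k * t) * cis (of_int (int n - int k) * s)
      + of_real (r^Suc k) * cis (- real (Suc k) * t) * cis (of_int (int n + int (Suc k)) * s)" for k s
    unfolding a_def by (simp add: cis_mult algebra_simps)
  have cint: "integrable circle_measure (\<lambda>s. cis (of_int m * s))" for m
    by (intro continuous_imp_integrable_real continuous_intros)
  have int: "integrable circle_measure (a k)" for k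
    unfolding a_eq by (intro Bochner_Integration.integrable_add integrable_mult_right cint)
  have ia: "integral\<^sup>L circle_measure (a k) = (if k = n then 2 * pi * (of_real (r^n) * cis (real n * t)) else 0)" for k
  proof -
    have "integral\<^sup>L circle_measure (a k)
        = of_real (r^k) * cis (real k * t) * integral\<^sup>L circle_measure (\<lambda>s. cis (of_int (int n - int k) * s))
        + of_real (r^Suc k) * cis (- real (Suc k) * t) * integral\<^sup>L circle_measure (\<lambda>s. cis (of_int (int n + int (Suc k)) * s))"
      unfolding a_eq by (subst Bochner_Integration.integral_add)
        (intro integrable_mult_right cint, intro integrable_mult_right cint, simp only: integral_mult_right_zero)
    then show ?thesis unfolding integral_cis by auto
  qed
  have na: "norm (a k s) \<le> 2 * r^k" for k s
  proof -
    have "norm (a k s) \<le> r^k + r^Suc k"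
      unfolding a_def norm_mult norm_cis mult_1_right
      by (rule order_trans[OF norm_triangle_ineq]) (use r in \<open>simp add: norm_mult norm_power\<close>)
    also have "r^Suc k \<le> r^k" using r by (simp add: mult_left_le_one_le)
    finally show ?thesis by simp
  qed
  have s: "summable (\<lambda>k. 2 * r^k)" using r by (intro summable_mult summable_geometric) simp
  have sm: "summable (\<lambda>k. norm (a k s))" for s
    by (rule summable_comparison_test'[OF s, of 0]) (use na in simp)
  have "summable (\<lambda>k. integral\<^sup>L circle_measure (\<lambda>s. norm (a k s)))"
  proof (rule summable_comparison_test'[OF summable_mult[OF s, of "2*pi"], of 0])
    fix k
    interpret finite_measure circle_measure by (rule finite_circle_measure)
    have "integral\<^sup>L circle_measure (\<lambda>s. norm (a k s)) \<le> integral\<^sup>L circle_measure (\<lambda>s. 2 * r^k)"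
      using na int by (intro integral_mono integrable_norm) auto
    then show "norm (integral\<^sup>L circle_measure (\<lambda>s. norm (a k s))) \<le> 2 * pi * (2 * r^k)"
      unfolding integral_circle_const by simp
  qed
  from sums_integral[OF int _ this] sm
  have "(\<lambda>k. integral\<^sup>L circle_measure (a k)) sums integral\<^sup>L circle_measure (\<lambda>s. \<Sum>k. a k s)" by simp
  moreover have "(\<Sum>k. a k s) = of_real (poisson r (t - s)) * cis (real n * s)" for s
    unfolding a_def by (intro sums_unique[symmetric] sums_mult2 poisson_sums r)
  moreover have "(\<lambda>k. integral\<^sup>L circle_measure (a k)) sums (2 * pi * (of_real (r^n) * cis (real n * t)))"
    unfolding ia using sums_single[of n "\<lambda>_. 2 * pi * (of_real (r^n) * cis (real n * t))"] by simp
  ultimately show ?thesis using sums_unique2 by fastforce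
qed

section \<open>Radial limits of vector-valued power series\<close>

lemma borel_measurable_circle_continuous:
  fixes f :: "real \<Rightarrow> 'a::topological_space"
  assumes "continuous_on UNIV f" shows "f \<in> borel_measurable circle_measure"
proof -
  have "f \<in> borel_measurable lborel" using borel_measurable_continuous_onI[OF assms] by simp
  then show ?thesis by (intro measurable_restrict_space1 measurable_completion)
qed

text \<open>\<open>norm u \<le> d / 2 + (norm u)\<^sup>2 / (2 d)\<close> is used with \<open>d\<close> slightly larger than the \<open>L\<^sup>2\<close> norm, which may
  be zero.\<close>

lemma L2_null_imp_L1_null:
  fixes u :: "nat \<Rightarrow> real \<Rightarrow> 'a::chilbert"
  assumes u: "\<And>n. square_integrable (u n)"
    and lim: "(\<lambda>n. integral\<^sup>L circle_measure (\<lambda>t. (norm (u n t))\<^sup>2)) \<longlonglongrightarrow> 0"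
  shows "(\<lambda>n. integral\<^sup>L circle_measure (\<lambda>t. norm (u n t))) \<longlonglongrightarrow> 0"
proof -
  interpret finite_measure circle_measure by (rule finite_circle_measure)
  define I where "I = (\<lambda>n. integral\<^sup>L circle_measure (\<lambda>t. (norm (u n t))\<^sup>2))"
  have I0: "0 \<le> I n" for n unfolding I_def by simp
  define d where "d = (\<lambda>n. sqrt (I n) + inverse (real (Suc n)))"
  have d: "d n > 0" for n using I0[of n] by (simp add: d_def add_nonneg_pos)
  have "(\<lambda>n. pi * d n + sqrt (I n) / 2) \<longlonglongrightarrow> pi * (sqrt 0 + 0) + sqrt 0 / 2"
    unfolding d_def using lim LIMSEQ_inverse_real_of_nat unfolding I_def[symmetric]
    by (intro tendsto_intros) auto
  then have *: "(\<lambda>n. pi * d n + sqrt (I n) / 2) \<longlonglongrightarrow> 0" by simp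
  have le: "integral\<^sup>L circle_measure (\<lambda>t. norm (u n t)) \<le> pi * d n + sqrt (I n) / 2" for n
  proof -
    have "norm (u n t) \<le> d n / 2 + (norm (u n t))\<^sup>2 / (2 * d n)" for t
    proof -
      have "2 * (d n * norm (u n t)) \<le> (d n)\<^sup>2 + (norm (u n t))\<^sup>2" by (rule two_mult_le_squares)
      then show ?thesis using d[of n] by (simp add: field_simps power2_eq_square)
    qed
    then have "integral\<^sup>L circle_measure (\<lambda>t. norm (u n t))
        \<le> integral\<^sup>L circle_measure (\<lambda>t. d n / 2 + (norm (u n t))\<^sup>2 / (2 * d n))"
      using square_integrable_imp_integrable_norm[OF u] square_integrable_integrable[OF u]
      by (intro integral_mono) auto
    also have "\<dots> = integral\<^sup>L circle_measure (\<lambda>t. d n / 2) + integral\<^sup>L circle_measure (\<lambda>t. (norm (u n t))\<^sup>2 / (2 * d n))"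
      using square_integrable_integrable[OF u] by (intro Bochner_Integration.integral_add) auto
    also have "\<dots> = pi * d n + I n / (2 * d n)" by (simp add: integral_circle_const I_def del: lebesgue_integral_const)
    also have "I n / (2 * d n) \<le> sqrt (I n) / 2"
    proof -
      have "I n = sqrt (I n) * sqrt (I n)" using I0[of n] by simp
      also have "\<dots> \<le> sqrt (I n) * d n" using I0[of n] by (intro mult_left_mono) (auto simp: d_def)
      finally show ?thesis using d[of n] by (simp add: pos_divide_le_eq)
    qed
    finally show ?thesis by simp
  qed
  show ?thesis
    by (rule tendsto_sandwich[OF _ _ tendsto_const *]) (use le in auto)
qed

context
  fixes x :: "nat \<Rightarrow> 'a::chilbert"
  assumes summable_x: "summable (\<lambda>n. (norm (x n))\<^sup>2)"
begin

lemma trig_poly_square_integrable: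
  "finite F \<Longrightarrow> square_integrable (\<lambda>s. \<Sum>n\<in>F. cis (real n * s) *\<^sub>C x n)"
proof (rule square_integrable_const_bound)
  have "continuous_on UNIV (\<lambda>s. cis (real n * s) *\<^sub>C x n)" for n
    by (rule bounded_linear.continuous_on[OF scaleC.bounded_linear_left]) (intro continuous_intros)
  then show "(\<lambda>s. \<Sum>n\<in>F. cis (real n * s) *\<^sub>C x n) \<in> borel_measurable circle_measure"
    by (intro borel_measurable_circle_continuous continuous_on_sum)
  show "AE s in circle_measure. norm (\<Sum>n\<in>F. cis (real n * s) *\<^sub>C x n) \<le> (\<Sum>n\<in>F. norm (x n))"
    by (intro AE_I2 sum_norm_le) (simp add: norm_scaleC)
qed

lemma integral_norm_trig_poly:
  assumes F: "finite F"
  shows "integral\<^sup>L circle_measure (\<lambda>s. (norm (\<Sum>n\<in>F. cis (real n * s) *\<^sub>C x n))\<^sup>2) = 2 * pi * (\<Sum>n\<in>F. (norm (x n))\<^sup>2)"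
proof -
  have i: "integrable circle_measure (\<lambda>s. cis (of_int k * s) * c)" for k c
    by (intro continuous_imp_integrable_real continuous_intros)
  define v where "v = (\<lambda>s. \<Sum>n\<in>F. cis (real n * s) *\<^sub>C x n)"
  have v: "complex_of_real ((norm (v s))\<^sup>2) = (\<Sum>n\<in>F. \<Sum>m\<in>F. cis (of_int (int n - int m) * s) * cinner (x n) (x m))" for s
  proof -
    have c: "cis (- (real m * s)) * cis (real n * s) = cis (of_int (int n - int m) * s)" for n m
      by (simp add: cis_mult left_diff_distrib)
    have "complex_of_real ((norm (v s))\<^sup>2) = cinner (v s) (v s)" by (rule cinner_self[symmetric])
    also have "\<dots> = (\<Sum>n\<in>F. cinner (cis (real n * s) *\<^sub>C x n) (v s))"
      by (subst (1) v_def) (rule cinner.sum_left)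
    also have "\<dots> = (\<Sum>n\<in>F. \<Sum>m\<in>F. cinner (cis (real n * s) *\<^sub>C x n) (cis (real m * s) *\<^sub>C x m))"
      by (simp only: v_def cinner.sum_right)
    also have "\<dots> = (\<Sum>n\<in>F. \<Sum>m\<in>F. cis (of_int (int n - int m) * s) * cinner (x n) (x m))"
      by (simp only: cinner_scaleC_left cinner_scaleC_right cis_cnj mult.assoc[symmetric] c)
    finally show ?thesis .
  qed
  have "complex_of_real (integral\<^sup>L circle_measure (\<lambda>s. (norm (v s))\<^sup>2))
      = integral\<^sup>L circle_measure (\<lambda>s. complex_of_real ((norm (v s))\<^sup>2))"
    by (rule integral_complex_of_real[symmetric])
  also have "\<dots> = integral\<^sup>L circle_measure (\<lambda>s. \<Sum>n\<in>F. \<Sum>m\<in>F. cis (of_int (int n - int m) * s) * cinner (x n) (x m))"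
    by (simp only: v)
  also have "\<dots> = (\<Sum>n\<in>F. \<Sum>m\<in>F. integral\<^sup>L circle_measure (\<lambda>s. cis (of_int (int n - int m) * s) * cinner (x n) (x m)))"
    by (subst Bochner_Integration.integral_sum) (intro Bochner_Integration.integrable_sum i,
        intro sum.cong refl Bochner_Integration.integral_sum i)
  also have "\<dots> = (\<Sum>n\<in>F. \<Sum>m\<in>F. if m = n then 2 * pi * cinner (x n) (x n) else 0)"
    unfolding integral_mult_left_zero integral_cis by (intro sum.cong refl) auto
  also have "\<dots> = (\<Sum>n\<in>F. 2 * pi * cinner (x n) (x n))" using F by simp
  also have "\<dots> = complex_of_real (2 * pi * (\<Sum>n\<in>F. (norm (x n))\<^sup>2))"
    by (simp add: cinner_self sum_distrib_left)
  finally show ?thesis unfolding v_def by (simp only: of_real_eq_iff)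
qed

lemma boundary_function:
  obtains g where "square_integrable g"
    "(\<lambda>N. integral\<^sup>L circle_measure (\<lambda>s. (norm ((\<Sum>n<N. cis (real n * s) *\<^sub>C x n) - g s))\<^sup>2)) \<longlonglongrightarrow> 0"
proof (rule square_integrable_complete)
  show "square_integrable (\<lambda>s. \<Sum>n<N. cis (real n * s) *\<^sub>C x n)" for N
    by (rule trig_poly_square_integrable) simp
  fix e :: real assume e: "e > 0"
  then have "e / (2 * pi) > 0" by simp
  then obtain N where N: "\<And>m n. m \<ge> N \<Longrightarrow> norm (\<Sum>k=m..<n. (norm (x k))\<^sup>2) < e / (2 * pi)"
    using summable_x unfolding summable_Cauchy by metis
  have *: "integral\<^sup>L circle_measure (\<lambda>s. (norm ((\<Sum>n<b. cis (real n * s) *\<^sub>C x n) - (\<Sum>n<a. cis (real n * s) *\<^sub>C x n)))\<^sup>2) < e"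
    if "N \<le> a" "a \<le> b" for a b
  proof -
    have "(\<Sum>n<b. cis (real n * s) *\<^sub>C x n) - (\<Sum>n<a. cis (real n * s) *\<^sub>C x n) = (\<Sum>n=a..<b. cis (real n * s) *\<^sub>C x n)" for s
      using sum_diff_nat_ivl[of 0 a b "\<lambda>n. cis (real n * s) *\<^sub>C x n"] that by (simp add: atLeast0LessThan)
    then have "integral\<^sup>L circle_measure (\<lambda>s. (norm ((\<Sum>n<b. cis (real n * s) *\<^sub>C x n) - (\<Sum>n<a. cis (real n * s) *\<^sub>C x n)))\<^sup>2)
        = 2 * pi * (\<Sum>n=a..<b. (norm (x n))\<^sup>2)"
      using integral_norm_trig_poly[of "{a..<b}"] by simp
    also have "\<dots> < 2 * pi * (e / (2 * pi))"
      using N[OF that(1), of b] by (intro mult_strict_left_mono) (auto simp: abs_less_iff)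
    finally show ?thesis by simp
  qed
  show "\<exists>N. \<forall>m\<ge>N. \<forall>n\<ge>N. integral\<^sup>L circle_measure
      (\<lambda>s. (norm ((\<Sum>n<m. cis (real n * s) *\<^sub>C x n) - (\<Sum>k<n. cis (real k * s) *\<^sub>C x k)))\<^sup>2) < e"
  proof (intro exI allI impI)
    fix m n assume "N \<le> m" "N \<le> n"
    then show "integral\<^sup>L circle_measure
      (\<lambda>s. (norm ((\<Sum>n<m. cis (real n * s) *\<^sub>C x n) - (\<Sum>k<n. cis (real k * s) *\<^sub>C x k)))\<^sup>2) < e"
      using *[of n m] *[of m n] by (cases "n \<le> m") (auto simp: norm_minus_commute)
  qed
qed

lemma poisson_integrable:
  assumes r: "0 \<le> r" "r < 1" and v: "square_integrable (v :: real \<Rightarrow> 'b::chilbert)"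
  shows "integrable circle_measure (\<lambda>s. poisson r (t - s) *\<^sub>R v s)"
proof (rule Bochner_Integration.integrable_bound)
  show "integrable circle_measure (\<lambda>s. 2 / (1 - r) * norm (v s))"
    using square_integrable_imp_integrable_norm[OF v] by simp
  have "(\<lambda>s. poisson r (t - s)) \<in> borel_measurable circle_measure"
    by (rule borel_measurable_circle_continuous[OF continuous_poisson[OF r]])
  then show "(\<lambda>s. poisson r (t - s) *\<^sub>R v s) \<in> borel_measurable circle_measure"
    using square_integrable_measurable[OF v] by (rule borel_measurable_scaleR)
  show "AE s in circle_measure. norm (poisson r (t - s) *\<^sub>R v s) \<le> norm (2 / (1 - r) * norm (v s))"
  proof (rule AE_I2)
    fix s
    have "poisson r (t - s) * norm (v s) \<le> 2 / (1 - r) * norm (v s)"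
      by (intro mult_right_mono poisson_bounded r) simp
    then show "norm (poisson r (t - s) *\<^sub>R v s) \<le> norm (2 / (1 - r) * norm (v s))"
      using poisson_nonneg[OF r] r by (simp add: abs_mult)
  qed
qed

lemma poisson_vector_fourier:
  fixes y :: "'b::chilbert"
  assumes r: "0 \<le> r" "r < 1"
  shows "integral\<^sup>L circle_measure (\<lambda>s. poisson r (t - s) *\<^sub>R (cis (real n * s) *\<^sub>C y)) = (2 * pi) *\<^sub>R ((of_real r * cis t)^n *\<^sub>C y)"
proof -
  have i: "integrable circle_measure (\<lambda>s. of_real (poisson r (t - s)) * cis (real n * s))"
    using continuous_poisson[OF r] by (intro continuous_imp_integrable_real continuous_intros)
  have "integral\<^sup>L circle_measure (\<lambda>s. (of_real (poisson r (t - s)) * cis (real n * s)) *\<^sub>C y)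
      = integral\<^sup>L circle_measure (\<lambda>s. of_real (poisson r (t - s)) * cis (real n * s)) *\<^sub>C y"
    by (rule integral_bounded_linear[OF scaleC.bounded_linear_left i])
  also have "\<dots> = (2 * pi) *\<^sub>R ((of_real r * cis t)^n *\<^sub>C y)"
    unfolding poisson_fourier[OF r] by (simp add: scaleR_scaleC scaleC_scaleC power_mult_distrib Complex.DeMoivre)
  finally show ?thesis by (simp add: scaleR_scaleC scaleC_scaleC)
qed

lemma power_series_summable:
  assumes r: "0 \<le> r" "r < 1" shows "summable (\<lambda>n. (of_real r * cis t)^n *\<^sub>C x n)"
proof (rule summable_norm_cancel, rule summable_comparison_test')
  show "summable (\<lambda>n. (r\<^sup>2)^n + (norm (x n))\<^sup>2)"
    using r by (intro summable_add summable_geometric summable_x) (simp add: power_less_one_iff abs_square_less_1)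
  fix n :: nat
  have "2 * (r^n * norm (x n)) \<le> (r^n)\<^sup>2 + (norm (x n))\<^sup>2" by (rule two_mult_le_squares)
  moreover have "0 \<le> r^n * norm (x n)" using r by simp
  ultimately have "r^n * norm (x n) \<le> (r\<^sup>2)^n + (norm (x n))\<^sup>2"
    by (simp add: power_mult[symmetric] mult.commute)
  then show "norm (norm ((of_real r * cis t)^n *\<^sub>C x n)) \<le> (r\<^sup>2)^n + (norm (x n))\<^sup>2"
    using r by (simp add: norm_scaleC norm_mult norm_power)
qed

lemma poisson_representation:
  assumes r: "0 \<le> r" "r < 1" and g: "square_integrable g"
    and lim: "(\<lambda>N. integral\<^sup>L circle_measure (\<lambda>s. (norm ((\<Sum>n<N. cis (real n * s) *\<^sub>C x n) - g s))\<^sup>2)) \<longlonglongrightarrow> 0"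
  shows "integral\<^sup>L circle_measure (\<lambda>s. poisson r (t - s) *\<^sub>R g s) = (2 * pi) *\<^sub>R (\<Sum>n. (of_real r * cis t)^n *\<^sub>C x n)"
proof (rule LIMSEQ_unique)
  define S where "S = (\<lambda>N s. \<Sum>n<N. cis (real n * s) *\<^sub>C x n)"
  have Ss: "square_integrable (S N)" for N unfolding S_def by (rule trig_poly_square_integrable) simp
  have term_sq: "square_integrable (\<lambda>s. cis (real n * s) *\<^sub>C x n)" for n
    using trig_poly_square_integrable[of "{n}"] by simp
  have Sd: "square_integrable (\<lambda>s. S N s - g s)" for N by (rule square_integrable_diff[OF Ss g])
  have IS: "integral\<^sup>L circle_measure (\<lambda>s. poisson r (t - s) *\<^sub>R S N s) = (2 * pi) *\<^sub>R (\<Sum>n<N. (of_real r * cis t)^n *\<^sub>C x n)" for N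
  proof -
    have "integral\<^sup>L circle_measure (\<lambda>s. poisson r (t - s) *\<^sub>R S N s)
        = integral\<^sup>L circle_measure (\<lambda>s. \<Sum>n<N. poisson r (t - s) *\<^sub>R (cis (real n * s) *\<^sub>C x n))"
      by (simp add: S_def scaleR_sum_right)
    also have "\<dots> = (\<Sum>n<N. integral\<^sup>L circle_measure (\<lambda>s. poisson r (t - s) *\<^sub>R (cis (real n * s) *\<^sub>C x n)))"
      by (rule Bochner_Integration.integral_sum) (rule poisson_integrable[OF r term_sq])
    finally show ?thesis unfolding poisson_vector_fourier[OF r] by (simp add: scaleR_sum_right)
  qed
  show "(\<lambda>N. integral\<^sup>L circle_measure (\<lambda>s. poisson r (t - s) *\<^sub>R S N s)) \<longlonglongrightarrow> (2 * pi) *\<^sub>R (\<Sum>n. (of_real r * cis t)^n *\<^sub>C x n)"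
    unfolding IS by (intro tendsto_intros summable_LIMSEQ power_series_summable r)
  show "(\<lambda>N. integral\<^sup>L circle_measure (\<lambda>s. poisson r (t - s) *\<^sub>R S N s)) \<longlonglongrightarrow> integral\<^sup>L circle_measure (\<lambda>s. poisson r (t - s) *\<^sub>R g s)"
  proof (rule LIM_zero_cancel, rule Lim_null_comparison)
    have "(\<lambda>N. 2 / (1 - r) * integral\<^sup>L circle_measure (\<lambda>s. norm (S N s - g s))) \<longlonglongrightarrow> 2 / (1 - r) * 0"
      using lim by (intro tendsto_mult tendsto_const L2_null_imp_L1_null[OF Sd]) (simp add: S_def)
    then show "(\<lambda>N. 2 / (1 - r) * integral\<^sup>L circle_measure (\<lambda>s. norm (S N s - g s))) \<longlonglongrightarrow> 0" by simp
    have "norm (integral\<^sup>L circle_measure (\<lambda>s. poisson r (t - s) *\<^sub>R S N s) - integral\<^sup>L circle_measure (\<lambda>s. poisson r (t - s) *\<^sub>R g s))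
        \<le> 2 / (1 - r) * integral\<^sup>L circle_measure (\<lambda>s. norm (S N s - g s))" for N
    proof -
      have "integral\<^sup>L circle_measure (\<lambda>s. poisson r (t - s) *\<^sub>R S N s) - integral\<^sup>L circle_measure (\<lambda>s. poisson r (t - s) *\<^sub>R g s)
          = integral\<^sup>L circle_measure (\<lambda>s. poisson r (t - s) *\<^sub>R (S N s - g s))"
        unfolding scaleR_diff_right
        by (rule Bochner_Integration.integral_diff[symmetric]) (intro poisson_integrable[OF r] Ss g)+
      also have "norm \<dots> \<le> integral\<^sup>L circle_measure (\<lambda>s. norm (poisson r (t - s) *\<^sub>R (S N s - g s)))"
        by (rule integral_norm_bound)
      also have "\<dots> \<le> integral\<^sup>L circle_measure (\<lambda>s. 2 / (1 - r) * norm (S N s - g s))"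
      proof (rule integral_mono)
        show "integrable circle_measure (\<lambda>s. norm (poisson r (t - s) *\<^sub>R (S N s - g s)))"
          by (rule integrable_norm[OF poisson_integrable[OF r Sd]])
        show "integrable circle_measure (\<lambda>s. 2 / (1 - r) * norm (S N s - g s))"
          by (rule integrable_mult_right[OF square_integrable_imp_integrable_norm[OF Sd]])
        fix s
        have "poisson r (t - s) * norm (S N s - g s) \<le> 2 / (1 - r) * norm (S N s - g s)"
          by (intro mult_right_mono poisson_bounded r) simp
        then show "norm (poisson r (t - s) *\<^sub>R (S N s - g s)) \<le> 2 / (1 - r) * norm (S N s - g s)"
          using poisson_nonneg[OF r] by simp
      qed
      finally show ?thesis by simp
    qed
    then show "\<forall>\<^sub>F N in sequentially. norm (integral\<^sup>L circle_measure (\<lambda>s. poisson r (t - s) *\<^sub>R S N s) - integral\<^sup>L circle_measure (\<lambda>s. poisson r (t - s) *\<^sub>R g s))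
        \<le> 2 / (1 - r) * integral\<^sup>L circle_measure (\<lambda>s. norm (S N s - g s))" by simp
  qed
qed

text \<open>Integrate the dyadic majorant of the kernel: the interval of length \<open>2\<^sup>k\<^sup>+\<^sup>1 \<delta>\<close> contributes at most
  \<open>64 / (4\<^sup>k \<delta>) \<cdot> e 2\<^sup>k \<delta> = 64 e / 2\<^sup>k\<close>.\<close>

lemma poisson_near_estimate:
  assumes r: "1/2 \<le> r" "r < 1" and e: "0 \<le> e" and \<eta>: "0 < \<eta>" "\<eta> \<le> 1"
    and \<phi>: "\<phi> \<in> borel_measurable circle_measure" and \<phi>0: "\<And>s. 0 \<le> \<phi> s"
    and mean: "\<And>d. 0 < d \<Longrightarrow> d \<le> \<eta> \<Longrightarrow> (\<integral>\<^sup>+s. ennreal (\<phi> s) * indicator (ball t d) s \<partial>circle_measure) \<le> ennreal (e * d)"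
  shows "(\<integral>\<^sup>+s. ennreal (poisson r (t - s) * \<phi> s) * indicator (ball t \<eta>) s \<partial>circle_measure) \<le> ennreal (128 * e)"
proof -
  define \<delta> where "\<delta> = 1 - r"
  have \<delta>: "\<delta> > 0" using r by (simp add: \<delta>_def)
  define c where "c = (\<lambda>k::nat. ennreal (64 * (1/4)^k / \<delta>))"
  have im: "(\<lambda>s. indicator (ball t d) s :: ennreal) \<in> borel_measurable circle_measure" for d
    by (intro measurable_restrict_space1 borel_measurable_indicator) simp
  have fm: "(\<lambda>s. ennreal (\<phi> s) * indicator (ball t d) s) \<in> borel_measurable circle_measure" for d
    by (intro borel_measurable_times_ennreal im measurable_compose[OF \<phi> measurable_ennreal])
  have "(\<integral>\<^sup>+s. ennreal (poisson r (t - s) * \<phi> s) * indicator (ball t \<eta>) s \<partial>circle_measure)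
      \<le> (\<integral>\<^sup>+s. (\<Sum>k. c k * (ennreal (\<phi> s) * indicator (ball t (min (2^k * \<delta>) \<eta>)) s)) \<partial>circle_measure)"
  proof (rule nn_integral_mono)
    fix s
    show "ennreal (poisson r (t - s) * \<phi> s) * indicator (ball t \<eta>) s
        \<le> (\<Sum>k. c k * (ennreal (\<phi> s) * indicator (ball t (min (2^k * \<delta>) \<eta>)) s))"
    proof (cases "s \<in> ball t \<eta>")
      case True
      then have u: "\<bar>t - s\<bar> \<le> 1" using \<eta> by (simp add: dist_real_def)
      have "ennreal (poisson r (t - s) * \<phi> s) = ennreal (poisson r (t - s)) * ennreal (\<phi> s)"
        using poisson_nonneg[of r] r \<phi>0 by (intro ennreal_mult) auto
      also have "\<dots> \<le> (\<Sum>k. c k * indicator {-(2^k * \<delta>)<..<2^k * \<delta>} (t - s)) * ennreal (\<phi> s)"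
        using poisson_dyadic[OF r u] unfolding c_def \<delta>_def by (intro mult_right_mono) auto
      also have "\<dots> = (\<Sum>k. c k * indicator {-(2^k * \<delta>)<..<2^k * \<delta>} (t - s) * ennreal (\<phi> s))"
        by (rule ennreal_suminf_multc[symmetric])
      also have "\<dots> = (\<Sum>k. c k * (ennreal (\<phi> s) * indicator (ball t (min (2^k * \<delta>) \<eta>)) s))"
        using True by (intro suminf_cong) (auto simp: indicator_def dist_real_def abs_less_iff)
      finally show ?thesis using True by simp
    qed simp
  qed
  also have "\<dots> = (\<Sum>k. \<integral>\<^sup>+s. c k * (ennreal (\<phi> s) * indicator (ball t (min (2^k * \<delta>) \<eta>)) s) \<partial>circle_measure)"
    by (intro nn_integral_suminf borel_measurable_times_ennreal fm borel_measurable_const)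
  also have "\<dots> = (\<Sum>k. c k * (\<integral>\<^sup>+s. (ennreal (\<phi> s) * indicator (ball t (min (2^k * \<delta>) \<eta>)) s) \<partial>circle_measure))"
    by (intro suminf_cong nn_integral_cmult fm)
  also have "\<dots> \<le> (\<Sum>k. ennreal (64 * e * (1/2)^k))"
  proof (rule suminf_le)
    fix k
    have "(\<integral>\<^sup>+s. (ennreal (\<phi> s) * indicator (ball t (min (2^k * \<delta>) \<eta>)) s) \<partial>circle_measure) \<le> ennreal (e * min (2^k * \<delta>) \<eta>)"
      using \<delta> \<eta> by (intro mean) auto
    also have "\<dots> \<le> ennreal (e * (2^k * \<delta>))" using e by (intro ennreal_leI mult_left_mono) auto
    finally have "c k * (\<integral>\<^sup>+s. (ennreal (\<phi> s) * indicator (ball t (min (2^k * \<delta>) \<eta>)) s) \<partial>circle_measure)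
        \<le> c k * ennreal (e * (2^k * \<delta>))" by (rule mult_left_mono) simp
    also have "\<dots> = ennreal (64 * (1/4)^k / \<delta> * (e * (2^k * \<delta>)))"
      unfolding c_def using \<delta> e by (intro ennreal_mult[symmetric]) auto
    also have "64 * (1/4)^k / \<delta> * (e * (2^k * \<delta>)) = 64 * e * ((1/4)^k * 2^k)" using \<delta> by simp
    also have "(1/4)^k * 2^k = ((1/2)::real)^k" by (simp flip: power_mult_distrib)
    finally show "c k * (\<integral>\<^sup>+s. (ennreal (\<phi> s) * indicator (ball t (min (2^k * \<delta>) \<eta>)) s) \<partial>circle_measure) \<le> ennreal (64 * e * (1/2)^k)" .
  qed auto
  also have "\<dots> = ennreal (\<Sum>k. 64 * e * (1/2)^k)"
    using e by (intro suminf_ennreal2) (auto intro!: summable_mult summable_geometric)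
  also have "(\<Sum>k. 64 * e * (1/2)^k) = 128 * e"
    by (subst suminf_mult) (auto simp: suminf_geometric summable_geometric)
  finally show ?thesis .
qed

text \<open>At a Lebesgue point \<open>t\<close> of the boundary function \<open>g\<close>, the difference of the series and \<open>g t\<close> is the
  Poisson integral of \<open>g - g t\<close>. Its part near \<open>t\<close> is small by the dyadic estimate; away from \<open>t\<close> the
  kernel itself is of the order of \<open>1 - r\<close>. The end points of the circle parametrization are excluded
  because the kernel has its peak at both of them.\<close>

theorem AE_radial_limit:
  "AE t in circle_measure. \<exists>l. ((\<lambda>r. \<Sum>n. (of_real r * cis t)^n *\<^sub>C x n) \<longlongrightarrow> l) (at_left 1)"
proof -
  obtain g where g: "square_integrable g"
    and lim: "(\<lambda>N. integral\<^sup>L circle_measure (\<lambda>s. (norm ((\<Sum>n<N. cis (real n * s) *\<^sub>C x n) - g s))\<^sup>2)) \<longlonglongrightarrow> 0"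
    by (rule boundary_function)
  have "AE t in circle_measure. t \<noteq> 0 \<and> t \<noteq> 2 * pi"
  proof -
    have "AE t in lebesgue. t \<noteq> 0 \<and> t \<noteq> 2 * pi"
      unfolding AE_completion_iff using AE_lborel_singleton[of 0] AE_lborel_singleton[of "2*pi"] by (rule AE_conjI)
    then show ?thesis by (subst AE_restrict_space_iff) (auto elim: eventually_mono)
  qed
  then show ?thesis
    using AE_Lebesgue_point[OF g] AE_space[of circle_measure]
  proof eventually_elim
    case (elim t)
    have t: "0 < t" "t < 2 * pi" using elim(1,3) by auto
    define \<phi> where "\<phi> = (\<lambda>s. norm (g s - g t))"
    have sqd: "square_integrable (\<lambda>s. g s - g t)"
      by (intro square_integrable_diff g square_integrable_const_bound[of _ "norm (g t)"]) auto
    have \<phi>m: "\<phi> \<in> borel_measurable circle_measure"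
      unfolding \<phi>_def by (rule borel_measurable_integrable[OF square_integrable_imp_integrable_norm[OF sqd]])
    have \<phi>i: "integrable circle_measure \<phi>" unfolding \<phi>_def by (rule square_integrable_imp_integrable_norm[OF sqd])
    have \<phi>0: "0 \<le> \<phi> s" for s by (simp add: \<phi>_def)
    define j where "j = integral\<^sup>L circle_measure \<phi>"
    have j0: "0 \<le> j" unfolding j_def using \<phi>0 by simp
    have "((\<lambda>r. \<Sum>n. (of_real r * cis t)^n *\<^sub>C x n) \<longlongrightarrow> g t) (at_left 1)"
    proof (rule tendstoI)
      fix e :: real assume e: "e > 0"
      then obtain \<eta>0 where \<eta>0: "\<eta>0 > 0" "\<And>d. 0 < d \<Longrightarrow> d < \<eta>0 \<Longrightarrow>
          (\<integral>\<^sup>+s. ennreal (\<phi> s) * indicator (ball t d) s \<partial>circle_measure) \<le> ennreal (e / 64 * d)"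
        using elim(2)[rule_format, of "e / 64"] unfolding \<phi>_def by auto
      define \<eta> where "\<eta> = min (\<eta>0 / 2) 1"
      have \<eta>: "0 < \<eta>" "\<eta> \<le> 1" "\<eta> < \<eta>0" using \<eta>0(1) by (auto simp: \<eta>_def)
      \<comment> \<open>For \<open>0 < t < 2 \<pi>\<close> the sine has no zero at \<open>(t - s) / 2\<close> with \<open>s \<noteq> t\<close> in the interval.\<close>
      obtain \<kappa> where \<kappa>: "\<kappa> > 0" "\<And>s. s \<in> {0..2*pi} - ball t \<eta> \<Longrightarrow> \<kappa> \<le> (sin ((t - s) / 2))\<^sup>2"
      proof (cases "{0..2*pi} - ball t \<eta> = {}")
        case True
        then show thesis by (intro that[of 1]) (simp, blast)
      next
        case False
        have "compact ({0..2*pi} - ball t \<eta>)" by (intro compact_diff) auto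
        then obtain s0 where s0: "s0 \<in> {0..2*pi} - ball t \<eta>"
          "\<And>s. s \<in> {0..2*pi} - ball t \<eta> \<Longrightarrow> (sin ((t - s0) / 2))\<^sup>2 \<le> (sin ((t - s) / 2))\<^sup>2"
        proof -
          have "continuous_on ({0..2*pi} - ball t \<eta>) (\<lambda>s. (sin ((t - s) / 2))\<^sup>2)"
            by (intro continuous_intros) simp
          from continuous_attains_inf[OF \<open>compact _\<close> False this] show thesis using that by blast
        qed
        have "\<bar>t - s0\<bar> / 2 > 0" "\<bar>t - s0\<bar> / 2 < pi" using s0(1) \<eta> t by (auto simp: dist_real_def)
        then have "sin (\<bar>t - s0\<bar> / 2) > 0" by (rule sin_gt_zero)
        moreover have "sin ((t - s0) / 2) = - sin ((s0 - t) / 2)"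
          by (simp flip: sin_minus add: minus_divide_left)
        ultimately have "sin ((t - s0) / 2) \<noteq> 0" by (auto simp: abs_if split: if_splits)
        then show thesis using that[of "(sin ((t - s0) / 2))\<^sup>2"] s0(2) by simp
      qed
      define \<delta>0 where "\<delta>0 = min (1/2) (e / (j / \<kappa> + 1))"
      have \<delta>0: "\<delta>0 > 0" using e j0 \<kappa>(1) by (simp add: \<delta>0_def add_nonneg_pos)
      have "dist (\<Sum>n. (of_real r * cis t)^n *\<^sub>C x n) (g t) < e" if r1: "1 - \<delta>0 < r" "r < 1" for r
      proof -
        have r: "1/2 \<le> r" "0 \<le> r" "r < 1" using r1 by (auto simp: \<delta>0_def)
        let ?F = "\<Sum>n. (of_real r * cis t)^n *\<^sub>C x n"
        have sqc: "square_integrable (\<lambda>s. g t)" by (intro square_integrable_const_bound[of _ "norm (g t)"]) auto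
        have "(2 * pi) *\<^sub>R (?F - g t) = integral\<^sup>L circle_measure (\<lambda>s. poisson r (t - s) *\<^sub>R g s)
            - integral\<^sup>L circle_measure (\<lambda>s. poisson r (t - s) *\<^sub>R g t)"
          using poisson_representation[OF r(2,3) g lim, of t] poisson_vector_fourier[OF r(2,3), of t 0 "g t"]
          by (simp add: scaleR_diff_right)
        also have "\<dots> = integral\<^sup>L circle_measure (\<lambda>s. poisson r (t - s) *\<^sub>R (g s - g t))"
          unfolding scaleR_diff_right
          by (rule Bochner_Integration.integral_diff[symmetric]) (intro poisson_integrable[OF r(2,3)] g sqc)+
        finally have "ennreal (2 * pi * norm (?F - g t)) = norm (integral\<^sup>L circle_measure (\<lambda>s. poisson r (t - s) *\<^sub>R (g s - g t)))"
          by (metis abs_of_nonneg mult_nonneg_nonneg norm_scaleR pi_ge_zero zero_le_numeral)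
        also have "\<dots> \<le> (\<integral>\<^sup>+s. norm (poisson r (t - s) *\<^sub>R (g s - g t)) \<partial>circle_measure)"
          by (rule integral_norm_bound_ennreal[OF poisson_integrable[OF r(2,3) sqd]])
        also have "\<dots> = (\<integral>\<^sup>+s. ennreal (poisson r (t - s) * \<phi> s) \<partial>circle_measure)"
          using poisson_nonneg[OF r(2,3)] by (simp add: \<phi>_def)
        also have "\<dots> \<le> (\<integral>\<^sup>+s. ennreal (poisson r (t - s) * \<phi> s) * indicator (ball t \<eta>) s + ennreal ((1 - r) / \<kappa> * \<phi> s) \<partial>circle_measure)"
        proof (rule nn_integral_mono)
          fix s assume s: "s \<in> space circle_measure"
          show "ennreal (poisson r (t - s) * \<phi> s) \<le> ennreal (poisson r (t - s) * \<phi> s) * indicator (ball t \<eta>) s + ennreal ((1 - r) / \<kappa> * \<phi> s)"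
          proof (cases "s \<in> ball t \<eta>")
            case False
            have "2 * \<kappa> \<le> 4 * r * (sin ((t - s) / 2))\<^sup>2"
              using \<kappa>(2)[of s] s False r \<kappa>(1) by (intro mult_mono) auto
            then have "poisson r (t - s) \<le> 2 * (1 - r) / (2 * \<kappa>)"
              using r \<kappa>(1) by (intro poisson_le) (auto intro: add_increasing)
            moreover have "2 * (1 - r) / (2 * \<kappa>) = (1 - r) / \<kappa>"
              by (rule mult_divide_mult_cancel_left) simp
            ultimately have "poisson r (t - s) \<le> (1 - r) / \<kappa>" by (simp only:)
            then have "poisson r (t - s) * \<phi> s \<le> (1 - r) / \<kappa> * \<phi> s" by (intro mult_right_mono \<phi>0)
            then show ?thesis using False by (simp add: ennreal_leI)
          qed simp
        qed
        also have "\<dots> = (\<integral>\<^sup>+s. ennreal (poisson r (t - s) * \<phi> s) * indicator (ball t \<eta>) s \<partial>circle_measure)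
            + (\<integral>\<^sup>+s. ennreal ((1 - r) / \<kappa> * \<phi> s) \<partial>circle_measure)"
        proof (rule nn_integral_add)
          have "(\<lambda>s. poisson r (t - s)) \<in> borel_measurable circle_measure"
            by (rule borel_measurable_circle_continuous[OF continuous_poisson[OF r(2,3)]])
          then have "(\<lambda>s. poisson r (t - s) * \<phi> s) \<in> borel_measurable circle_measure"
            using \<phi>m by (rule borel_measurable_times)
          moreover have "(\<lambda>s. indicator (ball t \<eta>) s :: ennreal) \<in> borel_measurable circle_measure"
            by (intro measurable_restrict_space1 borel_measurable_indicator) simp
          ultimately show "(\<lambda>s. ennreal (poisson r (t - s) * \<phi> s) * indicator (ball t \<eta>) s) \<in> borel_measurable circle_measure"
            by (intro borel_measurable_times_ennreal) auto
          show "(\<lambda>s. ennreal ((1 - r) / \<kappa> * \<phi> s)) \<in> borel_measurable circle_measure" using \<phi>m by auto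
        qed
        also have "(\<integral>\<^sup>+s. ennreal ((1 - r) / \<kappa> * \<phi> s) \<partial>circle_measure) = ennreal ((1 - r) / \<kappa> * j)"
          unfolding j_def using \<phi>i \<phi>0 r \<kappa>(1) by (subst nn_integral_eq_integral) auto
        also have "(\<integral>\<^sup>+s. ennreal (poisson r (t - s) * \<phi> s) * indicator (ball t \<eta>) s \<partial>circle_measure) \<le> ennreal (128 * (e / 64))"
          using e \<eta> \<eta>0(2) by (intro poisson_near_estimate[OF r(1,3) _ \<eta>(1,2) \<phi>m \<phi>0]) auto
        finally have "ennreal (2 * pi * norm (?F - g t)) \<le> ennreal (128 * (e / 64)) + ennreal ((1 - r) / \<kappa> * j)"
          by (simp add: add_right_mono)
        also have "\<dots> = ennreal (2 * e + (1 - r) / \<kappa> * j)"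
          using e r \<kappa>(1) j0 by (subst ennreal_plus[symmetric]) auto
        finally have le: "2 * pi * norm (?F - g t) \<le> 2 * e + (1 - r) / \<kappa> * j"
          using e r \<kappa>(1) j0 by (subst (asm) ennreal_le_iff) auto
        have "(1 - r) / \<kappa> * j = (1 - r) * (j / \<kappa>)" by simp
        also have "\<dots> \<le> (1 - r) * (j / \<kappa> + 1)" using r by (intro mult_left_mono) auto
        also have "\<dots> < e / (j / \<kappa> + 1) * (j / \<kappa> + 1)"
          using r1 j0 \<kappa>(1) by (intro mult_strict_right_mono) (auto simp: \<delta>0_def add_nonneg_pos)
        also have "\<dots> = e"
        proof -
          have "j / \<kappa> + 1 > 0" using j0 \<kappa>(1) by (simp add: add_nonneg_pos)
          then show ?thesis by simp
        qed
        finally have "2 * pi * norm (?F - g t) < 3 * e" using le by simp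
        moreover have "3 * norm (?F - g t) \<le> 2 * pi * norm (?F - g t)" using pi_gt3 by (intro mult_right_mono) auto
        ultimately show ?thesis by (simp add: dist_norm)
      qed
      then show "\<forall>\<^sub>F r in at_left 1. dist (\<Sum>n. (of_real r * cis t)^n *\<^sub>C x n) (g t) < e"
        unfolding eventually_at_left[of 0 1, OF zero_less_one] using \<delta>0 by (intro exI[of _ "1 - \<delta>0"]) auto
    qed
    then show ?case by blast
  qed
qed

end

section \<open>Boundary values of contractive analytic functions\<close>

definition has_boundary_value ::
  "'a::chilbert set \<Rightarrow> (complex \<Rightarrow> 'a \<Rightarrow> 'b::chilbert) \<Rightarrow> real \<Rightarrow> bool" where
  "has_boundary_value E \<Theta> t \<longleftrightarrow>
     (\<forall>x\<in>E. ((\<lambda>r. \<Theta> (of_real r * cis t) x) \<longlongrightarrow> boundary_value \<Theta> t x) (at_left 1))"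

lemma boundary_value_eqI:
  fixes l :: "'b::t2_space"
  assumes "((\<lambda>r. \<Theta> (of_real r * cis t) x) \<longlongrightarrow> l) (at_left 1)"
  shows "boundary_value \<Theta> t x = l"
  unfolding boundary_value_def using tendsto_Lim[OF trivial_limit_at_left_real assms] .

lemma has_boundary_valueI:
  assumes "\<And>x. x \<in> E \<Longrightarrow> \<exists>l. ((\<lambda>r. \<Theta> (of_real r * cis t) x) \<longlongrightarrow> l) (at_left 1)"
  shows "has_boundary_value E \<Theta> t"
  unfolding has_boundary_value_def
proof
  fix x assume "x \<in> E"
  then obtain l where l: "((\<lambda>r. \<Theta> (of_real r * cis t) x) \<longlongrightarrow> l) (at_left 1)" using assms by blast
  then show "((\<lambda>r. \<Theta> (of_real r * cis t) x) \<longlongrightarrow> boundary_value \<Theta> t x) (at_left 1)"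
    using l boundary_value_eqI[where \<Theta> = \<Theta> and x = x and t = t, OF l] by simp
qed

lemma eventually_at_left_1: "\<forall>\<^sub>F r in at_left (1::real). 0 < r \<and> r < 1"
  unfolding eventually_at_left[of 0 1, OF zero_less_one] by (intro exI[of _ 0]) auto

lemma disc_of_real_cis: "0 < r \<Longrightarrow> r < 1 \<Longrightarrow> cmod (of_real r * cis t) < 1"
  by (simp add: norm_mult)

lemma analytic_op_fun_continuous:
  fixes \<Theta> :: "complex \<Rightarrow> 'a::complex_inner \<Rightarrow> 'b::complex_inner"
  assumes \<Theta>: "analytic_op_fun E F \<Theta>" and x: "x \<in> E"
  shows "continuous_on {z. cmod z < 1} (\<lambda>z. \<Theta> z x)"
  unfolding continuous_on_def
proof
  fix z :: complex assume "z \<in> {z. cmod z < 1}"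
  then have z: "cmod z < 1" by simp
  obtain D where D: "\<forall>e>0. \<exists>d>0. \<forall>w. cmod w < 1 \<and> cmod (w - z) < d \<longrightarrow>
      (\<forall>x\<in>E. norm (\<Theta> w x - \<Theta> z x - (w - z) *\<^sub>C D x) \<le> e * cmod (w - z) * norm x)"
    using \<Theta> z unfolding analytic_op_fun_def by blast
  obtain d where d: "d > 0" "\<And>w. cmod w < 1 \<Longrightarrow> cmod (w - z) < d \<Longrightarrow>
      norm (\<Theta> w x - \<Theta> z x - (w - z) *\<^sub>C D x) \<le> cmod (w - z) * norm x"
    using D[rule_format, OF zero_less_one] x by auto
  have "((\<lambda>w. \<Theta> w x - \<Theta> z x) \<longlongrightarrow> 0) (at z within {z. cmod z < 1})"
  proof (rule Lim_null_comparison)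
    have "((\<lambda>w. cmod (w - z) * (norm x + norm (D x))) \<longlongrightarrow> cmod (z - z) * (norm x + norm (D x))) (at z within {z. cmod z < 1})"
      by (intro tendsto_intros)
    then show "((\<lambda>w. cmod (w - z) * (norm x + norm (D x))) \<longlongrightarrow> 0) (at z within {z. cmod z < 1})" by simp
    have "norm (\<Theta> w x - \<Theta> z x) \<le> cmod (w - z) * (norm x + norm (D x))" if "cmod w < 1" "cmod (w - z) < d" for w
    proof -
      have "norm (\<Theta> w x - \<Theta> z x) \<le> norm (\<Theta> w x - \<Theta> z x - (w - z) *\<^sub>C D x) + norm ((w - z) *\<^sub>C D x)"
        using norm_triangle_ineq[of "\<Theta> w x - \<Theta> z x - (w - z) *\<^sub>C D x" "(w - z) *\<^sub>C D x"] by simp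
      then show ?thesis using d(2)[OF that] by (simp add: norm_scaleC distrib_left)
    qed
    then show "\<forall>\<^sub>F w in at z within {z. cmod z < 1}. norm (\<Theta> w x - \<Theta> z x) \<le> cmod (w - z) * (norm x + norm (D x))"
      unfolding eventually_at by (intro exI[of _ d]) (use d(1) in \<open>auto simp: dist_norm\<close>)
  qed
  then show "((\<lambda>w. \<Theta> w x) \<longlongrightarrow> \<Theta> z x) (at z within {z. cmod z < 1})" by (rule LIM_zero_cancel)
qed

lemma boundary_value_contraction:
  assumes \<Theta>: "contractive_analytic E F \<Theta>" and t: "has_boundary_value E \<Theta> t"
  shows "contraction E F (boundary_value \<Theta> t)"
proof -
  have E: "closed_csubspace E" "closed_csubspace F" using \<Theta> by (auto simp: contractive_analytic_def)
  have c: "contraction E F (\<Theta> (of_real r * cis t))" if "0 < r" "r < 1" for r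
    using \<Theta> disc_of_real_cis[OF that] by (simp add: contractive_analytic_def)
  have lim: "((\<lambda>r. \<Theta> (of_real r * cis t) x) \<longlongrightarrow> boundary_value \<Theta> t x) (at_left 1)" if "x \<in> E" for x
    using t that by (simp add: has_boundary_value_def)
  have nt: "at_left (1::real) \<noteq> bot" by (rule trivial_limit_at_left_real)
  show ?thesis
  proof (rule contractionI)
    fix x assume x: "x \<in> E"
    show "boundary_value \<Theta> t x \<in> F"
      by (rule Lim_in_closed_set[OF csubspace_closed[OF E(2)] _ nt lim[OF x]])
        (use eventually_at_left_1 in \<open>auto elim!: eventually_mono intro: contraction_in[OF c x]\<close>)
    show "boundary_value \<Theta> t (x + y) = boundary_value \<Theta> t x + boundary_value \<Theta> t y" if y: "y \<in> E" for y
    proof (rule boundary_value_eqI, rule Lim_transform_eventually[OF tendsto_add[OF lim[OF x] lim[OF y]]])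
      show "\<forall>\<^sub>F r in at_left 1. \<Theta> (of_real r * cis t) x + \<Theta> (of_real r * cis t) y = \<Theta> (of_real r * cis t) (x + y)"
        using eventually_at_left_1 by eventually_elim (simp add: bounded_op_add[OF contraction_bounded_op[OF c] x y])
    qed
    show "boundary_value \<Theta> t (k *\<^sub>C x) = k *\<^sub>C boundary_value \<Theta> t x" for k
    proof (rule boundary_value_eqI, rule Lim_transform_eventually[OF scaleC.tendsto[OF tendsto_const lim[OF x]]])
      show "\<forall>\<^sub>F r in at_left 1. k *\<^sub>C \<Theta> (of_real r * cis t) x = \<Theta> (of_real r * cis t) (k *\<^sub>C x)"
        using eventually_at_left_1 by eventually_elim (simp add: bounded_op_scaleC[OF contraction_bounded_op[OF c] x])
    qed
    show "norm (boundary_value \<Theta> t x) \<le> norm x"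
      by (rule tendsto_upperbound[OF tendsto_norm[OF lim[OF x]] _ nt])
        (use eventually_at_left_1 in \<open>auto elim!: eventually_mono intro: contraction_norm[OF c x]\<close>)
  qed
qed

text \<open>Almost everywhere the boundary values agree with a field of contractions that is defined and
  measurable everywhere.\<close>

definition boundary_field ::
  "'a::chilbert set \<Rightarrow> (complex \<Rightarrow> 'a \<Rightarrow> 'b::chilbert) \<Rightarrow> real \<Rightarrow> 'a \<Rightarrow> 'b" where
  "boundary_field E \<Theta> t = (if has_boundary_value E \<Theta> t then boundary_value \<Theta> t else (\<lambda>_. 0))"

lemma boundary_field_op_field:
  assumes \<Theta>: "contractive_analytic E F \<Theta>" and bv: "AE t in circle_measure. has_boundary_value E \<Theta> t"
  shows "op_field E F (boundary_field E \<Theta>)"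
  unfolding op_field_def
proof (intro conjI allI ballI)
  have E: "closed_csubspace E" "closed_csubspace F" and an: "analytic_op_fun E F \<Theta>"
    using \<Theta> by (auto simp: contractive_analytic_def)
  show "contraction E F (boundary_field E \<Theta> t)" for t
    using boundary_value_contraction[OF \<Theta>, of t] csubspace_0[OF E(2)]
    by (auto simp: boundary_field_def scaleC.zero_right intro: contractionI)
  fix x assume x: "x \<in> E"
  define r where "r = (\<lambda>n. 1 - inverse (real (Suc (Suc n))))"
  have r: "0 < r n" "r n < 1" for n by (auto simp: r_def field_simps)
  have r1: "filterlim r (at_left 1) sequentially"
    unfolding filterlim_at
  proof
    show "\<forall>\<^sub>F n in sequentially. r n \<in> {..<1} \<and> r n \<noteq> 1" using r by (auto simp: less_le)
    have "r \<longlonglongrightarrow> 1 - 0" unfolding r_def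
      by (intro tendsto_diff tendsto_const LIMSEQ_Suc[OF LIMSEQ_inverse_real_of_nat])
    then show "r \<longlonglongrightarrow> 1" by simp
  qed
  show "(\<lambda>t. boundary_field E \<Theta> t x) \<in> borel_measurable circle_measure"
  proof (rule borel_measurable_AE_limit)
    show "(\<lambda>t. \<Theta> (of_real (r n) * cis t) x) \<in> borel_measurable circle_measure" for n
    proof (rule borel_measurable_circle_continuous)
      show "continuous_on UNIV (\<lambda>t. \<Theta> (of_real (r n) * cis t) x)"
        by (rule continuous_on_compose2[OF analytic_op_fun_continuous[OF an x]])
          (use disc_of_real_cis[OF r] in \<open>auto intro!: continuous_intros\<close>)
    qed
    show "AE t in circle_measure. (\<lambda>n. \<Theta> (of_real (r n) * cis t) x) \<longlonglongrightarrow> boundary_field E \<Theta> t x"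
      using bv
    proof eventually_elim
      case (elim t)
      then have "((\<lambda>r. \<Theta> (of_real r * cis t) x) \<longlongrightarrow> boundary_value \<Theta> t x) (at_left 1)"
        using x by (simp add: has_boundary_value_def)
      from filterlim_compose[OF this r1] show ?case using elim by (simp add: boundary_field_def)
    qed
  qed
qed

lemma mult_op_eq_pointwise_op:
  assumes \<Theta>: "contractive_analytic E F \<Theta>" and bv: "AE t in circle_measure. has_boundary_value E \<Theta> t"
    and v: "v \<in> L2_space E"
  shows "mult_op \<Theta> v = pointwise_op (boundary_field E \<Theta>) v"
proof -
  have E: "closed_csubspace E" using \<Theta> by (auto simp: contractive_analytic_def)
  have "mult_op \<Theta> v = pointwise_op (boundary_value \<Theta>) v" by (simp add: mult_op_def pointwise_op_def)
  also have "\<dots> = pointwise_op (boundary_field E \<Theta>) v"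
    by (rule pointwise_op_cong[OF E boundary_field_op_field[OF \<Theta> bv] v])
      (use bv in \<open>auto elim!: eventually_mono simp: boundary_field_def\<close>)
  finally show ?thesis .
qed

text \<open>The limits on the dense set depend contractively on the vector, so they converge along any sequence
  of dense vectors tending to \<open>x\<close>.\<close>

lemma radial_limit_from_dense:
  fixes F :: "real \<Rightarrow> 'a::chilbert \<Rightarrow> 'b::chilbert"
  assumes F: "\<And>r x y. 0 < r \<Longrightarrow> r < 1 \<Longrightarrow> norm (F r x - F r y) \<le> norm (x - y)"
    and C: "closure C = UNIV" and lim: "\<And>c. c \<in> C \<Longrightarrow> \<exists>l. ((\<lambda>r. F r c) \<longlongrightarrow> l) (at_left 1)"
  shows "\<exists>l. ((\<lambda>r. F r x) \<longlongrightarrow> l) (at_left 1)"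
proof -
  obtain l where l: "\<And>c. c \<in> C \<Longrightarrow> ((\<lambda>r. F r c) \<longlongrightarrow> l c) (at_left 1)" using lim by metis
  have ll: "norm (l c - l c') \<le> norm (c - c')" if "c \<in> C" "c' \<in> C" for c c'
    by (rule tendsto_upperbound[OF tendsto_norm[OF tendsto_diff[OF l[OF that(1)] l[OF that(2)]]] _ trivial_limit_at_left_real])
      (use eventually_at_left_1 F in \<open>auto elim!: eventually_mono\<close>)
  have "x \<in> closure C" using C by simp
  then obtain c where c: "\<forall>n. c n \<in> C" "c \<longlonglongrightarrow> x" unfolding closure_sequential by blast
  have "Cauchy (\<lambda>n. l (c n))"
  proof (rule metric_CauchyI)
    fix e :: real assume "e > 0"
    then obtain M where "\<forall>m\<ge>M. \<forall>n\<ge>M. dist (c m) (c n) < e"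
      using LIMSEQ_imp_Cauchy[OF c(2)] metric_CauchyD by blast
    then show "\<exists>M. \<forall>m\<ge>M. \<forall>n\<ge>M. dist (l (c m)) (l (c n)) < e"
      using ll c(1) unfolding dist_norm by (meson le_less_trans)
  qed
  then obtain L where L: "(\<lambda>n. l (c n)) \<longlonglongrightarrow> L" using Cauchy_convergent convergent_def by blast
  have "((\<lambda>r. F r x) \<longlongrightarrow> L) (at_left 1)"
  proof (rule tendstoI)
    fix e :: real assume e: "e > 0"
    obtain n1 where n1: "\<And>n. n \<ge> n1 \<Longrightarrow> dist (c n) x < e / 3" using metric_LIMSEQ_D[OF c(2), of "e/3"] e by auto
    obtain n2 where n2: "\<And>n. n \<ge> n2 \<Longrightarrow> dist (l (c n)) L < e / 3" using metric_LIMSEQ_D[OF L, of "e/3"] e by auto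
    define n where "n = max n1 n2"
    have cn: "c n \<in> C" "dist (c n) x < e / 3" "dist (l (c n)) L < e / 3" using c(1) n1 n2 by (auto simp: n_def)
    have "\<forall>\<^sub>F r in at_left 1. dist (F r (c n)) (l (c n)) < e / 3" using tendstoD[OF l[OF cn(1)], of "e/3"] e by simp
    then show "\<forall>\<^sub>F r in at_left 1. dist (F r x) L < e"
      using eventually_at_left_1
    proof eventually_elim
      case (elim r)
      have "dist (F r x) (F r (c n)) \<le> dist (c n) x" using F[of r x "c n"] elim by (simp add: dist_norm norm_minus_commute)
      then show ?case
        using dist_triangle[of "F r x" L "F r (c n)"] dist_triangle[of "F r (c n)" L "l (c n)"] elim(1) cn by linarith
    qed
  qed
  then show ?thesis by blast
qed

section \<open>The characteristic function of a contraction\<close>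

context
  fixes S :: "'a::chilbert \<Rightarrow> 'a"
  assumes S: "contraction UNIV UNIV S"
begin

text \<open>In the notation of the theory, \<open>\<Theta>\<^sub>S(z) = - S + z D\<^sub>S\<^sub>* (I - z S\<^sup>*)\<^sup>-\<^sup>1 D\<^sub>S\<close>. The resolvent exists on the whole
  disc as \<open>z S\<^sup>*\<close> is a strict contraction.\<close>

abbreviation "S_adj \<equiv> adjoint_op UNIV S"
abbreviation "D_S \<equiv> defect UNIV S"
abbreviation "D_S_adj \<equiv> defect_adj UNIV UNIV S"

definition resolvent :: "complex \<Rightarrow> 'a \<Rightarrow> 'a" where
  "resolvent z = inv (\<lambda>y. y - z *\<^sub>C S_adj y)"

lemma S_adj_contraction: "contraction UNIV UNIV S_adj"
  by (rule adjoint_op_contraction[OF csubspace_UNIV S])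

lemma S_adj_simps: "S_adj (x + y) = S_adj x + S_adj y" "S_adj (c *\<^sub>C x) = c *\<^sub>C S_adj x" "S_adj (x - y) = S_adj x - S_adj y"
  using bounded_op_add[OF contraction_bounded_op[OF S_adj_contraction], of x y]
    bounded_op_scaleC[OF contraction_bounded_op[OF S_adj_contraction], of x c]
    bounded_op_diff[OF csubspace_UNIV contraction_bounded_op[OF S_adj_contraction], of x y] by simp_all

lemma S_adj_norm: "norm (S_adj x) \<le> norm x"
  using contraction_norm[OF S_adj_contraction] by simp

lemma D_S_contraction: "contraction UNIV UNIV D_S"
  by (rule defect_contraction[OF csubspace_UNIV S])

lemma D_S_adj_contraction: "contraction UNIV UNIV D_S_adj"
  using defect_contraction[OF csubspace_UNIV S_adj_contraction]
  by (simp add: defect_adj_eq_defect[OF csubspace_UNIV csubspace_UNIV S])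

lemma D_S_simps: "D_S (x + y) = D_S x + D_S y" "D_S (c *\<^sub>C x) = c *\<^sub>C D_S x"
  using bounded_op_add[OF contraction_bounded_op[OF D_S_contraction], of x y]
    bounded_op_scaleC[OF contraction_bounded_op[OF D_S_contraction], of x c] by simp_all

lemma D_S_adj_simps: "D_S_adj (x + y) = D_S_adj x + D_S_adj y" "D_S_adj (c *\<^sub>C x) = c *\<^sub>C D_S_adj x" "D_S_adj (x - y) = D_S_adj x - D_S_adj y" "D_S_adj (- x) = - D_S_adj x"
  using bounded_op_add[OF contraction_bounded_op[OF D_S_adj_contraction], of x y]
    bounded_op_scaleC[OF contraction_bounded_op[OF D_S_adj_contraction], of x c]
    bounded_op_diff[OF csubspace_UNIV contraction_bounded_op[OF D_S_adj_contraction], of x y]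
    bounded_op_minus[OF contraction_bounded_op[OF D_S_adj_contraction], of x] by simp_all

lemma S_simps: "S (x + y) = S x + S y" "S (c *\<^sub>C x) = c *\<^sub>C S x"
  using bounded_op_add[OF contraction_bounded_op[OF S], of x y]
    bounded_op_scaleC[OF contraction_bounded_op[OF S], of x c] by simp_all

lemma norm_Ds: "(norm (D_S_adj x))\<^sup>2 = (norm x)\<^sup>2 - (norm (S_adj x))\<^sup>2"
  using norm_defect[OF csubspace_UNIV S_adj_contraction, of x]
  by (simp add: defect_adj_eq_defect[OF csubspace_UNIV csubspace_UNIV S])

lemma char_fun_eq: "char_fun S z x = - S x + z *\<^sub>C D_S_adj (resolvent z (D_S x))"
  by (simp add: char_fun_def resolvent_def)

lemma resolvent_bij:
  assumes z: "cmod z < 1" shows "bij (\<lambda>y. y - z *\<^sub>C S_adj y)"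
proof -
  have ex: "\<exists>!y. w + z *\<^sub>C S_adj y = y" for w
  proof (rule banach_fix_type[of "cmod z"])
    show "\<forall>x y. dist (w + z *\<^sub>C S_adj x) (w + z *\<^sub>C S_adj y) \<le> cmod z * dist x y"
    proof (intro allI)
      fix x y
      have "dist (w + z *\<^sub>C S_adj x) (w + z *\<^sub>C S_adj y) = cmod z * norm (S_adj (x - y))"
        by (simp add: dist_norm S_adj_simps norm_scaleC flip: scaleC.diff_right)
      then show "dist (w + z *\<^sub>C S_adj x) (w + z *\<^sub>C S_adj y) \<le> cmod z * dist x y"
        using S_adj_norm by (simp add: dist_norm mult_left_mono)
    qed
  qed (use z in auto)
  have "y - z *\<^sub>C S_adj y = w \<longleftrightarrow> w + z *\<^sub>C S_adj y = y" for w y by (auto simp: algebra_simps)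
  then show ?thesis unfolding bij_iff using ex by simp
qed

lemma resolvent_eq: "cmod z < 1 \<Longrightarrow> resolvent z w - z *\<^sub>C S_adj (resolvent z w) = w"
  unfolding resolvent_def using surj_f_inv_f[OF bij_is_surj[OF resolvent_bij], of z w] by simp

lemma resolvent_unique: "cmod z < 1 \<Longrightarrow> y - z *\<^sub>C S_adj y = w \<Longrightarrow> resolvent z w = y"
  unfolding resolvent_def using inv_f_f[OF bij_is_inj[OF resolvent_bij], of z y] by auto

lemma resolvent_add:
  assumes z: "cmod z < 1" shows "resolvent z (v + w) = resolvent z v + resolvent z w"
proof (rule resolvent_unique[OF z])
  have "resolvent z v + resolvent z w - z *\<^sub>C S_adj (resolvent z v + resolvent z w)
      = (resolvent z v - z *\<^sub>C S_adj (resolvent z v)) + (resolvent z w - z *\<^sub>C S_adj (resolvent z w))"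
    by (simp add: S_adj_simps scaleC_add_right)
  then show "resolvent z v + resolvent z w - z *\<^sub>C S_adj (resolvent z v + resolvent z w) = v + w"
    unfolding resolvent_eq[OF z] .
qed

lemma resolvent_scaleC:
  assumes z: "cmod z < 1" shows "resolvent z (c *\<^sub>C w) = c *\<^sub>C resolvent z w"
proof (rule resolvent_unique[OF z])
  have "c *\<^sub>C resolvent z w - z *\<^sub>C S_adj (c *\<^sub>C resolvent z w) = c *\<^sub>C (resolvent z w - z *\<^sub>C S_adj (resolvent z w))"
    by (simp add: S_adj_simps scaleC.diff_right scaleC_scaleC mult.commute)
  then show "c *\<^sub>C resolvent z w - z *\<^sub>C S_adj (c *\<^sub>C resolvent z w) = c *\<^sub>C w" using resolvent_eq[OF z] by simp
qed

lemma resolvent_norm: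
  assumes z: "cmod z < 1" shows "norm (resolvent z w) \<le> norm w / (1 - cmod z)"
proof -
  let ?y = "resolvent z w"
  have "norm ?y \<le> norm (?y - z *\<^sub>C S_adj ?y) + norm (z *\<^sub>C S_adj ?y)"
    using norm_triangle_ineq[of "?y - z *\<^sub>C S_adj ?y" "z *\<^sub>C S_adj ?y"] by simp
  also have "\<dots> \<le> norm w + cmod z * norm ?y"
    using S_adj_norm resolvent_eq[OF z] by (simp add: norm_scaleC mult_left_mono)
  finally have "(1 - cmod z) * norm ?y \<le> norm w" by (simp add: algebra_simps)
  then show ?thesis using z by (simp add: pos_le_divide_eq mult.commute)
qed

text \<open>Expand the square. With \<open>w\<close> the resolvent of \<open>D\<^sub>S x\<close>, the mixed term is
  \<open>\<langle>S x, z D\<^sub>S\<^sub>* w\<rangle> = \<langle>D\<^sub>S x, z S\<^sup>* w\<rangle>\<close> because \<open>D\<^sub>S\<^sub>* S = S D\<^sub>S\<close>, and \<open>z S\<^sup>* w = w - D\<^sub>S x\<close>.\<close>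

lemma norm_char_fun:
  assumes z: "cmod z < 1"
  shows "(norm (char_fun S z x))\<^sup>2 = (norm x)\<^sup>2 - (1 - (cmod z)\<^sup>2) * (norm (resolvent z (D_S x)))\<^sup>2"
proof -
  define w where "w = resolvent z (D_S x)"
  have zA: "z *\<^sub>C S_adj w = w - D_S x" using resolvent_eq[OF z, of "D_S x"] by (simp add: w_def algebra_simps)
  have "cinner (S x) (z *\<^sub>C D_S_adj w) = cnj z * cinner (D_S_adj (S x)) w"
    using defect_selfadjoint[OF csubspace_UNIV S_adj_contraction, of "S x" w]
    by (simp add: cinner_scaleC_right defect_adj_eq_defect[OF csubspace_UNIV csubspace_UNIV S])
  also have "D_S_adj (S x) = S (D_S x)" using defect_intertwine[OF csubspace_UNIV csubspace_UNIV S, of x] by simp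
  also have "cinner (S (D_S x)) w = cinner (D_S x) (S_adj w)"
    using adjoint_op_cinner[OF csubspace_UNIV contraction_bounded_op[OF S]] by simp
  also have "cnj z * cinner (D_S x) (S_adj w) = cinner (D_S x) (w - D_S x)"
    by (simp add: zA[symmetric] cinner_scaleC_right)
  finally have i: "Re (cinner (S x) (z *\<^sub>C D_S_adj w)) = Re (cinner (D_S x) w) - (norm (D_S x))\<^sup>2"
    by (simp add: cinner_simps norm_sq_cinner)
  have "(norm (z *\<^sub>C D_S_adj w))\<^sup>2 = (cmod z)\<^sup>2 * (norm w)\<^sup>2 - (cmod z * norm (S_adj w))\<^sup>2"
    by (simp add: norm_scaleC power_mult_distrib norm_Ds right_diff_distrib)
  also have "cmod z * norm (S_adj w) = norm (w - D_S x)" unfolding zA[symmetric] by (simp add: norm_scaleC)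
  finally have n: "(norm (z *\<^sub>C D_S_adj w))\<^sup>2 = (cmod z)\<^sup>2 * (norm w)\<^sup>2 - ((norm (D_S x))\<^sup>2 + (norm w)\<^sup>2 - 2 * Re (cinner (D_S x) w))"
    by (simp add: norm_diff_sq[of "D_S x" w, symmetric] norm_minus_commute)
  have "char_fun S z x = z *\<^sub>C D_S_adj w - S x" by (simp add: char_fun_eq w_def)
  then have "(norm (char_fun S z x))\<^sup>2 = (norm (S x))\<^sup>2 + (norm (z *\<^sub>C D_S_adj w))\<^sup>2 - 2 * Re (cinner (S x) (z *\<^sub>C D_S_adj w))"
    using norm_diff_sq[of "S x" "z *\<^sub>C D_S_adj w"] by (simp add: norm_minus_commute)
  then show ?thesis
    using i n norm_defect[OF csubspace_UNIV S, of x] by (simp add: w_def algebra_simps)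
qed

lemma char_fun_contraction:
  assumes z: "cmod z < 1" shows "contraction UNIV UNIV (char_fun S z)"
proof (rule contractionI)
  fix x y c
  show "char_fun S z (x + y) = char_fun S z x + char_fun S z y"
    by (simp add: char_fun_eq S_simps D_S_simps resolvent_add[OF z] D_S_adj_simps scaleC_add_right)
  show "char_fun S z (c *\<^sub>C x) = c *\<^sub>C char_fun S z x"
    by (simp add: char_fun_eq S_simps D_S_simps resolvent_scaleC[OF z] D_S_adj_simps scaleC.diff_right scaleC_scaleC mult.commute)
  have "0 \<le> (1 - (cmod z)\<^sup>2) * (norm (resolvent z (D_S x)))\<^sup>2"
    using z by (intro mult_nonneg_nonneg) (auto simp: power_le_one)
  then have "(norm (char_fun S z x))\<^sup>2 \<le> (norm x)\<^sup>2" unfolding norm_char_fun[OF z] by simp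
  then show "norm (char_fun S z x) \<le> norm x" by (rule power2_le_imp_le) simp
qed simp

lemma defect_adj_space_csubspace: "closed_csubspace (defect_space_adj UNIV UNIV S)"
  unfolding defect_adj_space_eq[OF csubspace_UNIV csubspace_UNIV S]
  by (rule defect_space_csubspace[OF csubspace_UNIV S_adj_contraction])

lemma char_fun_contraction_defect_spaces:
  assumes z: "cmod z < 1"
  shows "contraction (defect_space UNIV S) (defect_space_adj UNIV UNIV S) (char_fun S z)"
proof -
  note c = char_fun_contraction[OF z]
  have "char_fun S z x \<in> defect_space_adj UNIV UNIV S" if x: "x \<in> defect_space UNIV S" for x
    unfolding defect_space_adj_def
  proof (rule bounded_op_closure_image[OF csubspace_UNIV contraction_bounded_op[OF c]])
    show "x \<in> closure (range D_S)" using x by (simp add: defect_space_def)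
    fix y assume "y \<in> range D_S"
    then obtain u where "y = D_S u" by blast
    then have "char_fun S z y = D_S_adj (- S u + z *\<^sub>C resolvent z (D_S y))"
      using defect_intertwine[OF csubspace_UNIV csubspace_UNIV S, of u] unfolding char_fun_eq by (simp add: D_S_adj_simps)
    then show "char_fun S z y \<in> range D_S_adj" by simp
  qed simp
  then show ?thesis using c unfolding contraction_def bounded_op_def by auto
qed

text \<open>The error term of the derivative of \<open>z (I - z S\<^sup>*)\<^sup>-\<^sup>1\<close>, whose value is \<open>(I - z S\<^sup>*)\<^sup>-\<^sup>2\<close>; it is
  quadratic in \<open>w - z\<close>.\<close>

lemma resolvent_derivative:
  assumes z: "cmod z < 1" and w: "cmod w < 1"
  shows "w *\<^sub>C resolvent w y - z *\<^sub>C resolvent z y - (w - z) *\<^sub>C resolvent z (resolvent z y)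
    = (w - z)\<^sup>2 *\<^sub>C resolvent w (S_adj (resolvent z (resolvent z y)))"
proof -
  define b where "b = resolvent z y"
  define c where "c = resolvent z b"
  have b: "b - z *\<^sub>C S_adj b = y" unfolding b_def by (rule resolvent_eq[OF z])
  have c: "c - z *\<^sub>C S_adj c = b" unfolding c_def by (rule resolvent_eq[OF z])
  have 1: "resolvent w y = b + (w - z) *\<^sub>C resolvent w (S_adj b)"
  proof (rule resolvent_unique[OF w])
    have "(b + (w - z) *\<^sub>C resolvent w (S_adj b)) - w *\<^sub>C S_adj (b + (w - z) *\<^sub>C resolvent w (S_adj b))
      = b - w *\<^sub>C S_adj b + (w - z) *\<^sub>C (resolvent w (S_adj b) - w *\<^sub>C S_adj (resolvent w (S_adj b)))"
      by (simp add: S_adj_simps scaleC_add_right scaleC.diff_right scaleC_scaleC mult.commute)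
    also have "\<dots> = b - w *\<^sub>C S_adj b + (w - z) *\<^sub>C S_adj b" unfolding resolvent_eq[OF w] by simp
    also have "\<dots> = y" using b by (simp add: scaleC.diff_left)
    finally show "(b + (w - z) *\<^sub>C resolvent w (S_adj b)) - w *\<^sub>C S_adj (b + (w - z) *\<^sub>C resolvent w (S_adj b)) = y" .
  qed
  have 2: "resolvent w b = c + (w - z) *\<^sub>C resolvent w (S_adj c)"
  proof (rule resolvent_unique[OF w])
    have "(c + (w - z) *\<^sub>C resolvent w (S_adj c)) - w *\<^sub>C S_adj (c + (w - z) *\<^sub>C resolvent w (S_adj c))
      = c - w *\<^sub>C S_adj c + (w - z) *\<^sub>C (resolvent w (S_adj c) - w *\<^sub>C S_adj (resolvent w (S_adj c)))"
      by (simp add: S_adj_simps scaleC_add_right scaleC.diff_right scaleC_scaleC mult.commute)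
    also have "\<dots> = c - w *\<^sub>C S_adj c + (w - z) *\<^sub>C S_adj c" unfolding resolvent_eq[OF w] by simp
    also have "\<dots> = b" using c by (simp add: scaleC.diff_left)
    finally show "(c + (w - z) *\<^sub>C resolvent w (S_adj c)) - w *\<^sub>C S_adj (c + (w - z) *\<^sub>C resolvent w (S_adj c)) = b" .
  qed
  have 3: "w *\<^sub>C resolvent w (S_adj b) = resolvent w b - b"
  proof -
    have "resolvent w b = b + w *\<^sub>C resolvent w (S_adj b)"
    proof (rule resolvent_unique[OF w])
      have "(b + w *\<^sub>C resolvent w (S_adj b)) - w *\<^sub>C S_adj (b + w *\<^sub>C resolvent w (S_adj b))
        = b - w *\<^sub>C S_adj b + w *\<^sub>C (resolvent w (S_adj b) - w *\<^sub>C S_adj (resolvent w (S_adj b)))"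
        by (simp add: S_adj_simps scaleC_add_right scaleC.diff_right scaleC_scaleC)
      then show "(b + w *\<^sub>C resolvent w (S_adj b)) - w *\<^sub>C S_adj (b + w *\<^sub>C resolvent w (S_adj b)) = b"
        unfolding resolvent_eq[OF w] by simp
    qed
    then show ?thesis by simp
  qed
  have "w *\<^sub>C resolvent w y = w *\<^sub>C b + (w - z) *\<^sub>C (resolvent w b - b)"
    unfolding 1 3[symmetric] by (simp add: scaleC_add_right scaleC_scaleC mult.commute)
  then have "w *\<^sub>C resolvent w y - z *\<^sub>C b = (w - z) *\<^sub>C resolvent w b"
    by (simp add: scaleC.diff_right scaleC.diff_left algebra_simps)
  then have "w *\<^sub>C resolvent w y - z *\<^sub>C b - (w - z) *\<^sub>C c = (w - z) *\<^sub>C (resolvent w b - c)"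
    by (simp add: scaleC.diff_right)
  also have "\<dots> = (w - z)\<^sup>2 *\<^sub>C resolvent w (S_adj c)" unfolding 2 by (simp add: scaleC_scaleC power2_eq_square)
  finally show ?thesis by (simp add: b_def c_def)
qed

lemma char_fun_contractive_analytic:
  "contractive_analytic (defect_space UNIV S) (defect_space_adj UNIV UNIV S) (char_fun S)"
  unfolding contractive_analytic_def analytic_op_fun_def
proof (intro conjI allI impI)
  show "closed_csubspace (defect_space UNIV S)" by (rule defect_space_csubspace[OF csubspace_UNIV S])
  show "closed_csubspace (defect_space_adj UNIV UNIV S)" by (rule defect_adj_space_csubspace)
  fix z :: complex assume z: "cmod z < 1"
  show "contraction (defect_space UNIV S) (defect_space_adj UNIV UNIV S) (char_fun S z)"
    by (rule char_fun_contraction_defect_spaces[OF z])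
  then show "bounded_op (defect_space UNIV S) (defect_space_adj UNIV UNIV S) (char_fun S z)"
    by (rule contraction_bounded_op)
  define m where "m = 1 - cmod z"
  have m: "m > 0" using z by (simp add: m_def)
  have RR: "norm (resolvent z (resolvent z (D_S x))) \<le> norm x / m\<^sup>2" for x
  proof -
    have "norm (resolvent z (resolvent z (D_S x))) \<le> norm (resolvent z (D_S x)) / m"
      unfolding m_def by (rule resolvent_norm[OF z])
    also have "\<dots> \<le> (norm (D_S x) / m) / m"
      using m resolvent_norm[OF z, of "D_S x"] by (intro divide_right_mono) (auto simp: m_def)
    also have "\<dots> \<le> (norm x / m) / m" using m contraction_norm[OF D_S_contraction, of x] by (intro divide_right_mono) auto
    finally show ?thesis by (simp add: power2_eq_square)
  qed
  show "\<exists>D'. bounded_op (defect_space UNIV S) (defect_space_adj UNIV UNIV S) D' \<and>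
      (\<forall>e>0. \<exists>d>0. \<forall>w. cmod w < 1 \<and> cmod (w - z) < d \<longrightarrow>
        (\<forall>x\<in>defect_space UNIV S. norm (char_fun S w x - char_fun S z x - (w - z) *\<^sub>C D' x) \<le> e * cmod (w - z) * norm x))"
  proof (intro exI[of _ "\<lambda>x. D_S_adj (resolvent z (resolvent z (D_S x)))"] conjI allI impI)
    have "norm (D_S_adj (resolvent z (resolvent z (D_S x)))) \<le> (1 / m\<^sup>2) * norm x" for x
      using contraction_norm[OF D_S_adj_contraction, of "resolvent z (resolvent z (D_S x))"] RR[of x] by simp
    then show "bounded_op (defect_space UNIV S) (defect_space_adj UNIV UNIV S) (\<lambda>x. D_S_adj (resolvent z (resolvent z (D_S x))))"
      unfolding bounded_op_def
      by (intro conjI ballI allI exI[of _ "1 / m\<^sup>2"])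
        (auto simp: D_S_simps resolvent_add[OF z] resolvent_scaleC[OF z] D_S_adj_simps defect_space_adj_def
          intro: subsetD[OF closure_subset])
    fix e :: real assume e: "e > 0"
    \<comment> \<open>The first bound keeps \<open>1 - \<bar>w\<bar>\<close> above \<open>m / 2\<close>, the second makes the quadratic error at most \<open>e \<bar>w - z\<bar>\<close>.\<close>
    define d where "d = min (m / 2) (e * m^3 / 2)"
    have d: "d > 0" using m e by (simp add: d_def)
    have "norm (char_fun S w x - char_fun S z x - (w - z) *\<^sub>C D_S_adj (resolvent z (resolvent z (D_S x)))) \<le> e * cmod (w - z) * norm x"
      if w: "cmod w < 1" "cmod (w - z) < d" for w x
    proof -
      let ?q = "resolvent z (resolvent z (D_S x))"
      have wm: "m / 2 \<le> 1 - cmod w" using w(2) norm_triangle_ineq2[of w z] by (simp add: d_def m_def)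
      have "char_fun S w x - char_fun S z x - (w - z) *\<^sub>C D_S_adj ?q = D_S_adj ((w - z)\<^sup>2 *\<^sub>C resolvent w (S_adj ?q))"
        unfolding resolvent_derivative[OF z w(1), symmetric] by (simp add: char_fun_eq D_S_adj_simps)
      then have "norm (char_fun S w x - char_fun S z x - (w - z) *\<^sub>C D_S_adj ?q) \<le> norm ((w - z)\<^sup>2 *\<^sub>C resolvent w (S_adj ?q))"
        using contraction_norm[OF D_S_adj_contraction] by simp
      also have "\<dots> = (cmod (w - z))\<^sup>2 * norm (resolvent w (S_adj ?q))" by (simp add: norm_scaleC norm_power)
      also have "\<dots> \<le> (cmod (w - z))\<^sup>2 * ((norm x / m\<^sup>2) / (m / 2))"
      proof (rule mult_left_mono)
        have "norm (resolvent w (S_adj ?q)) \<le> norm (S_adj ?q) / (1 - cmod w)" by (rule resolvent_norm[OF w(1)])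
        also have "\<dots> \<le> (norm x / m\<^sup>2) / (m / 2)"
          using S_adj_norm[of ?q] RR[of x] wm m by (intro frac_le) auto
        finally show "norm (resolvent w (S_adj ?q)) \<le> (norm x / m\<^sup>2) / (m / 2)" .
      qed simp
      also have "\<dots> = cmod (w - z) * norm x * (cmod (w - z) * 2 / m^3)"
        using m by (simp add: power2_eq_square power3_eq_cube field_simps)
      also have "\<dots> \<le> cmod (w - z) * norm x * e"
        using w(2) m by (intro mult_left_mono) (auto simp: d_def field_simps)
      finally show ?thesis by (simp add: mult_ac)
    qed
    then show "\<exists>d>0. \<forall>w. cmod w < 1 \<and> cmod (w - z) < d \<longrightarrow>
        (\<forall>x\<in>defect_space UNIV S. norm (char_fun S w x - char_fun S z x - (w - z) *\<^sub>C D_S_adj (resolvent z (resolvent z (D_S x)))) \<le> e * cmod (w - z) * norm x)"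
      using d by blast
  qed
qed

text \<open>The Taylor coefficients of \<open>z \<mapsto> \<Theta>\<^sub>S(z) x\<close> at zero.\<close>

primrec char_coeff :: "'a \<Rightarrow> nat \<Rightarrow> 'a" where
  "char_coeff x 0 = - S x"
| "char_coeff x (Suc n) = D_S_adj ((S_adj ^^ n) (D_S x))"

text \<open>\<open>(norm (D\<^sub>S\<^sub>* y))\<^sup>2 = (norm y)\<^sup>2 - (norm (S\<^sup>* y))\<^sup>2\<close> telescopes along \<open>y = S\<^sup>*\<^sup>n D\<^sub>S x\<close>.\<close>

lemma char_coeff_summable: "summable (\<lambda>n. (norm (char_coeff x n))\<^sup>2)"
proof -
  have "(\<Sum>n<N. (norm (char_coeff x (Suc n)))\<^sup>2) = (norm (D_S x))\<^sup>2 - (norm ((S_adj ^^ N) (D_S x)))\<^sup>2" for N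
    by (induction N) (simp_all add: norm_Ds)
  then have "summable (\<lambda>n. (norm (char_coeff x (Suc n)))\<^sup>2)"
    by (intro summableI_nonneg_bounded[where x = "(norm (D_S x))\<^sup>2"]) auto
  then show ?thesis by (subst (asm) summable_Suc_iff)
qed

lemma char_fun_sums:
  assumes z: "cmod z < 1" shows "(\<lambda>n. z^n *\<^sub>C char_coeff x n) sums char_fun S z x"
proof -
  let ?y = "D_S x" and ?R = "resolvent z"
  have An: "norm ((S_adj ^^ n) ?y) \<le> norm ?y" for n
    by (induction n) (use S_adj_norm order_trans in auto)
  have R: "?R ?y = (\<Sum>n<N. z^n *\<^sub>C (S_adj ^^ n) ?y) + ?R (z^N *\<^sub>C (S_adj ^^ N) ?y)" for N
  proof (induction N)
    case (Suc N)
    have "?R (z^N *\<^sub>C (S_adj ^^ N) ?y) = z^N *\<^sub>C (S_adj ^^ N) ?y + ?R (z^Suc N *\<^sub>C (S_adj ^^ Suc N) ?y)"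
    proof (rule resolvent_unique[OF z])
      let ?u = "z^N *\<^sub>C (S_adj ^^ N) ?y" and ?v = "?R (z^Suc N *\<^sub>C (S_adj ^^ Suc N) ?y)"
      have "?u + ?v - z *\<^sub>C S_adj (?u + ?v) = ?u - z *\<^sub>C S_adj ?u + (?v - z *\<^sub>C S_adj ?v)"
        by (simp add: S_adj_simps scaleC_add_right)
      also have "\<dots> = ?u - z *\<^sub>C S_adj ?u + z^Suc N *\<^sub>C (S_adj ^^ Suc N) ?y" unfolding resolvent_eq[OF z] by simp
      also have "\<dots> = ?u" by (simp add: S_adj_simps scaleC_scaleC)
      finally show "?u + ?v - z *\<^sub>C S_adj (?u + ?v) = ?u" .
    qed
    then show ?case using Suc by (simp add: add.assoc)
  qed simp
  have D_S_adj_sum: "D_S_adj (\<Sum>n<N. z^n *\<^sub>C (S_adj ^^ n) ?y) = (\<Sum>n<N. z^n *\<^sub>C D_S_adj ((S_adj ^^ n) ?y))" for N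
    by (induction N) (use bounded_op_zero[OF contraction_bounded_op[OF D_S_adj_contraction]] in \<open>auto simp: D_S_adj_simps\<close>)
  have rem: "(\<lambda>N. ?R (z^N *\<^sub>C (S_adj ^^ N) ?y)) \<longlonglongrightarrow> 0"
  proof (rule Lim_null_comparison)
    have "(\<lambda>N. cmod z ^ N * (norm ?y / (1 - cmod z))) \<longlonglongrightarrow> 0 * (norm ?y / (1 - cmod z))"
      using z by (intro tendsto_intros LIMSEQ_realpow_zero) auto
    then show "(\<lambda>N. cmod z ^ N * (norm ?y / (1 - cmod z))) \<longlonglongrightarrow> 0" by simp
    have "norm (?R (z^N *\<^sub>C (S_adj ^^ N) ?y)) \<le> cmod z ^ N * (norm ?y / (1 - cmod z))" for N
    proof -
      have "norm (?R (z^N *\<^sub>C (S_adj ^^ N) ?y)) \<le> (cmod z ^ N * norm ((S_adj ^^ N) ?y)) / (1 - cmod z)"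
        using resolvent_norm[OF z, of "z^N *\<^sub>C (S_adj ^^ N) ?y"] by (simp add: norm_scaleC norm_power)
      also have "\<dots> \<le> (cmod z ^ N * norm ?y) / (1 - cmod z)"
        using An z by (intro divide_right_mono mult_left_mono) auto
      finally show ?thesis by simp
    qed
    then show "\<forall>\<^sub>F N in sequentially. norm (?R (z^N *\<^sub>C (S_adj ^^ N) ?y)) \<le> cmod z ^ N * (norm ?y / (1 - cmod z))" by simp
  qed
  have "(\<lambda>N. \<Sum>n<N. z^Suc n *\<^sub>C char_coeff x (Suc n)) \<longlonglongrightarrow> z *\<^sub>C D_S_adj (?R ?y)"
  proof -
    have eq: "(\<Sum>n<N. z^Suc n *\<^sub>C char_coeff x (Suc n)) = z *\<^sub>C D_S_adj (?R ?y - ?R (z^N *\<^sub>C (S_adj ^^ N) ?y))" for N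
    proof -
      have "?R ?y - ?R (z^N *\<^sub>C (S_adj ^^ N) ?y) = (\<Sum>n<N. z^n *\<^sub>C (S_adj ^^ n) ?y)"
        unfolding diff_eq_eq by (rule R)
      then show ?thesis by (simp add: D_S_adj_sum scaleC.sum_right scaleC_scaleC)
    qed
    have "(\<lambda>N. ?R ?y - ?R (z^N *\<^sub>C (S_adj ^^ N) ?y)) \<longlonglongrightarrow> ?R ?y - 0" by (intro tendsto_diff tendsto_const rem)
    then have "(\<lambda>N. ?R ?y - ?R (z^N *\<^sub>C (S_adj ^^ N) ?y)) \<longlonglongrightarrow> ?R ?y" by simp
    then have "(\<lambda>N. D_S_adj (?R ?y - ?R (z^N *\<^sub>C (S_adj ^^ N) ?y))) \<longlonglongrightarrow> D_S_adj (?R ?y)"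
      by (rule bounded_op_tendsto[OF csubspace_UNIV contraction_bounded_op[OF D_S_adj_contraction]]) auto
    then show ?thesis unfolding eq by (intro scaleC.tendsto tendsto_const)
  qed
  then have "(\<lambda>n. z^Suc n *\<^sub>C char_coeff x (Suc n)) sums (z *\<^sub>C D_S_adj (?R ?y))" by (simp add: sums_def)
  then have "(\<lambda>n. z^n *\<^sub>C char_coeff x n) sums (z *\<^sub>C D_S_adj (?R ?y) + z^0 *\<^sub>C char_coeff x 0)"
    by (rule sums_Suc[where f = "\<lambda>n. z^n *\<^sub>C char_coeff x n"])
  then show ?thesis by (simp add: char_fun_eq)
qed

lemma char_fun_has_boundary_value: "AE t in circle_measure. has_boundary_value UNIV (char_fun S) t"
proof -
  obtain C :: "'a set" where C: "countable C" "UNIV \<subseteq> closure C" by (rule countable_dense_subset[of "UNIV :: 'a set"])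
  have "AE t in circle_measure. \<forall>c\<in>C. \<exists>l. ((\<lambda>r. \<Sum>n. (of_real r * cis t)^n *\<^sub>C char_coeff c n) \<longlongrightarrow> l) (at_left 1)"
    unfolding AE_ball_countable[OF C(1)] using AE_radial_limit[OF char_coeff_summable] by blast
  then show ?thesis
  proof eventually_elim
    case (elim t)
    show ?case
    proof (rule has_boundary_valueI, rule radial_limit_from_dense[where C = C])
      show "closure C = UNIV" using C(2) by blast
      show "norm (char_fun S (of_real r * cis t) x - char_fun S (of_real r * cis t) y) \<le> norm (x - y)"
        if r: "0 < r" "r < 1" for r x y
      proof -
        note c = char_fun_contraction[OF disc_of_real_cis[OF r]]
        show ?thesis
          using contraction_norm[OF c, of "x - y"] bounded_op_diff[OF csubspace_UNIV contraction_bounded_op[OF c], of x y] by simp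
      qed
      fix c assume "c \<in> C"
      then obtain l where l: "((\<lambda>r. \<Sum>n. (of_real r * cis t)^n *\<^sub>C char_coeff c n) \<longlongrightarrow> l) (at_left 1)"
        using elim by blast
      have "\<forall>\<^sub>F r in at_left 1. (\<Sum>n. (of_real r * cis t)^n *\<^sub>C char_coeff c n) = char_fun S (of_real r * cis t) c"
        using eventually_at_left_1
        by eventually_elim (intro sums_unique[symmetric] char_fun_sums disc_of_real_cis, auto)
      then have "((\<lambda>r. char_fun S (of_real r * cis t) c) \<longlongrightarrow> l) (at_left 1)"
        by (rule Lim_transform_eventually[OF l])
      then show "\<exists>l. ((\<lambda>r. char_fun S (of_real r * cis t) c) \<longlongrightarrow> l) (at_left 1)" ..
    qed
  qed
qed

end

section \<open>Regularity in terms of the boundary values\<close>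

text \<open>The operators are contractions uniformly in \<open>r\<close>, so strong limits of products are products of strong
  limits.\<close>

lemma boundary_value_tendsto:
  assumes \<Psi>: "contractive_analytic F G \<Psi>" and t: "has_boundary_value F \<Psi> t"
    and h: "(h \<longlongrightarrow> l) (at_left 1)" "\<And>r. 0 < r \<Longrightarrow> r < 1 \<Longrightarrow> h r \<in> F" and l: "l \<in> F"
  shows "((\<lambda>r. \<Psi> (of_real r * cis t) (h r)) \<longlongrightarrow> boundary_value \<Psi> t l) (at_left 1)"
proof -
  have F: "closed_csubspace F" using \<Psi> by (simp add: contractive_analytic_def)
  have 2: "((\<lambda>r. \<Psi> (of_real r * cis t) l) \<longlongrightarrow> boundary_value \<Psi> t l) (at_left 1)"
    using t l by (simp add: has_boundary_value_def)
  have "((\<lambda>r. \<Psi> (of_real r * cis t) (h r) - \<Psi> (of_real r * cis t) l) \<longlongrightarrow> 0) (at_left 1)"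
  proof (rule Lim_null_comparison[OF _ tendsto_norm_zero[OF LIM_zero[OF h(1)]]])
    show "\<forall>\<^sub>F r in at_left 1. norm (\<Psi> (of_real r * cis t) (h r) - \<Psi> (of_real r * cis t) l) \<le> norm (h r - l)"
      using eventually_at_left_1
    proof eventually_elim
      case (elim r)
      then have c: "contraction F G (\<Psi> (of_real r * cis t))" and i: "h r \<in> F"
        using \<Psi> h(2) by (simp_all add: contractive_analytic_def disc_of_real_cis)
      show ?case
        using contraction_norm[OF c csubspace_diff[OF F i l]] bounded_op_diff[OF F contraction_bounded_op[OF c] i l] by simp
    qed
  qed
  from tendsto_add[OF this 2] show ?thesis by simp
qed

lemma pointwise_op_unitary:
  assumes E: "closed_csubspace E" and F: "closed_csubspace F" and S: "op_field E F S"
    and U: "AE t in circle_measure. unitary_op E F (S t)"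
  shows "unitary_op (L2_space E) (L2_space F) (pointwise_op S)"
  unfolding unitary_op_def
proof (intro conjI ballI)
  note c = pointwise_op_contraction[OF E S]
  show "bounded_op (L2_space E) (L2_space F) (pointwise_op S)" by (rule contraction_bounded_op[OF c])
  show "pointwise_op S ` L2_space E = L2_space F"
  proof
    show "pointwise_op S ` L2_space E \<subseteq> L2_space F" using contraction_in[OF c] by blast
    show "L2_space F \<subseteq> pointwise_op S ` L2_space E"
    proof
      fix w assume w: "w \<in> L2_space F"
      have A: "op_field F E (\<lambda>t. adjoint_op E (S t))" by (rule op_field_adjoint[OF E S])
      have v: "pointwise_op (\<lambda>t. adjoint_op E (S t)) w \<in> L2_space E"
        by (rule contraction_in[OF pointwise_op_contraction[OF F A] w])
      have "pointwise_op S (pointwise_op (\<lambda>t. adjoint_op E (S t)) w) = w"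
      proof (rule L2_eqI)
        show "AE t in circle_measure. rep_L2 (pointwise_op S (pointwise_op (\<lambda>t. adjoint_op E (S t)) w)) t = rep_L2 w t"
          using rep_pointwise_op[OF E S v] rep_pointwise_op[OF F A w] U w[unfolded L2_space_iff]
          by eventually_elim (simp add: unitary_op_adjoint(2)[OF E])
      qed
      then show "w \<in> pointwise_op S ` L2_space E" using v by (metis imageI)
    qed
  qed
  fix x y assume x: "x \<in> L2_space E" and y: "y \<in> L2_space E"
  show "cinner (pointwise_op S x) (pointwise_op S y) = cinner x y"
    unfolding cinner_L2_rep
  proof (rule integral_cong_AE)
    show "AE t in circle_measure. cinner (rep_L2 (pointwise_op S x) t) (rep_L2 (pointwise_op S y) t) = cinner (rep_L2 x t) (rep_L2 y t)"
      using rep_pointwise_op[OF E S x] rep_pointwise_op[OF E S y] U x[unfolded L2_space_iff] y[unfolded L2_space_iff]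
      by eventually_elim (simp add: unitary_op_def)
  qed (auto intro!: borel_measurable_cinner)
qed

text \<open>Over the circle this is \<open>isometric_extension_unitary_iff\<close> followed by \<open>trivial_complement_pointwise\<close>; in
  each fibre it is \<open>trivial_complement_iff_ranges\<close>.\<close>

theorem regular3_iff_boundary_ranges:
  fixes E1 :: "'a::chilbert set" and E2 :: "'b::chilbert set" and E3 :: "'c::chilbert set" and E4 :: "'d::chilbert set"
  assumes fac: "factorization3 E1 E2 E3 E4 \<Theta> \<Theta>1 \<Theta>2 \<Theta>3"
    and b: "AE t in circle_measure. has_boundary_value E1 \<Theta> t"
    and b1: "AE t in circle_measure. has_boundary_value E1 \<Theta>1 t"
    and b2: "AE t in circle_measure. has_boundary_value E2 \<Theta>2 t"
    and b3: "AE t in circle_measure. has_boundary_value E3 \<Theta>3 t"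
    and U: "AE t in circle_measure. unitary_op E2 E3 (boundary_value \<Theta>2 t)"
  shows "regular3 E1 E2 E3 E4 \<Theta> \<Theta>1 \<Theta>2 \<Theta>3 \<longleftrightarrow>
    (AE t in circle_measure. defect E3 (boundary_value \<Theta>3 t) ` E3 \<inter>
      boundary_value \<Theta>2 t ` defect_adj E1 E2 (boundary_value \<Theta>1 t) ` E2 = {0})"
proof -
  have ca: "contractive_analytic E1 E4 \<Theta>" "contractive_analytic E1 E2 \<Theta>1" "contractive_analytic E2 E3 \<Theta>2" "contractive_analytic E3 E4 \<Theta>3"
    and eq: "\<And>z x. cmod z < 1 \<Longrightarrow> x \<in> E1 \<Longrightarrow> \<Theta> z x = \<Theta>3 z (\<Theta>2 z (\<Theta>1 z x))"
    using fac by (auto simp: factorization3_def)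
  have E: "closed_csubspace E1" "closed_csubspace E2" "closed_csubspace E3" "closed_csubspace E4"
    using ca by (auto simp: contractive_analytic_def)
  define S where "S = boundary_field E1 \<Theta>"
  define S1 where "S1 = boundary_field E1 \<Theta>1"
  define S2 where "S2 = boundary_field E2 \<Theta>2"
  define S3 where "S3 = boundary_field E3 \<Theta>3"
  have f: "op_field E1 E4 S" "op_field E1 E2 S1" "op_field E2 E3 S2" "op_field E3 E4 S3"
    unfolding S_def S1_def S2_def S3_def using boundary_field_op_field ca b b1 b2 b3 by blast+
  have m: "v \<in> L2_space E1 \<Longrightarrow> mult_op \<Theta> v = pointwise_op S v"
    "v \<in> L2_space E1 \<Longrightarrow> mult_op \<Theta>1 v = pointwise_op S1 v"
    "w \<in> L2_space E2 \<Longrightarrow> mult_op \<Theta>2 w = pointwise_op S2 w"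
    "u \<in> L2_space E3 \<Longrightarrow> mult_op \<Theta>3 u = pointwise_op S3 u" for v w u
    unfolding S_def S1_def S2_def S3_def
    using mult_op_eq_pointwise_op[OF ca(1) b] mult_op_eq_pointwise_op[OF ca(2) b1]
      mult_op_eq_pointwise_op[OF ca(3) b2] mult_op_eq_pointwise_op[OF ca(4) b3] by blast+
  note LE = L2_space_csubspace[OF E(1)] L2_space_csubspace[OF E(2)] L2_space_csubspace[OF E(3)]
  have V: "contraction (L2_space E1) (L2_space E4) (pointwise_op S)"
    and V1: "contraction (L2_space E1) (L2_space E2) (pointwise_op S1)"
    and V3: "contraction (L2_space E3) (L2_space E4) (pointwise_op S3)"
    using pointwise_op_contraction E f by blast+
  have U2: "AE t in circle_measure. unitary_op E2 E3 (S2 t)"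
    using U b2 by eventually_elim (simp add: S2_def boundary_field_def)
  have V2: "unitary_op (L2_space E2) (L2_space E3) (pointwise_op S2)"
    by (rule pointwise_op_unitary[OF E(2,3) f(3) U2])
  note V2c = unitary_op_contraction[OF V2]
  have good: "AE t in circle_measure. S t = boundary_value \<Theta> t \<and> S1 t = boundary_value \<Theta>1 t \<and> S2 t = boundary_value \<Theta>2 t \<and> S3 t = boundary_value \<Theta>3 t"
    using b b1 b2 b3 by eventually_elim (simp add: S_def S1_def S2_def S3_def boundary_field_def)
  have prod: "pointwise_op S v = pointwise_op S3 (pointwise_op S2 (pointwise_op S1 v))" if v: "v \<in> L2_space E1" for v
  proof (rule L2_eqI)
    have i: "pointwise_op S1 v \<in> L2_space E2" by (rule contraction_in[OF V1 v])
    have i2: "pointwise_op S2 (pointwise_op S1 v) \<in> L2_space E3" by (rule contraction_in[OF V2c i])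
    show "AE t in circle_measure. rep_L2 (pointwise_op S v) t = rep_L2 (pointwise_op S3 (pointwise_op S2 (pointwise_op S1 v))) t"
      using rep_pointwise_op[OF E(1) f(1) v] rep_pointwise_op[OF E(1) f(2) v] rep_pointwise_op[OF E(2) f(3) i]
        rep_pointwise_op[OF E(3) f(4) i2] good b b1 b2 b3 v[unfolded L2_space_iff]
    proof eventually_elim
      case (elim t)
      let ?x = "rep_L2 v t" and ?z = "\<lambda>r. of_real r * cis t"
      have x: "?x \<in> E1" by (rule elim(10))
      have c: "contraction E2 E3 (\<Theta>2 (?z r))" "contraction E1 E2 (\<Theta>1 (?z r))" if "0 < r" "r < 1" for r
        using ca disc_of_real_cis[OF that] by (simp_all add: contractive_analytic_def)
      let ?x1 = "boundary_value \<Theta>1 t ?x"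
      have x1: "?x1 \<in> E2" by (rule contraction_in[OF boundary_value_contraction[OF ca(2) elim(7)] x])
      let ?l = "boundary_value \<Theta>2 t ?x1"
      have l: "?l \<in> E3" by (rule contraction_in[OF boundary_value_contraction[OF ca(3) elim(8)] x1])
      have "((\<lambda>r. \<Theta>1 (?z r) ?x) \<longlongrightarrow> ?x1) (at_left 1)" using elim(7) x by (simp add: has_boundary_value_def)
      from boundary_value_tendsto[OF ca(3) elim(8) this contraction_in[OF c(2) x] x1]
      have "((\<lambda>r. \<Theta>2 (?z r) (\<Theta>1 (?z r) ?x)) \<longlongrightarrow> ?l) (at_left 1)" by simp
      from boundary_value_tendsto[OF ca(4) elim(9) this contraction_in[OF c(1) contraction_in[OF c(2) x]] l]
      have "((\<lambda>r. \<Theta>3 (?z r) (\<Theta>2 (?z r) (\<Theta>1 (?z r) ?x))) \<longlongrightarrow> boundary_value \<Theta>3 t ?l) (at_left 1)" by simp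
      then have "((\<lambda>r. \<Theta> (of_real r * cis t) ?x) \<longlongrightarrow> boundary_value \<Theta>3 t ?l) (at_left 1)"
      proof (rule Lim_transform_eventually)
        show "\<forall>\<^sub>F r in at_left 1. \<Theta>3 (?z r) (\<Theta>2 (?z r) (\<Theta>1 (?z r) ?x)) = \<Theta> (?z r) ?x"
          using eventually_at_left_1 by eventually_elim (simp add: eq disc_of_real_cis x)
      qed
      then have "boundary_value \<Theta> t ?x = boundary_value \<Theta>3 t ?l" by (rule boundary_value_eqI)
      then show ?case using elim by simp
    qed
  qed
  have d: "defect (L2_space E1) (mult_op \<Theta>) = defect (L2_space E1) (pointwise_op S)"
    "defect (L2_space E1) (mult_op \<Theta>1) = defect (L2_space E1) (pointwise_op S1)"
    "defect (L2_space E2) (mult_op \<Theta>2) = defect (L2_space E2) (pointwise_op S2)"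
    "defect (L2_space E3) (mult_op \<Theta>3) = defect (L2_space E3) (pointwise_op S3)"
    using m by (auto intro: defect_cong)
  have "regular3 E1 E2 E3 E4 \<Theta> \<Theta>1 \<Theta>2 \<Theta>3 \<longleftrightarrow>
    (\<exists>Z. continuous_on (defect_space (L2_space E1) (pointwise_op S)) Z \<and>
      (\<forall>f\<in>L2_space E1. Z (defect (L2_space E1) (pointwise_op S) f)
        = (defect (L2_space E3) (pointwise_op S3) (pointwise_op S2 (pointwise_op S1 f)),
           defect (L2_space E2) (pointwise_op S2) (pointwise_op S1 f), defect (L2_space E1) (pointwise_op S1) f)) \<and>
      unitary_op (defect_space (L2_space E1) (pointwise_op S))
        (defect_space (L2_space E3) (pointwise_op S3) \<times> defect_space (L2_space E2) (pointwise_op S2) \<times> defect_space (L2_space E1) (pointwise_op S1)) Z)"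
    using fac contraction_in[OF V1] unfolding regular3_def is_Z3_def defect_space_def d
    by (simp add: m conj_assoc cong: ball_cong)
  also have "\<dots> \<longleftrightarrow> trivial_complement (L2_space E1) (L2_space E2) (L2_space E3) (pointwise_op S1) (pointwise_op S2) (pointwise_op S3)"
    by (rule isometric_extension_unitary_iff[OF LE V1 V2 V3 V prod])
  also have "\<dots> \<longleftrightarrow> (AE t in circle_measure. trivial_complement E1 E2 E3 (S1 t) (S2 t) (S3 t))"
    by (rule trivial_complement_pointwise[OF E f(2,3,4)])
  also have "\<dots> \<longleftrightarrow> (AE t in circle_measure. defect E3 (boundary_value \<Theta>3 t) ` E3 \<inter>
      boundary_value \<Theta>2 t ` defect_adj E1 E2 (boundary_value \<Theta>1 t) ` E2 = {0})"
  proof (rule eventually_subst)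
    show "AE t in circle_measure. trivial_complement E1 E2 E3 (S1 t) (S2 t) (S3 t) \<longleftrightarrow>
      (defect E3 (boundary_value \<Theta>3 t) ` E3 \<inter> boundary_value \<Theta>2 t ` defect_adj E1 E2 (boundary_value \<Theta>1 t) ` E2 = {0})"
      using good U
    proof eventually_elim
      case (elim t)
      have "unitary_op E2 E3 (S2 t)" using elim by simp
      from trivial_complement_iff_ranges[OF E(1,2,3) op_field_contraction[OF f(2), of t] this op_field_contraction[OF f(4), of t]]
      show ?case using elim by simp
    qed
  qed
  finally show ?thesis .
qed

section \<open>Composition with constant operators and direct sums\<close>

lemma contractive_analytic_comp_right:
  assumes \<Theta>: "contractive_analytic E F \<Theta>" and E0: "closed_csubspace E0" and U: "contraction E0 E U"
  shows "contractive_analytic E0 F (\<lambda>z. \<Theta> z \<circ> U)"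
  unfolding contractive_analytic_def analytic_op_fun_def
proof (intro conjI allI impI E0)
  show "closed_csubspace F" using \<Theta> by (simp add: contractive_analytic_def)
  fix z :: complex assume z: "cmod z < 1"
  have c: "contraction E F (\<Theta> z)" using \<Theta> z by (simp add: contractive_analytic_def)
  then show "contraction E0 F (\<Theta> z \<circ> U)" using contraction_comp[OF U c] by (simp add: comp_def)
  then show "bounded_op E0 F (\<Theta> z \<circ> U)" by (rule contraction_bounded_op)
  obtain D where D: "bounded_op E F D" and D': "\<forall>e>0. \<exists>d>0. \<forall>w. cmod w < 1 \<and> cmod (w - z) < d \<longrightarrow>
      (\<forall>x\<in>E. norm (\<Theta> w x - \<Theta> z x - (w - z) *\<^sub>C D x) \<le> e * cmod (w - z) * norm x)"
    using \<Theta> z unfolding contractive_analytic_def analytic_op_fun_def by blast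
  obtain K where K: "K > 0" "\<And>x. x \<in> E \<Longrightarrow> norm (D x) \<le> K * norm x" using bounded_op_bound[OF D] by blast
  have Ui: "U x \<in> E" "norm (U x) \<le> norm x" if "x \<in> E0" for x
    using contraction_in[OF U that] contraction_norm[OF U that] by auto
  have DU: "norm (D (U x)) \<le> K * norm x" if "x \<in> E0" for x
    using K(1) K(2)[OF Ui(1)[OF that]] Ui(2)[OF that] by (meson less_imp_le mult_left_mono order_trans)
  show "\<exists>D. bounded_op E0 F D \<and> (\<forall>e>0. \<exists>d>0. \<forall>w. cmod w < 1 \<and> cmod (w - z) < d \<longrightarrow>
      (\<forall>x\<in>E0. norm ((\<Theta> w \<circ> U) x - (\<Theta> z \<circ> U) x - (w - z) *\<^sub>C D x) \<le> e * cmod (w - z) * norm x))"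
  proof (intro exI[of _ "\<lambda>x. D (U x)"] conjI allI impI)
    show "bounded_op E0 F (\<lambda>x. D (U x))"
      unfolding bounded_op_def
      using Ui DU bounded_op_in[OF D] bounded_op_add[OF contraction_bounded_op[OF U]] bounded_op_add[OF D]
        bounded_op_scaleC[OF contraction_bounded_op[OF U]] bounded_op_scaleC[OF D]
      by (intro conjI ballI allI exI[of _ K]) auto
    fix e :: real assume e: "e > 0"
    then obtain d where d: "d > 0" "\<And>w x. cmod w < 1 \<Longrightarrow> cmod (w - z) < d \<Longrightarrow> x \<in> E \<Longrightarrow>
        norm (\<Theta> w x - \<Theta> z x - (w - z) *\<^sub>C D x) \<le> e * cmod (w - z) * norm x" using D' by blast
    show "\<exists>d>0. \<forall>w. cmod w < 1 \<and> cmod (w - z) < d \<longrightarrow>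
      (\<forall>x\<in>E0. norm ((\<Theta> w \<circ> U) x - (\<Theta> z \<circ> U) x - (w - z) *\<^sub>C D (U x)) \<le> e * cmod (w - z) * norm x)"
    proof (intro exI[of _ d] conjI allI impI ballI d(1))
      fix w x assume w: "cmod w < 1 \<and> cmod (w - z) < d" and x: "x \<in> E0"
      have "norm (\<Theta> w (U x) - \<Theta> z (U x) - (w - z) *\<^sub>C D (U x)) \<le> e * cmod (w - z) * norm (U x)"
        using d(2) w Ui(1)[OF x] by blast
      also have "\<dots> \<le> e * cmod (w - z) * norm x" using e Ui(2)[OF x] by (intro mult_left_mono) auto
      finally show "norm ((\<Theta> w \<circ> U) x - (\<Theta> z \<circ> U) x - (w - z) *\<^sub>C D (U x)) \<le> e * cmod (w - z) * norm x" by simp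
    qed
  qed
qed

lemma contractive_analytic_comp_left:
  assumes \<Theta>: "contractive_analytic E F \<Theta>" and G: "closed_csubspace G" and U: "contraction F G U"
  shows "contractive_analytic E G (\<lambda>z. U \<circ> \<Theta> z)"
  unfolding contractive_analytic_def analytic_op_fun_def
proof (intro conjI allI impI G)
  have F: "closed_csubspace F" and an: "analytic_op_fun E F \<Theta>" using \<Theta> by (auto simp: contractive_analytic_def)
  show "closed_csubspace E" using \<Theta> by (simp add: contractive_analytic_def)
  fix z :: complex assume z: "cmod z < 1"
  have c: "contraction E F (\<Theta> w)" if "cmod w < 1" for w using \<Theta> that by (simp add: contractive_analytic_def)
  show "contraction E G (U \<circ> \<Theta> z)" using contraction_comp[OF c[OF z] U] by (simp add: comp_def)
  then show "bounded_op E G (U \<circ> \<Theta> z)" by (rule contraction_bounded_op)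
  obtain D where D: "bounded_op E F D" and D': "\<forall>e>0. \<exists>d>0. \<forall>w. cmod w < 1 \<and> cmod (w - z) < d \<longrightarrow>
      (\<forall>x\<in>E. norm (\<Theta> w x - \<Theta> z x - (w - z) *\<^sub>C D x) \<le> e * cmod (w - z) * norm x)"
    using \<Theta> z unfolding contractive_analytic_def analytic_op_fun_def by blast
  obtain K where K: "K > 0" "\<And>x. x \<in> E \<Longrightarrow> norm (D x) \<le> K * norm x" using bounded_op_bound[OF D] by blast
  have UD: "norm (U (D x)) \<le> K * norm x" if "x \<in> E" for x
    using contraction_norm[OF U bounded_op_in[OF D that]] K(2)[OF that] by simp
  note Ub = contraction_bounded_op[OF U]
  show "\<exists>D. bounded_op E G D \<and> (\<forall>e>0. \<exists>d>0. \<forall>w. cmod w < 1 \<and> cmod (w - z) < d \<longrightarrow>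
      (\<forall>x\<in>E. norm ((U \<circ> \<Theta> w) x - (U \<circ> \<Theta> z) x - (w - z) *\<^sub>C D x) \<le> e * cmod (w - z) * norm x))"
  proof (intro exI[of _ "\<lambda>x. U (D x)"] conjI allI impI)
    show "bounded_op E G (\<lambda>x. U (D x))"
      unfolding bounded_op_def
      using UD bounded_op_in[OF D] bounded_op_in[OF Ub] bounded_op_add[OF Ub] bounded_op_add[OF D]
        bounded_op_scaleC[OF Ub] bounded_op_scaleC[OF D]
      by (intro conjI ballI allI exI[of _ K]) auto
    fix e :: real assume e: "e > 0"
    then obtain d where d: "d > 0" "\<And>w x. cmod w < 1 \<Longrightarrow> cmod (w - z) < d \<Longrightarrow> x \<in> E \<Longrightarrow>
        norm (\<Theta> w x - \<Theta> z x - (w - z) *\<^sub>C D x) \<le> e * cmod (w - z) * norm x" using D' by blast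
    show "\<exists>d>0. \<forall>w. cmod w < 1 \<and> cmod (w - z) < d \<longrightarrow>
      (\<forall>x\<in>E. norm ((U \<circ> \<Theta> w) x - (U \<circ> \<Theta> z) x - (w - z) *\<^sub>C U (D x)) \<le> e * cmod (w - z) * norm x)"
    proof (intro exI[of _ d] conjI allI impI ballI d(1))
      fix w x assume w: "cmod w < 1 \<and> cmod (w - z) < d" and x: "x \<in> E"
      have i: "\<Theta> w x \<in> F" "\<Theta> z x \<in> F" "D x \<in> F" using contraction_in[OF c x] w z bounded_op_in[OF D x] by auto
      then have j: "\<Theta> w x - \<Theta> z x \<in> F" "(w - z) *\<^sub>C D x \<in> F" using F by (auto simp: csubspace_rules)
      have "U (\<Theta> w x) - U (\<Theta> z x) - (w - z) *\<^sub>C U (D x) = U (\<Theta> w x - \<Theta> z x - (w - z) *\<^sub>C D x)"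
        using i j by (simp add: bounded_op_diff[OF F Ub] bounded_op_scaleC[OF Ub])
      then have "norm (U (\<Theta> w x) - U (\<Theta> z x) - (w - z) *\<^sub>C U (D x)) \<le> norm (\<Theta> w x - \<Theta> z x - (w - z) *\<^sub>C D x)"
        using contraction_norm[OF U csubspace_diff[OF F j]] by simp
      also have "\<dots> \<le> e * cmod (w - z) * norm x" using d(2) w x by blast
      finally show "norm ((U \<circ> \<Theta> w) x - (U \<circ> \<Theta> z) x - (w - z) *\<^sub>C U (D x)) \<le> e * cmod (w - z) * norm x" by simp
    qed
  qed
qed

lemma contractive_analytic_const:
  assumes E: "closed_csubspace E" and F: "closed_csubspace F" and U: "contraction E F U"
  shows "contractive_analytic E F (\<lambda>z. U)"
  unfolding contractive_analytic_def analytic_op_fun_def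
proof (intro conjI allI impI E F U contraction_bounded_op[OF U])
  fix z :: complex
  show "\<exists>D. bounded_op E F D \<and> (\<forall>e>0. \<exists>d>0. \<forall>w. cmod w < 1 \<and> cmod (w - z) < d \<longrightarrow>
      (\<forall>x\<in>E. norm (U x - U x - (w - z) *\<^sub>C D x) \<le> e * cmod (w - z) * norm x))"
  proof (intro exI[of _ "\<lambda>_. 0"] conjI allI impI)
    show "bounded_op E F (\<lambda>_. 0)"
      using csubspace_0[OF F] by (auto simp: bounded_op_def scaleC.zero_right intro: exI[of _ 0])
  qed (auto simp: scaleC.zero_right intro!: exI[of _ 1])
qed

abbreviation diag_id :: "('a::complex_inner \<Rightarrow> 'b::complex_inner) \<Rightarrow> 'a \<times> 'c \<Rightarrow> 'b \<times> 'c::complex_inner" where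
  "diag_id S \<equiv> block_op S (\<lambda>_. 0) (\<lambda>_. 0) (\<lambda>y. y)"

lemma diag_id_apply [simp]: "diag_id S p = (S (fst p), snd p)"
  by (simp add: block_op_def split_beta)

lemma norm_Pair_mono: "norm a \<le> norm a' \<Longrightarrow> norm b \<le> norm b' \<Longrightarrow> norm (a, b) \<le> norm (a', b')"
  unfolding norm_Pair by (intro real_sqrt_le_mono add_mono power_mono) auto

lemma diag_id_contraction:
  assumes "contraction E F S" shows "contraction (E \<times> G) (F \<times> G) (diag_id S)"
proof (rule contractionI)
  note b = contraction_bounded_op[OF assms]
  fix p assume p: "p \<in> E \<times> G"
  show "norm (diag_id S p) \<le> norm p"
    using contraction_norm[OF assms, of "fst p"] p norm_Pair_mono[of "S (fst p)" "fst p" "snd p" "snd p"] by auto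
  show "diag_id S (p + q) = diag_id S p + diag_id S q" if "q \<in> E \<times> G" for q
    using p that by (auto simp: bounded_op_add[OF b])
  show "diag_id S (c *\<^sub>C p) = c *\<^sub>C diag_id S p" for c
    using p by (auto simp: bounded_op_scaleC[OF b] scaleC_prod_def)
qed (use contraction_in[OF assms] in auto)

lemma bounded_op_diag_zero:
  fixes D :: "'a::complex_inner \<Rightarrow> 'b::complex_inner" and G :: "'c::complex_inner set"
  assumes D: "bounded_op E F D" and G: "0 \<in> G"
  shows "bounded_op (E \<times> G) (F \<times> G) (\<lambda>p. (D (fst p), 0))"
  unfolding bounded_op_def
proof (intro conjI ballI allI)
  fix p assume p: "p \<in> E \<times> G"
  then have f: "fst p \<in> E" by auto
  show "(D (fst p), 0) \<in> F \<times> G" using bounded_op_in[OF D f] G by simp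
  show "(D (fst (c *\<^sub>C p)), 0) = c *\<^sub>C (D (fst p), 0::'c)" for c
    by (simp add: scaleC_prod_def scaleC.zero_right bounded_op_scaleC[OF D f])
  show "(D (fst (p + q)), 0) = (D (fst p), 0::'c) + (D (fst q), 0)" if "q \<in> E \<times> G" for q
    using bounded_op_add[OF D f, of "fst q"] that by auto
next
  obtain K where K: "K > 0" "\<And>x. x \<in> E \<Longrightarrow> norm (D x) \<le> K * norm x" using bounded_op_bound[OF D] by blast
  have "norm (D (fst p), 0::'c) \<le> K * norm p" if "p \<in> E \<times> G" for p
  proof -
    have "norm (D (fst p), 0::'c) \<le> K * norm (fst p)" using K(2)[of "fst p"] that by (auto simp: norm_Pair)
    also have "norm (fst p) \<le> norm p" by (metis norm_fst_le prod.collapse)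
    finally show ?thesis using K(1) by simp
  qed
  then show "\<exists>K. \<forall>p\<in>E \<times> G. norm (D (fst p), 0::'c) \<le> K * norm p" by blast
qed

lemma contractive_analytic_diag_id:
  assumes \<Theta>: "contractive_analytic E F \<Theta>" and G: "closed_csubspace G"
  shows "contractive_analytic (E \<times> G) (F \<times> G) (\<lambda>z. diag_id (\<Theta> z))"
  unfolding contractive_analytic_def analytic_op_fun_def
proof (intro conjI allI impI)
  have E: "closed_csubspace E" and F: "closed_csubspace F" using \<Theta> by (auto simp: contractive_analytic_def)
  show "closed_csubspace (E \<times> G)" "closed_csubspace (F \<times> G)" by (intro csubspace_Times E F G)+
  fix z :: complex assume z: "cmod z < 1"
  show "contraction (E \<times> G) (F \<times> G) (diag_id (\<Theta> z))"
    by (rule diag_id_contraction) (use \<Theta> z in \<open>simp add: contractive_analytic_def\<close>)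
  then show "bounded_op (E \<times> G) (F \<times> G) (diag_id (\<Theta> z))" by (rule contraction_bounded_op)
  obtain D where D: "bounded_op E F D" and D': "\<forall>e>0. \<exists>d>0. \<forall>w. cmod w < 1 \<and> cmod (w - z) < d \<longrightarrow>
      (\<forall>x\<in>E. norm (\<Theta> w x - \<Theta> z x - (w - z) *\<^sub>C D x) \<le> e * cmod (w - z) * norm x)"
    using \<Theta> z unfolding contractive_analytic_def analytic_op_fun_def by blast
  have nf: "norm (fst p) \<le> norm p" for p :: "'a \<times> 'c" by (metis norm_fst_le prod.collapse)
  show "\<exists>D. bounded_op (E \<times> G) (F \<times> G) D \<and> (\<forall>e>0. \<exists>d>0. \<forall>w. cmod w < 1 \<and> cmod (w - z) < d \<longrightarrow>
      (\<forall>p\<in>E \<times> G. norm (diag_id (\<Theta> w) p - diag_id (\<Theta> z) p - (w - z) *\<^sub>C D p) \<le> e * cmod (w - z) * norm p))"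
  proof (intro exI[of _ "\<lambda>p. (D (fst p), 0)"] conjI allI impI)
    show "bounded_op (E \<times> G) (F \<times> G) (\<lambda>p. (D (fst p), 0))"
      by (rule bounded_op_diag_zero[OF D csubspace_0[OF G]])
    fix e :: real assume e: "e > 0"
    from D'[rule_format, OF e]
    obtain d where d: "d > 0" "\<forall>w. cmod w < 1 \<and> cmod (w - z) < d \<longrightarrow>
        (\<forall>x\<in>E. norm (\<Theta> w x - \<Theta> z x - (w - z) *\<^sub>C D x) \<le> e * cmod (w - z) * norm x)" by blast
    show "\<exists>d>0. \<forall>w. cmod w < 1 \<and> cmod (w - z) < d \<longrightarrow>
      (\<forall>p\<in>E \<times> G. norm (diag_id (\<Theta> w) p - diag_id (\<Theta> z) p - (w - z) *\<^sub>C (D (fst p), 0)) \<le> e * cmod (w - z) * norm p)"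
    proof (intro exI[of _ d] conjI allI impI ballI d(1))
      fix w and p :: "'a \<times> 'c" assume w: "cmod w < 1 \<and> cmod (w - z) < d" and p: "p \<in> E \<times> G"
      have "norm (diag_id (\<Theta> w) p - diag_id (\<Theta> z) p - (w - z) *\<^sub>C (D (fst p), 0::'c))
          = norm (\<Theta> w (fst p) - \<Theta> z (fst p) - (w - z) *\<^sub>C D (fst p))"
        by (simp add: scaleC_prod_def scaleC.zero_right norm_Pair)
      also have "\<dots> \<le> e * cmod (w - z) * norm (fst p)" using d(2) w p by auto
      also have "\<dots> \<le> e * cmod (w - z) * norm p" using e nf by (intro mult_left_mono) auto
      finally show "norm (diag_id (\<Theta> w) p - diag_id (\<Theta> z) p - (w - z) *\<^sub>C (D (fst p), 0)) \<le> e * cmod (w - z) * norm p" .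
    qed
  qed
qed

section \<open>Defect operators of block operators\<close>

lemma unitary_op_cinner: "unitary_op E F U \<Longrightarrow> x \<in> E \<Longrightarrow> y \<in> E \<Longrightarrow> cinner (U x) (U y) = cinner x y"
  by (simp add: unitary_op_def)

text \<open>This covers the inverses \<open>\<tau>\<^sup>-\<^sup>1\<close> and \<open>\<tau>\<^sub>*\<^sup>-\<^sup>1\<close>, which agree with the adjoints.\<close>

lemma unitary_op_adjoint_unitary:
  fixes U :: "'a::{complex_inner,complete_space} \<Rightarrow> 'b::complex_inner"
  assumes E: "closed_csubspace E" and F: "closed_csubspace F" and U: "unitary_op E F U"
  shows "unitary_op F E (adjoint_op E U)"
  unfolding unitary_op_def
proof (intro conjI ballI)
  note inv = unitary_op_adjoint[OF E U]
  have c: "contraction F E (adjoint_op E U)" by (rule adjoint_op_contraction[OF E unitary_op_contraction[OF U]])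
  then show "bounded_op F E (adjoint_op E U)" by (rule contraction_bounded_op)
  show "adjoint_op E U ` F = E"
  proof
    show "adjoint_op E U ` F \<subseteq> E" using contraction_in[OF c] by blast
    show "E \<subseteq> adjoint_op E U ` F"
    proof
      fix x assume x: "x \<in> E"
      then have "U x \<in> F" by (rule contraction_in[OF unitary_op_contraction[OF U]])
      then show "x \<in> adjoint_op E U ` F" using inv(1)[OF x] by (metis imageI)
    qed
  qed
  fix x y assume xy: "x \<in> F" "y \<in> F"
  have "cinner (U (adjoint_op E U x)) (U (adjoint_op E U y)) = cinner (adjoint_op E U x) (adjoint_op E U y)"
    using U contraction_in[OF c] xy by (simp add: unitary_op_def)
  then show "cinner (adjoint_op E U x) (adjoint_op E U y) = cinner x y" by (simp add: inv(2) xy)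
qed

lemma unitary_op_inv_into:
  fixes U :: "'a::{complex_inner,complete_space} \<Rightarrow> 'b::complex_inner"
  assumes E: "closed_csubspace E" and F: "closed_csubspace F" and U: "unitary_op E F U"
  shows "unitary_op F E (inv_into E U)"
proof -
  have eq: "inv_into E U y = adjoint_op E U y" if "y \<in> F" for y
  proof -
    have "inj_on U E" using unitary_op_adjoint(1)[OF E U] by (rule inj_on_inverseI)
    moreover have "adjoint_op E U y \<in> E" "U (adjoint_op E U y) = y"
      using adjoint_op_in[OF E contraction_bounded_op[OF unitary_op_contraction[OF U]]]
        unitary_op_adjoint(2)[OF E U that] by auto
    ultimately show ?thesis by (rule inv_into_f_eq)
  qed
  show ?thesis
    using unitary_op_adjoint_unitary[OF E F U] F image_cong[of F F "inv_into E U" "adjoint_op E U"] eq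
    unfolding unitary_op_def bounded_op_def by (simp add: csubspace_add csubspace_scaleC)
qed

text \<open>With \<open>R = U (S \<oplus> I)\<close> one has \<open>R\<^sup>*R = S\<^sup>*S \<oplus> I\<close>, so \<open>D\<^sub>S \<oplus> 0\<close> is the positive square root of
  \<open>I - R\<^sup>*R\<close>.\<close>

lemma defect_unitary_diag_id:
  fixes S :: "'a::{complex_inner,complete_space} \<Rightarrow> 'b::complex_inner"
    and U :: "'b \<times> 'c::{complex_inner,complete_space} \<Rightarrow> 'd::complex_inner"
  assumes E: "closed_csubspace E" and G: "closed_csubspace G"
    and S: "contraction E F S" and U: "unitary_op (F \<times> G) H U" and p: "p \<in> E \<times> G"
  shows "defect (E \<times> G) (\<lambda>p. U (diag_id S p)) p = (defect E S (fst p), 0)"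
proof -
  have EG: "closed_csubspace (E \<times> G)" by (rule csubspace_Times[OF E G])
  have c: "contraction (E \<times> G) H (\<lambda>p. U (diag_id S p))"
    by (rule contraction_comp[OF diag_id_contraction[OF S] unitary_op_contraction[OF U]])
  note D = defect_bounded[OF E S]
  show ?thesis
  proof (rule defect_unique[OF EG c _ _ p])
    have "bounded_op (E \<times> G) (E \<times> G) (\<lambda>p. (defect E S (fst p), 0))"
      by (rule bounded_op_diag_zero[OF D csubspace_0[OF G]])
    then show "positive_op (E \<times> G) (\<lambda>p. (defect E S (fst p), 0))"
      using defect_positive[OF E S] by (auto simp: positive_op_def cinner_prod_def cinner.zero_left)
    fix q assume q: "q \<in> E \<times> G"
    then have q': "fst q \<in> E" "snd q \<in> G" by auto
    have "adjoint_op (E \<times> G) (\<lambda>p. U (diag_id S p)) (U (diag_id S q)) = (adjoint_op E S (S (fst q)), snd q)"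
    proof (rule adjoint_op_eqI[OF EG])
      show "(adjoint_op E S (S (fst q)), snd q) \<in> E \<times> G"
        using q' adjoint_op_in[OF E contraction_bounded_op[OF S]] by simp
      fix u assume "u \<in> E \<times> G"
      then have i: "diag_id S u \<in> F \<times> G" "diag_id S q \<in> F \<times> G" and u: "fst u \<in> E"
        using contraction_in[OF diag_id_contraction[OF S]] q by (auto simp del: diag_id_apply)
      have "cinner (U (diag_id S u)) (U (diag_id S q)) = cinner (diag_id S u) (diag_id S q)"
        by (rule unitary_op_cinner[OF U i])
      then show "cinner (U (diag_id S u)) (U (diag_id S q)) = cinner u (adjoint_op E S (S (fst q)), snd q)"
        using adjoint_op_cinner[OF E contraction_bounded_op[OF S] u] by (simp add: cinner_prod_def)
    qed
    then show "(defect E S (fst (defect E S (fst q), 0::'c)), 0) = q - adjoint_op (E \<times> G) (\<lambda>p. U (diag_id S p)) (U (diag_id S q))"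
      using q' by (simp add: defect_square[OF E S] prod_eq_iff)
  qed
qed

text \<open>The adjoint of \<open>(S \<oplus> I) U\<close> is \<open>U\<^sup>* (S\<^sup>* \<oplus> I)\<close>, to which the preceding lemma applies.\<close>

lemma defect_adj_diag_id_unitary:
  fixes S :: "'a::{complex_inner,complete_space} \<Rightarrow> 'b::{complex_inner,complete_space}"
    and U :: "'d::{complex_inner,complete_space} \<Rightarrow> 'a \<times> 'c::{complex_inner,complete_space}"
  assumes H: "closed_csubspace H" and E: "closed_csubspace E" and F: "closed_csubspace F" and G: "closed_csubspace G"
    and S: "contraction E F S" and U: "unitary_op H (E \<times> G) U" and p: "p \<in> F \<times> G"
  shows "defect_adj H (F \<times> G) (\<lambda>x. diag_id S (U x)) p = (defect_adj E F S (fst p), 0)"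
proof -
  let ?R = "\<lambda>x. diag_id S (U x)"
  let ?A = "adjoint_op E S"
  have FG: "closed_csubspace (F \<times> G)" and EG: "closed_csubspace (E \<times> G)" by (intro csubspace_Times E F G)+
  have A: "contraction F E ?A" by (rule adjoint_op_contraction[OF E S])
  have c: "contraction H (F \<times> G) ?R"
    by (rule contraction_comp[OF unitary_op_contraction[OF U] diag_id_contraction[OF S]])
  define W where "W = adjoint_op H U"
  have W: "unitary_op (E \<times> G) H W" unfolding W_def by (rule unitary_op_adjoint_unitary[OF H EG U])
  have adj: "adjoint_op H ?R q = W (diag_id ?A q)" if q: "q \<in> F \<times> G" for q
  proof (rule adjoint_op_eqI[OF H])
    have i: "diag_id ?A q \<in> E \<times> G" by (rule contraction_in[OF diag_id_contraction[OF A] q])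
    then show "W (diag_id ?A q) \<in> H" using W by (auto simp: unitary_op_def)
    fix u assume u: "u \<in> H"
    have Uu: "fst (U u) \<in> E" "snd (U u) \<in> G"
      using contraction_in[OF unitary_op_contraction[OF U] u] by (auto simp: mem_Times_iff)
    have "cinner (?R u) q = cinner (U u) (diag_id ?A q)"
      using adjoint_op_cinner[OF E contraction_bounded_op[OF S] Uu(1)] by (simp add: cinner_prod_def)
    also have "\<dots> = cinner u (W (diag_id ?A q))"
      unfolding W_def by (rule adjoint_op_cinner[OF H contraction_bounded_op[OF unitary_op_contraction[OF U]] u])
    finally show "cinner (?R u) q = cinner u (W (diag_id ?A q))" .
  qed
  have "defect_adj H (F \<times> G) ?R p = defect (F \<times> G) (adjoint_op H ?R) p"
    by (simp only: defect_adj_eq_defect[OF H FG c])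
  also have "\<dots> = defect (F \<times> G) (\<lambda>q. W (diag_id ?A q)) p"
    using defect_cong[of "F \<times> G" "adjoint_op H ?R" "\<lambda>q. W (diag_id ?A q)"] adj by simp
  also have "\<dots> = (defect F ?A (fst p), 0)" by (rule defect_unitary_diag_id[OF F G A W p])
  also have "defect F ?A = defect_adj E F S" by (simp add: defect_adj_eq_defect[OF E F S])
  finally show ?thesis .
qed

text \<open>The Julia operator of a contraction. It preserves inner products because the mixed terms
  \<open>\<langle>L\<^sup>* y, D\<^sub>L v\<rangle>\<close> and \<open>\<langle>D\<^sub>L\<^sub>* y, L v\<rangle>\<close> are equal by \<open>L D\<^sub>L = D\<^sub>L\<^sub>* L\<close>. The same relation shows that its adjoint
  is a right inverse, so it is onto.\<close>

lemma julia_operator_unitary: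
  fixes L :: "'b::{complex_inner,complete_space} \<Rightarrow> 'a::{complex_inner,complete_space}"
  assumes E: "closed_csubspace E" and F: "closed_csubspace F" and L: "contraction E F L"
  shows "unitary_op (F \<times> defect_space E L) (E \<times> defect_space_adj E F L)
    (block_op (adjoint_op E L) (defect E L) (defect_adj E F L) (\<lambda>y. - L y))" (is "unitary_op ?P ?Q ?U")
proof -
  let ?A = "adjoint_op E L" and ?D = "defect E L" and ?Ds = "defect_adj E F L"
  have A: "contraction F E ?A" by (rule adjoint_op_contraction[OF E L])
  note Lb = contraction_bounded_op[OF L] and Ab = contraction_bounded_op[OF A] and Db = defect_bounded[OF E L]
  have Dsb: "bounded_op F F ?Ds" using defect_bounded[OF F A] by (simp add: defect_adj_eq_defect[OF E F L])
  have DE: "defect_space E L \<subseteq> E" by (rule defect_space_subset[OF E L])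
  have DF: "defect_space_adj E F L \<subseteq> F"
    unfolding defect_adj_space_eq[OF E F L] by (rule defect_space_subset[OF F A])
  have cDs: "closed_csubspace (defect_space_adj E F L)"
    unfolding defect_adj_space_eq[OF E F L] by (rule defect_space_csubspace[OF F A])
  have Lv: "L v \<in> defect_space_adj E F L" if "v \<in> defect_space E L" for v
    unfolding defect_space_adj_def
  proof (rule bounded_op_closure_image[OF E Lb])
    show "?D ` E \<subseteq> E" using bounded_op_in[OF Db] by blast
    show "v \<in> closure (?D ` E)" using that by (simp add: defect_space_def)
    show "L y \<in> ?Ds ` F" if "y \<in> ?D ` E" for y
      using that defect_intertwine[OF E F L] contraction_in[OF L] by auto
  qed
  have Aq: "?A q \<in> defect_space E L" if "q \<in> defect_space_adj E F L" for q
    unfolding defect_space_def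
  proof (rule bounded_op_closure_image[OF F Ab])
    show "?Ds ` F \<subseteq> F" using bounded_op_in[OF Dsb] by blast
    show "q \<in> closure (?Ds ` F)" using that by (simp add: defect_space_adj_def)
    show "?A y \<in> ?D ` E" if "y \<in> ?Ds ` F" for y
      using that defect_intertwine_adj[OF E F L] contraction_in[OF A] by auto
  qed
  have Dsin: "?Ds y \<in> defect_space_adj E F L" if "y \<in> F" for y
    unfolding defect_space_adj_def by (rule subsetD[OF closure_subset imageI[OF that]])
  have Din: "?D v \<in> defect_space E L" if "v \<in> E" for v by (rule defect_in_space[OF E L that])
  have Ds_sa: "cinner (?Ds x) y = cinner x (?Ds y)" if "x \<in> F" "y \<in> F" for x y
    using defect_selfadjoint[OF F A that] by (simp add: defect_adj_eq_defect[OF E F L])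
  have Uapp: "?U (y, v) = (?A y + ?D v, ?Ds y - L v)" for y v by (simp add: block_op_def)
  have Uin: "?U (y, v) \<in> ?Q" if y: "y \<in> F" and v: "v \<in> defect_space E L" for y v
    unfolding Uapp using bounded_op_in[OF Ab y] bounded_op_in[OF Db] DE v Dsin[OF y] Lv[OF v]
    by (auto intro!: csubspace_add[OF E] csubspace_diff[OF cDs])
  have Ucin: "cinner (?U (y, v)) (?U (y', v')) = cinner (y, v) (y', v')"
    if y: "y \<in> F" "y' \<in> F" and v: "v \<in> E" "v' \<in> E" for y v y' v'
  proof -
    have 1: "cinner (?A y) (?A y') + cinner (?Ds y) (?Ds y') = cinner y y'"
      using cinner_defect[OF F A y] by (simp add: defect_adj_eq_defect[OF E F L])
    have 2: "cinner (?D v) (?D v') + cinner (L v) (L v') = cinner v v'" using cinner_defect[OF E L v] by simp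
    have cross: "cinner (?A y) (?D v) = cinner (?Ds y) (L v)" if y: "y \<in> F" and v: "v \<in> E" for y v
    proof -
      have "cinner (?A y) (?D v) = cinner y (L (?D v))"
        using adjoint_op_cinner'[OF E Lb bounded_op_in[OF Db v]] by simp
      also have "\<dots> = cinner y (?Ds (L v))" by (simp add: defect_intertwine[OF E F L v])
      also have "\<dots> = cinner (?Ds y) (L v)" using Ds_sa[OF y contraction_in[OF L v]] by simp
      finally show ?thesis .
    qed
    have cross': "cinner (?D v) (?A y') = cinner (L v) (?Ds y')"
      using cross[OF y(2) v(1)] by (metis cinner_commute)
    show ?thesis
      unfolding Uapp cinner_prod_def fst_conv snd_conv 1[symmetric] 2[symmetric]
      using cross[OF y(1) v(2)] cross' by (simp add: cinner_simps)
  qed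
  have nU: "norm (?U p) \<le> 1 * norm p" if pP: "p \<in> ?P" for p
  proof -
    obtain y v where p: "p = (y, v)" "y \<in> F" "v \<in> E" using pP DE by blast
    have "(norm (?U p))\<^sup>2 = (norm p)\<^sup>2" unfolding norm_sq_cinner p(1) using Ucin p by simp
    then show ?thesis by (simp add: power2_eq_iff_nonneg)
  qed
  show ?thesis
    unfolding unitary_op_def
  proof (intro conjI ballI)
    show "bounded_op ?P ?Q ?U"
      unfolding bounded_op_def
    proof (intro conjI ballI allI exI[of _ 1])
      fix p assume p: "p \<in> ?P"
      obtain y v where yv: "p = (y, v)" "y \<in> F" "v \<in> defect_space E L" using p by auto
      show "?U p \<in> ?Q" unfolding yv(1) by (rule Uin[OF yv(2,3)])
      show "norm (?U p) \<le> 1 * norm p" by (rule nU[OF p])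
      show "?U (c *\<^sub>C p) = c *\<^sub>C ?U p" for c
        using yv DE by (simp add: scaleC_prod_def Uapp bounded_op_scaleC[OF Ab] bounded_op_scaleC[OF Db]
            bounded_op_scaleC[OF Dsb] bounded_op_scaleC[OF Lb] subsetD scaleC_add_right scaleC.diff_right)
      fix q assume "q \<in> ?P"
      then obtain y' v' where yv': "q = (y', v')" "y' \<in> F" "v' \<in> defect_space E L" by auto
      show "?U (p + q) = ?U p + ?U q"
        using yv yv' DE by (simp add: Uapp bounded_op_add[OF Ab] bounded_op_add[OF Db] bounded_op_add[OF Dsb]
            bounded_op_add[OF Lb] subsetD)
    qed
    show "?U ` ?P = ?Q"
    proof
      show "?U ` ?P \<subseteq> ?Q"
      proof (rule image_subsetI)
        fix p assume "p \<in> ?P"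
        then obtain y v where p: "p = (y, v)" "y \<in> F" "v \<in> defect_space E L" by blast
        show "?U p \<in> ?Q" unfolding p(1) by (rule Uin[OF p(2,3)])
      qed
      show "?Q \<subseteq> ?U ` ?P"
      proof
        fix r assume "r \<in> ?Q"
        then obtain p q where r: "r = (p, q)" and p: "p \<in> E" and q: "q \<in> defect_space_adj E F L" by auto
        have qF: "q \<in> F" using q DF by blast
        define y where "y = L p + ?Ds q"
        define v where "v = ?D p - ?A q"
        have i: "L p \<in> F" "?Ds q \<in> F" "?D p \<in> E" "?A q \<in> E"
          using bounded_op_in[OF Lb p] bounded_op_in[OF Dsb qF] bounded_op_in[OF Db p] bounded_op_in[OF Ab qF] by auto
        have y: "y \<in> F" unfolding y_def by (rule csubspace_add[OF F i(1,2)])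
        have v: "v \<in> defect_space E L"
          unfolding v_def by (rule csubspace_diff[OF defect_space_csubspace[OF E L] Din[OF p] Aq[OF q]])
        have "?A y + ?D v = ?A (L p) + ?A (?Ds q) + (?D (?D p) - ?D (?A q))"
          unfolding y_def v_def using i by (simp add: bounded_op_add[OF Ab] bounded_op_diff[OF E Db])
        also have "\<dots> = p" by (simp add: defect_intertwine_adj[OF E F L qF] defect_square[OF E L p])
        finally have 1: "?A y + ?D v = p" .
        have "?Ds y - L v = ?Ds (L p) + ?Ds (?Ds q) - (L (?D p) - L (?A q))"
          unfolding y_def v_def using i by (simp add: bounded_op_add[OF Dsb] bounded_op_diff[OF E Lb])
        also have "\<dots> = q" by (simp add: defect_intertwine[OF E F L p] defect_adj_square[OF E F L qF])
        finally have "?Ds y - L v = q" .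
        then have "?U (y, v) = r" using 1 by (simp add: Uapp r)
        then show "r \<in> ?U ` ?P" using y v by (metis SigmaI imageI)
      qed
    qed
    fix p q assume p: "p \<in> ?P" and q: "q \<in> ?P"
    obtain y v where yv: "p = (y, v)" "y \<in> F" "v \<in> E" using p DE by blast
    obtain y' v' where yv': "q = (y', v')" "y' \<in> F" "v' \<in> E" using q DE by blast
    show "cinner (?U p) (?U q) = cinner p q"
      unfolding yv(1) yv'(1) by (rule Ucin[OF yv(2) yv'(2) yv(3) yv'(3)])
  qed
qed

section \<open>Upper triangular contractions\<close>

lemma has_boundary_value_subset: "has_boundary_value E \<Theta> t \<Longrightarrow> E' \<subseteq> E \<Longrightarrow> has_boundary_value E' \<Theta> t"
  by (auto simp: has_boundary_value_def)

lemma boundary_value_const: "has_boundary_value E (\<lambda>z. U) t" "boundary_value (\<lambda>z. U) t = U"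
proof -
  show eq: "boundary_value (\<lambda>z. U) t = U"
  proof
    show "boundary_value (\<lambda>z. U) t x = U x" for x by (rule boundary_value_eqI) (rule tendsto_const)
  qed
  show "has_boundary_value E (\<lambda>z. U) t" unfolding has_boundary_value_def eq by simp
qed

lemma boundary_value_diag_id:
  assumes t: "has_boundary_value E \<Theta> t" and p: "fst p \<in> E"
  shows "((\<lambda>r. diag_id (\<Theta> (of_real r * cis t)) p) \<longlongrightarrow> diag_id (boundary_value \<Theta> t) p) (at_left 1)"
  using t p unfolding diag_id_apply by (intro tendsto_Pair tendsto_const) (simp add: has_boundary_value_def)

text \<open>Apply \<open>regular3_iff_boundary_ranges\<close>. In almost every fibre the ranges in it consist of pairs
  \<open>(\<Delta>\<^sub>B u, 0)\<close> and \<open>(L\<^sup>* y, D\<^sub>L\<^sub>* y)\<close> with \<open>y\<close> in the range of \<open>\<Delta>\<^sub>*\<^sub>A\<close>.\<close>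

theorem lemma3p8:
  fixes A :: "'a::chilbert \<Rightarrow> 'a" and B :: "'b::chilbert \<Rightarrow> 'b" and L :: "'b \<Rightarrow> 'a"
    and T :: "'a \<times> 'b \<Rightarrow> 'a \<times> 'b"
    and \<tau> :: "'a \<times> 'b \<Rightarrow> 'a \<times> 'b" and \<tau>s :: "'a \<times> 'b \<Rightarrow> 'b \<times> 'a"
    and DA DAs :: "'a set" and DB DBs :: "'b set"
    and DL :: "'b set" and DLs :: "'a set" and DT DTs :: "('a \<times> 'b) set"
    and \<Theta>1 :: "complex \<Rightarrow> 'a \<times> 'b \<Rightarrow> 'a \<times> 'b" and \<Theta>2 :: "complex \<Rightarrow> 'a \<times> 'b \<Rightarrow> 'b \<times> 'a"
    and \<Theta>3 :: "complex \<Rightarrow> 'b \<times> 'a \<Rightarrow> 'a \<times> 'b"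
  assumes "DA = defect_space UNIV A" and "DAs = defect_space_adj UNIV UNIV A"
    and "DB = defect_space UNIV B" and "DBs = defect_space_adj UNIV UNIV B"
    and "DT = defect_space UNIV T" and "DTs = defect_space_adj UNIV UNIV T"
    and "DL = defect_space DB L" and "DLs = defect_space_adj DB DAs L"
    and "contraction UNIV UNIV A" and "contraction UNIV UNIV B" and "contraction DB DAs L"
    and "T = block_op A (\<lambda>y. defect_adj UNIV UNIV A (L (defect UNIV B y))) (\<lambda>_. 0) B"
    and "contraction UNIV UNIV T"
    and "unitary_op DT (DA \<times> DL) \<tau>" and "unitary_op DTs (DBs \<times> DLs) \<tau>s"
    and "\<Theta>3 = (\<lambda>z. inv_into DTs \<tau>s \<circ> block_op (char_fun B z) (\<lambda>_. 0) (\<lambda>_. 0) (\<lambda>y. y))"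
    and "\<Theta>2 = (\<lambda>z. block_op (adjoint_op DB L) (defect DB L) (defect_adj DB DAs L) (\<lambda>y. - L y))"
    and "\<Theta>1 = (\<lambda>z. block_op (char_fun A z) (\<lambda>_. 0) (\<lambda>_. 0) (\<lambda>y. y) \<circ> \<tau>)"
    and "\<forall>z. cmod z < 1 \<longrightarrow> (\<forall>x\<in>DT. char_fun T z x = \<Theta>3 z (\<Theta>2 z (\<Theta>1 z x)))"
  shows "regular3 DT (DAs \<times> DL) (DB \<times> DLs) DTs (char_fun T) \<Theta>1 \<Theta>2 \<Theta>3 \<longleftrightarrow>
    (AE t in lebesgue_on {0..2 * pi}.
       defect DB (boundary_value (char_fun B) t) ` DB \<inter>
       adjoint_op DB L `
         (defect_adj DA DAs (boundary_value (char_fun A) t) ` DAs \<inter> {y \<in> DAs. defect_adj DB DAs L y = 0})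
       = {0})"
proof -
  note defs = assms(1-8) and A = assms(9) and B = assms(10) and L = assms(11) and T = assms(13)
    and \<tau> = assms(14) and \<tau>s = assms(15) and prod = assms(19)
  have cA: "contractive_analytic DA DAs (char_fun A)" unfolding defs by (rule char_fun_contractive_analytic[OF A])
  have cB: "contractive_analytic DB DBs (char_fun B)" unfolding defs by (rule char_fun_contractive_analytic[OF B])
  have cT: "contractive_analytic DT DTs (char_fun T)" unfolding defs by (rule char_fun_contractive_analytic[OF T])
  have cs: "closed_csubspace DA" "closed_csubspace DAs" "closed_csubspace DB" "closed_csubspace DBs"
    "closed_csubspace DT" "closed_csubspace DTs"
    using cA cB cT by (auto simp: contractive_analytic_def)
  have cDL: "closed_csubspace DL" unfolding assms(7) by (rule defect_space_csubspace[OF cs(3) L])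
  have cDLs: "closed_csubspace DLs"
    unfolding assms(8) defect_adj_space_eq[OF cs(3,2) L]
    by (rule defect_space_csubspace[OF cs(2) adjoint_op_contraction[OF cs(3) L]])
  define U where "U = block_op (adjoint_op DB L) (defect DB L) (defect_adj DB DAs L) (\<lambda>y. - L y)"
  have U: "unitary_op (DAs \<times> DL) (DB \<times> DLs) U"
    unfolding U_def assms(7,8) by (rule julia_operator_unitary[OF cs(3,2) L])
  define \<sigma> where "\<sigma> = inv_into DTs \<tau>s"
  have \<sigma>: "unitary_op (DBs \<times> DLs) DTs \<sigma>"
    unfolding \<sigma>_def by (rule unitary_op_inv_into[OF cs(6) csubspace_Times[OF cs(4) cDLs] \<tau>s])
  have \<Theta>1: "\<Theta>1 = (\<lambda>z. diag_id (char_fun A z) \<circ> \<tau>)" and \<Theta>2: "\<Theta>2 = (\<lambda>z. U)"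
    and \<Theta>3: "\<Theta>3 = (\<lambda>z. \<sigma> \<circ> diag_id (char_fun B z))"
    using assms(16,17,18) by (simp_all add: U_def \<sigma>_def)
  have c1: "contractive_analytic DT (DAs \<times> DL) \<Theta>1"
    unfolding \<Theta>1 by (rule contractive_analytic_comp_right[OF contractive_analytic_diag_id[OF cA cDL] cs(5) unitary_op_contraction[OF \<tau>]])
  have c2: "contractive_analytic (DAs \<times> DL) (DB \<times> DLs) \<Theta>2"
    unfolding \<Theta>2 by (intro contractive_analytic_const csubspace_Times cs cDL cDLs unitary_op_contraction[OF U])
  have c3: "contractive_analytic (DB \<times> DLs) DTs \<Theta>3"
    unfolding \<Theta>3 by (rule contractive_analytic_comp_left[OF contractive_analytic_diag_id[OF cB cDLs] cs(6) unitary_op_contraction[OF \<sigma>]])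
  have fac: "factorization3 DT (DAs \<times> DL) (DB \<times> DLs) DTs (char_fun T) \<Theta>1 \<Theta>2 \<Theta>3"
    using cT c1 c2 c3 prod by (simp add: factorization3_def)
  note gA = char_fun_has_boundary_value[OF A] and gB = char_fun_has_boundary_value[OF B] and gT = char_fun_has_boundary_value[OF T]
  have lim1: "((\<lambda>r. \<Theta>1 (of_real r * cis t) x) \<longlongrightarrow> diag_id (boundary_value (char_fun A) t) (\<tau> x)) (at_left 1)"
    if "has_boundary_value UNIV (char_fun A) t" for t x
    using boundary_value_diag_id[OF that, of "\<tau> x"] unfolding \<Theta>1 comp_def by simp
  have lim3: "((\<lambda>r. \<Theta>3 (of_real r * cis t) p) \<longlongrightarrow> \<sigma> (diag_id (boundary_value (char_fun B) t) p)) (at_left 1)"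
    if t: "has_boundary_value UNIV (char_fun B) t" and p: "p \<in> DB \<times> DLs" for t p
    unfolding \<Theta>3 comp_def
  proof (rule bounded_op_tendsto[OF csubspace_Times[OF cs(4) cDLs] contraction_bounded_op[OF unitary_op_contraction[OF \<sigma>]]])
    show "((\<lambda>r. diag_id (char_fun B (of_real r * cis t)) p) \<longlongrightarrow> diag_id (boundary_value (char_fun B) t) p) (at_left 1)"
      by (rule boundary_value_diag_id[OF t]) simp
    have "contraction DB DBs (boundary_value (char_fun B) t)"
      by (rule boundary_value_contraction[OF cB has_boundary_value_subset[OF t]]) simp
    from contraction_in[OF diag_id_contraction[OF this] p]
    show "diag_id (boundary_value (char_fun B) t) p \<in> DBs \<times> DLs" .
    show "\<forall>\<^sub>F r in at_left 1. diag_id (char_fun B (of_real r * cis t)) p \<in> DBs \<times> DLs"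
      using eventually_at_left_1
    proof eventually_elim
      case (elim r)
      then have "contraction DB DBs (char_fun B (of_real r * cis t))"
        using cB by (simp add: contractive_analytic_def disc_of_real_cis)
      from contraction_in[OF diag_id_contraction[OF this] p] show ?case .
    qed
  qed
  have b1: "has_boundary_value DT \<Theta>1 t" if "has_boundary_value UNIV (char_fun A) t" for t
    using lim1[OF that] by (intro has_boundary_valueI) blast
  have b3: "has_boundary_value (DB \<times> DLs) \<Theta>3 t" if "has_boundary_value UNIV (char_fun B) t" for t
    using lim3[OF that] by (intro has_boundary_valueI) blast
  have "regular3 DT (DAs \<times> DL) (DB \<times> DLs) DTs (char_fun T) \<Theta>1 \<Theta>2 \<Theta>3 \<longleftrightarrow>
    (AE t in circle_measure. defect (DB \<times> DLs) (boundary_value \<Theta>3 t) ` (DB \<times> DLs) \<inter>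
      boundary_value \<Theta>2 t ` defect_adj DT (DAs \<times> DL) (boundary_value \<Theta>1 t) ` (DAs \<times> DL) = {0})"
  proof (rule regular3_iff_boundary_ranges[OF fac])
    show "AE t in circle_measure. has_boundary_value DT (char_fun T) t"
      using gT by eventually_elim (rule has_boundary_value_subset, auto)
    show "AE t in circle_measure. has_boundary_value DT \<Theta>1 t" using gA by eventually_elim (rule b1)
    show "AE t in circle_measure. has_boundary_value (DAs \<times> DL) \<Theta>2 t" by (simp add: \<Theta>2 boundary_value_const)
    show "AE t in circle_measure. has_boundary_value (DB \<times> DLs) \<Theta>3 t" using gB by eventually_elim (rule b3)
    show "AE t in circle_measure. unitary_op (DAs \<times> DL) (DB \<times> DLs) (boundary_value \<Theta>2 t)"
      using U by (simp add: \<Theta>2 boundary_value_const)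
  qed
  also have "\<dots> \<longleftrightarrow> (AE t in circle_measure.
       defect DB (boundary_value (char_fun B) t) ` DB \<inter>
       adjoint_op DB L `
         (defect_adj DA DAs (boundary_value (char_fun A) t) ` DAs \<inter> {y \<in> DAs. defect_adj DB DAs L y = 0})
       = {0})"
  proof (rule eventually_subst)
    show "AE t in circle_measure. (defect (DB \<times> DLs) (boundary_value \<Theta>3 t) ` (DB \<times> DLs) \<inter>
        boundary_value \<Theta>2 t ` defect_adj DT (DAs \<times> DL) (boundary_value \<Theta>1 t) ` (DAs \<times> DL) = {0}) \<longleftrightarrow>
      (defect DB (boundary_value (char_fun B) t) ` DB \<inter> adjoint_op DB L `
         (defect_adj DA DAs (boundary_value (char_fun A) t) ` DAs \<inter> {y \<in> DAs. defect_adj DB DAs L y = 0}) = {0})"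
      using gA gB
    proof eventually_elim
      case (elim t)
      define a where "a = boundary_value (char_fun A) t"
      define b where "b = boundary_value (char_fun B) t"
      have a: "contraction DA DAs a"
        unfolding a_def by (rule boundary_value_contraction[OF cA has_boundary_value_subset[OF elim(1)]]) simp
      have b: "contraction DB DBs b"
        unfolding b_def by (rule boundary_value_contraction[OF cB has_boundary_value_subset[OF elim(2)]]) simp
      define DaS where "DaS = defect_adj DA DAs a"
      define Db where "Db = defect DB b"
      have v1: "boundary_value \<Theta>1 t = (\<lambda>x. diag_id a (\<tau> x))"
        unfolding a_def by (rule ext, rule boundary_value_eqI) (rule lim1[OF elim(1)])
      have v3: "boundary_value \<Theta>3 t p = \<sigma> (diag_id b p)" if "p \<in> DB \<times> DLs" for p
        unfolding b_def by (rule boundary_value_eqI) (rule lim3[OF elim(2) that])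
      have dc: "defect (DB \<times> DLs) (boundary_value \<Theta>3 t) = defect (DB \<times> DLs) (\<lambda>p. \<sigma> (diag_id b p))"
        by (rule defect_cong) (rule v3)
      have d3: "defect (DB \<times> DLs) (boundary_value \<Theta>3 t) p = (Db (fst p), 0)" if "p \<in> DB \<times> DLs" for p
        unfolding dc Db_def by (rule defect_unitary_diag_id[OF cs(3) cDLs b \<sigma> that])
      have d1: "defect_adj DT (DAs \<times> DL) (boundary_value \<Theta>1 t) p = (DaS (fst p), 0)" if "p \<in> DAs \<times> DL" for p
        unfolding v1 DaS_def by (rule defect_adj_diag_id_unitary[OF cs(5,1,2) cDL a \<tau> that])
      have r3: "defect (DB \<times> DLs) (boundary_value \<Theta>3 t) ` (DB \<times> DLs) = (\<lambda>x. (x, 0)) ` Db ` DB"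
        using csubspace_0[OF cDLs] by (force simp: d3 image_iff)
      have r1: "defect_adj DT (DAs \<times> DL) (boundary_value \<Theta>1 t) ` (DAs \<times> DL) = (\<lambda>y. (y, 0)) ` DaS ` DAs"
        using csubspace_0[OF cDL] by (force simp: d1 image_iff)
      have DaSin: "DaS y \<in> DAs" if "y \<in> DAs" for y unfolding DaS_def by (rule defect_adj_in[OF cs(1,2) a that])
      have Uy: "boundary_value \<Theta>2 t (y, 0) = (adjoint_op DB L y, defect_adj DB DAs L y)" for y
        using bounded_op_zero[OF defect_bounded[OF cs(3) L] csubspace_0[OF cs(3)]]
          bounded_op_zero[OF contraction_bounded_op[OF L] csubspace_0[OF cs(3)]]
        by (simp add: \<Theta>2 boundary_value_const U_def block_op_def)
      have "(\<lambda>x. (x, 0)) ` Db ` DB \<inter> boundary_value \<Theta>2 t ` (\<lambda>y. (y, 0)) ` DaS ` DAs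
          = (\<lambda>x. (x, 0)) ` (Db ` DB \<inter> adjoint_op DB L ` (DaS ` DAs \<inter> {y \<in> DAs. defect_adj DB DAs L y = 0}))"
        (is "?l = ?r")
      proof (intro equalityI subsetI)
        fix p assume "p \<in> ?l"
        then obtain u y where u: "u \<in> DB" "p = (Db u, 0)" and y: "y \<in> DAs" "p = boundary_value \<Theta>2 t (DaS y, 0)" by blast
        then have "Db u = adjoint_op DB L (DaS y)" "defect_adj DB DAs L (DaS y) = 0" by (auto simp: Uy)
        then have "Db u \<in> Db ` DB \<inter> adjoint_op DB L ` (DaS ` DAs \<inter> {y \<in> DAs. defect_adj DB DAs L y = 0})"
          using u(1) y(1) DaSin by blast
        then show "p \<in> ?r" unfolding u(2) by (rule imageI)
      next
        fix p assume "p \<in> ?r"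
        then obtain u y where u: "u \<in> DB" "p = (Db u, 0)" and y: "y \<in> DAs" "Db u = adjoint_op DB L (DaS y)"
          "defect_adj DB DAs L (DaS y) = 0" by blast
        then have "p = boundary_value \<Theta>2 t (DaS y, 0)" by (simp add: Uy)
        then show "p \<in> ?l" using u y(1) by blast
      qed
      moreover have "(\<lambda>x. (x, 0::'a)) ` X = {0} \<longleftrightarrow> X = {0}" for X :: "'b set"
        by (auto simp: zero_prod_def image_iff)
      ultimately show ?case unfolding r1 r3 a_def[symmetric] b_def[symmetric] DaS_def[symmetric] Db_def[symmetric] by simp
    qed
  qed
  finally show ?thesis .
qed

end
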